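(* Let $I^a:\mathcal{VL}\to R^a$ be the invariant of virtual links defined from the Markov trace $\{T_n^a=T_n'^a\circ\rho_n^a:R^a[\mathrm{VB}_n]\to R^a\}_{n=1}^\infty$, that is, $I^a(\hat\beta)=T_n^a(\beta)$ for all $n\ge1$ and all $\beta\in\mathrm{VB}_n$. Then $I^a$ coincides with the arrow polynomial, that is, $I^a(L)=\overrightarrow{f}(L)$ for every virtual link $L$.
   Context: Virtual links. A virtual link diagram is a collection of oriented circles smoothly immersed in the plane with only normal double crossings, each crossing being assigned a value "positive", "negative" (classical crossings, drawn with over/under strands, with the usual sign convention) or "virtual". A virtual link is an equivalence class of virtual link diagrams under isotopy and the virtual Reidemeister moves: the classical Reidemeister moves on classical crossings; the same three moves with all crossings virtual; and the mixed third move in which a strand having two virtual crossings moves across a classical crossing. $\mathcal{VL}$ is the set of virtual links. Virtual braids. A virtual braid diagram on $n$ strands is a collection of $n$ smooth paths $b_i:[0,1]\to\mathbb{R}^2$, $b_i(0)=(0,i)$, $b_i(1)=(1,w(i))$ with $w\in\mathfrak{S}_n$, with first coordinate of $b_i(t)$ equal to $t$, having only normal double crossings, each marked positive, negative or virtual. Modulo isotopy and virtual Reidemeister moves (those preserving the braid form) these form, under concatenation, the virtual braid group $\mathrm{VB}_n$. It is presented by generators $\sigma_1,\dots,\sigma_{n-1},\tau_1,\dots,\tau_{n-1}$ ($\sigma_i$: one positive crossing between strands $i,i+1$; $\tau_i$: one virtual crossing between strands $i,i+1$) and relations $\tau_i^2=1$; $\sigma_i\sigma_j=\sigma_j\sigma_i$,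 $\tau_i\tau_j=\tau_j\tau_i$, $\tau_i\sigma_j=\sigma_j\tau_i$ for $|i-j|\ge 2$; $\sigma_i\sigma_j\sigma_i=\sigma_j\sigma_i\sigma_j$, $\tau_i\tau_j\tau_i=\tau_j\tau_i\tau_j$, $\tau_i\tau_j\sigma_i=\sigma_j\tau_i\tau_j$ for $|i-j|=1$. The closure $\hat\beta$ of $\beta\in\mathrm{VB}_n$ is the virtual link obtained by joining $(0,i)$ to $(1,i)$ by parallel arcs outside the braid, as for classical braids, with strands oriented from left to right. Every virtual link is the closure of a virtual braid, and two virtual braids have the same closure if and only if they are related by virtual Markov moves (Kamada, Kauffman--Lambropoulou); consequently a Markov trace (a sequence of linear forms on the $R^a[\mathrm{VB}_n]$ compatible with these moves) defines an invariant of virtual links as in the claim. The arrow polynomial. Let $R_0^a=\mathbb{Z}[z_0,z_1,z_2,\dots]$ and $R^a=\mathbb{Z}[A^{\pm1},z_1,z_2,\dots]$, with $R_0^a$ embedded in $R^a$ via $z_0=-A^2-A^{-2}$. An arrow virtual link diagram is a collection of circles immersed in the plane with finitely many normal double crossings, each marked positive, negative or virtual, such that each circle carries an even number of marked points (cusps) away from crossings; each segment between successive cusps is oriented, the two segments adjacent to a cusp having opposite orientations (so each cusp is a sink or a source; a circle without cusps has one orientation); and each cusp has a privileged side of the curve. Virtual link diagrams are the arrow virtual link diagrams without cusps. If $L$ has only virtual crossings and $S$ is a component, a reduction of $S$ removes two consecutive cusps with the same privileged side (and reorients accordingly). Reducing as long as possible yields an irreducible component with $2c$ cusps; $\zeta(S)=c$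 is the number of zigzags of $S$. The arrow Kauffman bracket $\langle\!\langle L\rangle\!\rangle\in R^a$ is defined by: if $L$ has only virtual crossings and components $S_1,\dots,S_\ell$, then $\langle\!\langle L\rangle\!\rangle=\prod_{i=1}^\ell z_{\zeta(S_i)}$; if $p$ is a classical crossing of $L$, then $\langle\!\langle L\rangle\!\rangle=A\langle\!\langle L_1\rangle\!\rangle+A^{-1}\langle\!\langle L_2\rangle\!\rangle$ if $p$ is positive and $\langle\!\langle L\rangle\!\rangle=A^{-1}\langle\!\langle L_1\rangle\!\rangle+A\langle\!\langle L_2\rangle\!\rangle$ if $p$ is negative, where $L_1,L_2$ coincide with $L$ away from $p$; at $p$, $L_1$ is the orientation-respecting smoothing (no new cusp), and $L_2$ is the other smoothing, in which the two incoming half-strands are joined at a new cusp (a sink) and the two outgoing half-strands are joined at a new cusp (a source), the privileged side of each of the two new cusps being the inner (concave) side of its arc, i.e. the side away from the other new arc. The writhe $w(L)$ is the number of positive minus the number of negative crossings, and $\overrightarrow{f}(L)=(-A^3)^{-w(L)}\langle\!\langle L\rangle\!\rangle$. By a theorem of Miyazawa and Dye--Kauffman, on virtual link diagrams this depends only on the virtual link. The algebra $\mathrm{ATL}_n(R^a)$. Let $V_n=\{0,1\}\times\{1,\dots,n\}$, ordered by $(0,1)<(0,2)<\cdots<(0,n)<(1,n)<\cdots<(1,2)<(1,1)$. A flat virtual $n$-tangle is a partition of $V_n$ into pairs; $\mathcal{E}_n$ is the set of these. An arrow flat $n$-tangle is a pair $F=(E,f)$ with $E\in\mathcal{E}_n$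 and $f:E\to\mathbb{Z}$ such that, for $\alpha=\{(a,b),(c,d)\}\in E$, $f(\alpha)$ is odd if $a=c$ and even if $a\ne c$. $\mathcal{F}_n$ is the set of arrow flat $n$-tangles, and $\mathrm{ATL}_n(R^a)$ is the free $R^a$-module with basis $\mathcal{F}_n$, with the multiplication defined as follows. Let $E,E'\in\mathcal{E}_n$. An arc of length $\ell$ in $E\sqcup E'$ is an $\ell$-tuple $\hat\alpha=(\alpha_1,\dots,\alpha_\ell)$ of elements of $E\sqcup E'$, $\alpha_i=\{(a_i,b_{i-1}),(c_i,b_i)\}$, such that: (a) if $\alpha_i\in E$ and $i<\ell$, then $c_i=1$, $\alpha_{i+1}\in E'$ and $a_{i+1}=0$; (b) if $\alpha_i\in E'$ and $i<\ell$, then $c_i=0$, $\alpha_{i+1}\in E$ and $a_{i+1}=1$; (c) $a_1=0$ if $\alpha_1\in E$, $a_1=1$ if $\alpha_1\in E'$, $c_\ell=0$ if $\alpha_\ell\in E$, $c_\ell=1$ if $\alpha_\ell\in E'$, and $(a_1,b_0)<(c_\ell,b_\ell)$. Its boundary is $\partial\hat\alpha=\{(a_1,b_0),(c_\ell,b_\ell)\}$. There are $n$ arcs and their boundaries form a flat virtual $n$-tangle $E*E'$. A cycle of length $2p\ge2$ in $E\sqcup E'$ is a $2p$-tuple $\hat\gamma=(\gamma_1,\dots,\gamma_{2p})$, $\gamma_i=\{(a_i,b_{i-1}),(c_i,b_i)\}$, such that $\gamma_i\in E$ and $a_i=c_i=1$ for $i$ odd, $\gamma_i\in E'$ and $a_i=c_i=0$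 for $i$ even, and $b_0=b_{2p}<b_i$ for $1\le i\le 2p-1$. The parity of $\alpha=\{(a,b),(c,d)\}$ is $\varpi(\alpha)=-1$ if $a=c$ and $\varpi(\alpha)=1$ if $a\ne c$. For an arc or cycle $(\alpha_1,\dots,\alpha_\ell)$ with $\alpha_i=\{(a_i,b_{i-1}),(c_i,b_i)\}$ (also for the cycles in a closure, defined below), the cumulated parity is $\varpi^c(\alpha_i)=\prod_{j=1}^{i-1}\varpi(\alpha_j)$ if $(a_i,b_{i-1})<(c_i,b_i)$, and $\varpi^c(\alpha_i)=\prod_{j=1}^{i}\varpi(\alpha_j)$ if $(c_i,b_i)<(a_i,b_{i-1})$. Let $F=(E,f)$, $F'=(E',f')\in\mathcal{F}_n$, and let $f^*$ equal $f$ on $E$ and $f'$ on $E'$. For an arc $\hat\alpha$ of $E\sqcup E'$ put $g(\partial\hat\alpha)=\sum_{i=1}^\ell\varpi^c(\alpha_i)f^*(\alpha_i)$, and set $F*F'=(E*E',g)\in\mathcal{F}_n$. For a cycle $\hat\gamma$ put $h(\hat\gamma)=\sum_i\varpi^c(\gamma_i)f^*(\gamma_i)$ (an even number) and $\zeta(\hat\gamma)=|h(\hat\gamma)|/2$. If $\hat\gamma_1,\dots,\hat\gamma_m$ are the cycles of $E\sqcup E'$, then $F\,F'=z_{\zeta(\hat\gamma_1)}\cdots z_{\zeta(\hat\gamma_m)}(F*F')$. This is an associative unital algebra (unit: all pairs $\{(0,k),(1,k)\}$ labeled $0$). For $1\le i\le n-1$: $F_i$ has pairs $\{(0,i),(0,i+1)\}$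 and $\{(1,i),(1,i+1)\}$ both labeled $1$, and $\{(0,k),(1,k)\}$ labeled $0$ for $k\ne i,i+1$; $w_i$ has pairs $\{(0,i),(1,i+1)\}$, $\{(0,i+1),(1,i)\}$, and $\{(0,k),(1,k)\}$ for $k\ne i,i+1$, all labeled $0$. $\rho_n^a:R^a[\mathrm{VB}_n]\to\mathrm{ATL}_n(R^a)$ is the algebra homomorphism with $\rho_n^a(\sigma_i)=-A^{-2}\,1-A^{-4}F_i$ and $\rho_n^a(\tau_i)=w_i$. Trace. For $E\in\mathcal{E}_n$, a cycle of length $\ell$ in the closure $\hat E$ is an $\ell$-tuple $\hat\gamma=(\gamma_1,\dots,\gamma_\ell)$ in $E$, $\gamma_i=\{(a_i,b_{i-1}),(c_i,b_i)\}$, such that $a_{i+1}=1$ if $c_i=0$ and $a_{i+1}=0$ if $c_i=1$, for $1\le i\le\ell-1$; and $b_0=b_\ell<b_i$ for $1\le i\le\ell-1$, $a_1=0$, $c_\ell=1$. For $F=(E,f)\in\mathcal{F}_n$ and such a cycle put $h(\hat\gamma)=\sum_{i=1}^\ell\varpi^c(\gamma_i)f(\gamma_i)$ (an even number) and $\zeta(\hat\gamma)=|h(\hat\gamma)|/2$. If $\hat\gamma_1,\dots,\hat\gamma_m$ are the cycles of $\hat E$, set $T_n'^a(F)=z_{\zeta(\hat\gamma_1)}\cdots z_{\zeta(\hat\gamma_m)}$, and extend $R^a$-linearly to $T_n'^a:\mathrm{ATL}_n(R^a)\to R^a$. *)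

theory Defs
  imports
    "HOL-Library.Poly_Mapping"
    "HOL-Library.Product_Plus"
    "HOL-Library.Disjoint_Sets"
    "HOL-Combinatorics.Orbits"
    "HOL-Algebra.Group"
begin

section \<open>The ring $R^a$\<close>

text \<open>
  $\mathbb{Z}[A^{\pm1},z_1,z_2,\dots]$ as the monoid ring over the integers of the Laurent monomials:
  the key \<open>(k, m)\<close> is the monomial \<open>A^k * (\<Prod>j. z\<^bsub>j+1\<^esub> ^ m j)\<close>.
\<close>
type_synonym ra = "(int \<times> (nat \<Rightarrow>\<^sub>0 nat)) \<Rightarrow>\<^sub>0 int"

definition A_pow :: "int \<Rightarrow> ra" where
  "A_pow k = Poly_Mapping.single (k, 0) 1"

definition z :: "nat \<Rightarrow> ra" where
  "z k = (if k = 0 then - A_pow 2 - A_pow (-2)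
          else Poly_Mapping.single (0, Poly_Mapping.single (k - 1) 1) 1)"


section \<open>Diagrams\<close>

text \<open>
  A plane diagram in general position with respect to the first coordinate is cut by lines
  \<open>x = const\<close> into pieces containing one crossing, one extremum of the first coordinate or one
  cusp each, and is written as the list of its pieces from left to right.  The argument of type
  \<open>nat\<close> is the number of strands passing below the piece.

  \<^item> \<open>Cross c i\<close>: two strands cross; \<open>Over\<close> (\<open>Under\<close>) means that the strand that rises from left to
    right passes over (under) the other one.
  \<^item> \<open>Open i d\<close>: a left extremum, creating two strands, the lower one of which has direction \<open>d\<close>.
  \<^item> \<open>Close i\<close>: a right extremum, joining two adjacent strands.
  \<^item> \<open>Cusp i s\<close>: a cusp on one strand, with privileged side \<open>s\<close>.
\<close>

datatype dir = East | West
datatype crossing = Over | Under | Virtual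
datatype side = Above | Below
datatype piece = Cross crossing nat | Open nat dir | Close nat | Cusp nat side

fun opp :: "dir \<Rightarrow> dir" where
  "opp East = West"
| "opp West = East"

fun flip :: "crossing \<Rightarrow> crossing" where
  "flip Over = Under"
| "flip Under = Over"
| "flip Virtual = Virtual"

text \<open>
  The directions, from bottom to top, of the strands to the right of a piece in terms of those to
  its left; \<open>None\<close> if the piece does not fit.  A cusp reverses the direction of its strand, so that
  it is a sink or a source.
\<close>
fun act :: "piece \<Rightarrow> dir list \<Rightarrow> dir list option" where
  "act (Cross c i) ds =
     (if Suc i < length ds then Some (ds[i := ds ! Suc i, Suc i := ds ! i]) else None)"
| "act (Open i d) ds =
     (if i \<le> length ds then Some (take i ds @ [d, opp d] @ drop i ds) else None)"
| "act (Close i) ds =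
     (if Suc i < length ds \<and> ds ! i \<noteq> ds ! Suc i then Some (take i ds @ drop (i + 2) ds) else None)"
| "act (Cusp i s) ds =
     (if i < length ds then Some (ds[i := opp (ds ! i)]) else None)"

primrec run :: "piece list \<Rightarrow> dir list \<Rightarrow> dir list option" where
  "run [] ds = Some ds"
| "run (p # w) ds = Option.bind (act p ds) (run w)"

definition dirs_at :: "piece list \<Rightarrow> nat \<Rightarrow> dir list" where
  "dirs_at w k = the (run (take k w) [])"

text \<open>Diagrams consist of at least one circle.\<close>
definition arrow_diagram :: "piece list \<Rightarrow> bool" where
  "arrow_diagram w \<longleftrightarrow> w \<noteq> [] \<and> run w [] = Some []"

definition link_diagram :: "piece list \<Rightarrow> bool" where
  "link_diagram w \<longleftrightarrow> arrow_diagram w \<and> (\<forall>i s. Cusp i s \<notin> set w)"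


section \<open>Virtual links\<close>

fun ins :: "piece \<Rightarrow> nat" where
  "ins (Cross c i) = 2" | "ins (Open i d) = 0" | "ins (Close i) = 2" | "ins (Cusp i s) = 1"

fun outs :: "piece \<Rightarrow> nat" where
  "outs (Cross c i) = 2" | "outs (Open i d) = 2" | "outs (Close i) = 0" | "outs (Cusp i s) = 1"

fun height :: "piece \<Rightarrow> nat" where
  "height (Cross c i) = i" | "height (Open i d) = i" | "height (Close i) = i" | "height (Cusp i s) = i"

fun at_height :: "nat \<Rightarrow> piece \<Rightarrow> piece" where
  "at_height j (Cross c i) = Cross c j"
| "at_height j (Open i d) = Open j d"
| "at_height j (Close i) = Close j"
| "at_height j (Cusp i s) = Cusp j s"

text \<open>
  The first five rules generate plane isotopy of diagrams cut into pieces: exchange of the first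
  coordinates of two distant pieces, creation of a pair of extrema, and a strand sliding across an
  extremum of a strand it crosses.

  In \<open>r3\<close> the strands are numbered from bottom to top on the left; \<open>a\<close>, \<open>b\<close> and \<open>c\<close> are the
  crossings of the strands 1 and 2, 1 and 3, 2 and 3.  The two excluded classical cases are those
  in which each strand passes over one of the others and under the remaining one.
\<close>
inductive local_move :: "piece list \<Rightarrow> piece list \<Rightarrow> bool" where
  exchange: "height p + outs p \<le> height q \<Longrightarrow>
     local_move [p, q] [at_height (height q - outs p + ins p) q, p]"
| zigzag1: "local_move [Open i d, Close (Suc i)] []"
| zigzag2: "local_move [Open (Suc i) d, Close i] []"
| slide_open: "local_move [Open i d, Cross c (Suc i)] [Open (Suc i) d, Cross (flip c) i]"
| slide_close: "local_move [Cross c (Suc i), Close i] [Cross (flip c) i, Close (Suc i)]"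
| r1_open: "local_move [Open i d, Cross c i] [Open i (opp d)]"
| r1_close: "local_move [Cross c i, Close i] [Close i]"
| r2: "local_move [Cross c i, Cross (flip c) i] []"
| r3: "\<lbrakk>a \<noteq> Virtual; b \<noteq> Virtual; c \<noteq> Virtual; \<not> (a = c \<and> b \<noteq> a)\<rbrakk> \<Longrightarrow>
     local_move [Cross a i, Cross b (Suc i), Cross c i] [Cross c (Suc i), Cross b i, Cross a (Suc i)]"
| r3_virtual: "local_move [Cross Virtual i, Cross Virtual (Suc i), Cross Virtual i]
     [Cross Virtual (Suc i), Cross Virtual i, Cross Virtual (Suc i)]"
| r3_mixed: "\<lbrakk>(b = Virtual \<and> c = Virtual) \<or> (a = Virtual \<and> c = Virtual) \<or> (a = Virtual \<and> b = Virtual)\<rbrakk> \<Longrightarrow>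
     local_move [Cross a i, Cross b (Suc i), Cross c i] [Cross c (Suc i), Cross b i, Cross a (Suc i)]"

inductive diagram_move :: "piece list \<Rightarrow> piece list \<Rightarrow> bool" where
  "\<lbrakk>local_move l r; run u [] = Some s; run l s = Some t; run r s = Some t;
    link_diagram (u @ l @ v); link_diagram (u @ r @ v)\<rbrakk> \<Longrightarrow>
   diagram_move (u @ l @ v) (u @ r @ v)"

definition link_rel :: "(piece list \<times> piece list) set" where
  "link_rel = {(v, w). link_diagram v \<and> link_diagram w \<and> equivclp diagram_move v w}"

definition virtual_links :: "piece list set set" where
  "virtual_links = {w. link_diagram w} // link_rel"


section \<open>The arrow polynomial\<close>

text \<open>
  The sign of a crossing whose rising strand has direction \<open>d\<close> and whose falling strand has
  direction \<open>d'\<close>.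
\<close>
fun sign :: "crossing \<Rightarrow> dir \<Rightarrow> dir \<Rightarrow> int" where
  "sign Over d d' = (if d = d' then -1 else 1)"
| "sign Under d d' = (if d = d' then 1 else -1)"
| "sign Virtual d d' = 0"

definition sign_at :: "piece list \<Rightarrow> nat \<Rightarrow> int" where
  "sign_at w k = (case w ! k of
       Cross c i \<Rightarrow> sign c (dirs_at w k ! i) (dirs_at w k ! Suc i) | _ \<Rightarrow> 0)"

definition writhe :: "piece list \<Rightarrow> int" where
  "writhe w = (\<Sum>k<length w. sign_at w k)"

fun classical :: "piece \<Rightarrow> bool" where
  "classical (Cross c i) = (c \<noteq> Virtual)"
| "classical _ = False"

subsection \<open>Components and zigzags\<close>

text \<open>
  The end \<open>(False, i)\<close> (\<open>(True, i)\<close>) of a piece is the point with \<open>i\<close> strands below it on the left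
  (right) boundary line of the piece.  \<open>other_end p\<close> exchanges the two ends of each strand of \<open>p\<close>.
\<close>
fun other_end :: "piece \<Rightarrow> bool \<times> nat \<Rightarrow> bool \<times> nat" where
  "other_end (Cross c j) (r, i) = (\<not> r, if i = j then Suc j else if i = Suc j then j else i)"
| "other_end (Open j d) (r, i) =
     (if i < j then (\<not> r, i)
      else if \<not> r then (True, i + 2)
      else if i = j then (True, Suc j)
      else if i = Suc j then (True, j)
      else (False, i - 2))"
| "other_end (Close j) (r, i) =
     (if i < j then (\<not> r, i)
      else if r then (False, i + 2)
      else if i = j then (False, Suc j)
      else if i = Suc j then (False, j)
      else (True, i - 2))"
| "other_end (Cusp j s) (r, i) = (\<not> r, i)"

text \<open>The state \<open>(k, e)\<close>: a traveller along the curves is about to enter the piece \<open>w ! k\<close> at \<open>e\<close>.\<close>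
type_synonym state = "nat \<times> bool \<times> nat"

definition states :: "piece list \<Rightarrow> state set" where
  "states w = {(k, r, i). k < length w \<and> i < length (dirs_at w (if r then Suc k else k))}"

fun travel :: "piece list \<Rightarrow> state \<Rightarrow> state" where
  "travel w (k, e) = (case other_end (w ! k) e of (r, i) \<Rightarrow> (if r then Suc k else k - 1, \<not> r, i))"

text \<open>A component as the set of its strands, so that it does not depend on the direction of travel.\<close>
definition component :: "piece list \<Rightarrow> state \<Rightarrow> (nat \<times> (bool \<times> nat) set) set" where
  "component w x = (\<lambda>(k, e). (k, {e, other_end (w ! k) e})) ` orbit (travel w) x"

definition components :: "piece list \<Rightarrow> (nat \<times> (bool \<times> nat) set) set set" where
  "components w = component w ` states w"

text \<open>A cusp is recorded as \<open>True\<close> if its privileged side is to the left of the traveller.\<close>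
fun cusp_met :: "piece list \<Rightarrow> state \<Rightarrow> bool list" where
  "cusp_met w (k, r, i) = (case w ! k of
       Cusp j s \<Rightarrow> if i = j then [(s = Above) \<noteq> r] else [] | _ \<Rightarrow> [])"

definition cusp_word :: "piece list \<Rightarrow> state \<Rightarrow> bool list" where
  "cusp_word w x =
     concat (map (\<lambda>m. cusp_met w ((travel w ^^ m) x)) [0..<funpow_dist1 (travel w) x x])"

text \<open>Cusp words are cyclic words: the last letter and the first one are consecutive.\<close>
inductive cusp_reduction :: "bool list \<Rightarrow> bool list \<Rightarrow> bool" where
  "rotate k xs = a # a # ys \<Longrightarrow> cusp_reduction xs ys"

definition zigzags :: "piece list \<Rightarrow> (nat \<times> (bool \<times> nat) set) set \<Rightarrow> nat" where
  "zigzags w S = (THE c. \<exists>x\<in>states w. \<exists>ys. component w x = S \<and>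
     cusp_reduction\<^sup>*\<^sup>* (cusp_word w x) ys \<and> (\<nexists>ys'. cusp_reduction ys ys') \<and> length ys = 2 * c)"

subsection \<open>The bracket\<close>

text \<open>
  Two strands of the same direction: the incoming half-strands are those on one side of the
  crossing, so the oriented smoothing is horizontal and the other one is vertical, with each new
  cusp (placed on the lower half of its arc) pointing towards the crossing and its concave side
  above that lower half.  Two strands of opposite directions: the oriented smoothing is vertical,
  the other one is horizontal, with the lower arc concave downwards and the upper one upwards.
\<close>
definition smoothing1 :: "nat \<Rightarrow> dir \<Rightarrow> dir \<Rightarrow> piece list" where
  "smoothing1 i d d' = (if d = d' then [] else [Close i, Open i d'])"

definition smoothing2 :: "nat \<Rightarrow> dir \<Rightarrow> dir \<Rightarrow> piece list" where
  "smoothing2 i d d' = (if d = d' then [Cusp i Above, Close i, Open i (opp d), Cusp i Above]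
                        else [Cusp i Below, Cusp (Suc i) Above])"

definition smooth_at ::
    "(nat \<Rightarrow> dir \<Rightarrow> dir \<Rightarrow> piece list) \<Rightarrow> piece list \<Rightarrow> nat \<Rightarrow> piece list" where
  "smooth_at sm w k =
     take k w @ sm (height (w ! k)) (dirs_at w k ! height (w ! k)) (dirs_at w k ! Suc (height (w ! k)))
       @ drop (Suc k) w"

lemma classical_smoothing:
  "filter classical (smoothing1 i d d') = []" "filter classical (smoothing2 i d d') = []"
  by (auto simp: smoothing1_def smoothing2_def)

lemma smooth_at_decreases:
  assumes "k < length w" "classical (w ! k)" "filter classical (sm (height (w ! k))
    (dirs_at w k ! height (w ! k)) (dirs_at w k ! Suc (height (w ! k)))) = []"
  shows "length (filter classical (smooth_at sm w k)) < length (filter classical w)"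
proof -
  have "filter classical w =
      filter classical (take k w) @ [w ! k] @ filter classical (drop (Suc k) w)"
    using assms(1,2) by (subst id_take_nth_drop[OF assms(1)]) simp
  then show ?thesis
    using assms(3) by (simp add: smooth_at_def)
qed

text \<open>The crossings are expanded from left to right.\<close>
function arrow_bracket :: "piece list \<Rightarrow> ra" where
  "arrow_bracket w =
     (if \<exists>k<length w. classical (w ! k)
      then let k = (LEAST k. k < length w \<and> classical (w ! k)) in
        A_pow (sign_at w k) * arrow_bracket (smooth_at smoothing1 w k) +
        A_pow (- sign_at w k) * arrow_bracket (smooth_at smoothing2 w k)
      else \<Prod>S\<in>components w. z (zigzags w S))"
  by auto
termination
proof (relation "measure (\<lambda>w. length (filter classical w))", goal_cases)
  case 1
  then show ?case by simp
next
  case (2 w k)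
  then have "k < length w \<and> classical (w ! k)"
    by (metis (mono_tags, lifting) LeastI_ex)
  then show ?case
    by (simp add: smooth_at_decreases classical_smoothing)
next
  case (3 w k)
  then have "k < length w \<and> classical (w ! k)"
    by (metis (mono_tags, lifting) LeastI_ex)
  then show ?case
    by (simp add: smooth_at_decreases classical_smoothing)
qed

declare arrow_bracket.simps [simp del]

text \<open>The first two factors are $(-A^3)^{-w}$.\<close>
definition arrow_polynomial :: "piece list \<Rightarrow> ra" where
  "arrow_polynomial w =
     (-1) ^ nat \<bar>writhe w\<bar> * A_pow (- 3 * writhe w) * arrow_bracket w"


section \<open>Virtual braids\<close>

datatype braid_letter = Sigma nat | SigmaInv nat | Tau nat

definition braid_words :: "nat \<Rightarrow> braid_letter list set" where
  "braid_words n = lists (\<Union>i\<in>{1..<n}. {Sigma i, SigmaInv i, Tau i})"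

inductive braid_relation :: "braid_letter list \<Rightarrow> braid_letter list \<Rightarrow> bool" where
  "braid_relation [Sigma i, SigmaInv i] []"
| "braid_relation [SigmaInv i, Sigma i] []"
| "braid_relation [Tau i, Tau i] []"
| "2 \<le> \<bar>int i - int j\<bar> \<Longrightarrow> braid_relation [Sigma i, Sigma j] [Sigma j, Sigma i]"
| "2 \<le> \<bar>int i - int j\<bar> \<Longrightarrow> braid_relation [Tau i, Tau j] [Tau j, Tau i]"
| "2 \<le> \<bar>int i - int j\<bar> \<Longrightarrow> braid_relation [Tau i, Sigma j] [Sigma j, Tau i]"
| "\<bar>int i - int j\<bar> = 1 \<Longrightarrow> braid_relation [Sigma i, Sigma j, Sigma i] [Sigma j, Sigma i, Sigma j]"
| "\<bar>int i - int j\<bar> = 1 \<Longrightarrow> braid_relation [Tau i, Tau j, Tau i] [Tau j, Tau i, Tau j]"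
| "\<bar>int i - int j\<bar> = 1 \<Longrightarrow> braid_relation [Tau i, Tau j, Sigma i] [Sigma j, Tau i, Tau j]"

inductive braid_step :: "nat \<Rightarrow> braid_letter list \<Rightarrow> braid_letter list \<Rightarrow> bool" for n where
  "\<lbrakk>braid_relation l r; u @ l @ v \<in> braid_words n; u @ r @ v \<in> braid_words n\<rbrakk> \<Longrightarrow>
   braid_step n (u @ l @ v) (u @ r @ v)"

definition braid_rel :: "nat \<Rightarrow> (braid_letter list \<times> braid_letter list) set" where
  "braid_rel n = {(u, v). u \<in> braid_words n \<and> v \<in> braid_words n \<and> equivclp (braid_step n) u v}"

definition VB :: "nat \<Rightarrow> braid_letter list set monoid" where
  "VB n = \<lparr>carrier = braid_words n // braid_rel n,
           monoid.mult = (\<lambda>\<beta> \<gamma>. \<Union>u\<in>\<beta>. \<Union>v\<in>\<gamma>. braid_rel n `` {u @ v}),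
           one = braid_rel n `` {[]}\<rparr>"

text \<open>
  In a positive crossing of two strands directed to the right, the falling strand passes over.
  The closing arcs run above the braid: the strand number \<open>i\<close> of the braid (from the bottom) is
  joined to the strand number \<open>i\<close> from the top among \<open>2 * n\<close> strands.
\<close>
fun letter_piece :: "braid_letter \<Rightarrow> piece" where
  "letter_piece (Sigma i) = Cross Under (i - 1)"
| "letter_piece (SigmaInv i) = Cross Over (i - 1)"
| "letter_piece (Tau i) = Cross Virtual (i - 1)"

definition closure_diagram :: "nat \<Rightarrow> braid_letter list \<Rightarrow> piece list" where
  "closure_diagram n u =
     map (\<lambda>i. Open i East) [0..<n] @ map letter_piece u @ map Close (rev [0..<n])"

definition braid_closure :: "nat \<Rightarrow> braid_letter list set \<Rightarrow> piece list set" where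
  "braid_closure n \<beta> = (\<Union>u\<in>\<beta>. link_rel `` {closure_diagram n u})"


section \<open>Free modules and algebras over $R^a$\<close>

text \<open>\<open>'b \<Rightarrow>\<^sub>0 ra\<close> is the free module with basis \<open>'b\<close>.\<close>

definition scale :: "ra \<Rightarrow> ('b \<Rightarrow>\<^sub>0 ra) \<Rightarrow> ('b \<Rightarrow>\<^sub>0 ra)" where
  "scale c x = Poly_Mapping.map ((*) c) x"

definition bilinear_extension ::
    "('b \<Rightarrow> 'b \<Rightarrow> ('b \<Rightarrow>\<^sub>0 ra)) \<Rightarrow> ('b \<Rightarrow>\<^sub>0 ra) \<Rightarrow> ('b \<Rightarrow>\<^sub>0 ra) \<Rightarrow> ('b \<Rightarrow>\<^sub>0 ra)" where
  "bilinear_extension m x y =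
     (\<Sum>F\<in>Poly_Mapping.keys x. \<Sum>G\<in>Poly_Mapping.keys y. scale (Poly_Mapping.lookup x F * Poly_Mapping.lookup y G) (m F G))"

definition VB_algebra :: "nat \<Rightarrow> (braid_letter list set \<Rightarrow>\<^sub>0 ra) set" where
  "VB_algebra n = {x. Poly_Mapping.keys x \<subseteq> carrier (VB n)}"

definition VB_algebra_mult ::
    "nat \<Rightarrow> (braid_letter list set \<Rightarrow>\<^sub>0 ra) \<Rightarrow> (braid_letter list set \<Rightarrow>\<^sub>0 ra)
      \<Rightarrow> (braid_letter list set \<Rightarrow>\<^sub>0 ra)" where
  "VB_algebra_mult n =
     bilinear_extension (\<lambda>\<beta> \<gamma>. Poly_Mapping.single (\<beta> \<otimes>\<^bsub>VB n\<^esub> \<gamma>) 1)"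


section \<open>The algebra $\mathrm{ATL}_n(R^a)$\<close>

type_synonym vertex = "nat \<times> nat"
type_synonym flat_tangle = "vertex set set"
type_synonym arrow_tangle = "flat_tangle \<times> (vertex set \<Rightarrow> int)"

definition V :: "nat \<Rightarrow> vertex set" where
  "V n = {0, 1} \<times> {1..n}"

fun vless :: "vertex \<Rightarrow> vertex \<Rightarrow> bool" where
  "vless (a, b) (c, d) \<longleftrightarrow> a < c \<or> (a = c \<and> (if a = 0 then b < d else d < b))"

definition flat_tangles :: "nat \<Rightarrow> flat_tangle set" where
  "flat_tangles n = {E. partition_on (V n) E \<and> (\<forall>\<alpha>\<in>E. card \<alpha> = 2)}"

text \<open>Labels are extensional (\<open>undefined\<close> outside \<open>E\<close>), so that each basis element occurs once.\<close>
definition arrow_tangles :: "nat \<Rightarrow> arrow_tangle set" where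
  "arrow_tangles n = {(E, f). E \<in> flat_tangles n \<and> f \<in> extensional E \<and>
     (\<forall>p q. {p, q} \<in> E \<longrightarrow> (if fst p = fst q then odd (f {p, q}) else even (f {p, q})))}"

definition ATL :: "nat \<Rightarrow> (arrow_tangle \<Rightarrow>\<^sub>0 ra) set" where
  "ATL n = {x. Poly_Mapping.keys x \<subseteq> arrow_tangles n}"

subsection \<open>Parity\<close>

text \<open>
  A tuple $(\alpha_1,\dots,\alpha_\ell)$ with $\alpha_i=\{(a_i,b_{i-1}),(c_i,b_i)\}$ is given by the list of
  the pairs $((a_i,b_{i-1}),(c_i,b_i))$; list positions start from 0.
\<close>

fun parity :: "vertex \<times> vertex \<Rightarrow> int" where
  "parity (p, q) = (if fst p = fst q then -1 else 1)"

definition cumulated_parity :: "(vertex \<times> vertex) list \<Rightarrow> nat \<Rightarrow> int" where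
  "cumulated_parity \<alpha> i =
     (if vless (fst (\<alpha> ! i)) (snd (\<alpha> ! i)) then \<Prod>j<i. parity (\<alpha> ! j) else \<Prod>j\<le>i. parity (\<alpha> ! j))"

subsection \<open>Multiplication\<close>

text \<open>
  In the disjoint union of \<open>E\<close> and \<open>E'\<close>, elements of \<open>E\<close> are tagged with \<open>False\<close> and those of \<open>E'\<close>
  with \<open>True\<close>.
\<close>
type_synonym tagged = "bool \<times> vertex \<times> vertex"

fun tagged_in :: "flat_tangle \<Rightarrow> flat_tangle \<Rightarrow> tagged \<Rightarrow> bool" where
  "tagged_in E E' (t, p, q) \<longleftrightarrow> {p, q} \<in> (if t then E' else E)"

fun tagged_label :: "(vertex set \<Rightarrow> int) \<Rightarrow> (vertex set \<Rightarrow> int) \<Rightarrow> tagged \<Rightarrow> int" where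
  "tagged_label f f' (t, p, q) = (if t then f' else f) {p, q}"

definition is_arc :: "flat_tangle \<Rightarrow> flat_tangle \<Rightarrow> tagged list \<Rightarrow> bool" where
  "is_arc E E' \<alpha> \<longleftrightarrow> \<alpha> \<noteq> [] \<and> (\<forall>i<length \<alpha>. tagged_in E E' (\<alpha> ! i)) \<and>
     (\<forall>i. Suc i < length \<alpha> \<longrightarrow>
        (case (\<alpha> ! i, \<alpha> ! Suc i) of ((t, _, (c, b)), (t', (a, b'), _)) \<Rightarrow>
           b' = b \<and> (if \<not> t then c = 1 \<and> t' \<and> a = 0 else c = 0 \<and> \<not> t' \<and> a = 1))) \<and>
     (case (hd \<alpha>, last \<alpha>) of ((t, p, _), (t', _, q)) \<Rightarrow>
        fst p = (if t then 1 else 0) \<and> fst q = (if t' then 1 else 0) \<and> vless p q)"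

definition boundary :: "tagged list \<Rightarrow> vertex set" where
  "boundary \<alpha> = {fst (snd (hd \<alpha>)), snd (snd (last \<alpha>))}"

definition is_cycle :: "flat_tangle \<Rightarrow> flat_tangle \<Rightarrow> tagged list \<Rightarrow> bool" where
  "is_cycle E E' \<gamma> \<longleftrightarrow> 2 \<le> length \<gamma> \<and> even (length \<gamma>) \<and> (\<forall>i<length \<gamma>. tagged_in E E' (\<gamma> ! i)) \<and>
     (\<forall>i<length \<gamma>. case \<gamma> ! i of (t, (a, _), (c, _)) \<Rightarrow>
        if even i then \<not> t \<and> a = 1 \<and> c = 1 else t \<and> a = 0 \<and> c = 0) \<and>
     (\<forall>i. Suc i < length \<gamma> \<longrightarrow>
        (case (\<gamma> ! i, \<gamma> ! Suc i) of ((_, _, (_, b)), (_, (_, b'), _)) \<Rightarrow> b' = b)) \<and>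
     (case (hd \<gamma>, last \<gamma>) of ((_, (_, b\<^sub>0), _), (_, _, (_, b))) \<Rightarrow> b\<^sub>0 = b) \<and>
     (\<forall>i. Suc i < length \<gamma> \<longrightarrow>
        (case (hd \<gamma>, \<gamma> ! i) of ((_, (_, b\<^sub>0), _), (_, _, (_, b))) \<Rightarrow> b\<^sub>0 < b))"

definition path_label ::
    "(vertex set \<Rightarrow> int) \<Rightarrow> (vertex set \<Rightarrow> int) \<Rightarrow> tagged list \<Rightarrow> int" where
  "path_label f f' \<alpha> =
     (\<Sum>i<length \<alpha>. cumulated_parity (map snd \<alpha>) i * tagged_label f f' (\<alpha> ! i))"

definition flat_product :: "flat_tangle \<Rightarrow> flat_tangle \<Rightarrow> flat_tangle" where
  "flat_product E E' = boundary ` {\<alpha>. is_arc E E' \<alpha>}"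

fun arrow_product :: "arrow_tangle \<Rightarrow> arrow_tangle \<Rightarrow> arrow_tangle" where
  "arrow_product (E, f) (E', f') = (flat_product E E',
     \<lambda>B\<in>flat_product E E'. path_label f f' (THE \<alpha>. is_arc E E' \<alpha> \<and> boundary \<alpha> = B))"

fun cycle_factor :: "arrow_tangle \<Rightarrow> arrow_tangle \<Rightarrow> ra" where
  "cycle_factor (E, f) (E', f') =
     (\<Prod>\<gamma> | is_cycle E E' \<gamma>. z (nat \<bar>path_label f f' \<gamma>\<bar> div 2))"

definition ATL_mult ::
    "(arrow_tangle \<Rightarrow>\<^sub>0 ra) \<Rightarrow> (arrow_tangle \<Rightarrow>\<^sub>0 ra) \<Rightarrow> (arrow_tangle \<Rightarrow>\<^sub>0 ra)" where
  "ATL_mult =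
     bilinear_extension (\<lambda>F F'. Poly_Mapping.single (arrow_product F F') (cycle_factor F F'))"

definition tangle_id :: "nat \<Rightarrow> arrow_tangle" where
  "tangle_id n = (let E = (\<lambda>k. {(0, k), (1, k)}) ` {1..n} in (E, \<lambda>\<alpha>\<in>E. 0))"

definition tangle_F :: "nat \<Rightarrow> nat \<Rightarrow> arrow_tangle" where
  "tangle_F n i = (let E\<^sub>1 = {{(0, i), (0, Suc i)}, {(1, i), (1, Suc i)}};
                       E\<^sub>0 = (\<lambda>k. {(0, k), (1, k)}) ` ({1..n} - {i, Suc i})
                   in (E\<^sub>1 \<union> E\<^sub>0, \<lambda>\<alpha>\<in>E\<^sub>1 \<union> E\<^sub>0. if \<alpha> \<in> E\<^sub>1 then 1 else 0))"

definition tangle_w :: "nat \<Rightarrow> nat \<Rightarrow> arrow_tangle" where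
  "tangle_w n i = (let E = {{(0, i), (1, Suc i)}, {(0, Suc i), (1, i)}} \<union>
                           (\<lambda>k. {(0, k), (1, k)}) ` ({1..n} - {i, Suc i})
                   in (E, \<lambda>\<alpha>\<in>E. 0))"

text \<open>\<open>\<rho>\<close> is the algebra homomorphism $\rho_n^a$.\<close>
definition arrow_representation ::
    "nat \<Rightarrow> ((braid_letter list set \<Rightarrow>\<^sub>0 ra) \<Rightarrow> (arrow_tangle \<Rightarrow>\<^sub>0 ra)) \<Rightarrow> bool" where
  "arrow_representation n \<rho> \<longleftrightarrow>
     (\<forall>x\<in>VB_algebra n. \<rho> x \<in> ATL n) \<and>
     (\<forall>x\<in>VB_algebra n. \<forall>y\<in>VB_algebra n. \<rho> (x + y) = \<rho> x + \<rho> y) \<and>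
     (\<forall>c. \<forall>x\<in>VB_algebra n. \<rho> (scale c x) = scale c (\<rho> x)) \<and>
     \<rho> (Poly_Mapping.single \<one>\<^bsub>VB n\<^esub> 1) = Poly_Mapping.single (tangle_id n) 1 \<and>
     (\<forall>x\<in>VB_algebra n. \<forall>y\<in>VB_algebra n.
        \<rho> (VB_algebra_mult n x y) = ATL_mult (\<rho> x) (\<rho> y)) \<and>
     (\<forall>i\<in>{1..<n}.
        \<rho> (Poly_Mapping.single (braid_rel n `` {[Sigma i]}) 1) =
          Poly_Mapping.single (tangle_id n) (- A_pow (-2)) +
          Poly_Mapping.single (tangle_F n i) (- A_pow (-4))) \<and>
     (\<forall>i\<in>{1..<n}.
        \<rho> (Poly_Mapping.single (braid_rel n `` {[Tau i]}) 1) =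
          Poly_Mapping.single (tangle_w n i) 1)"

subsection \<open>Trace\<close>

definition is_closure_cycle :: "flat_tangle \<Rightarrow> (vertex \<times> vertex) list \<Rightarrow> bool" where
  "is_closure_cycle E \<gamma> \<longleftrightarrow> \<gamma> \<noteq> [] \<and> (\<forall>(p, q)\<in>set \<gamma>. {p, q} \<in> E) \<and>
     (\<forall>i. Suc i < length \<gamma> \<longrightarrow>
        (case (\<gamma> ! i, \<gamma> ! Suc i) of ((_, (c, b)), ((a, b'), _)) \<Rightarrow>
           b' = b \<and> a = (if c = 0 then 1 else 0))) \<and>
     (case (hd \<gamma>, last \<gamma>) of (((a, b\<^sub>0), _), (_, (c, b))) \<Rightarrow> b\<^sub>0 = b \<and> a = 0 \<and> c = 1) \<and>
     (\<forall>i. Suc i < length \<gamma> \<longrightarrow> snd (fst (hd \<gamma>)) < snd (snd (\<gamma> ! i)))"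

definition closure_cycle_label :: "(vertex set \<Rightarrow> int) \<Rightarrow> (vertex \<times> vertex) list \<Rightarrow> int" where
  "closure_cycle_label f \<gamma> =
     (\<Sum>i<length \<gamma>. cumulated_parity \<gamma> i * (case \<gamma> ! i of (p, q) \<Rightarrow> f {p, q}))"

fun basis_trace :: "arrow_tangle \<Rightarrow> ra" where
  "basis_trace (E, f) =
     (\<Prod>\<gamma> | is_closure_cycle E \<gamma>. z (nat \<bar>closure_cycle_label f \<gamma>\<bar> div 2))"

definition arrow_trace :: "(arrow_tangle \<Rightarrow>\<^sub>0 ra) \<Rightarrow> ra" where
  "arrow_trace x = (\<Sum>F\<in>Poly_Mapping.keys x. Poly_Mapping.lookup x F * basis_trace F)"

end

theory Submission imports Defs begin

text \<open>
  A diagram is read from left to right.  After some pieces, the strands cut by a vertical line are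
  paired by the arcs on the left, and each arc carries a label, the signed number of its cusps, which
  records the reduced zigzag; labels of consecutive arcs compose by \<open>s \<oplus> t = s \<plusminus> t\<close>, the
  sign being the parity of \<open>s\<close>.  Expanding each classical crossing when it is met turns the arrow
  polynomial into a state sum over such labelled pairings.  The state sum is invariant under those
  moves that bring a diagram into the form of a closed braid (Alexander's theorem for virtual links),
  so that only closures of braids have to be compared.  There the pairing of the \<open>2 * n\<close> strands is
  an arrow flat tangle, a generator acts on it as the corresponding pieces of the smoothings do, and
  joining the strands is the trace.  The action of the inverse of \<open>\<sigma>\<^sub>i\<close> is found by solving the
  action of \<open>\<sigma>\<^sub>i\<close>, using $F_i^2 = z_0 F_i$.
\<close>

section \<open>Labels\<close>

text \<open>A word in the two kinds of cusps, in which equal neighbours cancel, is an element of the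
  free product of two groups of order two, that is, of the infinite dihedral group. The integers
  with \<open>\<oplus>\<close> are this group: the generators are 1 and -1, both of order two, and
  an alternating word of length m has the value m or -m according to its first letter. A loop
  determines an even element up to conjugation, hence an absolute value, and half of it is the
  number of zigzags. Reduction of words thus becomes arithmetic.

  The invariant \<open>I\<close> is given as a function on links, so for a diagram \<open>D\<close>
  it is enough to reach one closed braid by moves that preserve the state sum. The braiding is
  therefore arranged so that classical crossings are neither created nor removed nor exchanged with
  each other: they only slide around left extrema, past flat pieces and along pairs of virtual
  crossings. The classical Reidemeister moves enter in showing that words for the same braid have
  the same closure.\<close>

definition dop :: "int \<Rightarrow> int \<Rightarrow> int" (infixl "\<oplus>" 65) where
  "s \<oplus> t = (if even s then s + t else s - t)"

text \<open>Reading a path backwards reverses its word and exchanges left and right. Reversal of a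
  word is inversion in the dihedral group and the exchange of sides is negation; together they fix
  the even labels and negate the odd ones.\<close>

definition drev :: "int \<Rightarrow> int" where
  "drev t = (if even t then t else - t)"

lemma dop_assoc: "r \<oplus> s \<oplus> t = r \<oplus> (s \<oplus> t)"
  by (auto simp: dop_def)

lemma dop_0 [simp]: "0 \<oplus> t = t" "t \<oplus> 0 = t"
  by (auto simp: dop_def)

lemma even_dop [simp]: "even (s \<oplus> t) \<longleftrightarrow> (even s \<longleftrightarrow> even t)"
  by (auto simp: dop_def)

lemma even_drev [simp]: "even (drev t) \<longleftrightarrow> even t"
  by (auto simp: drev_def)

lemma drev_drev [simp]: "drev (drev t) = t"
  by (auto simp: drev_def)

lemma drev_0 [simp]: "drev 0 = 0"
  by (auto simp: drev_def)

lemma abs_drev [simp]: "\<bar>drev t\<bar> = \<bar>t\<bar>"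
  by (auto simp: drev_def)

lemma drev_dop: "drev (s \<oplus> t) = drev t \<oplus> drev s"
  by (auto simp: drev_def dop_def)

text \<open>Two even labels commute, and two odd ones give opposite differences. Hence a loop made
  of two arcs has the same value from either starting point.\<close>

lemma abs_dop_commute: "even s = even t \<Longrightarrow> \<bar>s \<oplus> t\<bar> = \<bar>t \<oplus> s\<bar>"
  by (auto simp: dop_def)

definition zval :: "int \<Rightarrow> ra" where
  "zval t = z (nat \<bar>t\<bar> div 2)"

lemma zval_drev [simp]: "zval (drev t) = zval t"
  by (simp add: zval_def)

lemma zval_dop_commute: "even s = even t \<Longrightarrow> zval (s \<oplus> t) = zval (t \<oplus> s)"
  by (simp add: zval_def abs_dop_commute)


section \<open>States of a partial diagram\<close>

text \<open>The components are the direction of a strand, the other end of its arc in the part of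
  the diagram on the left, and a label. The label of \<open>x\<close> is read from the end
  \<open>x\<close> to the other end of the arc.\<close>

type_synonym strands = "(nat \<Rightarrow> dir) \<times> (nat \<Rightarrow> nat) \<times> (nat \<Rightarrow> int)"
type_synonym lstate = "nat list \<times> strands"

fun dirs :: "lstate \<Rightarrow> dir list" where
  "dirs (xs, D, A, g) = map D xs"

text \<open>An arc without cusps leaves the cut and returns to it, so its two ends have opposite
  directions there. Every cusp reverses one of them, and the parity of the label is the parity of
  the number of cusps.\<close>

fun good :: "lstate \<Rightarrow> bool" where
  "good (xs, D, A, g) \<longleftrightarrow> distinct xs \<and> (\<forall>x\<in>set xs. A x \<in> set xs \<and> A (A x) = x \<and> A x \<noteq> x \<and>
     g (A x) = drev (g x) \<and> (even (g x) \<longleftrightarrow> D x \<noteq> D (A x)))"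

fun new_names :: "piece \<Rightarrow> nat list \<Rightarrow> nat \<Rightarrow> nat \<Rightarrow> nat list" where
  "new_names (Cross c i) P a b = [P ! 1, P ! 0]"
| "new_names (Open i d) P a b = [a, b]"
| "new_names (Close i) P a b = []"
| "new_names (Cusp i s) P a b = [P ! 0]"

text \<open>The label is read by a traveller who enters at the cut and moves to the left; the upper
  side is on the right hand of that traveller, and left counts as 1.\<close>

fun cusp_label :: "side \<Rightarrow> int" where
  "cusp_label Above = -1"
| "cusp_label Below = 1"

fun tr :: "piece \<Rightarrow> nat list \<Rightarrow> nat \<Rightarrow> nat \<Rightarrow> strands \<Rightarrow> strands" where
  "tr (Cross c i) P a b (D, A, g) = (D, A, g)"
| "tr (Open i d) P a b (D, A, g) = (D(a := d, b := opp d), A(a := b, b := a), g(a := 0, b := 0))"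
| "tr (Close i) P a b (D, A, g) = (D, A(A (P ! 0) := A (P ! 1), A (P ! 1) := A (P ! 0)),
     g(A (P ! 0) := g (A (P ! 0)) \<oplus> g (P ! 1), A (P ! 1) := g (A (P ! 1)) \<oplus> g (P ! 0)))"
| "tr (Cusp i s) P a b (D, A, g) = (D(P ! 0 := opp (D (P ! 0))), A,
     g(P ! 0 := cusp_label s \<oplus> g (P ! 0), A (P ! 0) := g (A (P ! 0)) \<oplus> (- cusp_label s)))"

text \<open>The names of a new arc are arguments, so that the same pieces in two orders can be run
  with the same names and compared; \<open>stp\<close> then fixes a choice.\<close>

fun stp_with :: "nat \<Rightarrow> nat \<Rightarrow> piece \<Rightarrow> lstate \<Rightarrow> lstate" where
  "stp_with a b p (xs, \<sigma>) = (let P = take (ins p) (drop (height p) xs) in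
     (take (height p) xs @ new_names p P a b @ drop (height p + ins p) xs, tr p P a b \<sigma>))"

definition fresh :: "nat list \<Rightarrow> nat" where
  "fresh xs = Suc (sum_list xs)"

definition stp :: "piece \<Rightarrow> lstate \<Rightarrow> lstate" where
  "stp p s = stp_with (fresh (fst s)) (Suc (fresh (fst s))) p s"

text \<open>A loop is completed only when a right extremum joins the two ends of one arc.\<close>

fun fac :: "piece \<Rightarrow> lstate \<Rightarrow> ra" where
  "fac (Close i) (xs, D, A, g) = (if A (xs ! i) = xs ! Suc i then zval (g (xs ! i)) else 1)"
| "fac _ s = 1"

primrec stps :: "piece list \<Rightarrow> lstate \<Rightarrow> lstate" where
  "stps [] s = s"
| "stps (p # w) s = stps w (stp p s)"

primrec facs :: "piece list \<Rightarrow> lstate \<Rightarrow> ra" where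
  "facs [] s = 1"
| "facs (p # w) s = fac p s * facs w (stp p s)"

lemma opp_opp [simp]: "opp (opp d) = d"
  by (cases d) auto

lemma opp_neq [simp]: "opp d \<noteq> d" "d \<noteq> opp d"
  by (cases d; simp)+

lemma neq_opp_iff: "d \<noteq> e \<longleftrightarrow> e = opp d"
  by (cases d; cases e; simp)

lemma fresh_notin: "fresh xs + k \<notin> set xs"
  using member_le_sum_list[of _ xs] by (fastforce simp: fresh_def)

lemma fresh_notin': "fresh xs \<notin> set xs" "Suc (fresh xs) \<notin> set xs"
  using fresh_notin[of xs 0] fresh_notin[of xs 1] by auto

lemma split_names:
  assumes "act p (map D xs) = Some ds"
  obtains us P zs where "xs = us @ P @ zs" "length us = height p" "length P = ins p"
proof -
  have le: "height p + ins p \<le> length xs"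
    using assms by (cases p) (auto split: if_splits)
  let ?us = "take (height p) xs" and ?P = "take (ins p) (drop (height p) xs)"
    and ?zs = "drop (height p + ins p) xs"
  have 1: "xs = ?us @ ?P @ ?zs"
    by (metis add.commute append_assoc append_take_drop_id take_add)
  have 2: "length ?us = height p" "length ?P = ins p"
    using le by auto
  show ?thesis
    by (rule that[OF 1 2])
qed

lemma stp_with_split:
  "length us = height p \<Longrightarrow> length P = ins p \<Longrightarrow>
   stp_with a b p (us @ P @ zs, \<sigma>) = (us @ new_names p P a b @ zs, tr p P a b \<sigma>)"
  by (simp add: Let_def)

declare good.simps [simp del]

lemma goodI:
  assumes "distinct xs"
    and "\<And>u. u \<in> set xs \<Longrightarrow> A u \<in> set xs \<and> A (A u) = u \<and> A u \<noteq> u \<and>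
      g (A u) = drev (g u) \<and> (even (g u) \<longleftrightarrow> D u \<noteq> D (A u))"
  shows "good (xs, D, A, g)"
  using assms by (simp only: good.simps) blast

lemma goodD:
  assumes "good (xs, D, A, g)" and "u \<in> set xs"
  shows "A u \<in> set xs" "A (A u) = u" "A u \<noteq> u" "g (A u) = drev (g u)"
    "even (g u) \<longleftrightarrow> D u \<noteq> D (A u)"
  using assms unfolding good.simps by blast+

lemma good_distinct: "good (xs, D, A, g) \<Longrightarrow> distinct xs"
  by (simp only: good.simps)

lemma length_Suc_0_conv: "length P = Suc 0 \<longleftrightarrow> (\<exists>x. P = [x])"
  by (cases P) auto

lemma length_2_conv: "length P = 2 \<longleftrightarrow> (\<exists>x y. P = [x, y])"
  by (auto simp: numeral_2_eq_2 length_Suc_conv)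

lemma act_split:
  assumes "length us = height p" "length P = ins p"
    and "act p (map D (us @ P @ zs)) = Some ds" "a \<noteq> b"
  shows "ds = map D us @ map (fst (tr p P a b (D, \<sigma>))) (new_names p P a b) @ map D zs"
  using assms
  by (cases p; cases \<sigma>)
    (auto simp: length_2_conv length_Suc_0_conv nth_append list_update_append neq_opp_iff split: if_splits)

lemma tr_outside:
  assumes "x \<notin> set P" "x \<noteq> a" "x \<noteq> b" "length P = ins p"
  shows "fst (tr p P a b (D, \<sigma>)) x = D x"
  using assms by (cases p; cases \<sigma>) (auto simp: length_2_conv length_Suc_0_conv)

text \<open>Either the two ends belong to one arc, which disappears, or two arcs are merged. In the
  second case the labels are composed and, as the joined ends have opposite directions, the parity
  of the result still compares the directions of the outer ends.\<close>

lemma good_tr_Close: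
  assumes "good (us @ [x, y] @ zs, D, A, g)" and "D x \<noteq> D y"
  shows "good (us @ zs, tr (Close i) [x, y] a b (D, A, g))"
proof -
  let ?S = "set us \<union> set zs"
  have I: "A u \<in> insert x (insert y ?S)" "A (A u) = u" "A u \<noteq> u"
    and G: "g (A u) = drev (g u)" "even (g u) \<longleftrightarrow> D u \<noteq> D (A u)"
    if "u \<in> insert x (insert y ?S)" for u
    using goodD[OF assms(1), of u] that by auto
  have d: "x \<notin> ?S" "y \<notin> ?S" "x \<noteq> y" "distinct (us @ zs)"
    using good_distinct[OF assms(1)] by auto
  let ?A = "A(A x := A y, A y := A x)"
  let ?g = "g(A x := g (A x) \<oplus> g y, A y := g (A y) \<oplus> g x)"
  have "?A u \<in> ?S \<and> ?A (?A u) = u \<and> ?A u \<noteq> u \<and> ?g (?A u) = drev (?g u) \<and>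
      (even (?g u) \<longleftrightarrow> D u \<noteq> D (?A u))" if u: "u \<in> ?S" for u
  proof (cases "A x = y")
    case True
    then have "A y = x" using I(2)[of x] by simp
    moreover have "A (A u) = u" using I(2) u by blast
    ultimately have "A u \<noteq> x" "A u \<noteq> y" "u \<noteq> x" "u \<noteq> y"
      using True u d(1,2) by metis+
    then show ?thesis using True \<open>A y = x\<close> I[of u] G[of u] u by simp
  next
    case False
    have ne: "A x \<noteq> y" "A y \<noteq> x" "A x \<noteq> A y" "A x \<noteq> x" "A y \<noteq> y"
      using False I(2)[of x] I(2)[of y] I(3)[of x] I(3)[of y] d(3) by (metis insertCI)+
    have S: "A x \<in> ?S" "A y \<in> ?S"
      using ne I(1)[of x] I(1)[of y] by auto
    show ?thesis
    proof (cases "u = A x \<or> u = A y")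
      case True
      have e: "even (g x) \<longleftrightarrow> D x \<noteq> D (A x)" "even (g y) \<longleftrightarrow> D y \<noteq> D (A y)"
        "g (A x) = drev (g x)" "g (A y) = drev (g y)"
        using G[of x] G[of y] by simp_all
      have "D (A x) \<noteq> D (A y) \<longleftrightarrow> (even (g x) \<longleftrightarrow> even (g y))"
        unfolding e(1,2) using assms(2)
        by (cases "D x"; cases "D y"; cases "D (A x)"; cases "D (A y)") simp_all
      then show ?thesis using True S ne e by (elim disjE) (simp_all add: drev_dop eq_commute[of "D (A y)"], argo?)
    next
      case False
      have "A u \<noteq> A x" "A u \<noteq> A y"
        using I(2)[of u] I(2)[of x] I(2)[of y] u d(1,2) by (metis insertCI)+
      moreover have "A u \<noteq> x" "A u \<noteq> y"
        using I(2)[of u] u False by (metis insertCI)+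
      ultimately show ?thesis using False I[of u] G[of u] u by simp
    qed
  qed
  then show ?thesis unfolding tr.simps using d(4) by (intro goodI) simp_all
qed

lemma good_stp_with:
  assumes "good (xs, D, A, g)" "act p (map D xs) = Some ds" "a \<noteq> b" "a \<notin> set xs" "b \<notin> set xs"
  shows "good (stp_with a b p (xs, D, A, g)) \<and> dirs (stp_with a b p (xs, D, A, g)) = ds"
proof -
  obtain us P zs where xs: "xs = us @ P @ zs" and l: "length us = height p" "length P = ins p"
    using split_names[OF assms(2)] by metis
  obtain \<sigma> where \<sigma>: "\<sigma> = (A, g)" by simp
  have tr: "map (fst (tr p P a b (D, A, g))) us = map D us" "map (fst (tr p P a b (D, A, g))) zs = map D zs"
    using assms(4,5) good_distinct[OF assms(1)] xs by (auto intro!: tr_outside l(2))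
  have 1: "dirs (stp_with a b p (xs, D, A, g)) = ds"
    unfolding xs stp_with_split[OF l]
    using act_split[OF l, of D zs ds a b "(A, g)"] assms tr xs
    by (cases "tr p P a b (D, A, g)") (simp del: map_eq_conv)
  have 2: "good (us @ new_names p P a b @ zs, tr p P a b (D, A, g))"
  proof (cases p)
    case (Cross c i)
    then obtain x y where "P = [x, y]" using l by (auto simp: length_2_conv)
    then show ?thesis using good_distinct[OF assms(1)] goodD[OF assms(1)] Cross xs
      unfolding Cross tr.simps by (intro goodI) auto
  next
    case (Open i d)
    then have P: "P = []" using l by simp
    have N: "set (us @ [a, b] @ zs) = insert a (insert b (set xs))" using xs P by auto
    have w: "A u \<noteq> a" "A u \<noteq> b" "u \<noteq> a" "u \<noteq> b" if "u \<in> set xs" for u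
      using goodD(1)[OF assms(1) that] assms(4,5) that by auto
    have "good (us @ [a, b] @ zs, D(a := d, b := opp d), A(a := b, b := a), g(a := 0, b := 0))"
    proof (rule goodI)
      show "distinct (us @ [a, b] @ zs)"
        using good_distinct[OF assms(1)] assms(3-5) xs P by auto
      fix u assume "u \<in> set (us @ [a, b] @ zs)"
      then consider "u = a" | "u = b" | "u \<in> set xs" unfolding N by blast
      then show "(A(a := b, b := a)) u \<in> set (us @ [a, b] @ zs) \<and>
         (A(a := b, b := a)) ((A(a := b, b := a)) u) = u \<and>
         (A(a := b, b := a)) u \<noteq> u \<and>
         (g(a := 0, b := 0)) ((A(a := b, b := a)) u) = drev ((g(a := 0, b := 0)) u) \<and>
         even ((g(a := 0, b := 0)) u) =
         ((D(a := d, b := opp d)) u \<noteq> (D(a := d, b := opp d)) ((A(a := b, b := a)) u))"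
        unfolding N using assms(3) by cases (simp_all add: w goodD[OF assms(1)])
    qed
    then show ?thesis unfolding Open by simp
  next
    case (Close i)
    obtain x y where P: "P = [x, y]" using l Close by (auto simp: length_2_conv)
    have "D x \<noteq> D y"
      using assms(2) xs l P Close by (auto simp: nth_append split: if_splits)
    then show ?thesis using good_tr_Close[of us x y zs D A g] assms(1) xs P Close by simp
  next
    case (Cusp i s)
    obtain x where P: "P = [x]" using l Cusp by (auto simp: length_Suc_0_conv)
    have odd: "odd (cusp_label s)" "drev (cusp_label s) = - cusp_label s"
      by (cases s; simp add: drev_def)+
    have w: "\<And>u. u \<in> set xs \<Longrightarrow> A u \<in> set xs \<and> A (A u) = u \<and> A u \<noteq> u \<and>
     g (A u) = drev (g u) \<and> (even (g u) \<longleftrightarrow> D u \<noteq> D (A u))" and dx: "distinct xs"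
      using goodD[OF assms(1)] good_distinct[OF assms(1)] by simp_all
    have x: "x \<in> set xs" using xs P by auto
    have st: "set (us @ new_names p P a b @ zs) = set xs" "distinct (us @ new_names p P a b @ zs)"
      using xs P Cusp dx by auto
    let ?D = "D(x := opp (D x))" 
    let ?g = "g(x := cusp_label s \<oplus> g x, A x := g (A x) \<oplus> (- cusp_label s))"
    have "A u \<in> set xs \<and> A (A u) = u \<and> A u \<noteq> u \<and> ?g (A u) = drev (?g u) \<and>
        (even (?g u) \<longleftrightarrow> ?D u \<noteq> ?D (A u))" if u: "u \<in> set xs" for u
    proof -
      consider "u = x" | "u = A x" | "u \<noteq> x" "u \<noteq> A x" by blast
      then show ?thesis
      proof cases
        case 1
        have "(opp (D x) \<noteq> D (A x)) \<longleftrightarrow> D x = D (A x)"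
          by (cases "D x"; cases "D (A x)") simp_all
        then show ?thesis using 1 w[of x] x odd by (auto simp: drev_dop)
      next
        case 2
        have "(opp (D x) \<noteq> D (A x)) \<longleftrightarrow> D x = D (A x)"
          by (cases "D x"; cases "D (A x)") simp_all
        moreover have "drev (- cusp_label s) = cusp_label s" using odd by (metis drev_drev)
        moreover have "A x \<noteq> x" "A (A x) = x" "A x \<in> set xs" "g (A x) = drev (g x)"
          "even (g x) \<longleftrightarrow> D x \<noteq> D (A x)"
          using w[OF x] by simp_all
        ultimately show ?thesis unfolding 2 using x odd by (simp add: drev_dop eq_commute[of "D (A x)"])
      next
        case 3
        have "A u \<noteq> x" "A u \<noteq> A x" using 3 w[OF u] w[OF x] by auto
        then show ?thesis using 3 w[OF u] by simp
      qed
    qed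
    then show ?thesis unfolding Cusp tr.simps P using st unfolding Cusp P by (intro goodI) simp_all
  qed
  show ?thesis using 1 2 unfolding xs stp_with_split[OF l] by simp
qed

lemma good_stp: "good s \<Longrightarrow> act p (dirs s) = Some ds \<Longrightarrow> good (stp p s)"
  and dirs_stp: "good s \<Longrightarrow> act p (dirs s) = Some ds \<Longrightarrow> dirs (stp p s) = ds"
  using good_stp_with[of "fst s" "fst (snd s)" "fst (snd (snd s))" "snd (snd (snd s))" p ds
      "fresh (fst s)" "Suc (fresh (fst s))"] fresh_notin'[of "fst s"]
  by (cases s; simp only: stp_def dirs.simps fst_conv snd_conv prod.collapse; simp)+

lemma good_stps: "good s \<Longrightarrow> run w (dirs s) = Some ds \<Longrightarrow> good (stps w s) \<and> dirs (stps w s) = ds"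
proof (induction w arbitrary: s)
  case (Cons p w)
  then obtain es where es: "act p (dirs s) = Some es" "run w es = Some ds"
    by (auto simp: bind_eq_Some_conv)
  then show ?case
    using Cons.IH[of "stp p s"] good_stp[OF Cons.prems(1) es(1)] dirs_stp[OF Cons.prems(1) es(1)]
    by (simp del: dirs.simps)
qed auto

subsection \<open>Renaming\<close>

text \<open>Different orders of the same pieces create different fresh names, so states are compared
  up to a bijection of names. Only listed names count: elsewhere the functions may carry stale
  values.\<close>

fun rnf :: "(nat \<Rightarrow> nat) \<Rightarrow> lstate \<Rightarrow> lstate \<Rightarrow> bool" where
  "rnf f (xs, D, A, g) (ys, D', A', g') \<longleftrightarrow> inj_on f (set xs) \<and> ys = map f xs \<and>
     (\<forall>x\<in>set xs. D' (f x) = D x \<and> A' (f x) = f (A x) \<and> g' (f x) = g x)"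

definition rn :: "lstate \<Rightarrow> lstate \<Rightarrow> bool" where
  "rn s s' \<longleftrightarrow> (\<exists>f. rnf f s s')"

lemma rnI: "rnf f s s' \<Longrightarrow> rn s s'"
  unfolding rn_def by blast

lemma rn_refl [simp]: "rn s s"
  unfolding rn_def by (cases s) (auto intro!: exI[of _ id])

lemma rn_trans:
  assumes "good s" "rn s s'" "rn s' s''"
  shows "rn s s''"
proof -
  obtain f f' where f: "rnf f s s'" "rnf f' s' s''" using assms by (auto simp: rn_def)
  have "rnf (f' \<circ> f) s s''"
    using goodD(1) f assms(1) by (cases s; cases s'; cases s'') (auto intro: comp_inj_on)
  then show ?thesis unfolding rn_def by blast
qed

lemma rn_dirs: "rn s s' \<Longrightarrow> dirs s' = dirs s"
  unfolding rn_def by (cases s; cases s') auto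

text \<open>The inverse of the renaming is under control on the listed names only;
  \<open>good\<close> puts the partners \<open>A x\<close> among them.\<close>

lemma rn_sym:
  assumes "good s" "rn s s'"
  shows "rn s' s"
proof -
  obtain f where f: "rnf f s s'" using assms by (auto simp: rn_def)
  then have "rnf (inv_into (set (fst s)) f) s' s"
    using assms(1) goodD(1) by (cases s; cases s') (auto simp: inj_on_inv_into map_idI)
  then show ?thesis unfolding rn_def by blast
qed

text \<open>A step sees only positions, directions, the pairing and the labels, so it commutes with
  renaming. At a left extremum the renaming is extended by sending the new names to the new
  names.\<close>

lemma rnf_stp_with:
  assumes "good (xs, D, A, g)" "act p (map D xs) = Some ds" and f: "rnf f (xs, D, A, g) s'"
    and ab: "a \<noteq> b" "a \<notin> set xs" "b \<notin> set xs" and cd: "c \<noteq> d" "c \<notin> set (fst s')" "d \<notin> set (fst s')"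
  shows "rn (stp_with a b p (xs, D, A, g)) (stp_with c d p s') \<and> fac p s' = fac p (xs, D, A, g)"
proof -
  obtain us P zs where xs: "xs = us @ P @ zs" and l: "length us = height p" "length P = ins p"
    using split_names[OF assms(2)] by metis
  obtain ys D' A' g' where s': "s' = (ys, D', A', g')" by (cases s')
  have ys: "ys = map f us @ map f P @ map f zs" using f xs s' by simp
  have l': "length (map f us) = height p" "length (map f P) = ins p" using l by auto
  have w: "\<And>u. u \<in> set xs \<Longrightarrow> A u \<in> set xs \<and> A (A u) = u \<and> A u \<noteq> u" and dx: "distinct xs"
    using goodD[OF assms(1)] good_distinct[OF assms(1)] by simp_all
  have inj: "f x = f y \<longleftrightarrow> x = y" if "x \<in> set xs" "y \<in> set xs" for x y
    using f s' that by (auto simp: inj_on_eq_iff)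
  have fe: "D' (f x) = D x" "A' (f x) = f (A x)" "g' (f x) = g x" if "x \<in> set xs" for x
    using f s' that by auto
  have sub: "rnf f (us @ N @ zs, D\<^sub>1, A\<^sub>1, g\<^sub>1) (map f us @ map f N @ map f zs, D\<^sub>2, A\<^sub>2, g\<^sub>2)"
    if "set N \<subseteq> set P" and "\<And>u. u \<in> set xs \<Longrightarrow> D\<^sub>2 (f u) = D\<^sub>1 u \<and> A\<^sub>2 (f u) = f (A\<^sub>1 u) \<and> g\<^sub>2 (f u) = g\<^sub>1 u"
    for N D\<^sub>1 A\<^sub>1 g\<^sub>1 D\<^sub>2 A\<^sub>2 g\<^sub>2
  proof -
    have "set (us @ N @ zs) \<subseteq> set xs" using that(1) xs by auto
    moreover have "inj_on f (set xs)" using f s' by simp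
    ultimately show ?thesis using that(2) by (auto intro: inj_on_subset)
  qed
  note split = stp_with_split[OF l] stp_with_split[OF l']
  show ?thesis
  proof (cases p)
    case (Cross k i)
    then obtain x y where P: "P = [x, y]" using l by (auto simp: length_2_conv)
    have "rnf f (us @ new_names p P a b @ zs, tr p P a b (D, A, g))
          (map f us @ new_names p (map f P) c d @ map f zs, tr p (map f P) c d (D', A', g'))"
      using sub[of "[y, x]" D' D A' A g' g] fe Cross P by simp
    then show ?thesis unfolding xs s' ys split
      by (intro conjI, intro rnI) (simp_all only: Cross fac.simps)
  next
    case (Open i e)
    then have P: "P = []" using l by simp
    have ab': "f x \<noteq> c" "f x \<noteq> d" "x \<noteq> a" "x \<noteq> b" "A x \<noteq> a" "A x \<noteq> b" if "x \<in> set xs" for x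
      using cd ab f s' that w[of x] by auto
    have ab2: "c \<noteq> f x" "d \<noteq> f x" "a \<noteq> x" "b \<noteq> x" if "x \<in> set xs" for x
      using ab'[OF that] by auto
    have st: "set (us @ [a, b] @ zs) = insert a (insert b (set xs))" using xs P by auto
    have mp: "map (f(a := c, b := d)) us = map f us" "map (f(a := c, b := d)) zs = map f zs"
      using ab xs by auto
    have 1: "inj_on (f(a := c, b := d)) (insert a (insert b (set xs)))"
    proof (rule inj_onI)
      fix u v
      assume "u \<in> insert a (insert b (set xs))" "v \<in> insert a (insert b (set xs))"
        and "(f(a := c, b := d)) u = (f(a := c, b := d)) v"
      then show "u = v"
        by (elim insertE) (simp_all add: ab' ab2 inj ab(1) cd(1) ab(1)[symmetric] cd(1)[symmetric])
    qed
    have 2: "map f us @ [c, d] @ map f zs = map (f(a := c, b := d)) (us @ [a, b] @ zs)"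
      using ab(1) by (simp add: mp)
    have 3: "(D'(c := e, d := opp e)) ((f(a := c, b := d)) u) = (D(a := e, b := opp e)) u \<and>
        (A'(c := d, d := c)) ((f(a := c, b := d)) u) = (f(a := c, b := d)) ((A(a := b, b := a)) u) \<and>
        (g'(c := 0, d := 0)) ((f(a := c, b := d)) u) = (g(a := 0, b := 0)) u"
      if u: "u \<in> insert a (insert b (set xs))" for u
    proof -
      consider "u = a" | "u = b" | "u \<in> set xs" using u by auto
      then show ?thesis
      proof cases
        case 3
        then show ?thesis using ab'[OF 3] fe[OF 3] by simp
      qed (use ab(1) cd(1) in auto)
    qed
    have "rnf (f(a := c, b := d)) (us @ [a, b] @ zs, tr p P a b (D, A, g))
          (map f us @ [c, d] @ map f zs, tr p (map f P) c d (D', A', g'))"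
      unfolding tr.simps rnf.simps Open st
      by (intro conjI ballI 1 2; (drule 3)?, (elim conjE)?, assumption)
    then show ?thesis unfolding xs s' ys split
      by (intro conjI, intro rnI) (simp_all only: Open new_names.simps fac.simps)
  next
    case (Close i)
    then obtain x y where P: "P = [x, y]" using l by (auto simp: length_2_conv)
    have xy: "x \<in> set xs" "y \<in> set xs" using xs P by auto
    note e = fe(2)[OF xy(1)] fe(2)[OF xy(2)] fe(3)[OF xy(1)] fe(3)[OF xy(2)]
    have wx: "A x \<in> set xs" "A y \<in> set xs" using w xy by auto
    have "rnf f (us @ new_names p P a b @ zs, tr p P a b (D, A, g))
          (map f us @ new_names p (map f P) c d @ map f zs, tr p (map f P) c d (D', A', g'))"
      using Close P sub[of "[]"] by (simp add: fe e wx inj del: rnf.simps)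
    moreover have "fac p s' = fac p (xs, D, A, g)"
    proof -
      have n: "xs ! i = x" "xs ! Suc i = y" "ys ! i = f x" "ys ! Suc i = f y"
        using P l Close unfolding xs ys by (auto simp: nth_append)
      show ?thesis using Close s' n e inj[OF wx(1) xy(2)] fe(3)[OF xy(1)] by simp
    qed
    ultimately show ?thesis unfolding xs s' ys split
      using rnI by blast
  next
    case (Cusp i s)
    then obtain x where P: "P = [x]" using l by (auto simp: length_Suc_0_conv)
    have xy: "x \<in> set xs" using xs P by auto
    note e = fe[OF xy]
    have wx: "A x \<in> set xs" using w xy by auto
    have "rnf f (us @ new_names p P a b @ zs, tr p P a b (D, A, g))
          (map f us @ new_names p (map f P) c d @ map f zs, tr p (map f P) c d (D', A', g'))"
      using Cusp P sub[of "[x]"] by (simp add: fe e wx xy inj del: rnf.simps)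
    then show ?thesis unfolding xs s' ys split
      by (intro conjI, intro rnI) (simp_all only: Cusp fac.simps)
  qed
qed

lemma rn_stp_with:
  assumes "good s" "act p (dirs s) = Some ds" "rn s s'"
    and ab: "a \<noteq> b" "a \<notin> set (fst s)" "b \<notin> set (fst s)" and cd: "c \<noteq> d" "c \<notin> set (fst s')" "d \<notin> set (fst s')"
  shows "rn (stp_with a b p s) (stp_with c d p s')" "fac p s' = fac p s"
proof -
  obtain xs D A g where s: "s = (xs, D, A, g)" by (cases s)
  obtain f where f: "rnf f s s'" using assms(3) rn_def by blast
  have "act p (map D xs) = Some ds" "a \<notin> set xs" "b \<notin> set xs" using assms s by simp_all
  from rnf_stp_with[OF assms(1)[unfolded s] this(1) f[unfolded s] ab(1) this(2,3) cd]
  show "rn (stp_with a b p s) (stp_with c d p s')" "fac p s' = fac p s"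
    unfolding s by blast+
qed

lemma rn_stp:
  assumes "good s" "act p (dirs s) = Some ds" "rn s s'"
  shows "rn (stp p s) (stp p s')" "fac p s' = fac p s"
  using rn_stp_with[OF assms, of "fresh (fst s)" "Suc (fresh (fst s))" "fresh (fst s')" "Suc (fresh (fst s'))"]
  fresh_notin' by (simp_all add: stp_def)

lemma rn_stps:
  assumes "good s" "run w (dirs s) = Some ds" "rn s s'"
  shows "rn (stps w s) (stps w s') \<and> facs w s' = facs w s"
  using assms
proof (induction w arbitrary: s s')
  case (Cons p w)
  then obtain es where es: "act p (dirs s) = Some es" "run w es = Some ds"
    by (auto simp: bind_eq_Some_conv)
  then show ?case
    using Cons.IH[of "stp p s" "stp p s'"] good_stp[OF Cons.prems(1) es(1)] dirs_stp[OF Cons.prems(1) es(1)]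
      rn_stp[OF Cons.prems(1) es(1) Cons.prems(3)] by (simp del: dirs.simps)
qed auto

declare split_paired_All [simp del] split_paired_Ex [simp del] dirs.simps [simp del]

section \<open>State sums\<close>

fun piece_sign :: "piece \<Rightarrow> dir list \<Rightarrow> int" where
  "piece_sign (Cross c i) ds = sign c (ds ! i) (ds ! Suc i)"
| "piece_sign _ ds = 0"

definition flat :: "piece list \<Rightarrow> (lstate \<Rightarrow> ra) \<Rightarrow> lstate \<Rightarrow> ra" where
  "flat w K s = facs w s * K (stps w s)"

text \<open>\<open>K\<close> is the value of the rest of the diagram as a function of the state. The
  factor \<open>- A_pow (- 3 * e)\<close> is (-A^3)^(-e) for the sign e = 1 or e = -1, so the
  normalisation by the writhe is distributed over the crossings.\<close>

definition cont :: "piece \<Rightarrow> (lstate \<Rightarrow> ra) \<Rightarrow> lstate \<Rightarrow> ra" where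
  "cont p K s = (if classical p
     then let h = height p; d = dirs s ! h; d' = dirs s ! Suc h; e = piece_sign p (dirs s) in
       - A_pow (- 3 * e) * (A_pow e * flat (smoothing1 h d d') K s +
         A_pow (- e) * flat (smoothing2 h d d') K s)
     else fac p s * K (stp p s))"

definition ev :: "piece list \<Rightarrow> lstate \<Rightarrow> ra" where
  "ev w = foldr cont w (\<lambda>_. 1)"

lemma ev_simps [simp]: "ev [] s = 1" "ev (p # w) = cont p (ev w)" "ev (u @ w) = foldr cont u (ev w)"
  by (simp_all add: ev_def)

lemma flat_simps [simp]: "flat [] K = K" "flat (p # w) K s = fac p s * flat w K (stp p s)"
  by (auto simp: flat_def fun_eq_iff)

lemma flat_append: "flat (u @ w) K s = flat u (flat w K) s"
  by (induction u arbitrary: s) auto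

lemma foldr_flat: "filter classical w = [] \<Longrightarrow> foldr cont w K s = flat w K s"
  by (induction w arbitrary: s) (auto simp: cont_def split: if_splits)

lemma run_append: "run (u @ w) ds = Option.bind (run u ds) (run w)"
  by (induction u arbitrary: ds) (auto simp: Option.bind_assoc intro!: Option.bind_cong)

text \<open>Opposite directions are exchanged by the crossing, by a right extremum followed by a
  suitable left one, and by a cusp on each strand; equal directions come out unchanged in all cases.
  So the rest of the diagram fits after either smoothing.\<close>

lemma run_smoothing:
  assumes "act (Cross c i) ds = Some ds'"
  shows "run (smoothing1 i (ds ! i) (ds ! Suc i)) ds = Some ds'"
    and "run (smoothing2 i (ds ! i) (ds ! Suc i)) ds = Some ds'"
proof -
  have "Suc i < length ds" using assms by (auto split: if_splits)
  then obtain us x y zs where ds: "ds = us @ x # y # zs" "length us = i"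
    by (metis Cons_nth_drop_Suc Suc_lessD append_take_drop_id length_take min.absorb4)
  show "run (smoothing1 i (ds ! i) (ds ! Suc i)) ds = Some ds'"
    using assms unfolding ds(1) ds(2)[symmetric]
    by (auto simp: smoothing1_def nth_append list_update_append neq_opp_iff)
  show "run (smoothing2 i (ds ! i) (ds ! Suc i)) ds = Some ds'"
    using assms unfolding ds(1) ds(2)[symmetric]
    by (auto simp: smoothing2_def nth_append list_update_append neq_opp_iff)
qed

lemma flat_cong:
  assumes "run w ds = Some ds'" "\<And>s. good s \<Longrightarrow> dirs s = ds' \<Longrightarrow> K s = K' s"
    and "good s" "dirs s = ds"
  shows "flat w K s = flat w K' s"
  using good_stps[of s w ds'] assms by (simp add: flat_def)

lemma cont_cong:
  assumes "act p ds = Some ds'" "\<And>s. good s \<Longrightarrow> dirs s = ds' \<Longrightarrow> K s = K' s"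
    and "good s" "dirs s = ds"
  shows "cont p K s = cont p K' s"
proof (cases "classical p")
  case True
  then obtain c i where p: "p = Cross c i" by (cases p) auto
  note r = run_smoothing[OF assms(1)[unfolded p]]
  show ?thesis
    using flat_cong[OF r(1) assms(2-4)] flat_cong[OF r(2) assms(2-4)] True p assms(4)
    by (simp add: cont_def Let_def)
next
  case False
  then show ?thesis using good_stp dirs_stp assms by (simp add: cont_def)
qed

lemma foldr_cont_cong:
  assumes "run w ds = Some ds'" "\<And>s. good s \<Longrightarrow> dirs s = ds' \<Longrightarrow> K s = K' s"
    and "good s" "dirs s = ds"
  shows "foldr cont w K s = foldr cont w K' s"
  using assms(1,3,4)
proof (induction w arbitrary: s ds)
  case Nil
  then show ?case using assms(2) by simp
next
  case (Cons p w)
  then obtain es where es: "act p ds = Some es" "run w es = Some ds'"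
    by (auto simp: bind_eq_Some_conv)
  show ?case unfolding foldr.simps o_apply
    by (rule cont_cong[OF es(1) _ Cons.prems(2,3)]) (rule Cons.IH[OF es(2)])
qed

definition resp :: "dir list \<Rightarrow> (lstate \<Rightarrow> ra) \<Rightarrow> bool" where
  "resp ds K \<longleftrightarrow> (\<forall>s s'. good s \<and> dirs s = ds \<and> rn s s' \<longrightarrow> K s = K s')"

lemma respD: "resp ds K \<Longrightarrow> good s \<Longrightarrow> dirs s = ds \<Longrightarrow> rn s s' \<Longrightarrow> K s' = K s"
  unfolding resp_def by metis

lemma resp_flat:
  assumes "run w ds = Some ds'" "resp ds' K"
  shows "resp ds (flat w K)"
  unfolding resp_def flat_def
proof (intro allI impI, elim conjE)
  fix s s' assume s: "good s" "dirs s = ds" "rn s s'"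
  show "facs w s * K (stps w s) = facs w s' * K (stps w s')"
    using rn_stps[OF s(1) _ s(3), of w ds'] good_stps[OF s(1), of w ds'] s(2) assms(1)
      respD[OF assms(2), of "stps w s" "stps w s'"] by simp
qed

lemma resp_cont:
  assumes "act p ds = Some ds'" "resp ds' K"
  shows "resp ds (cont p K)"
proof (cases "classical p")
  case True
  then obtain c i where p: "p = Cross c i" by (cases p) auto
  note r = run_smoothing[OF assms(1)[unfolded p]]
  show ?thesis unfolding resp_def
  proof (intro allI impI, elim conjE)
    fix s s' assume s: "good s" "dirs s = ds" "rn s s'"
    show "cont p K s = cont p K s'"
      using respD[OF resp_flat[OF r(1) assms(2)] s] respD[OF resp_flat[OF r(2) assms(2)] s] True p
        rn_dirs[OF s(3)] s(2) unfolding cont_def Let_def by simp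
  qed
next
  case False
  then show ?thesis
    using resp_flat[of "[p]" ds ds' K] assms
    by (simp add: cont_def resp_def del: split_paired_All)
qed

lemma resp_foldr: "run w ds = Some ds' \<Longrightarrow> resp ds' K \<Longrightarrow> resp ds (foldr cont w K)"
  by (induction w arbitrary: ds) (auto simp: bind_eq_Some_conv intro: resp_cont)

text \<open>Equality is demanded for every continuation that respects renaming, and not just for
  complete diagrams. This makes the relation usable inside any context.\<close>

definition sim :: "dir list \<Rightarrow> piece list \<Rightarrow> piece list \<Rightarrow> bool" where
  "sim ds l r \<longleftrightarrow> run l ds \<noteq> None \<and> run r ds = run l ds \<and>
     (\<forall>K s. good s \<and> dirs s = ds \<and> resp (the (run l ds)) K \<longrightarrow> foldr cont l K s = foldr cont r K s)"

lemma sim_refl: "run l ds \<noteq> None \<Longrightarrow> sim ds l l"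
  by (simp add: sim_def)

lemma sim_sym: "sim ds l r \<Longrightarrow> sim ds r l"
  by (simp add: sim_def)

lemma sim_trans [trans]: "sim ds l r \<Longrightarrow> sim ds r t \<Longrightarrow> sim ds l t"
  by (simp add: sim_def)

text \<open>What follows is absorbed into the continuation, which still respects renaming; what
  precedes only changes the state at which the two sides are compared.\<close>

lemma sim_context:
  assumes "sim es l r" "run u ds = Some es" "run (u @ l @ v) ds \<noteq> None"
  shows "sim ds (u @ l @ v) (u @ r @ v)"
proof -
  obtain fs where fs: "run l es = Some fs" "run r es = Some fs" 
    using assms(1) by (auto simp: sim_def)
  obtain gs where gs: "run v fs = Some gs"
    using assms(2,3) fs by (auto simp: run_append)
  have lr: "foldr cont l (foldr cont v K) s = foldr cont r (foldr cont v K) s"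
    if "good s" "dirs s = es" "resp gs K" for K s
    using assms(1) that resp_foldr[OF gs that(3)] fs unfolding sim_def by simp
  show ?thesis unfolding sim_def
  proof (intro conjI allI impI; (elim conjE)?)
    fix K s assume s: "good s" "dirs s = ds" "resp (the (run (u @ l @ v) ds)) K"
    have "resp gs K" using s(3) assms(2) fs gs by (simp add: run_append)
    then show "foldr cont (u @ l @ v) K s = foldr cont (u @ r @ v) K s"
      unfolding foldr_append
      by (intro foldr_cont_cong[OF assms(2) lr s(1,2)])
  qed (use assms(2,3) fs in \<open>simp_all add: run_append\<close>)
qed

text \<open>Without classical crossings the state sum has a single summand, so equal factors and
  final states equal up to renaming suffice.\<close>

lemma sim_flatI:
  assumes "filter classical l = []" "filter classical r = []"
    and "run l ds = Some es" "run r ds = Some es"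
    and "\<And>s. good s \<Longrightarrow> dirs s = ds \<Longrightarrow> facs l s = facs r s \<and> rn (stps l s) (stps r s)"
  shows "sim ds l r"
  unfolding sim_def
proof (intro conjI allI impI; (elim conjE)?)
  fix K s assume s: "good s" "dirs s = ds" "resp (the (run l ds)) K"
  have "good (stps l s) \<and> dirs (stps l s) = es"
    using good_stps[of s l es] assms(3) s(1,2) by simp
  then show "foldr cont l K s = foldr cont r K s"
    using assms(3) assms(5)[OF s(1,2)] s(3) respD[of es K "stps l s" "stps r s"]
    by (simp add: foldr_flat[OF assms(1)] foldr_flat[OF assms(2)] flat_def)
qed (use assms in simp_all)

lemma ev_sim:
  assumes "sim [] l r" "run l [] = Some []"
  shows "ev l ([], D, A, g) = ev r ([], D, A, g)"
proof -
  have "good ([], D, A, g)" "dirs ([], D, A, g) = []" "resp [] (\<lambda>_. 1)"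
    by (simp_all add: good.simps dirs.simps resp_def)
  then show ?thesis using assms unfolding sim_def ev_def by simp
qed

subsection \<open>Single steps\<close>

lemma stp_split:
  "length us = height p \<Longrightarrow> length P = ins p \<Longrightarrow>
   stp p (us @ P @ zs, \<sigma>) = (us @ new_names p P (fresh (us @ P @ zs)) (Suc (fresh (us @ P @ zs))) @ zs,
     tr p P (fresh (us @ P @ zs)) (Suc (fresh (us @ P @ zs))) \<sigma>)"
  unfolding stp_def by (subst stp_with_split) simp_all

lemma stp_Cross [simp]:
  "stp (Cross c (length us)) (us @ x # y # zs, \<sigma>) = (us @ y # x # zs, \<sigma>)"
  "stp (Cross c (Suc (length us))) (us @ w # x # y # zs, \<sigma>) = (us @ w # y # x # zs, \<sigma>)"
  using stp_split[of us "Cross c (length us)" "[x, y]"]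
    stp_split[of "us @ [w]" "Cross c (Suc (length us))" "[x, y]"] by (cases \<sigma>; simp)+

lemma stp_Close [simp]:
  "stp (Close (length us)) (us @ x # y # zs, \<sigma>) = (us @ zs, tr (Close 0) [x, y] 0 0 \<sigma>)"
  "stp (Close (Suc (length us))) (us @ w # x # y # zs, \<sigma>) = (us @ w # zs, tr (Close 0) [x, y] 0 0 \<sigma>)"
  using stp_split[of us "Close (length us)" "[x, y]"]
    stp_split[of "us @ [w]" "Close (Suc (length us))" "[x, y]"] by (cases \<sigma>; simp)+

lemma stp_Cusp [simp]:
  "stp (Cusp (length us) s) (us @ x # zs, \<sigma>) = (us @ x # zs, tr (Cusp 0 s) [x] 0 0 \<sigma>)"
  "stp (Cusp (Suc (length us)) s) (us @ w # x # zs, \<sigma>) = (us @ w # x # zs, tr (Cusp 0 s) [x] 0 0 \<sigma>)"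
  "stp (Cusp (Suc (Suc (length us))) s) (us @ w # w' # x # zs, \<sigma>) =
     (us @ w # w' # x # zs, tr (Cusp 0 s) [x] 0 0 \<sigma>)"
  using stp_split[of us "Cusp (length us) s" "[x]"]
    stp_split[of "us @ [w]" "Cusp (Suc (length us)) s" "[x]"]
    stp_split[of "us @ [w, w']" "Cusp (Suc (Suc (length us))) s" "[x]"] by (cases \<sigma>; simp)+

lemma stp_Open [simp]:
  "stp (Open (length us) d) (us @ zs, \<sigma>) = (us @ fresh (us @ zs) # Suc (fresh (us @ zs)) # zs,
     tr (Open 0 d) [] (fresh (us @ zs)) (Suc (fresh (us @ zs))) \<sigma>)"
  "stp (Open (Suc (length us)) d) (us @ w # zs, \<sigma>) =
     (us @ w # fresh (us @ w # zs) # Suc (fresh (us @ w # zs)) # zs,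
     tr (Open 0 d) [] (fresh (us @ w # zs)) (Suc (fresh (us @ w # zs))) \<sigma>)"
  "stp (Open (Suc (Suc (length us))) d) (us @ w # w' # zs, \<sigma>) =
     (us @ w # w' # fresh (us @ w # w' # zs) # Suc (fresh (us @ w # w' # zs)) # zs,
     tr (Open 0 d) [] (fresh (us @ w # w' # zs)) (Suc (fresh (us @ w # w' # zs))) \<sigma>)"
  using stp_split[of us "Open (length us) d" "[]"]
    stp_split[of "us @ [w]" "Open (Suc (length us)) d" "[]"]
    stp_split[of "us @ [w, w']" "Open (Suc (Suc (length us))) d" "[]"] by (cases \<sigma>; simp)+

lemma fac_Close [simp]:
  "fac (Close (length us)) (us @ x # y # zs, D, A, g) = (if A x = y then zval (g x) else 1)"
  "fac (Close (Suc (length us))) (us @ w # x # y # zs, D, A, g) = (if A x = y then zval (g x) else 1)"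
  by (simp_all add: nth_append)

lemma split_at1: 
  assumes "i < length xs" obtains us x zs where "xs = us @ x # zs" "length us = i"
  using assms id_take_nth_drop length_take min.absorb4 by metis

lemma split_at2: 
  assumes "Suc i < length xs" obtains us x y zs where "xs = us @ x # y # zs" "length us = i"
  using assms
  by (metis Cons_nth_drop_Suc Suc_lessD append_take_drop_id length_take min.absorb4)

lemma split_at3: 
  assumes "Suc (Suc i) < length xs" obtains us x y w zs where "xs = us @ x # y # w # zs" "length us = i"
  using assms
  by (metis Cons_nth_drop_Suc Suc_lessD append_take_drop_id length_take min.absorb4)

lemma sim_r2_virtual:
  assumes "Suc i < length ds"
  shows "sim ds [Cross Virtual i, Cross Virtual i] []"
proof (rule sim_flatI)
  fix s assume s: "good s" "dirs s = ds"
  obtain xs \<sigma> where s': "s = (xs, \<sigma>)" by (cases s)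
  have "Suc i < length xs" using assms s s' by (cases \<sigma>) (auto simp: dirs.simps)
  then obtain us x y zs where "xs = us @ x # y # zs" "length us = i" by (rule split_at2)
  then show "facs [Cross Virtual i, Cross Virtual i] s = facs [] s \<and>
      rn (stps [Cross Virtual i, Cross Virtual i] s) (stps [] s)"
    using s' by auto
qed (use assms in \<open>auto simp: list_eq_iff_nth_eq nth_list_update\<close>)

lemma sim_r3_virtual:
  assumes "Suc (Suc i) < length ds"
  shows "sim ds [Cross Virtual i, Cross Virtual (Suc i), Cross Virtual i]
     [Cross Virtual (Suc i), Cross Virtual i, Cross Virtual (Suc i)]"
proof (rule sim_flatI)
  fix s assume s: "good s" "dirs s = ds"
  obtain xs \<sigma> where s': "s = (xs, \<sigma>)" by (cases s)
  have "Suc (Suc i) < length xs" using assms s s' by (cases \<sigma>) (auto simp: dirs.simps)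
  then obtain us x y w zs where "xs = us @ x # y # w # zs" "length us = i" by (rule split_at3)
  then show "facs [Cross Virtual i, Cross Virtual (Suc i), Cross Virtual i] s =
      facs [Cross Virtual (Suc i), Cross Virtual i, Cross Virtual (Suc i)] s \<and>
      rn (stps [Cross Virtual i, Cross Virtual (Suc i), Cross Virtual i] s)
       (stps [Cross Virtual (Suc i), Cross Virtual i, Cross Virtual (Suc i)] s)"
    using s' by auto
next
  obtain us x y w zs where "ds = us @ x # y # w # zs" "length us = i"
    using split_at3[OF assms] by metis
  then show "run [Cross Virtual (Suc i), Cross Virtual i, Cross Virtual (Suc i)] ds =
    Some (the (run [Cross Virtual i, Cross Virtual (Suc i), Cross Virtual i] ds))"
    by (auto simp: nth_append list_update_append)
qed (use assms in auto)

subsection \<open>Exchange of distant pieces\<close>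

fun dead :: "piece \<Rightarrow> nat list \<Rightarrow> nat set" where
  "dead (Close i) P = set P"
| "dead _ P = {}"

fun fac_names :: "piece \<Rightarrow> nat list \<Rightarrow> strands \<Rightarrow> ra" where
  "fac_names (Close i) P (D, A, g) = (if A (P ! 0) = P ! 1 then zval (g (P ! 0)) else 1)"
| "fac_names _ P \<sigma> = 1"

fun agree :: "nat set \<Rightarrow> strands \<Rightarrow> strands \<Rightarrow> bool" where
  "agree S (D, A, g) (D', A', g') \<longleftrightarrow> (\<forall>x\<in>S. D x = D' x \<and> A x = A' x \<and> g x = g' x)"

text \<open>Right extrema commute. The results depend on how arcs join the four ends; the delicate
  situation is the one in which both extrema together complete one loop, since the two orders read
  it from different points.\<close>

lemma close_close:
  fixes A :: "nat \<Rightarrow> nat" and g :: "nat \<Rightarrow> int"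
  assumes inv: "\<And>z. z \<in> X \<Longrightarrow> A z \<in> X" "\<And>z. z \<in> X \<Longrightarrow> A (A z) = z" "\<And>z. z \<in> X \<Longrightarrow> A z \<noteq> z"
    and g: "\<And>z. z \<in> X \<Longrightarrow> g (A z) = drev (g z)" "\<And>z. z \<in> X \<Longrightarrow> even (g z) \<longleftrightarrow> D z \<noteq> D (A z)"
    and X: "x \<in> X" "y \<in> X" "u \<in> X" "v \<in> X" and dist: "distinct [x, y, u, v]"
    and D: "D x \<noteq> (D y :: dir)" "D u \<noteq> D v"
  defines "A\<^sub>1 \<equiv> A(A x := A y, A y := A x)" and "A\<^sub>2 \<equiv> A(A u := A v, A v := A u)"
    and "g\<^sub>1 \<equiv> g(A x := g (A x) \<oplus> g y, A y := g (A y) \<oplus> g x)"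
    and "g\<^sub>2 \<equiv> g(A u := g (A u) \<oplus> g v, A v := g (A v) \<oplus> g u)"
  shows "(\<forall>z\<in>X - {x, y, u, v}.
      (A\<^sub>1(A\<^sub>1 u := A\<^sub>1 v, A\<^sub>1 v := A\<^sub>1 u)) z = (A\<^sub>2(A\<^sub>2 x := A\<^sub>2 y, A\<^sub>2 y := A\<^sub>2 x)) z \<and>
      (g\<^sub>1(A\<^sub>1 u := g\<^sub>1 (A\<^sub>1 u) \<oplus> g\<^sub>1 v, A\<^sub>1 v := g\<^sub>1 (A\<^sub>1 v) \<oplus> g\<^sub>1 u)) z =
      (g\<^sub>2(A\<^sub>2 x := g\<^sub>2 (A\<^sub>2 x) \<oplus> g\<^sub>2 y, A\<^sub>2 y := g\<^sub>2 (A\<^sub>2 y) \<oplus> g\<^sub>2 x)) z) \<and>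
    (if A x = y then zval (g x) else 1) * (if A\<^sub>1 u = v then zval (g\<^sub>1 u) else 1) =
    (if A u = v then zval (g u) else 1) * (if A\<^sub>2 x = y then zval (g\<^sub>2 x) else 1)"
proof -
  have ne: "x \<noteq> y" "x \<noteq> u" "x \<noteq> v" "y \<noteq> u" "y \<noteq> v" "u \<noteq> v"
    "y \<noteq> x" "u \<noteq> x" "v \<noteq> x" "u \<noteq> y" "v \<noteq> y" "v \<noteq> u"
    using dist by auto
  have inj: "A s = A t \<longleftrightarrow> s = t" if "s \<in> X" "t \<in> X" for s t
    using that inv(2) by metis
  have sw: "A s = t \<longleftrightarrow> A t = s" if "s \<in> X" "t \<in> X" for s t
    using that inv(2) by metis
  have xyuv: "A x \<noteq> A y" "A x \<noteq> A u" "A x \<noteq> A v" "A y \<noteq> A u" "A y \<noteq> A v" "A u \<noteq> A v"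
    "A y \<noteq> A x" "A u \<noteq> A x" "A v \<noteq> A x" "A u \<noteq> A y" "A v \<noteq> A y" "A v \<noteq> A u"
    "A x \<noteq> x" "A y \<noteq> y" "A u \<noteq> u" "A v \<noteq> v" "A (A x) = x" "A (A y) = y" "A (A u) = u" "A (A v) = v"
    using ne inj X inv by simp_all
  have gg: "g (A x) = drev (g x)" "g (A y) = drev (g y)" "g (A u) = drev (g u)" "g (A v) = drev (g v)"
    using g X by simp_all
  \<comment> \<open>Reading a loop backwards and from another starting point keeps its
    value.\<close>
  have par: "zval (drev (g x) \<oplus> g y) = zval (g x \<oplus> drev (g y))" if "even (g x) = even (g y)"
    using that by (metis drev_dop drev_drev even_drev zval_dop_commute zval_drev)
  \<comment> \<open>All ways in which arcs can join the four ends among themselves. In the cases 4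
    and 5 the two extrema together complete one loop.\<close>
  consider (1) "A x = y" "A y = x" "A u = v" "A v = u"
    | (2) "A x = y" "A y = x" "A u \<noteq> v" "A v \<noteq> u" "A u \<noteq> x" "A u \<noteq> y" "A v \<noteq> x" "A v \<noteq> y"
    | (3) "A u = v" "A v = u" "A x \<noteq> y" "A y \<noteq> x" "A x \<noteq> u" "A y \<noteq> u" "A x \<noteq> v" "A y \<noteq> v"
    | (4) "A x = u" "A u = x" "A y = v" "A v = y"
    | (5) "A x = v" "A v = x" "A y = u" "A u = y"
    | (6) "A x = u" "A u = x" "A y \<noteq> v" "A v \<noteq> y"
    | (7) "A x = v" "A v = x" "A y \<noteq> u" "A u \<noteq> y"
    | (8) "A y = v" "A v = y" "A x \<noteq> u" "A u \<noteq> x"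
    | (9) "A y = u" "A u = y" "A x \<noteq> v" "A v \<noteq> x"
    | (10) "A x \<noteq> y" "A y \<noteq> x" "A u \<noteq> v" "A v \<noteq> u" "A u \<noteq> x" "A u \<noteq> y" "A v \<noteq> x" "A v \<noteq> y"
      "A x \<noteq> u" "A x \<noteq> v" "A y \<noteq> u" "A y \<noteq> v"
    using sw[OF X(1,2)] sw[OF X(1,3)] sw[OF X(1,4)] sw[OF X(2,3)] sw[OF X(2,4)] sw[OF X(3,4)]
    by (metis xyuv)
  then show ?thesis
  proof cases
    case 4
    have "even (g x) \<longleftrightarrow> even (g y)"
      using g(2)[OF X(1)] g(2)[OF X(2)] 4 D by (cases "D x"; cases "D y"; cases "D u"; cases "D v"; simp)
    then have "zval (g u \<oplus> g y) = zval (g x \<oplus> g v)" using par 4 gg by simp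
    then show ?thesis using 4 ne unfolding A\<^sub>1_def A\<^sub>2_def g\<^sub>1_def g\<^sub>2_def by auto
  next
    case 5
    have "even (g x) \<longleftrightarrow> even (g y)"
      using g(2)[OF X(1)] g(2)[OF X(2)] 5 D by (cases "D x"; cases "D y"; cases "D u"; cases "D v"; simp)
    then have "zval (g u \<oplus> g x) = zval (g x \<oplus> g u)" "even (g x) = even (g u)" using par 5 gg
      by (simp_all add: zval_dop_commute)
    then show ?thesis using 5 ne unfolding A\<^sub>1_def A\<^sub>2_def g\<^sub>1_def g\<^sub>2_def 
      by (auto simp: )
  qed (use ne xyuv gg in \<open>simp_all add: A\<^sub>1_def A\<^sub>2_def g\<^sub>1_def g\<^sub>2_def dop_assoc\<close>)
qed

fun born :: "piece \<Rightarrow> nat \<Rightarrow> nat \<Rightarrow> nat set" where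
  "born (Open i d) a b = {a, b}"
| "born _ a b = {}"

text \<open>The names consumed by a right extremum keep stale values, so the two orders are compared
  on the surviving names only.\<close>

definition commute_at ::
    "nat set \<Rightarrow> strands \<Rightarrow> piece \<Rightarrow> nat list \<Rightarrow> nat \<Rightarrow> nat \<Rightarrow> piece \<Rightarrow> nat list \<Rightarrow> nat \<Rightarrow> nat \<Rightarrow> bool" where
  "commute_at X \<sigma> p P a b q Q c d \<longleftrightarrow>
     agree (X \<union> born p a b \<union> born q c d - dead p P - dead q Q)
       (tr q Q c d (tr p P a b \<sigma>)) (tr p P a b (tr q Q c d \<sigma>)) \<and>
     fac_names p P \<sigma> * fac_names q Q (tr p P a b \<sigma>) =
     fac_names q Q \<sigma> * fac_names p P (tr q Q c d \<sigma>)"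

lemma agree_sym: "agree S \<sigma> \<sigma>' \<longleftrightarrow> agree S \<sigma>' \<sigma>"
  by (cases \<sigma>; cases \<sigma>') auto

lemma commute_at_sym: "commute_at X \<sigma> p P a b q Q c d \<Longrightarrow> commute_at X \<sigma> q Q c d p P a b"
proof -
  have "X \<union> born p a b \<union> born q c d - dead p P - dead q Q =
      X \<union> born q c d \<union> born p a b - dead q Q - dead p P" by auto
  then show "commute_at X \<sigma> p P a b q Q c d \<Longrightarrow> commute_at X \<sigma> q Q c d p P a b"
    unfolding commute_at_def by (metis agree_sym)
qed

lemma agree_refl: "agree S \<sigma> \<sigma>"
  by (cases \<sigma>) auto

lemma commute_Cross: "length Q = ins q \<Longrightarrow> commute_at X \<sigma> (Cross k i) P a b q Q c d"
  unfolding commute_at_def by (cases \<sigma>; cases "tr q Q c d \<sigma>") (auto simp: agree_refl)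

context
  fixes xs D A g
  assumes good: "good (xs, D, A, g)"
begin

lemma inv: "u \<in> set xs \<Longrightarrow> A u \<in> set xs" "u \<in> set xs \<Longrightarrow> A (A u) = u" "u \<in> set xs \<Longrightarrow> A u \<noteq> u"
  using goodD[OF good] by blast+

lemma ginv: "u \<in> set xs \<Longrightarrow> g (A u) = drev (g u)" "u \<in> set xs \<Longrightarrow> even (g u) \<longleftrightarrow> D u \<noteq> D (A u)"
  using goodD[OF good] by blast+

lemma A_eq_iff: "u \<in> set xs \<Longrightarrow> v \<in> set xs \<Longrightarrow> A u = A v \<longleftrightarrow> u = v"
  using inv(2) by metis

lemma A_swap: "u \<in> set xs \<Longrightarrow> v \<in> set xs \<Longrightarrow> A u = v \<longleftrightarrow> A v = u"
  using inv(2) by metis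

lemma commute_Open_Open:
  assumes "distinct [a, b, c, d]"
  shows "commute_at (set xs) (D, A, g) (Open i e) [] a b (Open j f) [] c d"
  using assms unfolding commute_at_def by auto

lemma commute_Open_Close:
  assumes "a \<notin> set xs" "b \<notin> set xs" and P: "x \<in> set xs" "y \<in> set xs"
  shows "commute_at (set xs) (D, A, g) (Open i e) [] a b (Close j) [x, y] c d"
proof -
  have "x \<noteq> a" "x \<noteq> b" "y \<noteq> a" "y \<noteq> b" "A x \<noteq> a" "A x \<noteq> b" "A y \<noteq> a" "A y \<noteq> b"
    "a \<noteq> A x" "b \<noteq> A x" "a \<noteq> A y" "b \<noteq> A y"
    using assms inv(1) by metis+
  then show ?thesis unfolding commute_at_def by simp
qed

lemma commute_Open_Cusp:
  assumes "a \<notin> set xs" "b \<notin> set xs" and P: "x \<in> set xs"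
  shows "commute_at (set xs) (D, A, g) (Open i e) [] a b (Cusp j s) [x] c d"
proof -
  have "x \<noteq> a" "x \<noteq> b" "A x \<noteq> a" "A x \<noteq> b" "a \<noteq> A x" "b \<noteq> A x" "a \<noteq> x" "b \<noteq> x"
    using assms inv(1) by metis+
  then show ?thesis unfolding commute_at_def by simp
qed

lemma commute_Close_Close:
  assumes P: "x \<in> set xs" "y \<in> set xs" "u \<in> set xs" "v \<in> set xs" "distinct [x, y, u, v]"
    and "D x \<noteq> D y" "D u \<noteq> D v"
  shows "commute_at (set xs) (D, A, g) (Close i) [x, y] a b (Close j) [u, v] c d"
proof -
  have *: "set xs \<union> {} \<union> {} - {x, y} - {u, v} = set xs - {x, y, u, v}" by auto
  show ?thesis
    unfolding commute_at_def tr.simps dead.simps born.simps agree.simps fac_names.simps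
      nth_Cons_0 One_nat_def nth_Cons_Suc list.set * simp_thms
    by (rule close_close[OF inv ginv P assms(6,7)])
qed

lemma commute_Close_Cusp:
  assumes P: "x \<in> set xs" "y \<in> set xs" "u \<in> set xs" "distinct [x, y, u]"
  shows "commute_at (set xs) (D, A, g) (Close i) [x, y] a b (Cusp j s) [u] c d"
proof -
  have ne: "x \<noteq> y" "x \<noteq> u" "y \<noteq> u" "y \<noteq> x" "u \<noteq> x" "u \<noteq> y"
    using P by auto
  have f: "A x \<noteq> x" "A y \<noteq> y" "A u \<noteq> u" "A (A x) = x" "A (A y) = y" "A (A u) = u"
    "A x \<noteq> A y" "A x \<noteq> A u" "A y \<noteq> A u" "A y \<noteq> A x" "A u \<noteq> A x" "A u \<noteq> A y"
    using P inv by (simp_all add: A_eq_iff)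
  consider "A u = x" "A x = u" "A x \<noteq> y" "A y \<noteq> x" "A u \<noteq> y" "A y \<noteq> u"
    | "A u = y" "A y = u" "A x \<noteq> y" "A y \<noteq> x" "A u \<noteq> x" "A x \<noteq> u"
    | "A u \<noteq> y" "A y \<noteq> u" "A u \<noteq> x" "A x \<noteq> u"
    using A_swap[OF P(1,2)] A_swap[OF P(1,3)] A_swap[OF P(2,3)] ne by metis
  then show ?thesis
    by cases (use ne f in \<open>simp_all add: commute_at_def dop_assoc\<close>)
qed

lemma commute_Cusp_Cusp:
  assumes P: "x \<in> set xs" "u \<in> set xs" "x \<noteq> u"
  shows "commute_at (set xs) (D, A, g) (Cusp i t) [x] a b (Cusp j s) [u] c d"
proof -
  have f: "A x \<noteq> x" "A u \<noteq> u" "A (A x) = x" "A (A u) = u" "A x \<noteq> A u" "A u \<noteq> A x" "u \<noteq> x"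
    using P inv by (auto simp: A_eq_iff)
  consider "A u = x" "A x = u" | "A u \<noteq> x" "A x \<noteq> u"
    using A_swap[OF P(1,2)] by metis
  then show ?thesis
    by cases (use P f in \<open>simp_all add: commute_at_def dop_assoc\<close>)
qed

lemma commute_tr:
  assumes "length P = ins p" "length Q = ins q" "set P \<subseteq> set xs" "set Q \<subseteq> set xs"
    and "distinct (P @ Q)" "distinct [a, b, c, d]" "{a, b, c, d} \<inter> set xs = {}"
    and "\<And>i. p = Close i \<Longrightarrow> D (P ! 0) \<noteq> D (P ! 1)" "\<And>i. q = Close i \<Longrightarrow> D (Q ! 0) \<noteq> D (Q ! 1)"
  shows "commute_at (set xs) (D, A, g) p P a b q Q c d"
proof -
  have ab: "a \<notin> set xs" "b \<notin> set xs" "c \<notin> set xs" "d \<notin> set xs" using assms(7) by auto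
  have d2: "distinct [c, d, a, b]" using assms(6) by auto
  consider k i where "p = Cross k i" | k i where "q = Cross k i"
    | "\<forall>k i. p \<noteq> Cross k i" "\<forall>k i. q \<noteq> Cross k i" by blast
  then show ?thesis
  proof cases
    case 1
    then show ?thesis using commute_Cross assms(2) by simp
  next
    case 2
    then show ?thesis using commute_at_sym commute_Cross assms(1) by metis
  next
    case 3
    then show ?thesis
      using assms(1-5,8,9)
      by (cases p; cases q)
        (auto simp: length_2_conv length_Suc_0_conv
          intro!: commute_Open_Open[OF assms(6)] commute_Open_Close[OF ab(1,2)]
            commute_Open_Cusp[OF ab(1,2)] commute_at_sym[OF commute_Open_Close[OF ab(3,4)]]
            commute_at_sym[OF commute_Open_Cusp[OF ab(3,4)]] commute_Close_Close commute_Cusp_Cusp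
            commute_Close_Cusp commute_at_sym[OF commute_Close_Cusp])
  qed
qed

end

lemma tr_at_height [simp]: "tr (at_height k p) = tr p"
  by (cases p) (auto simp: fun_eq_iff)

lemma new_names_at_height [simp]: "new_names (at_height k p) = new_names p"
  by (cases p) (auto simp: fun_eq_iff)

lemma at_height_simps [simp]:
  "ins (at_height k p) = ins p" "outs (at_height k p) = outs p" "height (at_height k p) = k"
  "classical (at_height k p) = classical p" "born (at_height k p) = born p"
  by (cases p; simp add: fun_eq_iff)+

lemma length_new_names: "length P = ins p \<Longrightarrow> length (new_names p P a b) = outs p"
  by (cases p) auto

lemma set_new_names: "length P = ins p \<Longrightarrow> set (new_names p P a b) \<subseteq> (set P - dead p P) \<union> born p a b"
  by (cases p) (auto simp: length_2_conv length_Suc_0_conv)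

lemma fac_split:
  "length us = height p \<Longrightarrow> length P = ins p \<Longrightarrow> fac p (us @ P @ zs, \<sigma>) = fac_names p P \<sigma>"
  by (cases p; cases \<sigma>) (auto simp: length_2_conv nth_append)

declare stp_with.simps [simp del]

lemma act_at:
  "length us = height p \<Longrightarrow> length P = ins p \<Longrightarrow>
   act p (us @ P @ zs) = map_option (\<lambda>R. us @ R @ zs) (act (at_height 0 p) P)"
  by (cases p) (auto simp: length_2_conv length_Suc_0_conv nth_append list_update_append)

lemma act_length: "act p ds = Some es \<Longrightarrow> height p + ins p \<le> length ds \<and> length es + ins p = length ds + outs p"
  by (cases p) (auto split: if_splits)

lemma act_dirs_Close:
  assumes "act p (us @ P @ zs) = Some es" "p = Close i" "length us = height p" "length P = ins p"
  shows "P ! 0 \<noteq> P ! 1"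
  using assms by (auto simp: length_2_conv nth_append split: if_splits)

text \<open>The height of \<open>q\<close> counts strands to the right of \<open>p\<close>, where
  \<open>p\<close> has \<open>outs p\<close> strands; this gives the number of strands between the
  two pieces.\<close>

lemma two_pieces:
  assumes "height p + outs p \<le> height q" "height p + ins p \<le> length xs"
    and "height q + ins q + ins p \<le> length xs + outs p"
  obtains us P ms Q zs where "xs = us @ P @ ms @ Q @ zs" "length us = height p" "length P = ins p"
    "length Q = ins q" "height q = height p + outs p + length ms"
proof -
  define k where "k = height q - height p - outs p"
  have "length (take (height p) xs) = height p" "length (take (ins p) (drop (height p) xs)) = ins p"
    using assms(2) by simp_all
  moreover have "length (take k (drop (height p + ins p) xs)) = k"
    "length (take (ins q) (drop (height p + ins p + k) xs)) = ins q"
    using assms unfolding k_def by simp_all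
  moreover have "xs = take (height p) xs @ take (ins p) (drop (height p) xs) @
      take k (drop (height p + ins p) xs) @ take (ins q) (drop (height p + ins p + k) xs) @
      drop (height p + ins p + k + ins q) xs"
    by (metis add.commute append_take_drop_id drop_drop)
  ultimately show ?thesis
    using that assms(1) k_def by (metis add.assoc le_add_diff_inverse diff_diff_left)
qed

lemma act_exchange:
  assumes "height p + outs p \<le> height q" "act p ds = Some es" "act q es = Some fs"
  shows "\<exists>es'. act (at_height (height q - outs p + ins p) q) ds = Some es' \<and> act p es' = Some fs"
proof -
  have "height q + ins q + ins p \<le> length ds + outs p"
    using act_length[OF assms(2)] act_length[OF assms(3)] by simp
  then obtain us P ms Q zs where ds: "ds = us @ P @ ms @ Q @ zs"
    and l: "length us = height p" "length P = ins p" "length Q = ins q"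
      "height q = height p + outs p + length ms"
    using two_pieces[OF assms(1), of ds] act_length[OF assms(2)] by metis
  obtain R where R: "act (at_height 0 p) P = Some R" "es = us @ R @ ms @ Q @ zs"
    using assms(2) act_at[OF l(1,2)] unfolding ds by auto
  have lR: "length R = outs p"
    using act_length[OF R(1)] l(2) by simp
  have "act q ((us @ R @ ms) @ Q @ zs) = map_option (\<lambda>S. (us @ R @ ms) @ S @ zs) (act (at_height 0 q) Q)"
    by (rule act_at) (use lR l in auto)
  then obtain S where S: "act (at_height 0 q) Q = Some S" "fs = (us @ R @ ms) @ S @ zs"
    using assms(3) R(2) by auto
  have "at_height 0 (at_height k q) = at_height 0 q" for k by (cases q) auto
  then have "act (at_height (height q - outs p + ins p) q) ((us @ P @ ms) @ Q @ zs) =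
      Some ((us @ P @ ms) @ S @ zs)"
    using S by (subst act_at) (use l in auto)
  moreover have "act p (us @ P @ ms @ S @ zs) = Some fs"
    using act_at[OF l(1,2)] R(1) S(2) by simp
  ultimately show ?thesis unfolding ds by simp
qed

lemma stp_rn:
  assumes "good s" "act p (dirs s) = Some ds" "a \<noteq> b" "a \<notin> set (fst s)" "b \<notin> set (fst s)"
  shows "rn (stp p s) (stp_with a b p s)"
  unfolding stp_def using fresh_notin' assms by (intro rn_stp_with) auto

lemma rn_agree:
  "agree (set xs) \<sigma> \<sigma>' \<Longrightarrow> rn (xs, \<sigma>) (xs, \<sigma>')"
  by (cases \<sigma>; cases \<sigma>') (auto intro!: rnI[of id])

lemma agree_mono: "agree S \<sigma> \<sigma>' \<Longrightarrow> T \<subseteq> S \<Longrightarrow> agree T \<sigma> \<sigma>'"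
  by (cases \<sigma>; cases \<sigma>') auto

lemma sim_exchange_flat:
  assumes "\<not> classical p" "\<not> classical q" "height p + outs p \<le> height q"
    and ds: "act p ds = Some es" "act q es = Some fs"
  shows "sim ds [p, q] [at_height (height q - outs p + ins p) q, p]"
proof -
  let ?q = "at_height (height q - outs p + ins p) q"
  obtain es' where es': "act ?q ds = Some es'" "act p es' = Some fs"
    using act_exchange[OF assms(3-5)] by blast
  show ?thesis
  proof (rule sim_flatI)
    fix s assume s: "good s" "dirs s = ds"
    obtain xs D A g where s': "s = (xs, D, A, g)" by (cases s)
    have m: "map D xs = ds" using s s' by (simp add: dirs.simps)
    have len: "length xs = length ds" using m by auto
    have "height p + ins p \<le> length xs" "height q + ins q + ins p \<le> length xs + outs p"
      using act_length[OF ds(1)] act_length[OF ds(2)] len by simp_all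
    then obtain us P ms Q zs where xs: "xs = us @ P @ ms @ Q @ zs"
      and l: "length us = height p" "length P = ins p" "length Q = ins q"
        "height q = height p + outs p + length ms"
      by (rule two_pieces[OF assms(3)])
    \<comment> \<open>Run with four distinct new names, the two orders end in states that agree on
      all surviving names. The names chosen by \<open>stp\<close> are related to these by
      renaming.\<close>
    define a b c d where "a = fresh xs + 0" and "b = fresh xs + 1" and "c = fresh xs + 2"
      and "d = fresh xs + 3"
    have abcd: "distinct [a, b, c, d]" "a \<notin> set xs" "b \<notin> set xs" "c \<notin> set xs" "d \<notin> set xs"
      unfolding a_def b_def c_def d_def by (simp, (rule fresh_notin)+)
    define N M where "N = new_names p P a b" and "M = new_names q Q c d"
    have lN: "length N = outs p" "length M = outs q" using length_new_names l N_def M_def by auto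
    have sN: "set N \<subseteq> (set P - dead p P) \<union> born p a b"
      "set M \<subseteq> (set Q - dead q Q) \<union> born q c d"
      unfolding N_def M_def by (rule set_new_names[OF l(2)], rule set_new_names[OF l(3)])
    have bn: "born p a b \<subseteq> {a, b}" "born q c d \<subseteq> {c, d}" by (cases p; simp) (cases q; simp)
    have dd: "dead p P \<subseteq> set P" "dead q Q \<subseteq> set Q" by (cases p; simp) (cases q; simp)
    have dxs: "distinct xs" using good_distinct s s' by metis
    have p1: "stp_with a b p s = (us @ N @ ms @ Q @ zs, tr p P a b (D, A, g))"
      unfolding s' xs N_def using stp_with_split[OF l(1,2)] by simp
    have p2: "stp_with c d q (us @ N @ ms @ Q @ zs, \<sigma>) = (us @ N @ ms @ M @ zs, tr q Q c d \<sigma>)" for \<sigma>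
      using stp_with_split[of "us @ N @ ms" q Q c d zs \<sigma>] l lN unfolding M_def by simp
    have q1: "stp_with c d ?q s = (us @ P @ ms @ M @ zs, tr q Q c d (D, A, g))"
      unfolding s' xs M_def using stp_with_split[of "us @ P @ ms" ?q Q c d zs "(D, A, g)"] l by simp
    have q2: "stp_with a b p (us @ P @ ms @ M @ zs, \<sigma>) = (us @ N @ ms @ M @ zs, tr p P a b \<sigma>)" for \<sigma>
      using stp_with_split[OF l(1,2)] unfolding N_def by simp
    have f: "fac p s = fac_names p P (D, A, g)" "fac ?q s = fac_names q Q (D, A, g)"
      "fac q (us @ N @ ms @ Q @ zs, \<sigma>) = fac_names q Q \<sigma>"
      "fac p (us @ P @ ms @ M @ zs, \<sigma>) = fac_names p P \<sigma>" for \<sigma>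
    proof -
      have "fac_names (at_height k q) = fac_names q" for k by (cases q) (auto simp: fun_eq_iff)
      then show "fac p s = fac_names p P (D, A, g)" "fac ?q s = fac_names q Q (D, A, g)"
        "fac q (us @ N @ ms @ Q @ zs, \<sigma>) = fac_names q Q \<sigma>"
        "fac p (us @ P @ ms @ M @ zs, \<sigma>) = fac_names p P \<sigma>"
        using fac_split[OF l(1,2)] fac_split[of "us @ P @ ms" ?q Q zs "(D, A, g)"]
          fac_split[of "us @ N @ ms" q Q zs \<sigma>] l lN unfolding s' xs by simp_all
    qed
    have ds1: "act p (dirs s) = Some es" "act ?q (dirs s) = Some es'" using s ds es' by simp_all
    have Dp: "D (P ! 0) \<noteq> D (P ! 1)" if "p = Close i" for i
    proof -
      have "act p (map D us @ map D P @ map D (ms @ Q @ zs)) = Some es" using ds(1) m xs by auto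
      then have "map D P ! 0 \<noteq> map D P ! 1"
        by (rule act_dirs_Close) (use that l in simp_all)
      then show ?thesis using that l(2) by simp
    qed
    have Dq: "D (Q ! 0) \<noteq> D (Q ! 1)" if "q = Close i" for i
    proof -
      have "act ?q (map D (us @ P @ ms) @ map D Q @ map D zs) = Some es'" using es'(1) m xs by auto
      then have "map D Q ! 0 \<noteq> map D Q ! 1"
        by (rule act_dirs_Close[of _ _ _ _ _ "height q - outs p + ins p"]) (use that l in simp_all)
      then show ?thesis using that l(3) by simp
    qed
    have comm: "commute_at (set xs) (D, A, g) p P a b q Q c d"
      by (rule commute_tr) (use s s' l xs dxs abcd Dp Dq in auto)
    have sub: "set (us @ N @ ms @ M @ zs) \<subseteq> set xs \<union> born p a b \<union> born q c d - dead p P - dead q Q"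
    proof -
      have "set P \<inter> set Q = {}" "set us \<union> set ms \<union> set zs \<subseteq> set xs - set P - set Q"
        "set P \<subseteq> set xs" "set Q \<subseteq> set xs"
        using dxs xs by auto
      moreover have "born p a b \<inter> set xs = {}" "born q c d \<inter> set xs = {}"
        using bn abcd by blast+
      ultimately show ?thesis unfolding set_append using sN dd by blast
    qed
    have r1: "rn (stp p s) (stp_with a b p s)" and r1': "rn (stp ?q s) (stp_with c d ?q s)"
      using stp_rn[OF s(1) ds1(1)] stp_rn[OF s(1) ds1(2)] abcd s' by simp_all
    have g1: "good (stp p s)" "dirs (stp p s) = es" "good (stp ?q s)" "dirs (stp ?q s) = es'"
      using good_stp dirs_stp s(1) ds1 by blast+
    have notin: "c \<notin> set (us @ N @ ms @ Q @ zs)" "d \<notin> set (us @ N @ ms @ Q @ zs)"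
      "a \<notin> set (us @ P @ ms @ M @ zs)" "b \<notin> set (us @ P @ ms @ M @ zs)"
      using sN bn abcd xs by auto
    have r2: "rn (stp q (stp p s)) (stp_with c d q (stp_with a b p s))"
        "fac q (stp_with a b p s) = fac q (stp p s)"
      unfolding stp_def[of q]
      using rn_stp_with[OF g1(1) _ r1, of q fs "fresh (fst (stp p s))" "Suc (fresh (fst (stp p s)))" c d]
        g1 ds fresh_notin' abcd notin p1 by auto
    have r2': "rn (stp p (stp ?q s)) (stp_with a b p (stp_with c d ?q s))"
        "fac p (stp_with c d ?q s) = fac p (stp ?q s)"
      unfolding stp_def[of p "stp ?q s"]
      using rn_stp_with[OF g1(3) _ r1', of p fs "fresh (fst (stp ?q s))" "Suc (fresh (fst (stp ?q s)))" a b]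
        g1 es' fresh_notin' abcd notin q1 by auto
    have "rn (us @ N @ ms @ M @ zs, tr q Q c d (tr p P a b (D, A, g)))
        (us @ N @ ms @ M @ zs, tr p P a b (tr q Q c d (D, A, g)))"
      by (rule rn_agree, rule agree_mono[OF _ sub]) (use comm commute_at_def in blast)
    then have "rn (stp_with c d q (stp_with a b p s)) (stp_with a b p (stp_with c d ?q s))"
      using p1 p2 q1 q2 by simp
    moreover have g2: "good (stp q (stp p s))" "good (stp p (stp ?q s))"
      using good_stp g1 ds es' by auto
    ultimately have "rn (stp q (stp p s)) (stp p (stp ?q s))"
      using r2(1) r2'(1) rn_trans rn_sym by metis
    moreover have "fac p s * fac q (stp p s) = fac ?q s * fac p (stp ?q s)"
      using r2(2) r2'(2) p1 q1 f comm unfolding commute_at_def by simp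
    ultimately show "facs [p, q] s = facs [?q, p] s \<and> rn (stps [p, q] s) (stps [?q, p] s)"
      by simp
  qed (use assms es' in auto)
qed

declare fac.simps(1) [simp del]

subsection \<open>Flat moves\<close>

text \<open>The strands touched by a move are exposed as the block \<open>P\<close>, so that the
  rules for single steps can be applied by rewriting.\<close>

lemma sim_names:
  assumes "filter classical l = []" "filter classical r = []" "i + k \<le> length ds"
    and r: "\<And>us P zs. ds = us @ P @ zs \<Longrightarrow> length us = i \<Longrightarrow> length P = k \<Longrightarrow>
      run l ds \<noteq> None \<and> run r ds = run l ds"
    and s: "\<And>us P zs D A g. length us = i \<Longrightarrow> length P = k \<Longrightarrow> good (us @ P @ zs, D, A, g) \<Longrightarrow>
      map D us @ map D P @ map D zs = ds \<Longrightarrow>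
      facs l (us @ P @ zs, D, A, g) = facs r (us @ P @ zs, D, A, g) \<and>
      rn (stps l (us @ P @ zs, D, A, g)) (stps r (us @ P @ zs, D, A, g))"
  shows "sim ds l r"
proof -
  have split: "\<exists>us P zs. xs = us @ P @ zs \<and> length us = i \<and> length P = k" if "length xs = length ds"
    for xs :: "'a list"
  proof (intro exI conjI)
    show "xs = take i xs @ take k (drop i xs) @ drop k (drop i xs)"
      by (simp only: append_take_drop_id)
  qed (use that assms(3) in simp_all)
  obtain us P zs where ds: "ds = us @ P @ zs" "length us = i" "length P = k"
    using split[of ds] by blast
  have run: "run l ds \<noteq> None" "run r ds = run l ds" using r[OF ds] by simp_all
  show ?thesis
  proof (rule sim_flatI)
    show "run l ds = Some (the (run l ds))" "run r ds = Some (the (run l ds))" using run by simp_all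
    fix s' assume s': "good s'" "dirs s' = ds"
    obtain xs D A g where x: "s' = (xs, D, A, g)" by (cases s')
    then have m: "map D xs = ds" using s' by (simp add: dirs.simps)
    then have "length xs = length ds" by auto
    then obtain us P zs where xs: "xs = us @ P @ zs" and l: "length us = i" "length P = k"
      using split[of xs] by blast
    show "facs l s' = facs r s' \<and> rn (stps l s') (stps r s')"
      unfolding x xs by (rule s[OF l]) (use s' m x xs in simp_all)
  qed (use assms(1,2) in simp_all)
qed

lemma good_fresh:
  assumes "good (xs, D, A, g)" "u \<in> set xs"
  shows "u \<noteq> fresh xs" "u \<noteq> Suc (fresh xs)" "A u \<noteq> fresh xs" "A u \<noteq> Suc (fresh xs)"
    "fresh xs \<noteq> u" "Suc (fresh xs) \<noteq> u" "fresh xs \<noteq> A u" "Suc (fresh xs) \<noteq> A u"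
  using fresh_notin'[of xs] assms goodD(1)[OF assms] by metis+

lemma sim_slide_open_virtual:
  "i < length ds \<Longrightarrow> sim ds [Open i d, Cross Virtual (Suc i)] [Open (Suc i) d, Cross Virtual i]"
  by (rule sim_names[where i = i and k = 1]) (auto simp: length_Suc_conv nth_append list_update_append)

lemma sim_slide_close_virtual:
  assumes "Suc (Suc i) < length ds" "ds ! i \<noteq> ds ! Suc (Suc i)"
  shows "sim ds [Cross Virtual (Suc i), Close i] [Cross Virtual i, Close (Suc i)]"
  by (rule sim_names[where i = i and k = 3])
    (use assms in \<open>auto simp: numeral_3_eq_3 length_Suc_conv nth_append list_update_append\<close>)

lemma sim_r1_close_virtual:
  assumes "Suc i < length ds" "ds ! i \<noteq> ds ! Suc i"
  shows "sim ds [Cross Virtual i, Close i] [Close i]"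
proof (rule sim_names[where i = i and k = 2])
  fix us P zs D A g
  assume s: "length us = i" "length P = 2" "good (us @ P @ zs, D, A, g)"
  then obtain x y where P: "P = [x, y]" by (auto simp: length_2_conv)
  note i = goodD[OF s(3)]
  have xy: "x \<in> set (us @ P @ zs)" "y \<in> set (us @ P @ zs)" "x \<noteq> y" 
    using P good_distinct[OF s(3)] by auto
  have "A y = x \<longleftrightarrow> A x = y" "A x \<noteq> A y" using i(2) xy by metis+
  moreover have "zval (g y) = zval (g x)" if "A x = y"
    using i(4)[OF xy(1)] that by simp
  ultimately show "facs [Cross Virtual i, Close i] (us @ P @ zs, D, A, g) =
       facs [Close i] (us @ P @ zs, D, A, g) \<and>
       rn (stps [Cross Virtual i, Close i] (us @ P @ zs, D, A, g))
        (stps [Close i] (us @ P @ zs, D, A, g))"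
    unfolding s(1)[symmetric] P by (auto simp: fun_upd_twist)
qed (use assms in \<open>auto simp: length_2_conv nth_append list_update_append\<close>)

lemma sim_r1_open_virtual:
  assumes "i \<le> length ds"
  shows "sim ds [Open i d, Cross Virtual i] [Open i (opp d)]"
proof (rule sim_names[where i = i and k = 0])
  fix us P zs D A g
  assume s: "length us = i" "length P = 0" "good (us @ P @ zs, D, A, g)"
  then have P: "P = []" by simp
  define a where "a = fresh (us @ zs)"
  note f = good_fresh[OF s(3)[unfolded P append.simps], folded a_def]
  \<comment> \<open>The kink exchanges the two ends of the new arc, so the renaming exchanges their
    names; both labels are 0.\<close>
  let ?f = "id(a := Suc a, Suc a := a)"
  have ni: "a \<notin> set (us @ zs)" "Suc a \<notin> set (us @ zs)"
    unfolding a_def by (rule fresh_notin')+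
  then have m: "map ?f us = us" "map ?f zs = zs" by (auto intro!: map_idI)
  have *: "u \<noteq> a \<and> u \<noteq> Suc a \<and> A u \<noteq> a \<and> A u \<noteq> Suc a" if "u \<in> set us \<union> set zs" for u
    using f(1-4)[of u] that by simp
  have "rnf ?f (us @ Suc a # a # zs, D(a := d, Suc a := opp d), A(a := Suc a, Suc a := a), g(a := 0, Suc a := 0))
      (us @ a # Suc a # zs, D(a := opp d, Suc a := d), A(a := Suc a, Suc a := a), g(a := 0, Suc a := 0))"
    unfolding rnf.simps
  proof (intro conjI ballI)
    show "inj_on ?f (set (us @ Suc a # a # zs))" using ni by (auto simp: inj_on_def)
    show "us @ a # Suc a # zs = map ?f (us @ Suc a # a # zs)" using m by simp
    fix u assume "u \<in> set (us @ Suc a # a # zs)"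
    then consider "u = a" | "u = Suc a" | "u \<in> set us \<union> set zs" by auto
    note cases = this
    show "(D(a := opp d, Suc a := d)) (?f u) = (D(a := d, Suc a := opp d)) u"
      using cases by cases (simp_all add: *)
    show "(A(a := Suc a, Suc a := a)) (?f u) = ?f ((A(a := Suc a, Suc a := a)) u)"
      using cases by cases (simp_all add: *)
    show "(g(a := 0, Suc a := 0)) (?f u) = (g(a := 0, Suc a := 0)) u"
      using cases by cases (simp_all add: *)
  qed
  then show "facs [Open i d, Cross Virtual i] (us @ P @ zs, D, A, g) =
       facs [Open i (opp d)] (us @ P @ zs, D, A, g) \<and>
       rn (stps [Open i d, Cross Virtual i] (us @ P @ zs, D, A, g))
        (stps [Open i (opp d)] (us @ P @ zs, D, A, g))"
    unfolding s(1)[symmetric] P using rnI by (simp add: a_def[symmetric] del: rnf.simps)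
qed (use assms in \<open>auto simp: nth_append list_update_append\<close>)

text \<open>Used for zigzags: after the new arc has been joined to the strand \<open>x\<close>, that
  strand goes on under the name \<open>b\<close> of the free end of the new arc.\<close>

lemma rn_replace:
  assumes "good (us @ x # zs, D, A, g)" "b \<notin> set (us @ x # zs)"
    and "\<And>u. u \<in> set us \<union> set zs \<Longrightarrow> D' u = D u \<and> g' u = g u"
    and "\<And>u. u \<in> set us \<union> set zs \<Longrightarrow> u \<noteq> A x \<Longrightarrow> A' u = A u"
    and "D' b = D x" "g' b = g x" "A' b = A x" "A' (A x) = b"
  shows "rn (us @ x # zs, D, A, g) (us @ b # zs, D', A', g')"
proof (rule rnI[of "id(x := b)"])
  note i = goodD[OF assms(1)]
  have x: "x \<notin> set us" "x \<notin> set zs" using good_distinct[OF assms(1)] by auto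
  have ne: "A u \<noteq> x" if "u \<in> set us \<union> set zs" "u \<noteq> A x" for u
    using i(2)[of u] that by auto
  have "A x \<in> set us \<union> set zs" "A (A x) = x" "A x \<noteq> x" using i(1-3)[of x] by auto
  moreover have "A' u = (id(x := b)) (A u)" if "u \<in> set us \<union> set zs" for u
    using assms(4)[OF that] assms(8) ne[OF that] \<open>A (A x) = x\<close> by (cases "u = A x") auto
  moreover have "inj_on (id(x := b)) (insert x (set us \<union> set zs))"
    using assms(2) x by (auto simp: inj_on_def)
  moreover have "map (id(x := b)) us = us" "map (id(x := b)) zs = zs"
    using x by (auto intro!: map_idI)
  ultimately show "rnf (id(x := b)) (us @ x # zs, D, A, g) (us @ b # zs, D', A', g')"
    using assms(3,5,6,7) x by auto
qed

lemma sim_zigzag2: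
  assumes "i < length ds" "ds ! i = opp d"
  shows "sim ds [Open (Suc i) d, Close i] []"
proof (rule sim_sym, rule sim_names[where i = i and k = 1])
  fix us P zs D A g
  assume s: "length us = i" "length P = 1" "good (us @ P @ zs, D, A, g)"
    "map D us @ map D P @ map D zs = ds"
  then obtain x where P: "P = [x]" by (auto simp: length_Suc_conv)
  define a where "a = fresh (us @ x # zs)"
  have good: "good (us @ x # zs, D, A, g)" using s(3) P by simp
  note f = good_fresh[OF good, folded a_def] and i = goodD[OF good]
  have fx: "x \<noteq> a" "x \<noteq> Suc a" "A x \<noteq> a" "A x \<noteq> Suc a" "a \<noteq> x" "Suc a \<noteq> x" "a \<noteq> A x" "Suc a \<noteq> A x"
    "A x \<noteq> x" "x \<noteq> A x"
    using f[of x] i(3)[of x] by auto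
  have "D x = opp d" using assms(2) s(1,4) P by (auto simp: nth_append)
  then have "rn (us @ x # zs, D, A, g) (us @ Suc a # zs, tr (Close 0) [x, a] 0 0
      (tr (Open 0 d) [] a (Suc a) (D, A, g)))"
    unfolding tr.simps using fx f(5,6)
    by (intro rn_replace[OF good]) (use f(1,2)[of "Suc a"] fx in \<open>auto\<close>)
  then show "facs [] (us @ P @ zs, D, A, g) = facs [Open (Suc i) d, Close i] (us @ P @ zs, D, A, g) \<and>
       rn (stps [] (us @ P @ zs, D, A, g)) (stps [Open (Suc i) d, Close i] (us @ P @ zs, D, A, g))"
    unfolding s(1)[symmetric] P using fx by (simp add: a_def[symmetric])
qed (use assms in \<open>auto simp: length_Suc_conv nth_append\<close>)

lemma sim_zigzag1:
  assumes "i < length ds" "ds ! i = d"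
  shows "sim ds [Open i d, Close (Suc i)] []"
proof (rule sim_sym, rule sim_names[where i = i and k = 1])
  fix us P zs D A g
  assume s: "length us = i" "length P = 1" "good (us @ P @ zs, D, A, g)"
    "map D us @ map D P @ map D zs = ds"
  then obtain x where P: "P = [x]" by (auto simp: length_Suc_conv)
  define a where "a = fresh (us @ x # zs)"
  have good: "good (us @ x # zs, D, A, g)" using s(3) P by simp
  note f = good_fresh[OF good, folded a_def] and i = goodD[OF good]
  have fx: "x \<noteq> a" "x \<noteq> Suc a" "A x \<noteq> a" "A x \<noteq> Suc a" "a \<noteq> x" "Suc a \<noteq> x" "a \<noteq> A x" "Suc a \<noteq> A x"
    "A x \<noteq> x" "x \<noteq> A x"
    using f[of x] i(3)[of x] by auto
  have "D x = d" using assms(2) s(1,4) P by (auto simp: nth_append)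
  then have "rn (us @ x # zs, D, A, g) (us @ a # zs, tr (Close 0) [Suc a, x] 0 0
      (tr (Open 0 d) [] a (Suc a) (D, A, g)))"
    unfolding tr.simps using fx f(5,6)
    by (intro rn_replace[OF good]) (use f(1,2)[of a] fx in \<open>auto\<close>)
  then show "facs [] (us @ P @ zs, D, A, g) = facs [Open i d, Close (Suc i)] (us @ P @ zs, D, A, g) \<and>
       rn (stps [] (us @ P @ zs, D, A, g)) (stps [Open i d, Close (Suc i)] (us @ P @ zs, D, A, g))"
    unfolding s(1)[symmetric] P using fx by (simp add: a_def[symmetric])
qed (use assms in \<open>auto simp: length_Suc_conv nth_append\<close>)

text \<open>A cusp slides along the new arc around the extremum. The turn exchanges above and below
  for the privileged side, and as the cusp now lies on the other half, the extremum itself has the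
  opposite direction.\<close>

lemma sim_cusp_open:
  assumes "i \<le> length ds"
  shows "sim ds [Open i d, Cusp (Suc i) Above] [Open i (opp d), Cusp i Below]"
    and "sim ds [Open i d, Cusp (Suc i) Below] [Open i (opp d), Cusp i Above]"
proof -
  have *: "sim ds [Open i d, Cusp (Suc i) t] [Open i (opp d), Cusp i t']"
    if t: "cusp_label t' = - cusp_label t" for t t'
  proof (rule sim_names[where i = i and k = 0])
    fix us P zs D A g
    assume s: "length us = i" "length P = 0" "good (us @ P @ zs, D, A, g)"
    then show "facs [Open i d, Cusp (Suc i) t] (us @ P @ zs, D, A, g) =
         facs [Open i (opp d), Cusp i t'] (us @ P @ zs, D, A, g) \<and>
         rn (stps [Open i d, Cusp (Suc i) t] (us @ P @ zs, D, A, g))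
          (stps [Open i (opp d), Cusp i t'] (us @ P @ zs, D, A, g))"
      unfolding s(1)[symmetric] by (auto intro!: rn_agree simp: t)
  qed (use assms in \<open>auto simp: nth_append list_update_append\<close>)
  show "sim ds [Open i d, Cusp (Suc i) Above] [Open i (opp d), Cusp i Below]"
    "sim ds [Open i d, Cusp (Suc i) Below] [Open i (opp d), Cusp i Above]"
    by (rule *, simp)+
qed

subsection \<open>Expansion of classical crossings\<close>

lemma foldr_expand:
  assumes "filter classical u = []" "c \<noteq> Virtual" "run u ds = Some es" "good s" "dirs s = ds"
  shows "foldr cont (u @ [Cross c i] @ v) K s =
    - A_pow (- 3 * piece_sign (Cross c i) es) *
     (A_pow (piece_sign (Cross c i) es) * foldr cont (u @ smoothing1 i (es ! i) (es ! Suc i) @ v) K s +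
      A_pow (- piece_sign (Cross c i) es) * foldr cont (u @ smoothing2 i (es ! i) (es ! Suc i) @ v) K s)"
proof -
  have "dirs (stps u s) = es" using good_stps assms by blast
  then show ?thesis
    using assms(1,2) classical_smoothing
    by (simp add: foldr_flat flat_append[symmetric] foldr_append flat_def cont_def Let_def algebra_simps)
qed

text \<open>The two expansions have the same coefficients because the signs agree, so corresponding
  smoothings can be compared separately.\<close>

lemma sim_expand:
  assumes flat: "filter classical u = []" "filter classical u' = []" "c \<noteq> Virtual" "c' \<noteq> Virtual"
    and run: "run u ds = Some es" "run u' ds = Some es'" "Suc i < length es" "Suc i' < length es'"
    and sign: "piece_sign (Cross c i) es = piece_sign (Cross c' i') es'"
    and sim: "sim ds (u @ smoothing1 i (es ! i) (es ! Suc i) @ v) (u' @ smoothing1 i' (es' ! i') (es' ! Suc i') @ v')"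
      "sim ds (u @ smoothing2 i (es ! i) (es ! Suc i) @ v) (u' @ smoothing2 i' (es' ! i') (es' ! Suc i') @ v')"
  shows "sim ds (u @ [Cross c i] @ v) (u' @ [Cross c' i'] @ v')"
proof -
  obtain fs where fs: "act (Cross c i) es = Some fs" using run(3) by simp
  obtain fs' where fs': "act (Cross c' i') es' = Some fs'" using run(4) by simp
  have r: "run (u @ [Cross c i] @ v) ds = run v fs" "run (u' @ [Cross c' i'] @ v') ds = run v' fs'"
    using run(1,2) fs fs' by (simp_all add: run_append)
  have r1: "run (u @ smoothing1 i (es ! i) (es ! Suc i) @ v) ds = run v fs"
    "run (u' @ smoothing1 i' (es' ! i') (es' ! Suc i') @ v') ds = run v' fs'"
    "run (u @ smoothing2 i (es ! i) (es ! Suc i) @ v) ds = run v fs"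
    using run(1,2) run_smoothing[OF fs] run_smoothing[OF fs'] by (simp_all add: run_append)
  show ?thesis unfolding sim_def
  proof (intro conjI allI impI; (elim conjE)?)
    show "run (u @ [Cross c i] @ v) ds \<noteq> None" "run (u' @ [Cross c' i'] @ v') ds = run (u @ [Cross c i] @ v) ds"
      using sim(1) unfolding r r1 sim_def by auto
    fix K s assume s: "good s" "dirs s = ds" "resp (the (run (u @ [Cross c i] @ v) ds)) K"
    have "resp (the (run v fs)) K" using s(3) r by simp
    then have "foldr cont (u @ smoothing1 i (es ! i) (es ! Suc i) @ v) K s = foldr cont (u' @ smoothing1 i' (es' ! i') (es' ! Suc i') @ v') K s"
      "foldr cont (u @ smoothing2 i (es ! i) (es ! Suc i) @ v) K s = foldr cont (u' @ smoothing2 i' (es' ! i') (es' ! Suc i') @ v') K s"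
      using sim s(1,2) unfolding sim_def r1 by blast+
    then show "foldr cont (u @ [Cross c i] @ v) K s = foldr cont (u' @ [Cross c' i'] @ v') K s"
      unfolding foldr_expand[OF flat(1,3) run(1) s(1,2)] foldr_expand[OF flat(2,4) run(2) s(1,2)] sign
      by (simp only:)
  qed
qed

subsection \<open>Moves involving classical crossings\<close>

lemma at_height_at_height [simp]: "at_height j (at_height k p) = at_height j p"
  by (cases p) auto

lemma at_height_self: "height p = k \<Longrightarrow> at_height k p = p"
  by (cases p) auto

text \<open>A piece at height \<open>h\<close> in front of \<open>ps\<close> that lies above all
  pieces of \<open>ps\<close> gets the resulting height when it is placed behind \<open>ps\<close>.
  Failure means that it meets one of them, or that one of them is classical.\<close>

fun gap :: "nat \<Rightarrow> piece list \<Rightarrow> nat option" where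
  "gap h [] = Some h"
| "gap h (p # ps) =
     (if \<not> classical p \<and> height p + ins p \<le> h then gap (h - ins p + outs p) ps else None)"

lemma gap_smoothing:
  "i + 2 \<le> k \<Longrightarrow> gap k (smoothing1 i d d') = Some k"
  "i + 2 \<le> k \<Longrightarrow> gap k (smoothing2 i d d') = Some k"
  by (auto simp: smoothing1_def smoothing2_def)

lemma sim_pass_upper:
  assumes "gap h ps = Some h'" "\<not> classical q" "run (ps @ [at_height h' q]) ds \<noteq> None"
  shows "sim ds (ps @ [at_height h' q]) (at_height h q # ps)"
  using assms(1,3)
proof (induction ps arbitrary: h ds)
  case Nil
  then show ?case by (auto intro!: sim_refl)
next
  case (Cons p ps)
  let ?h = "h - ins p + outs p"
  have p: "\<not> classical p" "height p + ins p \<le> h" "gap ?h ps = Some h'"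
    using Cons.prems(1) by (auto split: if_splits)
  obtain es where es: "act p ds = Some es" "run (ps @ [at_height h' q]) es \<noteq> None"
    using Cons.prems(2) by (cases "act p ds") auto
  have IH: "sim es (ps @ [at_height h' q]) (at_height ?h q # ps)"
    by (rule Cons.IH[OF p(3) es(2)])
  then have r: "run (at_height ?h q # ps) es \<noteq> None"
    unfolding sim_def by metis
  then obtain fs where fs: "act (at_height ?h q) es = Some fs" "run ps fs \<noteq> None"
    by (cases "act (at_height ?h q) es") auto
  have "sim ds ([p] @ (ps @ [at_height h' q]) @ []) ([p] @ (at_height ?h q # ps) @ [])"
    by (rule sim_context[OF IH]) (use es in auto)
  moreover have "sim ds ([] @ [p, at_height ?h q] @ ps) ([] @ [at_height h q, p] @ ps)"
  proof (rule sim_context)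
    show "sim ds [p, at_height ?h q] [at_height h q, p]"
      using sim_exchange_flat[of p "at_height ?h q" ds es fs] p assms(2) es fs by simp
  qed (use es fs in auto)
  ultimately show ?case by (simp add: sim_trans)
qed

lemma sim_pass_lower:
  assumes "\<not> classical p" "\<forall>q\<in>set qs. \<not> classical q \<and> height p + outs p \<le> height q"
    and "run (p # qs) ds \<noteq> None"
  shows "sim ds (p # qs) (map (\<lambda>q. at_height (height q - outs p + ins p) q) qs @ [p])"
  using assms(2,3)
proof (induction qs arbitrary: ds)
  case Nil
  then show ?case by (auto intro!: sim_refl)
next
  case (Cons q qs)
  let ?q = "at_height (height q - outs p + ins p) q"
  obtain es where es: "act p ds = Some es" "run (q # qs) es \<noteq> None"
    using Cons.prems(2) by (cases "act p ds") auto
  obtain fs where fs: "act q es = Some fs" "run qs fs \<noteq> None"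
    using es(2) by (cases "act q es") auto
  have q: "\<not> classical q" "height p + outs p \<le> height q" using Cons.prems(1) by auto
  obtain es' where es': "act ?q ds = Some es'" "act p es' = Some fs"
    using act_exchange[OF q(2) es(1) fs(1)] by blast
  have "sim ds ([] @ [p, q] @ qs) ([] @ [?q, p] @ qs)"
    by (rule sim_context[OF sim_exchange_flat[OF assms(1) q es(1) fs(1)]]) (use es fs in auto)
  moreover have IH: "sim es' (p # qs) (map (\<lambda>q. at_height (height q - outs p + ins p) q) qs @ [p])"
    by (rule Cons.IH) (use Cons.prems(1) es' fs in auto)
  have "sim ds ([?q] @ (p # qs) @ [])
      ([?q] @ (map (\<lambda>q. at_height (height q - outs p + ins p) q) qs @ [p]) @ [])"
    by (rule sim_context[OF IH]) (use es' fs in auto)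
  ultimately show ?case by (simp add: sim_trans)
qed

lemma act_nth_below: "act q ds = Some es \<Longrightarrow> j < height q \<Longrightarrow> es ! j = ds ! j"
  by (cases q) (auto simp: nth_append nth_list_update split: if_splits)

lemma act_nth_above: "act p ds = Some es \<Longrightarrow> height p + outs p \<le> j \<Longrightarrow> es ! j = ds ! (j - outs p + ins p)"
  by (cases p) (auto simp: nth_append nth_list_update numeral_2_eq_2 Suc_diff_Suc split: if_splits)

text \<open>After expansion of the crossing, \<open>q\<close> passes the pieces of each smoothing
  one at a time. Both smoothings have two strands on either side, so the height of \<open>q\<close>
  does not change.\<close>

lemma sim_exchange_classical_lower:
  assumes "c \<noteq> Virtual" "\<not> classical q" "i + 2 \<le> height q"
    and ds: "act (Cross c i) ds = Some es" "act q es = Some fs"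
  shows "sim ds [Cross c i, q] [q, Cross c i]"
proof -
  have q: "at_height (height q - outs (Cross c i) + ins (Cross c i)) q = q"
    by (rule at_height_self) (use assms(3) in auto)
  obtain es' where es': "act q ds = Some es'" "act (Cross c i) es' = Some fs"
    using act_exchange[of "Cross c i" q ds es fs] assms(3) ds unfolding q by auto
  have l: "Suc i < length ds" "Suc i < length es'" using ds es' by (auto split: if_splits)
  have e: "es' ! i = ds ! i" "es' ! Suc i = ds ! Suc i"
    using act_nth_below[OF es'(1)] assms(3) by simp_all
  have "sim ds (sm @ [q]) (q # sm)"
    if "gap (height q) sm = Some (height q)" "run sm ds = Some es" for sm
    using sim_pass_upper[OF that(1) assms(2), of ds] that(2) ds(2)
    by (simp add: at_height_self run_append)
  note s = this[OF gap_smoothing(1)[OF assms(3)] run_smoothing(1)[OF ds(1)]]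
    this[OF gap_smoothing(2)[OF assms(3)] run_smoothing(2)[OF ds(1)]]
  have "sim ds ([] @ [Cross c i] @ [q]) ([q] @ [Cross c i] @ [])"
    by (rule sim_expand[of _ _ _ _ ds ds es']) (use assms(1,2) l e es' s in auto)
  then show ?thesis by simp
qed

lemma sim_exchange_classical_upper:
  assumes "c \<noteq> Virtual" "\<not> classical p" "height p + outs p \<le> i"
    and ds: "act p ds = Some es" "act (Cross c i) es = Some fs"
  shows "sim ds [p, Cross c i] [Cross c (i - outs p + ins p), p]"
proof -
  let ?i = "i - outs p + ins p"
  obtain es' where es': "act (Cross c ?i) ds = Some es'" "act p es' = Some fs"
    using act_exchange[of p "Cross c i" ds es fs] assms(3) ds by auto
  have l: "Suc i < length es" "Suc ?i < length ds" using ds es' by (auto split: if_splits)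
  have e: "es ! i = ds ! ?i" "es ! Suc i = ds ! Suc ?i"
    using act_nth_above[OF ds(1), of i] act_nth_above[OF ds(1), of "Suc i"] assms(3)
    by (simp_all add: Suc_diff_le)
  have m: "map (\<lambda>q. at_height (height q - outs p + ins p) q) (smoothing1 i d d') = smoothing1 ?i d d'"
    "map (\<lambda>q. at_height (height q - outs p + ins p) q) (smoothing2 i d d') = smoothing2 ?i d d'" for d d'
    using assms(3) by (simp_all add: smoothing1_def smoothing2_def Suc_diff_le)
  have h: "\<forall>q\<in>set (smoothing1 i d d'). \<not> classical q \<and> height p + outs p \<le> height q"
    "\<forall>q\<in>set (smoothing2 i d d'). \<not> classical q \<and> height p + outs p \<le> height q" for d d'
    using assms(3) by (auto simp: smoothing1_def smoothing2_def)
  have "sim ds ([p] @ [Cross c i] @ []) ([] @ [Cross c ?i] @ [p])"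
  proof (rule sim_expand[of _ _ _ _ ds es ds])
    show "sim ds ([p] @ smoothing1 i (es ! i) (es ! Suc i) @ [])
        ([] @ smoothing1 ?i (ds ! ?i) (ds ! Suc ?i) @ [p])"
      using sim_pass_lower[OF assms(2) h(1)[of "es ! i" "es ! Suc i"], of ds] ds(1)
        run_smoothing(1)[OF ds(2)] unfolding m e by simp
    show "sim ds ([p] @ smoothing2 i (es ! i) (es ! Suc i) @ [])
        ([] @ smoothing2 ?i (ds ! ?i) (ds ! Suc ?i) @ [p])"
      using sim_pass_lower[OF assms(2) h(2)[of "es ! i" "es ! Suc i"], of ds] ds(1)
        run_smoothing(2)[OF ds(2)] unfolding m e by simp
  qed (use assms(1,2) l e ds in auto)
  then show ?thesis by simp
qed

lemma sim_exchange:
  assumes "\<not> (classical p \<and> classical q)" "height p + outs p \<le> height q"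
    and ds: "act p ds = Some es" "act q es = Some fs"
  shows "sim ds [p, q] [at_height (height q - outs p + ins p) q, p]"
proof -
  consider c i where "p = Cross c i" "c \<noteq> Virtual" "\<not> classical q"
    | c i where "q = Cross c i" "c \<noteq> Virtual" "\<not> classical p"
    | "\<not> classical p" "\<not> classical q"
    using assms(1) by (metis classical.elims(2))
  then show ?thesis
  proof cases
    case (1 c i)
    then show ?thesis
      using sim_exchange_classical_lower[OF 1(2,3), of i ds es fs] assms(2) ds by (simp add: at_height_self)
  next
    case (2 c i)
    then show ?thesis
      using sim_exchange_classical_upper[OF 2(2,3), of i ds es fs] assms(2) ds by simp
  next
    case 3
    then show ?thesis using sim_exchange_flat assms(2) ds by blast
  qed
qed

text \<open>These are the second smoothings of the two sides of \<open>slide_open\<close> when the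
  upper new strand has the direction of the old one: vertical on the left, horizontal on the right.
  The first cusp is pushed around the left extremum, after which the extremum and the closing cancel
  as a zigzag.\<close>

lemma sim_cusp_slide_cap:
  assumes "i < length ds" "ds ! i = opp d"
  shows "sim ds [Open i d, Cusp (Suc i) Above, Close (Suc i), Open (Suc i) d, Cusp (Suc i) Above]
    [Open (Suc i) d, Cusp i Below, Cusp (Suc i) Above]" (is "sim ds ?l ?r")
proof -
  let ?w = "[Open (Suc i) d, Cusp (Suc i) Above]"
  obtain us zs where ds: "ds = us @ opp d # zs" "length us = i"
    using assms by (metis id_take_nth_drop length_take min.absorb4)
  have "sim ds ([] @ [Open i d, Cusp (Suc i) Above] @ (Close (Suc i) # ?w))
      ([] @ [Open i (opp d), Cusp i Below] @ (Close (Suc i) # ?w))"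
    by (rule sim_context[OF sim_cusp_open(1)]) (auto simp: ds nth_append list_update_append)
  moreover have "sim ds ([Open i (opp d)] @ [Cusp i Below, Close (Suc i)] @ ?w)
      ([Open i (opp d)] @ [Close (Suc i), Cusp i Below] @ ?w)"
  proof (rule sim_context)
    show "sim (us @ opp d # d # opp d # zs) [Cusp i Below, Close (Suc i)] [Close (Suc i), Cusp i Below]"
      using sim_exchange[of "Cusp i Below" "Close (Suc i)" "us @ opp d # d # opp d # zs"]
      by (auto simp: ds(2)[symmetric] nth_append list_update_append)
  qed (auto simp: ds nth_append list_update_append)
  moreover have "sim ds ([] @ [Open i (opp d), Close (Suc i)] @ (Cusp i Below # ?w))
      ([] @ [] @ (Cusp i Below # ?w))"
    by (rule sim_context[OF sim_zigzag1]) (auto simp: ds nth_append list_update_append)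
  moreover have "sim ds ([] @ [Cusp i Below, Open (Suc i) d] @ [Cusp (Suc i) Above])
      ([] @ [Open (Suc i) d, Cusp i Below] @ [Cusp (Suc i) Above])"
  proof (rule sim_context)
    show "sim ds [Cusp i Below, Open (Suc i) d] [Open (Suc i) d, Cusp i Below]"
      using sim_exchange[of "Cusp i Below" "Open (Suc i) d" ds]
      by (auto simp: ds nth_append list_update_append)
  qed (auto simp: ds nth_append list_update_append)
  ultimately show ?thesis by (auto dest: sim_trans)
qed

text \<open>The complementary case of \<open>slide_open\<close>, with horizontal and vertical
  exchanged. Both sides are brought to a cusp followed by a left extremum with a cusp on its lower
  strand.\<close>

lemma sim_cusp_slide_cup:
  assumes "i < length ds" "ds ! i = d"
  shows "sim ds [Open i d, Cusp (Suc i) Below, Cusp (Suc (Suc i)) Above]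
    [Open (Suc i) d, Cusp i Above, Close i, Open i (opp d), Cusp i Above]" (is "sim ds ?l ?r")
proof -
  let ?w = "[Open i (opp d), Cusp i Above]"
  obtain us zs where ds: "ds = us @ d # zs" "length us = i"
    using assms by (metis id_take_nth_drop length_take min.absorb4)
  have "sim ds ([] @ [Cusp i Above, Open (Suc i) d] @ (Close i # ?w))
      ([] @ [Open (Suc i) d, Cusp i Above] @ (Close i # ?w))"
  proof (rule sim_context)
    show "sim ds [Cusp i Above, Open (Suc i) d] [Open (Suc i) d, Cusp i Above]"
      using sim_exchange[of "Cusp i Above" "Open (Suc i) d" ds]
      by (auto simp: ds nth_append list_update_append)
  qed (auto simp: ds nth_append list_update_append)
  then have 1: "sim ds (Cusp i Above # Open (Suc i) d # Close i # ?w) ?r" by simp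
  have "sim ds ([Cusp i Above] @ [Open (Suc i) d, Close i] @ ?w) ([Cusp i Above] @ [] @ ?w)"
  proof (rule sim_context)
    show "sim (us @ opp d # zs) [Open (Suc i) d, Close i] []"
      by (rule sim_zigzag2) (auto simp: ds(2)[symmetric] nth_append)
  qed (auto simp: ds nth_append list_update_append)
  then have 2: "sim ds (Cusp i Above # ?w) (Cusp i Above # Open (Suc i) d # Close i # ?w)"
    by (simp add: sim_sym)
  have "sim ds ([] @ [Open i (opp d), Cusp (Suc (Suc i)) Above] @ [Cusp i Above])
     ([] @ [Cusp i Above, Open i (opp d)] @ [Cusp i Above])"
  proof (rule sim_context)
    show "sim ds [Open i (opp d), Cusp (Suc (Suc i)) Above] [Cusp i Above, Open i (opp d)]"
      using sim_exchange[of "Open i (opp d)" "Cusp (Suc (Suc i)) Above" ds]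
      by (auto simp: ds nth_append list_update_append)
  qed (auto simp: ds nth_append list_update_append)
  moreover have "sim ds ([Open i (opp d)] @ [Cusp i Above, Cusp (Suc (Suc i)) Above] @ [])
     ([Open i (opp d)] @ [Cusp (Suc (Suc i)) Above, Cusp i Above] @ [])"
  proof (rule sim_context)
    show "sim (us @ opp d # d # d # zs) [Cusp i Above, Cusp (Suc (Suc i)) Above] [Cusp (Suc (Suc i)) Above, Cusp i Above]"
      using sim_exchange[of "Cusp i Above" "Cusp (Suc (Suc i)) Above" "us @ opp d # d # d # zs"]
      by (auto simp: ds(2)[symmetric] nth_append list_update_append)
  qed (auto simp: ds nth_append list_update_append)
  moreover have "sim ds ([] @ [Open i d, Cusp (Suc i) Below] @ [Cusp (Suc (Suc i)) Above])
     ([] @ [Open i (opp d), Cusp i Above] @ [Cusp (Suc (Suc i)) Above])"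
    by (rule sim_context[OF sim_cusp_open(2)]) (auto simp: ds nth_append list_update_append)
  ultimately have "sim ds ?l (Cusp i Above # ?w)" by (auto dest: sim_trans)
  then show ?thesis using 1 2 by (blast intro: sim_trans)
qed

lemma sign_flip: "sign c (opp d) e = sign (flip c) e d"
  by (cases c; cases d; cases e; simp)

text \<open>The slide turns the strand of the arc from the rising into the falling strand of the
  crossing, and \<open>flip\<close> keeps it above or below the other one. In the first smoothing
  the sides differ by a zigzag or not at all up to that; the second one is settled by pushing
  cusps.\<close>

lemma sim_slide_open:
  assumes "i < length ds"
  shows "sim ds [Open i d, Cross c (Suc i)] [Open (Suc i) d, Cross (flip c) i]"
proof (cases "c = Virtual")
  case True
  then show ?thesis using sim_slide_open_virtual assms by simp
next
  case False
  obtain us e zs where ds: "ds = us @ e # zs" "length us = i"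
    using assms by (metis id_take_nth_drop length_take min.absorb4)
  have e: "ds ! i = e" using ds by (simp add: nth_append)
  have f: "flip c \<noteq> Virtual" using False by (cases c) auto
  have "sim ds ([Open i d] @ [Cross c (Suc i)] @ []) ([Open (Suc i) d] @ [Cross (flip c) i] @ [])"
  proof (rule sim_expand[of _ _ _ _ ds "us @ d # opp d # e # zs" "us @ e # d # opp d # zs"])
    have z: "sim ds ([] @ [Open (Suc i) d, Close i] @ [Open i d]) ([] @ [] @ [Open i d])" if "e = opp d"
      by (rule sim_context[OF sim_zigzag2]) (use ds that in \<open>auto simp: nth_append\<close>)
    have z': "sim ds ([] @ [Open i d, Close (Suc i)] @ [Open (Suc i) d]) ([] @ [] @ [Open (Suc i) d])" if "e = d"
      by (rule sim_context[OF sim_zigzag1]) (use ds that in \<open>auto simp: nth_append\<close>)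
    show "sim ds ([Open i d] @ smoothing1 (Suc i) ((us @ d # opp d # e # zs) ! Suc i)
        ((us @ d # opp d # e # zs) ! Suc (Suc i)) @ [])
      ([Open (Suc i) d] @ smoothing1 i ((us @ e # d # opp d # zs) ! i)
        ((us @ e # d # opp d # zs) ! Suc i) @ [])"
      using z[THEN sim_sym] z' ds(2)
      by (cases "e = d") (auto simp: nth_append smoothing1_def neq_opp_iff)
    show "sim ds ([Open i d] @ smoothing2 (Suc i) ((us @ d # opp d # e # zs) ! Suc i)
        ((us @ d # opp d # e # zs) ! Suc (Suc i)) @ [])
      ([Open (Suc i) d] @ smoothing2 i ((us @ e # d # opp d # zs) ! i)
        ((us @ e # d # opp d # zs) ! Suc i) @ [])"
      using sim_cusp_slide_cap[OF assms] sim_cusp_slide_cup[OF assms] e ds(2)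
      by (cases "e = d") (auto simp: nth_append smoothing2_def neq_opp_iff)
  qed (use ds False f in \<open>auto simp: nth_append sign_flip\<close>)
  then show ?thesis by simp
qed

text \<open>The two virtual crossings carry the third strand past either smoothing, since virtual
  crossings only permute the positions of the names.\<close>

lemma sim_r3_mixed:
  assumes "Suc (Suc i) < length ds"
  shows "sim ds [Cross c i, Cross Virtual (Suc i), Cross Virtual i]
     [Cross Virtual (Suc i), Cross Virtual i, Cross c (Suc i)]"
proof (cases "c = Virtual")
  case True
  then show ?thesis using sim_r3_virtual[OF assms] by simp
next
  case False
  obtain us d d' e zs where ds: "ds = us @ d # d' # e # zs" "length us = i"
    by (rule split_at3[OF assms])
  have dn: "ds ! i = d" "ds ! Suc i = d'" "(us @ e # d # d' # zs) ! Suc i = d"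
    "(us @ e # d # d' # zs) ! Suc (Suc i) = d'"
    unfolding ds(1) ds(2)[symmetric] by (simp_all add: nth_append)
  have "sim ds ([] @ [Cross c i] @ [Cross Virtual (Suc i), Cross Virtual i])
     ([Cross Virtual (Suc i), Cross Virtual i] @ [Cross c (Suc i)] @ [])"
  proof (rule sim_expand[of _ _ _ _ ds ds "us @ e # d # d' # zs"])
    show "sim ds ([] @ smoothing1 i (ds ! i) (ds ! Suc i) @ [Cross Virtual (Suc i), Cross Virtual i])
     ([Cross Virtual (Suc i), Cross Virtual i] @ smoothing1 (Suc i)
        ((us @ e # d # d' # zs) ! Suc i) ((us @ e # d # d' # zs) ! Suc (Suc i)) @ [])"
      unfolding dn
    proof (rule sim_names[where i = i and k = 3])
      fix us P zs :: "nat list" and D A g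
      assume "length us = i" "length P = 3"
      then obtain x y w where P: "P = [x, y, w]" and i: "i = length us"
        by (auto simp: numeral_3_eq_3 length_Suc_conv)
      show "facs ([] @ smoothing1 i d d' @ [Cross Virtual (Suc i), Cross Virtual i]) (us @ P @ zs, D, A, g) =
          facs ([Cross Virtual (Suc i), Cross Virtual i] @ smoothing1 (Suc i) d d' @ []) (us @ P @ zs, D, A, g) \<and>
          rn (stps ([] @ smoothing1 i d d' @ [Cross Virtual (Suc i), Cross Virtual i]) (us @ P @ zs, D, A, g))
           (stps ([Cross Virtual (Suc i), Cross Virtual i] @ smoothing1 (Suc i) d d' @ []) (us @ P @ zs, D, A, g))"
        unfolding P i by (cases "d = d'") (simp_all add: smoothing1_def)
    next
      show "run ([] @ smoothing1 i d d' @ [Cross Virtual (Suc i), Cross Virtual i]) ds \<noteq> None \<and>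
        run ([Cross Virtual (Suc i), Cross Virtual i] @ smoothing1 (Suc i) d d' @ []) ds =
        run ([] @ smoothing1 i d d' @ [Cross Virtual (Suc i), Cross Virtual i]) ds"
        unfolding ds(1) ds(2)[symmetric]
        by (cases "d = d'") (simp_all add: smoothing1_def nth_append list_update_append neq_opp_iff)
    qed (use assms in \<open>simp_all add: smoothing1_def\<close>)
    show "sim ds ([] @ smoothing2 i (ds ! i) (ds ! Suc i) @ [Cross Virtual (Suc i), Cross Virtual i])
     ([Cross Virtual (Suc i), Cross Virtual i] @ smoothing2 (Suc i)
        ((us @ e # d # d' # zs) ! Suc i) ((us @ e # d # d' # zs) ! Suc (Suc i)) @ [])"
      unfolding dn
    proof (rule sim_names[where i = i and k = 3])
      fix us P zs :: "nat list" and D A g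
      assume "length us = i" "length P = 3"
      then obtain x y w where P: "P = [x, y, w]" and i: "i = length us"
        by (auto simp: numeral_3_eq_3 length_Suc_conv)
      show "facs ([] @ smoothing2 i d d' @ [Cross Virtual (Suc i), Cross Virtual i]) (us @ P @ zs, D, A, g) =
          facs ([Cross Virtual (Suc i), Cross Virtual i] @ smoothing2 (Suc i) d d' @ []) (us @ P @ zs, D, A, g) \<and>
          rn (stps ([] @ smoothing2 i d d' @ [Cross Virtual (Suc i), Cross Virtual i]) (us @ P @ zs, D, A, g))
           (stps ([Cross Virtual (Suc i), Cross Virtual i] @ smoothing2 (Suc i) d d' @ []) (us @ P @ zs, D, A, g))"
        unfolding P i by (cases "d = d'") (simp_all add: smoothing2_def)
    next
      show "run ([] @ smoothing2 i d d' @ [Cross Virtual (Suc i), Cross Virtual i]) ds \<noteq> None \<and>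
        run ([Cross Virtual (Suc i), Cross Virtual i] @ smoothing2 (Suc i) d d' @ []) ds =
        run ([] @ smoothing2 i d d' @ [Cross Virtual (Suc i), Cross Virtual i]) ds"
        unfolding ds(1) ds(2)[symmetric]
        by (cases "d = d'") (simp_all add: smoothing2_def nth_append list_update_append neq_opp_iff)
    qed (use assms in \<open>simp_all add: smoothing2_def\<close>)
  qed (use ds False in \<open>auto simp: nth_append list_update_append\<close>)
  then show ?thesis by simp
qed

section \<open>Moves preserving the crossings\<close>

text \<open>Every move keeps the classical crossings with their signs and their order, so its two
  sides can be compared term by term in the expansion. The relation is a part of
  \<open>local_move\<close>.\<close>

inductive gmove :: "piece list \<Rightarrow> piece list \<Rightarrow> bool" where
  exchange: "\<lbrakk>\<not> (classical p \<and> classical q); height p + outs p \<le> height q\<rbrakk> \<Longrightarrow>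
     gmove [p, q] [at_height (height q - outs p + ins p) q, p]"
| zigzag: "gmove [Open (Suc i) d, Close i] []"
| slide_open: "gmove [Open i d, Cross c (Suc i)] [Open (Suc i) d, Cross (flip c) i]"
| slide_close: "gmove [Cross Virtual (Suc i), Close i] [Cross Virtual i, Close (Suc i)]"
| r1_open: "gmove [Open i d, Cross Virtual i] [Open i (opp d)]"
| r1_close: "gmove [Cross Virtual i, Close i] [Close i]"
| r2: "gmove [Cross Virtual i, Cross Virtual i] []"
| r3: "gmove [Cross c i, Cross Virtual (Suc i), Cross Virtual i]
     [Cross Virtual (Suc i), Cross Virtual i, Cross c (Suc i)]"

lemma gmove_local_move: "gmove l r \<Longrightarrow> local_move l r"
proof (induction rule: gmove.induct)
  case (exchange p q)
  then show ?case by (intro local_move.exchange)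
next
  case (slide_close i)
  then show ?case using local_move.slide_close[of Virtual i] by simp
next
  case (r2 i)
  then show ?case using local_move.r2[of Virtual i] by simp
next
  case (r3 c i)
  then show ?case using local_move.r3_mixed[of Virtual Virtual c i] by simp
qed (auto intro: local_move.intros)

lemma run_pair: "run [p, q] ds \<noteq> None \<Longrightarrow> \<exists>es fs. act p ds = Some es \<and> act q es = Some fs"
  by (auto simp: bind_eq_Some_conv)

lemma gmove_sim: "gmove l r \<Longrightarrow> run l ds \<noteq> None \<Longrightarrow> sim ds l r"
proof (induction rule: gmove.induct)
  case (exchange p q)
  then obtain es fs where "act p ds = Some es" "act q es = Some fs"
    using run_pair by blast
  then show ?case using sim_exchange exchange.hyps by blast
next
  case (zigzag i d)
  then show ?case
    by (intro sim_zigzag2) (auto simp: nth_append neq_opp_iff split: if_splits)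
next
  case (slide_open i d c)
  then show ?case by (intro sim_slide_open) (auto split: if_splits)
next
  case (slide_close i)
  then show ?case by (intro sim_slide_close_virtual) (auto split: if_splits)
next
  case (r1_open i d)
  then show ?case by (intro sim_r1_open_virtual) (auto split: if_splits)
next
  case (r1_close i)
  then show ?case by (intro sim_r1_close_virtual) (auto split: if_splits)
next
  case (r2 i)
  then show ?case by (intro sim_r2_virtual) (auto split: if_splits)
next
  case (r3 c i)
  then show ?case by (intro sim_r3_mixed) (auto split: if_splits)
qed

lemma gmove_run: "gmove l r \<Longrightarrow> run l ds \<noteq> None \<Longrightarrow> run r ds = run l ds"
  using gmove_sim unfolding sim_def by metis

definition gstep :: "dir list \<Rightarrow> piece list \<Rightarrow> piece list \<Rightarrow> bool" where
  "gstep ds l r \<longleftrightarrow> run l ds \<noteq> None \<and> (\<exists>u v l' r'. l = u @ l' @ v \<and> r = u @ r' @ v \<and> gmove l' r')"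

text \<open>One chain of moves serves two purposes: it preserves the state sum by
  \<open>teq_sim\<close>, and it is an equivalence of link diagrams by
  \<open>teq_link\<close>.\<close>

definition teq :: "dir list \<Rightarrow> piece list \<Rightarrow> piece list \<Rightarrow> bool" where
  "teq ds l r \<longleftrightarrow> run l ds \<noteq> None \<and> equivclp (gstep ds) l r"

lemma gstep_sim: "gstep ds l r \<Longrightarrow> sim ds l r"
proof -
  assume "gstep ds l r"
  then obtain u v l' r' where *: "run l ds \<noteq> None" "l = u @ l' @ v" "r = u @ r' @ v" "gmove l' r'"
    unfolding gstep_def by blast
  then obtain es where es: "run u ds = Some es" "run (l' @ v) es \<noteq> None"
    by (cases "run u ds") (auto simp: run_append)
  then have "run l' es \<noteq> None" by (cases "run l' es") (auto simp: run_append)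
  then show ?thesis using sim_context[OF gmove_sim[OF *(4)] es(1)] * by simp
qed

lemma equivclp_sim:
  assumes "equivclp (gstep ds) l r" "run l ds \<noteq> None"
  shows "sim ds l r"
  using assms(1)
proof (induction rule: equivclp_induct)
  case base
  then show ?case using assms(2) by (rule sim_refl)
next
  case (step y x)
  then show ?case using gstep_sim sim_sym sim_trans by metis
qed

lemma teq_sim: "teq ds l r \<Longrightarrow> sim ds l r"
  unfolding teq_def using equivclp_sim by blast

lemma teq_run: "teq ds l r \<Longrightarrow> run r ds = run l ds"
  using teq_sim unfolding sim_def by blast

lemma teq_refl: "run l ds \<noteq> None \<Longrightarrow> teq ds l l"
  by (simp add: teq_def)

lemma teq_sym: "teq ds l r \<Longrightarrow> teq ds r l"
  using teq_run unfolding teq_def by (metis equivclp_sym)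

lemma teq_trans [trans]: "teq ds l r \<Longrightarrow> teq ds r t \<Longrightarrow> teq ds l t"
  unfolding teq_def by (metis equivclp_trans)

lemma teq_gmove: "gmove l r \<Longrightarrow> run l ds \<noteq> None \<Longrightarrow> teq ds l r"
proof -
  assume *: "gmove l r" "run l ds \<noteq> None"
  have "gstep ds l r"
    unfolding gstep_def using * by (metis append_Nil append_Nil2)
  then show ?thesis using *(2) unfolding teq_def by blast
qed

lemma teq_context:
  assumes "teq es l r" "run u ds = Some es" "run (u @ l @ v) ds \<noteq> None"
  shows "teq ds (u @ l @ v) (u @ r @ v)"
proof -
  have *: "gstep ds (u @ l @ v) (u @ r @ v)" if "gstep es l r" "run (u @ l @ v) ds \<noteq> None" for l r
  proof -
    obtain a b l' r' where "l = a @ l' @ b" "r = a @ r' @ b" "gmove l' r'"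
      using \<open>gstep es l r\<close> unfolding gstep_def by blast
    then show ?thesis unfolding gstep_def using that(2)
      by (metis append_assoc)
  qed
  have "equivclp (gstep es) l r" using assms(1) unfolding teq_def by blast
  then have "equivclp (gstep ds) (u @ l @ v) (u @ r @ v) \<and> run (u @ r @ v) ds \<noteq> None"
  proof (induction rule: equivclp_induct)
    case base
    then show ?case using assms(3) by simp
  next
    case (step y x)
    have r: "run (u @ y @ v) ds = run (u @ x @ v) ds"
      using step.hyps(2) gstep_sim[of es y x] gstep_sim[of es x y] assms(2)
      unfolding sim_def by (auto simp: run_append)
    have "gstep ds (u @ y @ v) (u @ x @ v) \<or> gstep ds (u @ x @ v) (u @ y @ v)"
      using step.hyps(2) * step.IH r by metis
    then show ?case using step.IH r
      by (metis equivclp_into_equivclp)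
  qed
  then show ?thesis using assms(3) unfolding teq_def by blast
qed

definition cusp_free :: "piece list \<Rightarrow> bool" where
  "cusp_free w \<longleftrightarrow> (\<forall>i s. Cusp i s \<notin> set w)"

lemma gmove_cusp_free: "gmove l r \<Longrightarrow> cusp_free l \<longleftrightarrow> cusp_free r"
proof (induction rule: gmove.induct)
  case (exchange p q)
  then show ?case by (cases q) (auto simp: cusp_free_def)
qed (auto simp: cusp_free_def)

text \<open>Link diagrams are nonempty, so a move must not delete a whole diagram. A move with empty
  result acts on strands that come from the left, and there are none at the beginning.\<close>

lemma gmove_Nil: "gmove l [] \<Longrightarrow> run l [] = None"
  by (induction l "[] :: piece list" rule: gmove.induct) auto

lemma gstep_link:
  assumes "gstep [] l r"
  shows "link_diagram l \<longleftrightarrow> link_diagram r"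
    and "link_diagram l \<Longrightarrow> diagram_move l r"
proof -
  obtain u v l' r' where *: "run l [] \<noteq> None" "l = u @ l' @ v" "r = u @ r' @ v" "gmove l' r'"
    using assms unfolding gstep_def by blast
  have "l' \<noteq> []" using *(4) by (auto elim: gmove.cases)
  moreover have "r \<noteq> []" using * gmove_Nil by auto
  moreover have r: "run r [] = run l []" using gstep_sim[OF assms] unfolding sim_def by metis
  moreover have "cusp_free l \<longleftrightarrow> cusp_free r"
    using gmove_cusp_free[OF *(4)] * by (auto simp: cusp_free_def)
  ultimately show iff: "link_diagram l \<longleftrightarrow> link_diagram r"
    using *(2) unfolding link_diagram_def arrow_diagram_def cusp_free_def by auto
  obtain es where es: "run u [] = Some es" "run (l' @ v) es \<noteq> None"
    using * by (cases "run u []") (auto simp: run_append)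
  then obtain fs where fs: "run l' es = Some fs" by (cases "run l' es") (auto simp: run_append)
  then have fs': "run r' es = Some fs" using gmove_run[OF *(4), of es] by simp
  show "diagram_move l r" if "link_diagram l"
    using diagram_move.intros[OF gmove_local_move[OF *(4)] es(1) fs fs', of v] that iff * by simp
qed

lemma teq_link:
  assumes "teq [] l r" "link_diagram l"
  shows "(l, r) \<in> link_rel"
proof -
  have "equivclp (gstep []) l r" using assms(1) unfolding teq_def by blast
  then have "link_diagram r \<and> equivclp diagram_move l r"
  proof (induction rule: equivclp_induct)
    case base
    then show ?case using assms(2) by simp
  next
    case (step y x)
    then show ?case using gstep_link by (metis equivclp_into_equivclp)
  qed
  then show ?thesis using assms(2) unfolding link_rel_def by simp
qed

lemma act_exchange_rev:
  assumes "height p + outs p \<le> height q" 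
    and "act (at_height (height q - outs p + ins p) q) ds = Some es" "act p es = Some fs"
  shows "\<exists>es'. act p ds = Some es' \<and> act q es' = Some fs"
proof -
  let ?q = "at_height (height q - outs p + ins p) q"
  have "height p + ins p \<le> length ds" "height q + ins q + ins p \<le> length ds + outs p"
    using act_length[OF assms(2)] act_length[OF assms(3)] assms(1) unfolding at_height_simps by arith+
  then obtain us P ms Q zs where ds: "ds = us @ P @ ms @ Q @ zs"
    and l: "length us = height p" "length P = ins p" "length Q = ins q"
      "height q = height p + outs p + length ms"
    by (rule two_pieces[OF assms(1)])
  have hh: "at_height 0 (at_height k q) = at_height 0 q" for k by (cases q) auto
  have "act ?q ((us @ P @ ms) @ Q @ zs) = map_option (\<lambda>S. (us @ P @ ms) @ S @ zs) (act (at_height 0 ?q) Q)"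
    by (rule act_at) (use l in auto)
  then obtain S where S: "act (at_height 0 q) Q = Some S" "es = us @ P @ ms @ S @ zs"
    using assms(2) unfolding ds hh by (cases "act (at_height 0 q) Q") auto
  obtain R where R: "act (at_height 0 p) P = Some R" "fs = us @ R @ ms @ S @ zs"
    using assms(3) act_at[OF l(1,2)] unfolding S(2) by (cases "act (at_height 0 p) P") auto
  have lR: "length R = outs p"
    using act_length[OF R(1)] l(2) by simp
  have "act p ds = Some (us @ R @ ms @ Q @ zs)"
    using act_at[OF l(1,2)] R(1) unfolding ds by simp
  moreover have "act q ((us @ R @ ms) @ Q @ zs) = map_option (\<lambda>S. (us @ R @ ms) @ S @ zs) (act (at_height 0 q) Q)"
    by (rule act_at) (use lR l in auto)
  ultimately show ?thesis using S(1) R(2) by simp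
qed

lemma teq_exchange:
  assumes "\<not> (classical p \<and> classical q)" "height p + outs p \<le> height q" "run [p, q] ds \<noteq> None"
  shows "teq ds [p, q] [at_height (height q - outs p + ins p) q, p]"
  by (rule teq_gmove[OF gmove.exchange]) (use assms in auto)

lemma teq_exchange_rev:
  assumes "\<not> (classical p \<and> classical q)" "height p + outs p \<le> height q"
    "run [at_height (height q - outs p + ins p) q, p] ds \<noteq> None"
  shows "teq ds [at_height (height q - outs p + ins p) q, p] [p, q]"
proof -
  obtain es fs where "act (at_height (height q - outs p + ins p) q) ds = Some es" "act p es = Some fs"
    using run_pair[OF assms(3)] by blast
  then obtain es' where "act p ds = Some es'" "act q es' = Some fs"
    using act_exchange_rev[OF assms(2)] by blast
  then have "run [p, q] ds \<noteq> None" by simp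
  then show ?thesis using teq_exchange[OF assms(1,2)] teq_sym by blast
qed

fun below :: "nat \<Rightarrow> piece list \<Rightarrow> nat option" where
  "below h [] = Some h"
| "below h (p # ps) = (if height p + ins p \<le> h then below (h - ins p + outs p) ps else None)"

lemma teq_pass_upper:
  assumes "below h ps = Some h'" "\<not> classical q \<or> filter classical ps = []"
    and "run (ps @ [at_height h' q]) ds \<noteq> None"
  shows "teq ds (ps @ [at_height h' q]) (at_height h q # ps)"
  using assms
proof (induction ps arbitrary: h ds)
  case Nil
  then show ?case by (auto intro!: teq_refl)
next
  case (Cons p ps)
  let ?h = "h - ins p + outs p"
  have p: "height p + ins p \<le> h" "below ?h ps = Some h'"
    using Cons.prems(1) by (auto split: if_splits)
  have c: "\<not> (classical p \<and> classical q)" "\<not> classical q \<or> filter classical ps = []"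
    using Cons.prems(2) by (auto split: if_splits)
  obtain es where es: "act p ds = Some es" "run (ps @ [at_height h' q]) es \<noteq> None"
    using Cons.prems(3) by (cases "act p ds") auto
  have IH: "teq es (ps @ [at_height h' q]) (at_height ?h q # ps)"
    by (rule Cons.IH[OF p(2) c(2) es(2)])
  then have r: "run (at_height ?h q # ps) es \<noteq> None"
    using es(2) teq_run by metis
  then obtain fs where fs: "act (at_height ?h q) es = Some fs" "run ps fs \<noteq> None"
    by (cases "act (at_height ?h q) es") auto
  have "teq ds ([p] @ (ps @ [at_height h' q]) @ []) ([p] @ (at_height ?h q # ps) @ [])"
    by (rule teq_context[OF IH]) (use es in auto)
  moreover have "teq ds ([] @ [p, at_height ?h q] @ ps) ([] @ [at_height h q, p] @ ps)"
  proof (rule teq_context)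
    show "teq ds [p, at_height ?h q] [at_height h q, p]"
      using teq_exchange[of p "at_height ?h q" ds] p c es fs by simp
  qed (use es fs in auto)
  ultimately show ?case by (simp add: teq_trans)
qed

section \<open>Virtual words\<close>

abbreviation vw :: "nat list \<Rightarrow> piece list" where
  "vw is \<equiv> map (Cross Virtual) is"

definition valid :: "nat \<Rightarrow> nat list \<Rightarrow> bool" where
  "valid N v \<longleftrightarrow> (\<forall>j\<in>set v. Suc j < N)"

lemma valid_simps [simp]:
  "valid N []" "valid N (j # v) \<longleftrightarrow> Suc j < N \<and> valid N v" "valid N (u @ v) \<longleftrightarrow> valid N u \<and> valid N v"
  "valid N (rev v) \<longleftrightarrow> valid N v"
  by (auto simp: valid_def)

fun vrun :: "nat list \<Rightarrow> dir list \<Rightarrow> dir list" where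
  "vrun [] ds = ds"
| "vrun (j # v) ds = vrun v (ds[j := ds ! Suc j, Suc j := ds ! j])"

lemma length_vrun [simp]: "length (vrun v ds) = length ds"
  by (induction v arbitrary: ds) auto

lemma vrun_append [simp]: "vrun (u @ v) ds = vrun v (vrun u ds)"
  by (induction u arbitrary: ds) auto

lemma run_vw: "valid (length ds) v \<Longrightarrow> run (vw v) ds = Some (vrun v ds)"
  by (induction v arbitrary: ds) auto

lemma teq_step:
  assumes "teq ds w (u @ l @ v)" "run u ds = Some es" "teq es l r"
  shows "teq ds w (u @ r @ v)"
proof -
  have "run (u @ l @ v) ds \<noteq> None" using assms(1) teq_run teq_def by metis
  then show ?thesis using teq_context[OF assms(3,2)] assms(1) teq_trans by blast
qed

text \<open>The relations \<open>veq_r2\<close>, \<open>veq_comm\<close> and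
  \<open>veq_braid\<close> are the Coxeter relations, so virtual words can be treated as elements of
  the symmetric group.\<close>

definition veq :: "nat \<Rightarrow> nat list \<Rightarrow> nat list \<Rightarrow> bool" where
  "veq N v w \<longleftrightarrow> valid N v \<and> valid N w \<and> (\<forall>ds. length ds = N \<longrightarrow> teq ds (vw v) (vw w))"

lemma veq_refl: "valid N v \<Longrightarrow> veq N v v"
  by (auto simp: veq_def run_vw intro!: teq_refl)

lemma veq_sym: "veq N v w \<Longrightarrow> veq N w v"
  using teq_sym by (auto simp: veq_def)

lemma veq_trans [trans]: "veq N v w \<Longrightarrow> veq N w x \<Longrightarrow> veq N v x"
  using teq_trans by (auto simp: veq_def)

lemma veq_context:
  assumes "veq N v w" "valid N u" "valid N t"
  shows "veq N (u @ v @ t) (u @ w @ t)"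
  unfolding veq_def
proof (intro conjI allI impI)
  fix ds :: "dir list" assume "length ds = N"
  then have "teq ds (vw u @ vw v @ vw t) (vw u @ vw w @ vw t)"
    using assms unfolding veq_def
    by (intro teq_context[of "vrun u ds"]) (auto simp: run_vw run_append)
  then show "teq ds (vw (u @ v @ t)) (vw (u @ w @ t))" by simp
qed (use assms in \<open>auto simp: veq_def\<close>)

lemma veq_vrun: "veq N v w \<Longrightarrow> length ds = N \<Longrightarrow> vrun w ds = vrun v ds"
  using teq_run[of ds "vw v" "vw w"] by (auto simp: veq_def run_vw)

lemma teq_r2: "Suc j < length ds \<Longrightarrow> teq ds [Cross Virtual j, Cross Virtual j] []"
  by (rule teq_gmove[OF gmove.r2]) auto

lemma veq_r2: "Suc j < N \<Longrightarrow> veq N [j, j] []"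
  by (auto simp: veq_def intro: teq_r2)

lemma veq_comm:
  assumes "Suc i < N" "Suc j < N" "i + 2 \<le> j \<or> j + 2 \<le> i"
  shows "veq N [i, j] [j, i]"
proof -
  have "veq N [i, j] [j, i]" if "Suc i < N" "Suc j < N" "i + 2 \<le> j" for i j
  proof -
    have "Suc (Suc (j - 2)) = j" using that by simp
    then show ?thesis
      using teq_exchange[of "Cross Virtual i" "Cross Virtual j"] that by (auto simp: veq_def)
  qed
  then show ?thesis using assms veq_sym by blast
qed

lemma veq_braid: "Suc (Suc j) < N \<Longrightarrow> veq N [j, Suc j, j] [Suc j, j, Suc j]"
  unfolding veq_def by (auto intro!: teq_gmove[OF gmove.r3])

lemma veq_comm_list:
  assumes "Suc j < N" "valid N v" "\<forall>i\<in>set v. i + 2 \<le> j \<or> j + 2 \<le> i"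
  shows "veq N (j # v) (v @ [j])"
  using assms(2,3)
proof (induction v)
  case Nil
  then show ?case using assms(1) by (auto intro: veq_refl)
next
  case (Cons i v)
  have "veq N ([] @ [j, i] @ v) ([] @ [i, j] @ v)"
    by (rule veq_context[OF veq_comm]) (use assms(1) Cons.prems in auto)
  moreover have "veq N ([i] @ (j # v) @ []) ([i] @ (v @ [j]) @ [])"
    by (rule veq_context[OF Cons.IH]) (use assms(1) Cons.prems in auto)
  ultimately show ?case by (auto intro: veq_trans)
qed

lemma veq_rev: "valid N v \<Longrightarrow> veq N (rev v @ v) []"
proof (induction v)
  case Nil
  then show ?case by (auto intro: veq_refl)
next
  case (Cons j v)
  have "veq N (rev v @ [j, j] @ v) (rev v @ [] @ v)"
    by (rule veq_context[OF veq_r2]) (use Cons.prems in auto)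
  then show ?case using Cons veq_trans by auto
qed

definition down :: "nat \<Rightarrow> nat \<Rightarrow> nat list" where
  "down h a = rev [h..<a]"

lemma down_simps: "down h h = []" "h \<le> a \<Longrightarrow> down h (Suc a) = a # down h a"
  by (simp_all add: down_def)

lemma set_down [simp]: "set (down h a) = {h..<a}"
  by (simp add: down_def)

lemma down_split: "h \<le> j \<Longrightarrow> Suc j < a \<Longrightarrow> down h a = rev [Suc (Suc j)..<a] @ [Suc j, j] @ down h j"
proof -
  assume "h \<le> j" "Suc j < a"
  then have "[h..<a] = [h..<j] @ [j..<a]" "[j..<a] = j # Suc j # [Suc (Suc j)..<a]"
    using upt_add_eq_append[of h j "a - j"] by (auto simp: upt_conv_Cons)
  then show ?thesis unfolding down_def by simp
qed

text \<open>The coset decomposition of the symmetric group: \<open>down h a\<close> moves the strand \<open>a\<close> to the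
  position \<open>h\<close>, and \<open>r\<close> fixes that position.\<close>
lemma coset:
  assumes "valid N v" "\<forall>j\<in>set v. h \<le> j" "h < N"
  obtains a r where "h \<le> a" "a < N" "\<forall>j\<in>set r. Suc h \<le> j" "veq N v (down h a @ r)"
proof -
  have "\<exists>a r. h \<le> a \<and> a < N \<and> (\<forall>j\<in>set r. Suc h \<le> j) \<and> veq N v (down h a @ r)"
    using assms(1,2)
  proof (induction v)
    case Nil
    have "veq N [] (down h h @ [])" by (simp add: down_simps veq_refl)
    then show ?case using assms(3) by (intro exI[of _ h] exI[of _ "[]"]) auto
  next
    case (Cons j v)
    then obtain a r where a: "h \<le> a" "a < N" and r: "\<forall>j\<in>set r. Suc h \<le> j" and v: "veq N v (down h a @ r)"
      by auto
    have j: "h \<le> j" "Suc j < N" using Cons.prems by auto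
    have vr: "valid N r" using v by (auto simp: veq_def)
    have "veq N ([j] @ v @ []) ([j] @ (down h a @ r) @ [])"
      by (rule veq_context[OF v]) (use j in auto)
    then have jv: "veq N (j # v) (j # down h a @ r)" by simp
    \<comment> \<open>The new letter commutes with the descending run, or lengthens it, or cancels
      its first letter, or passes through it by a braid relation and comes out raised by
      one.\<close>
    consider "j > a" | "j = a" | "Suc j = a" | "Suc j < a" by linarith
    then show ?case
    proof cases
      case 1
      have "veq N ([] @ (j # down h a) @ r) ([] @ (down h a @ [j]) @ r)"
        by (rule veq_context[OF veq_comm_list]) (use 1 j vr a in \<open>auto simp: valid_def\<close>)
      then have "veq N (j # v) (down h a @ (j # r))" using jv veq_trans by auto
      then show ?thesis using a r 1 by (intro exI[of _ a] exI[of _ "j # r"]) auto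
    next
      case 2
      then have "veq N (j # v) (down h (Suc a) @ r)" using jv a by (simp add: down_simps)
      then show ?thesis using a r j 2 by (intro exI[of _ "Suc a"] exI[of _ r]) auto
    next
      case 3
      then have d: "down h a = j # down h j" using j down_simps by auto
      have "veq N ([] @ [j, j] @ (down h j @ r)) ([] @ [] @ (down h j @ r))"
        by (rule veq_context[OF veq_r2]) (use j vr in \<open>auto simp: valid_def\<close>)
      then have "veq N (j # v) (down h j @ r)" using jv d veq_trans by auto
      then show ?thesis using r j by (intro exI[of _ j] exI[of _ r]) auto
    next
      case 4
      let ?u = "rev [Suc (Suc j)..<a]"
      have vu: "valid N ?u" "valid N (down h j)" using a j by (auto simp: valid_def)
      have d: "down h a = ?u @ [Suc j, j] @ down h j" by (rule down_split[OF j(1) 4])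
      have sj: "Suc (Suc j) < N" using 4 a by simp
      have "veq N ([] @ (j # ?u) @ ([Suc j, j] @ down h j @ r)) ([] @ (?u @ [j]) @ ([Suc j, j] @ down h j @ r))"
        by (rule veq_context[OF veq_comm_list]) (use vu sj j vr in auto)
      then have 1: "veq N (j # v) (?u @ [j, Suc j, j] @ down h j @ r)" using jv d veq_trans by auto
      have 2: "veq N (?u @ [j, Suc j, j] @ (down h j @ r)) (?u @ [Suc j, j, Suc j] @ (down h j @ r))"
        by (rule veq_context[OF veq_braid]) (use vu sj j vr in auto)
      have 3: "veq N ((?u @ [Suc j, j]) @ (Suc j # down h j) @ r) ((?u @ [Suc j, j]) @ (down h j @ [Suc j]) @ r)"
        by (rule veq_context[OF veq_comm_list]) (use vu sj j vr in auto)
      have "veq N (j # v) (down h a @ (Suc j # r))"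
        using veq_trans[OF 1 veq_trans[OF 2]] 3 d by simp
      then show ?thesis using a r j by (intro exI[of _ a] exI[of _ "Suc j # r"]) auto
    qed
  qed
  then show ?thesis using that by blast
qed

section \<open>Permutations that preserve the directions\<close>

lemma vrun_const:
  "valid (length ds) v \<Longrightarrow> \<forall>j\<in>set v. ds ! j = ds ! Suc j \<Longrightarrow> vrun v ds = ds"
proof (induction v)
  case (Cons j v)
  have "ds[j := ds ! Suc j, Suc j := ds ! j] = ds"
    using Cons.prems by (simp add: list_update_id) (metis list_update_id)
  then show ?case using Cons by simp
qed simp

lemma vrun_nth_other: "\<forall>j\<in>set v. h < j \<Longrightarrow> vrun v ds ! h = ds ! h"
  by (induction v arbitrary: ds) auto

lemma vrun_down_nth: "h \<le> a \<Longrightarrow> a < length ds \<Longrightarrow> vrun (down h a) ds ! h = ds ! a"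
proof (induction a arbitrary: ds rule: dec_induct)
  case base
  then show ?case by (simp add: down_simps)
next
  case (step a)
  then show ?case by (simp add: down_simps)
qed

text \<open>The strand that arrives at position \<open>h\<close> starts at position
  \<open>a\<close>. As it is directed to the East, \<open>a\<close> is below \<open>n\<close>, so
  the run \<open>down h a\<close> only permutes East strands and the directions stay as they
  are.\<close>

lemma pull_down:
  assumes v: "valid N v" "\<forall>j\<in>set v. h \<le> j" "h < N" and ds: "length ds = N"
    and E: "\<forall>i. h \<le> i \<and> i < n \<longrightarrow> ds ! i = East" "\<forall>i. n \<le> i \<and> i < N \<longrightarrow> ds ! i = West"
    and e: "vrun v ds ! h = East"
  obtains a r where "h \<le> a" "a < n" "\<forall>j\<in>set r. Suc h \<le> j" "veq N v (down h a @ r)"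
    "vrun (down h a) ds = ds" "vrun r ds = vrun v ds"
proof -
  obtain a r where ar: "h \<le> a" "a < N" "\<forall>j\<in>set r. Suc h \<le> j" "veq N v (down h a @ r)"
    using coset[OF v] by blast
  have "vrun v ds = vrun r (vrun (down h a) ds)" using veq_vrun[OF ar(4) ds] by simp
  moreover have "vrun r (vrun (down h a) ds) ! h = ds ! a"
    using vrun_nth_other[of r h] ar vrun_down_nth[of h a ds] ds by (simp add: Suc_le_eq)
  ultimately have "ds ! a = East" using e by simp
  then have a: "a < n" using E(2) ar(2) by (metis dir.distinct(1) not_le)
  have "vrun (down h a) ds = ds"
    by (rule vrun_const) (use a E(1) ar(2) ds in \<open>auto simp: valid_def\<close>)
  then show ?thesis using that[OF ar(1) a ar(3,4)] \<open>vrun v ds = _\<close> by simp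
qed

text \<open>The positions below \<open>n\<close> are filled one after the other by East strands from
  the same block, which contributes to \<open>vb\<close>; what is left when they are all filled
  moves only positions from \<open>n\<close> on.\<close>

lemma split_blocks:
  assumes "valid N v" "\<forall>j\<in>set v. h \<le> j" "h \<le> n" "n \<le> N" "length ds = N"
    and "\<forall>i. h \<le> i \<and> i < n \<longrightarrow> ds ! i = East" "\<forall>i. n \<le> i \<and> i < N \<longrightarrow> ds ! i = West"
    and "vrun v ds = ds"
  shows "\<exists>vb vt. veq N v (vb @ vt) \<and> (\<forall>j\<in>set vb. Suc j < n) \<and> (\<forall>j\<in>set vt. n \<le> j)"
  using assms(3,1,2,6,8)
proof (induction h arbitrary: v rule: inc_induct)
  case base
  then show ?case by (intro exI[of _ "[]"] exI[of _ v]) (auto intro: veq_refl)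
next
  case (step h)
  have "vrun v ds ! h = East" using step by auto
  then obtain a r where ar: "h \<le> a" "a < n" "\<forall>j\<in>set r. Suc h \<le> j" "veq N v (down h a @ r)"
    "vrun (down h a) ds = ds" "vrun r ds = vrun v ds"
    using pull_down[OF step.prems(1,2) _ assms(5) step.prems(3) assms(7)] step.hyps assms(4)
    by (metis less_le_trans)
  have vr: "valid N r" using ar(4) by (auto simp: veq_def)
  then obtain vb vt where b: "veq N r (vb @ vt)" "\<forall>j\<in>set vb. Suc j < n" "\<forall>j\<in>set vt. n \<le> j"
    using step.IH[of r] ar(3,6) step.prems by auto
  have "veq N (down h a @ r @ []) (down h a @ (vb @ vt) @ [])"
    by (rule veq_context[OF b(1)]) (use ar assms(4) in \<open>auto simp: valid_def\<close>)
  then have "veq N v ((down h a @ vb) @ vt)" using ar(4) veq_trans by auto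
  then show ?case using b ar by (intro exI[of _ "down h a @ vb"] exI[of _ vt]) auto
qed

text \<open>In each round the strand above the pair that began at the bottom moves below that pair,
  so the pair rises by one position.\<close>

fun carry :: "nat \<Rightarrow> nat list" where
  "carry 0 = []"
| "carry (Suc j) = carry j @ [Suc j, j]"

lemma valid_carry: "Suc j < N \<Longrightarrow> valid N (carry j)"
  by (induction j) auto

text \<open>By the mixed third move the classical crossing of the pair rises together with
  it.\<close>

lemma teq_carry:
  assumes "Suc j < length ds"
  shows "teq ds (Cross c 0 # vw (carry j)) (vw (carry j) @ [Cross c j])"
  using assms
proof (induction j)
  case 0
  then show ?case by (auto intro: teq_refl)
next
  case (Suc j)
  let ?es = "vrun (carry j) ds"
  have r: "run (vw (carry j)) ds = Some ?es" "length ?es = length ds"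
    using valid_carry[of j] Suc.prems by (simp_all add: run_vw)
  have rr: "run (Cross c 0 # vw (carry j)) ds = run (vw (carry j) @ [Cross c j]) ds"
    using teq_run[OF Suc.IH] Suc.prems by simp
  have "teq ds ([] @ (Cross c 0 # vw (carry j)) @ [Cross Virtual (Suc j), Cross Virtual j])
     ([] @ (vw (carry j) @ [Cross c j]) @ [Cross Virtual (Suc j), Cross Virtual j])"
  proof (rule teq_context)
    show "run ([] @ (Cross c 0 # vw (carry j)) @ [Cross Virtual (Suc j), Cross Virtual j]) ds \<noteq> None"
      using rr r Suc.prems by (simp add: run_append)
  qed (use Suc in auto)
  moreover have "teq ds (vw (carry j) @ [Cross c j, Cross Virtual (Suc j), Cross Virtual j] @ [])
     (vw (carry j) @ [Cross Virtual (Suc j), Cross Virtual j, Cross c (Suc j)] @ [])"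
    by (rule teq_context[OF teq_gmove[OF gmove.r3] r(1)]) (use r Suc.prems in \<open>auto simp: run_append\<close>)
  ultimately show ?case by (auto intro: teq_trans)
qed

section \<open>Braiding of virtual links\<close>

definition EW :: "nat \<Rightarrow> dir list" where
  "EW n = replicate n East @ replicate n West"

definition opens :: "nat \<Rightarrow> piece list" where
  "opens n = map (\<lambda>i. Open i East) [0..<n]"

definition crossings :: "nat \<Rightarrow> piece list \<Rightarrow> bool" where
  "crossings n w \<longleftrightarrow> (\<forall>p\<in>set w. \<exists>c i. p = Cross c i \<and> Suc i < n)"

lemma length_EW [simp]: "length (EW n) = 2 * n"
  by (simp add: EW_def)

lemma EW_nth: "i < n \<Longrightarrow> EW n ! i = East" "n \<le> i \<Longrightarrow> i < 2 * n \<Longrightarrow> EW n ! i = West"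
  by (auto simp: EW_def nth_append)

lemma opens_Suc: "opens (Suc n) = opens n @ [Open n East]"
  by (simp add: opens_def)

lemma run_opens: "run (opens n) [] = Some (EW n)"
proof (induction n)
  case (Suc n)
  then show ?case
    by (simp add: opens_Suc run_append) (simp add: EW_def replicate_append_same[symmetric])
qed (simp add: opens_def EW_def)

lemma run_crossings: "crossings n b \<Longrightarrow> run b (EW n) = Some (EW n)"
proof (induction b)
  case (Cons p b)
  then obtain c i where p: "p = Cross c i" "Suc i < n" by (auto simp: crossings_def)
  have "(EW n)[i := EW n ! Suc i, Suc i := EW n ! i] = EW n"
    using p(2) EW_nth(1)[of i n] EW_nth(1)[of "Suc i" n] by (metis Suc_lessD list_update_id)
  then show ?case using Cons p by (auto simp: crossings_def)
qed simp

lemma crossings_simps [simp]: "crossings n []" "crossings n (u @ v) \<longleftrightarrow> crossings n u \<and> crossings n v"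
  "crossings n (Cross c i # v) \<longleftrightarrow> Suc i < n \<and> crossings n v"
  "crossings n (vw is) \<longleftrightarrow> valid n is"
  by (auto simp: crossings_def valid_def)

text \<open>Nested left extrema, a braid on the East strands below, a virtual permutation of all
  strands, and right extrema at the bottom. With the closings at the bottom, a further piece passes
  all of them when its height is raised by \<open>2 * k\<close>.\<close>

definition normal_form :: "nat \<Rightarrow> piece list \<Rightarrow> nat list \<Rightarrow> nat \<Rightarrow> piece list" where
  "normal_form n b is k = opens n @ b @ vw is @ replicate k (Close 0)"

definition nfable :: "piece list \<Rightarrow> bool" where
  "nfable w \<longleftrightarrow> (\<exists>n b is k. crossings n b \<and> valid (2 * n) is \<and> teq [] w (normal_form n b is k))"

lemma run_braid_part:
  "crossings n b \<Longrightarrow> valid (2 * n) is \<Longrightarrow> run (opens n @ b @ vw is) [] = Some (vrun is (EW n))"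
  by (simp add: run_append run_opens run_crossings run_vw)

lemma below_replicate_Close: "below (h + 2 * k) (replicate k (Close 0)) = Some h"
  by (induction k arbitrary: h) auto

lemma nfable_snoc:
  assumes "nfable w" "run (w @ [p]) [] \<noteq> None"
  obtains n b "is" k es where "crossings n b" "valid (2 * n) is"
    "run (opens n @ b @ vw is) [] = Some es" "length es = 2 * n"
    "teq [] (w @ [p]) ((opens n @ b @ vw is) @ [at_height (height p + 2 * k) p] @ replicate k (Close 0))"
    "run [at_height (height p + 2 * k) p] es \<noteq> None"
    "run (replicate k (Close 0)) es = run w []"
proof -
  obtain n b "is" k where *: "crossings n b" "valid (2 * n) is" "teq [] w (normal_form n b is k)"
    using assms(1) unfolding nfable_def by blast
  let ?u = "opens n @ b @ vw is" and ?C = "replicate k (Close 0)"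
  let ?q = "at_height (height p + 2 * k) p"
  obtain es where es: "run ?u [] = Some es" "length es = 2 * n"
    using run_braid_part[OF *(1,2)] by simp
  have "teq [] ([] @ w @ [p]) ([] @ normal_form n b is k @ [p])"
    by (rule teq_context[OF *(3)]) (use assms(2) in auto)
  then have 1: "teq [] (w @ [p]) (?u @ (?C @ [p]) @ [])" by (simp add: normal_form_def)
  have rr: "run (?u @ x) [] = run x es" for x
    by (subst run_append) (simp only: es(1) Option.bind.simps)
  have r: "run (?C @ [at_height (height p) p]) es \<noteq> None"
    using teq_run[OF 1] assms(2) unfolding rr by (simp add: at_height_self)
  have "teq es (?C @ [at_height (height p) p]) (?q # ?C)"
    by (rule teq_pass_upper[OF below_replicate_Close _ r]) simp
  then have 2: "teq es (?C @ [p]) ([?q] @ ?C)" by (simp add: at_height_self)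
  have "run ([?q] @ ?C) es \<noteq> None" using teq_run[OF 2] r by (simp add: at_height_self)
  then have "run [?q] es \<noteq> None" by (cases "act ?q es") auto
  moreover have "run (replicate k (Close 0)) es = run w []"
    using teq_run[OF *(3)] rr[of ?C] by (simp add: normal_form_def)
  moreover have "teq [] (w @ [p]) (?u @ [?q] @ ?C)" using teq_step[OF 1 es(1) 2] by simp
  ultimately show ?thesis using that[OF *(1,2) es] by blast
qed

lemma nfableI:
  assumes "teq [] w ((opens n @ b @ vw is) @ replicate k (Close 0))" "crossings n b" "valid (2 * n) is"
  shows "nfable w"
  unfolding nfable_def normal_form_def using assms by (metis append_assoc)

text \<open>Two cancelling virtual crossings are inserted in front of the extremum, and the second
  one is used for a slide that lowers the extremum by one position.\<close>

lemma close_down: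
  assumes "Suc j < length es" "es ! j \<noteq> es ! Suc j"
  shows "\<exists>js. valid (length es) js \<and> teq es [Close j] (vw js @ [Close 0])"
  using assms
proof (induction j arbitrary: es)
  case 0
  then show ?case by (intro exI[of _ "[]"]) (auto intro!: teq_refl)
next
  case (Suc j)
  have "teq es ([] @ [] @ [Close (Suc j)]) ([] @ [Cross Virtual j, Cross Virtual j] @ [Close (Suc j)])"
    by (rule teq_context[OF teq_sym[OF teq_r2]]) (use Suc.prems in auto)
  moreover have "teq es ([Cross Virtual j] @ [Cross Virtual j, Close (Suc j)] @ [])
      ([Cross Virtual j] @ [Cross Virtual (Suc j), Close j] @ [])"
  proof (rule teq_context)
    show "teq (es[j := es ! Suc j, Suc j := es ! j]) [Cross Virtual j, Close (Suc j)] [Cross Virtual (Suc j), Close j]"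
      by (rule teq_sym, rule teq_gmove[OF gmove.slide_close]) (use Suc.prems in \<open>auto simp: nth_list_update\<close>)
  qed (use Suc.prems in \<open>auto simp: nth_list_update\<close>)
  moreover
  let ?fs = "vrun [j, Suc j] es"
  obtain js where js: "valid (length ?fs) js" "teq ?fs [Close j] (vw js @ [Close 0])"
    using Suc.IH[of ?fs] Suc.prems by (auto simp: nth_list_update)
  have "teq es ([Cross Virtual j, Cross Virtual (Suc j)] @ [Close j] @ [])
      ([Cross Virtual j, Cross Virtual (Suc j)] @ (vw js @ [Close 0]) @ [])"
    by (rule teq_context[OF js(2)]) (use Suc.prems in \<open>auto simp: nth_list_update\<close>)
  ultimately have "teq es [Close (Suc j)] (vw (j # Suc j # js) @ [Close 0])"
    by (auto intro: teq_trans)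
  then show ?case using js(1) Suc.prems by (intro exI[of _ "j # Suc j # js"]) auto
qed

lemma nfable_Close:
  assumes "nfable w" "run (w @ [Close i]) [] \<noteq> None"
  shows "nfable (w @ [Close i])"
proof -
  obtain n b "is" k es where *: "crossings n b" "valid (2 * n) is"
    "run (opens n @ b @ vw is) [] = Some es" "length es = 2 * n"
    "teq [] (w @ [Close i]) ((opens n @ b @ vw is) @ [Close (i + 2 * k)] @ replicate k (Close 0))"
    "run [Close (i + 2 * k)] es \<noteq> None"
    using nfable_snoc[OF assms] by (metis at_height.simps(3) height.simps(3))
  obtain js where js: "valid (length es) js" "teq es [Close (i + 2 * k)] (vw js @ [Close 0])"
    using close_down[of "i + 2 * k" es] *(6) by (auto split: if_splits)
  have "teq [] (w @ [Close i]) ((opens n @ b @ vw is) @ (vw js @ [Close 0]) @ replicate k (Close 0))"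
    by (rule teq_step[OF *(5,3) js(2)])
  then show ?thesis
    using js(1) * by (intro nfableI[of _ n b "is @ js" "Suc k"]) auto
qed

lemma open_up:
  assumes "i \<le> length es"
  shows "\<exists>js. valid (length es + 2) js \<and> teq es [Open i d] (Open (length es) d # vw js)"
  using assms
proof (induction i rule: inc_induct)
  case base
  then show ?case by (intro exI[of _ "[]"]) (auto intro!: teq_refl)
next
  case (step i)
  have "teq es ([Open i d] @ [] @ []) ([Open i d] @ [Cross Virtual (Suc i), Cross Virtual (Suc i)] @ [])"
  proof (rule teq_context)
    show "teq (take i es @ [d, opp d] @ drop i es) [] [Cross Virtual (Suc i), Cross Virtual (Suc i)]"
      by (rule teq_sym[OF teq_r2]) (use step.hyps in auto)
  qed (use step.hyps in auto)
  moreover have "teq es ([] @ [Open i d, Cross Virtual (Suc i)] @ [Cross Virtual (Suc i)])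
      ([] @ [Open (Suc i) d, Cross Virtual i] @ [Cross Virtual (Suc i)])"
    using teq_gmove[OF gmove.slide_open[of i d Virtual]] step.hyps by (intro teq_context) auto
  moreover obtain js where js: "valid (length es + 2) js" "teq es [Open (Suc i) d] (Open (length es) d # vw js)"
    using step.IH by blast
  have "teq es ([] @ [Open (Suc i) d] @ [Cross Virtual i, Cross Virtual (Suc i)])
      ([] @ (Open (length es) d # vw js) @ [Cross Virtual i, Cross Virtual (Suc i)])"
    by (rule teq_context[OF js(2)]) (use step.hyps in auto)
  ultimately have "teq es [Open i d] (Open (length es) d # vw (js @ [i, Suc i]))"
    by (auto intro: teq_trans)
  then show ?case using js(1) step.hyps by (intro exI[of _ "js @ [i, Suc i]"]) auto
qed

lemma open_down:
  assumes "n \<le> h" "h \<le> length es"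
  shows "\<exists>ks. valid (length es + 2) ks \<and> (\<forall>k\<in>set ks. n \<le> k) \<and> teq es [Open h d] (Open n d # vw ks)"
  using assms
proof (induction h rule: dec_induct)
  case base
  then show ?case by (intro exI[of _ "[]"]) (auto intro!: teq_refl)
next
  case (step h)
  have "teq es ([Open (Suc h) d] @ [] @ []) ([Open (Suc h) d] @ [Cross Virtual h, Cross Virtual h] @ [])"
  proof (rule teq_context)
    show "teq (take (Suc h) es @ [d, opp d] @ drop (Suc h) es) [] [Cross Virtual h, Cross Virtual h]"
      by (rule teq_sym[OF teq_r2]) (use step.prems in auto)
  qed (use step.prems in auto)
  moreover have "teq es ([] @ [Open (Suc h) d, Cross Virtual h] @ [Cross Virtual h])
      ([] @ [Open h d, Cross Virtual (Suc h)] @ [Cross Virtual h])"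
    using teq_sym[OF teq_gmove[OF gmove.slide_open[of h d Virtual]]] step.prems by (intro teq_context) auto
  moreover obtain ks where ks: "valid (length es + 2) ks" "\<forall>k\<in>set ks. n \<le> k" "teq es [Open h d] (Open n d # vw ks)"
    using step.IH step.prems by auto
  have "teq es ([] @ [Open h d] @ [Cross Virtual (Suc h), Cross Virtual h])
      ([] @ (Open n d # vw ks) @ [Cross Virtual (Suc h), Cross Virtual h])"
    by (rule teq_context[OF ks(3)]) (use step.prems in auto)
  ultimately have "teq es [Open (Suc h) d] (Open n d # vw (ks @ [Suc h, h]))"
    by (auto intro: teq_trans)
  then show ?case using ks(1,2) step.prems step.hyps by (intro exI[of _ "ks @ [Suc h, h]"]) auto
qed

lemma below_crossings: "crossings n b \<Longrightarrow> n \<le> h \<Longrightarrow> below h b = Some h"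
  by (induction b) (auto simp: crossings_def)

lemma below_append: "below h (u @ v) = Option.bind (below h u) (\<lambda>h. below h v)"
  by (induction u arbitrary: h) auto

lemma open_East:
  assumes "n \<le> h" "h \<le> length es"
  shows "\<exists>ks. valid (length es + 2) ks \<and> (\<forall>k\<in>set ks. n \<le> k) \<and> teq es [Open h d] (Open n East # vw ks)"
proof (cases d)
  case East
  then show ?thesis using open_down[OF assms] by simp
next
  case West
  obtain ks where ks: "valid (length es + 2) ks" "\<forall>k\<in>set ks. n \<le> k" "teq es [Open h East] (Open n East # vw ks)"
    using open_down[OF assms] by blast
  \<comment> \<open>A virtual kink reverses the direction of the new arc.\<close>
  have "teq es [Open h East, Cross Virtual h] [Open h (opp East)]"
    by (rule teq_gmove[OF gmove.r1_open]) (use assms in auto)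
  then have 1: "teq es [Open h d] [Open h East, Cross Virtual h]" using West teq_sym by simp
  have "teq es ([] @ [Open h East] @ [Cross Virtual h]) ([] @ (Open n East # vw ks) @ [Cross Virtual h])"
    by (rule teq_context[OF ks(3)]) (use assms in auto)
  then have "teq es [Open h d] (Open n East # vw (ks @ [h]))" using 1 by (auto intro: teq_trans)
  then show ?thesis using ks(1,2) assms by (intro exI[of _ "ks @ [h]"]) auto
qed

lemma teq_virtual_pass:
  assumes "valid (length es) ks" "\<forall>k\<in>set ks. n \<le> k" "crossings n b" "n \<le> length es"
  shows "teq es (vw ks @ b) (b @ vw ks)"
  using assms
proof (induction ks arbitrary: es rule: rev_induct)
  case Nil
  have "run b es \<noteq> None" using Nil(3,4) 
  proof (induction b arbitrary: es)
    case (Cons p b)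
    then obtain c i where "p = Cross c i" "Suc i < n" by (auto simp: crossings_def)
    then show ?case using Cons by (auto simp: crossings_def)
  qed simp
  then show ?case by (auto intro: teq_refl)
next
  case (snoc k ks)
  have r: "run b fs \<noteq> None \<and> (\<forall>gs. run b fs = Some gs \<longrightarrow> length gs = length fs)" if "n \<le> length fs" for fs :: "dir list"
    using snoc.prems(3) that
  proof (induction b arbitrary: fs)
    case (Cons p b)
    then obtain c i where "p = Cross c i" "Suc i < n" by (auto simp: crossings_def)
    then show ?case
      using Cons.IH[of "fs[i := fs ! Suc i, Suc i := fs ! i]"] Cons.prems by (auto simp: crossings_def)
  qed simp
  let ?fs = "vrun ks es"
  obtain gs where gs: "run b ?fs = Some gs" "length gs = length es" using r[of ?fs] snoc.prems(4) by auto
  have k: "Suc k < length es" "n \<le> k" using snoc.prems by auto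
  have "teq ?fs (b @ [at_height k (Cross Virtual k)]) (at_height k (Cross Virtual k) # b)"
    by (rule teq_pass_upper[OF below_crossings[OF snoc.prems(3) k(2)]]) (use gs k in \<open>auto simp: run_append\<close>)
  then have 1: "teq ?fs ([Cross Virtual k] @ b) (b @ [Cross Virtual k])" using teq_sym by simp
  have rks: "run (vw ks) es = Some ?fs" using snoc.prems by (simp add: run_vw)
  have "teq es (vw ks @ ([Cross Virtual k] @ b) @ []) (vw ks @ (b @ [Cross Virtual k]) @ [])"
    by (rule teq_context[OF 1 rks])
      (use rks r[of "?fs[k := ?fs ! Suc k, Suc k := ?fs ! k]"] k snoc.prems(4) in \<open>auto simp: run_append\<close>)
  moreover have IH: "teq es (vw ks @ b) (b @ vw ks)" using snoc by auto
  have "teq es ([] @ (vw ks @ b) @ [Cross Virtual k]) ([] @ (b @ vw ks) @ [Cross Virtual k])"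
    by (rule teq_context[OF IH]) (use rks gs k in \<open>auto simp: run_append\<close>)
  ultimately show ?case by (auto intro: teq_trans)
qed

text \<open>The new arc is first moved to the top, where it passes the virtual permutation and the
  braid. In front of them it is lowered to the middle, as the innermost of the nested arcs. The
  virtual crossings that this costs lie above the braid and pass to the other side of it.\<close>

lemma nfable_Open:
  assumes "nfable w" "run (w @ [Open i d]) [] \<noteq> None"
  shows "nfable (w @ [Open i d])"
proof -
  obtain n b "is" k es where *: "crossings n b" "valid (2 * n) is"
    "run (opens n @ b @ vw is) [] = Some es" "length es = 2 * n"
    "teq [] (w @ [Open i d]) ((opens n @ b @ vw is) @ [Open (i + 2 * k) d] @ replicate k (Close 0))"
    "run [Open (i + 2 * k) d] es \<noteq> None"
    using nfable_snoc[OF assms] by (metis at_height.simps(2) height.simps(2))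
  obtain js where js: "valid (length es + 2) js" "teq es [Open (i + 2 * k) d] (Open (length es) d # vw js)"
    using open_up[of "i + 2 * k" es d] *(6) by (auto split: if_splits)
  let ?v = "vw js @ replicate k (Close 0)"
  have 1: "teq [] (w @ [Open i d]) (opens n @ ((b @ vw is) @ [at_height (2 * n) (Open 0 d)]) @ ?v)"
    using teq_step[OF *(5,3) js(2)] *(4) by simp
  have "run ((b @ vw is) @ [at_height (2 * n) (Open 0 d)]) (EW n) \<noteq> None"
    using *(1-4) run_crossings[OF *(1)] by (auto simp: run_append run_vw)
  moreover have "below (2 * n) (b @ vw is) = Some (2 * n)"
    using below_crossings[OF *(1), of "2 * n"] below_crossings[of "2 * n" "vw is" "2 * n"] *(2)
    by (simp add: below_append)
  ultimately have "teq (EW n) ((b @ vw is) @ [at_height (2 * n) (Open 0 d)]) (at_height (2 * n) (Open 0 d) # b @ vw is)"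
    by (intro teq_pass_upper) auto
  from teq_step[OF 1 run_opens this]
  have 2: "teq [] (w @ [Open i d]) (opens n @ [Open (2 * n) d] @ (b @ vw is @ ?v))" by simp
  obtain ks where ks: "valid (2 * n + 2) ks" "\<forall>k\<in>set ks. n \<le> k" "teq (EW n) [Open (2 * n) d] (Open n East # vw ks)"
    using open_East[of n "2 * n" "EW n" d] by auto
  have 3: "teq [] (w @ [Open i d]) (opens (Suc n) @ (vw ks @ b) @ vw is @ ?v)"
    using teq_step[OF 2 run_opens ks(3)] by (simp add: opens_Suc)
  have "teq (EW (Suc n)) (vw ks @ b) (b @ vw ks)"
    by (rule teq_virtual_pass[OF _ ks(2) *(1)]) (use ks(1) in auto)
  from teq_step[OF 3 run_opens this]
  have "teq [] (w @ [Open i d]) ((opens (Suc n) @ b @ vw (ks @ is @ js)) @ replicate k (Close 0))"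
    by simp
  moreover have "crossings (Suc n) b" using *(1) by (fastforce simp: crossings_def)
  moreover have "valid (2 * Suc n) (ks @ is @ js)"
    using ks(1) js(1) *(2,4) by (auto simp: valid_def)
  ultimately show ?thesis by (rule nfableI)
qed

lemma run_replicate_Close: "run (replicate k (Close 0)) es = Some ds \<Longrightarrow> ds = drop (2 * k) es"
proof (induction k arbitrary: es)
  case (Suc k)
  then have "run (replicate k (Close 0)) (drop 2 es) = Some ds"
    by (auto simp: numeral_2_eq_2 split: if_splits)
  from Suc.IH[OF this] show ?case by simp
qed simp

lemma vrun_carry:
  "Suc j < length fs \<Longrightarrow> vrun (carry j) fs ! j = fs ! 0 \<and> vrun (carry j) fs ! Suc j = fs ! Suc 0"
  by (induction j) auto

text \<open>The obstacle is that the virtual permutation stands between the braid and the new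
  crossing, and a classical crossing cannot be pushed through arbitrary virtual ones. After
  conjugation the crossing involves the two lowest strands, and the permutation is rewritten so that
  its last part fixes those two positions.\<close>

lemma nfable_East_East:
  assumes "nfable w" "run w [] = Some ds" "Suc i < length ds" "ds ! i = East" "ds ! Suc i = East"
  shows "nfable (w @ [Cross c i])"
proof -
  have r: "run (w @ [Cross c i]) [] \<noteq> None" using assms by (simp add: run_append)
  obtain n b "is" k es where *: "crossings n b" "valid (2 * n) is"
    "run (opens n @ b @ vw is) [] = Some es" "length es = 2 * n"
    "teq [] (w @ [Cross c i]) ((opens n @ b @ vw is) @ [Cross c (i + 2 * k)] @ replicate k (Close 0))"
    "run [Cross c (i + 2 * k)] es \<noteq> None" "run (replicate k (Close 0)) es = run w []"
    using nfable_snoc[OF assms(1) r] by (metis at_height.simps(1) height.simps(1))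
  define j where "j = i + 2 * k"
  define s where "s = carry j"
  define v where "v = is @ rev s"
  let ?N = "2 * n" and ?C = "replicate k (Close 0)"
  have j: "Suc j < ?N" using *(4,6) by (auto simp: j_def split: if_splits)
  have dirs: "es ! j = East" "es ! Suc j = East"
    using run_replicate_Close[of k es ds] *(7) assms j *(4) by (auto simp: j_def add.commute)
  have vs: "valid ?N s" unfolding s_def by (rule valid_carry[OF j])
  have vv: "valid ?N v" using vs *(2) by (simp add: v_def)
  define fs where "fs = vrun (rev s) es"
  have lfs: "length fs = ?N" using *(4) by (simp add: fs_def)
  have es: "es = vrun is (EW n)" using run_braid_part[OF *(1,2)] *(3) by simp
  have fs: "fs = vrun v (EW n)" by (simp add: fs_def v_def es)
  have "vrun s fs = es"
    using veq_vrun[OF veq_rev[OF vs] *(4)] by (simp add: fs_def)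
  then have dirs0: "fs ! 0 = East" "fs ! Suc 0 = East"
    using vrun_carry[of j fs] dirs j lfs by (auto simp: s_def)
  have rs: "run (vw (rev s)) es = Some fs" using vs *(4) by (simp add: run_vw fs_def)
  have "teq es (vw (rev s @ s)) (vw [])"
    using veq_rev[OF vs] *(4) unfolding veq_def by blast
  \<comment> \<open>The word \<open>rev s @ s\<close> is inserted; carrying the crossing back
    through \<open>s\<close> makes it a crossing of the two lowest strands.\<close>
  then have "teq es ([] @ [] @ [Cross c j]) ([] @ vw (rev s @ s) @ [Cross c j])"
    by (intro teq_context[OF teq_sym]) (use j *(4) in auto)
  then have 1: "teq es [Cross c j] (vw (rev s) @ (vw s @ [Cross c j]) @ [])" by simp
  have "teq fs (vw s @ [Cross c j]) (Cross c 0 # vw s)"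
    unfolding s_def by (rule teq_sym[OF teq_carry]) (use j lfs in simp)
  from teq_step[OF 1 rs this]
  have 2: "teq es [Cross c j] (vw (rev s) @ [Cross c 0] @ vw s)" by simp
  have 3: "teq [] (w @ [Cross c i]) ((opens n @ b) @ vw v @ ([Cross c 0] @ vw s @ ?C))"
    using teq_step[OF *(5)[folded j_def] *(3) 2] by (simp add: v_def)
  have rob: "run (opens n @ b) [] = Some (EW n)" by (simp add: run_append run_opens run_crossings *(1))
  have E: "\<forall>i. 0 \<le> i \<and> i < n \<longrightarrow> EW n ! i = East" "\<forall>i. n \<le> i \<and> i < ?N \<longrightarrow> EW n ! i = West"
    using EW_nth by auto
  \<comment> \<open>Both lowest strands are directed to the East. Hence \<open>v\<close> is a
    product of two runs among the East strands and a rest that fixes the positions 0 and 1.\<close>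
  obtain a r1 where a: "0 \<le> a" "a < n" "\<forall>j\<in>set r1. Suc 0 \<le> j" "veq ?N v (down 0 a @ r1)"
    "vrun (down 0 a) (EW n) = EW n" "vrun r1 (EW n) = vrun v (EW n)"
    using pull_down[OF vv _ _ _ E, of thesis] dirs0 j fs by auto
  have v1: "valid ?N r1" using a(4) by (simp add: veq_def)
  have E1: "\<forall>i. Suc 0 \<le> i \<and> i < n \<longrightarrow> EW n ! i = East" using E(1) by auto
  have "vrun r1 (EW n) ! Suc 0 = East" using a(6) fs dirs0 by simp
  moreover have "Suc 0 < ?N" "length (EW n) = ?N" using j by simp_all
  ultimately obtain a' r2 where a': "Suc 0 \<le> a'" "a' < n" "\<forall>j\<in>set r2. Suc (Suc 0) \<le> j"
    "veq ?N r1 (down (Suc 0) a' @ r2)" "vrun (down (Suc 0) a') (EW n) = EW n"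
    using pull_down[OF v1 a(3) _ _ E1 E(2)] by metis
  have v2: "valid ?N r2" using a'(4) by (simp add: veq_def)
  let ?d = "down 0 a @ down (Suc 0) a'"
  have "veq ?N (down 0 a @ r1 @ []) (down 0 a @ (down (Suc 0) a' @ r2) @ [])"
    by (rule veq_context[OF a'(4)]) (use a(2) in \<open>auto simp: valid_def\<close>)
  then have "veq ?N v (?d @ r2)" using a(4) veq_trans by auto
  then have "teq (EW n) (vw v) (vw (?d @ r2))" unfolding veq_def by simp
  from teq_step[OF 3 rob this]
  have 4: "teq [] (w @ [Cross c i]) ((opens n @ b @ vw ?d) @ (vw r2 @ [Cross c 0]) @ (vw s @ ?C))"
    by simp
  have "valid ?N ?d" using a(2) a'(2) by (auto simp: valid_def)
  then have rd: "run (opens n @ b @ vw ?d) [] = Some (EW n)"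
    using run_braid_part[OF *(1), of ?d] a(5) a'(5) by simp
  \<comment> \<open>The letters of \<open>r2\<close> are at least 2, so the crossing passes it and
    joins the braid.\<close>
  have "teq (EW n) (vw r2 @ [Cross c 0]) ([Cross c 0] @ vw r2)"
    by (rule teq_virtual_pass[of _ _ 2]) (use a' v2 in auto)
  from teq_step[OF 4 rd this]
  have "teq [] (w @ [Cross c i]) ((opens n @ (b @ vw ?d @ [Cross c 0]) @ vw (r2 @ s)) @ ?C)" by simp
  moreover have "crossings n (b @ vw ?d @ [Cross c 0])"
    using *(1) a(2) a'(1,2) by (auto simp: valid_def)
  moreover have "valid ?N (r2 @ s)" using v2 vs by simp
  ultimately show ?thesis by (rule nfableI)
qed

text \<open>A quarter turn: a zigzag is made in the lower strand and slid through the crossing. The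
  directions (x, y) of the crossing become (y, opp x).\<close>

lemma teq_rotate:
  assumes "Suc i < length ds"
  shows "teq ds [Cross c i] [Open (i + 2) (opp (ds ! i)), Cross (flip c) (Suc i), Close i]"
proof -
  let ?d = "opp (ds ! i)"
  obtain us x y zs where ds: "ds = us @ x # y # zs" "length us = i"
    using split_at2[OF assms] by metis
  have d: "?d = opp x" using ds by (simp add: nth_append)
  have "teq ds [Open (Suc i) ?d, Close i] []"
    by (rule teq_gmove[OF gmove.zigzag]) (auto simp: ds nth_append)
  then have "teq ds ([] @ [] @ [Cross c i]) ([] @ [Open (Suc i) ?d, Close i] @ [Cross c i])"
    by (intro teq_context[OF teq_sym]) (use assms in auto)
  moreover have "teq ds ([Open (Suc i) ?d] @ [Close i, Cross c i] @ []) ([Open (Suc i) ?d] @ [Cross c (i + 2), Close i] @ [])"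
  proof (rule teq_context)
    show "teq (us @ x # opp x # x # y # zs) [Close i, Cross c i] [Cross c (i + 2), Close i]"
      using teq_exchange[of "Close i" "Cross c i" "us @ x # opp x # x # y # zs"]
      by (auto simp: ds(2)[symmetric] nth_append)
  qed (auto simp: ds d nth_append)
  moreover have "teq ds ([] @ [Open (Suc i) ?d, Cross c (Suc (Suc i))] @ [Close i]) ([] @ [Open (Suc (Suc i)) ?d, Cross (flip c) (Suc i)] @ [Close i])"
    by (rule teq_context[OF teq_gmove[OF gmove.slide_open]]) (auto simp: ds d nth_append list_update_append)
  ultimately show ?thesis by (auto intro: teq_trans)
qed

lemma nfable_teq: "teq [] v w \<Longrightarrow> nfable w \<Longrightarrow> nfable v"
  unfolding nfable_def using teq_trans by blast

lemma nfable_rotate: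
  assumes w: "nfable w" "run w [] = Some ds" "Suc i < length ds"
    and step: "\<And>w' ds' j c'. nfable w' \<Longrightarrow> run w' [] = Some ds' \<Longrightarrow> Suc j < length ds' \<Longrightarrow>
      ds' ! j = ds ! Suc i \<Longrightarrow> ds' ! Suc j = opp (ds ! i) \<Longrightarrow> nfable (w' @ [Cross c' j])"
  shows "nfable (w @ [Cross c i])"
proof -
  let ?d = "opp (ds ! i)"
  obtain us x y zs where ds: "ds = us @ x # y # zs" "length us = i"
    using split_at2[OF w(3)] by metis
  have d: "ds ! i = x" "ds ! Suc i = y" using ds by (simp_all add: nth_append)
  have r1: "run (w @ [Open (i + 2) ?d]) [] = Some (us @ x # y # opp x # x # zs)"
    using w(2) ds d by (simp add: run_append)
  have n1: "nfable (w @ [Open (i + 2) ?d])" by (rule nfable_Open[OF w(1)]) (use r1 in auto)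
  have n2: "nfable ((w @ [Open (i + 2) ?d]) @ [Cross (flip c) (Suc i)])"
    by (rule step[OF n1 r1]) (use ds d in \<open>auto simp: nth_append\<close>)
  have "nfable (((w @ [Open (i + 2) ?d]) @ [Cross (flip c) (Suc i)]) @ [Close i])"
    by (rule nfable_Close[OF n2]) (use w(2) ds d in \<open>auto simp: run_append nth_append list_update_append\<close>)
  moreover have "teq [] (w @ [Cross c i] @ []) (w @ [Open (i + 2) ?d, Cross (flip c) (Suc i), Close i] @ [])"
    by (rule teq_context[OF teq_rotate w(2)]) (use w in \<open>auto simp: run_append\<close>)
  ultimately show ?thesis using nfable_teq by simp
qed

text \<open>At most three quarter turns lead to two East strands: from East, West to West, West,
  then to West, East, then to East, East. The extrema needed for them are absorbed into the normal
  form.\<close>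

lemma nfable_Cross:
  assumes "nfable w" "run w [] = Some ds" "Suc i < length ds"
  shows "nfable (w @ [Cross c i])"
proof -
  have 1: "nfable (w @ [Cross c i])" if "nfable w" "run w [] = Some ds" "Suc i < length ds"
    "ds ! i = West" "ds ! Suc i = East" for w ds i c
    by (rule nfable_rotate[OF that(1-3)]) (use that(4,5) nfable_East_East in auto)
  have 2: "nfable (w @ [Cross c i])" if "nfable w" "run w [] = Some ds" "Suc i < length ds"
    "ds ! i = West" "ds ! Suc i = West" for w ds i c
    by (rule nfable_rotate[OF that(1-3)]) (use that(4,5) 1 in auto)
  have 3: "nfable (w @ [Cross c i])" if "nfable w" "run w [] = Some ds" "Suc i < length ds"
    "ds ! i = East" "ds ! Suc i = West" for w ds i c
    by (rule nfable_rotate[OF that(1-3)]) (use that(4,5) 2 in auto)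
  show ?thesis
    using 1 2 3 nfable_East_East[OF assms] assms by (cases "ds ! i"; cases "ds ! Suc i") blast+
qed

lemma nfable_all:
  assumes "run w [] \<noteq> None" "cusp_free w"
  shows "nfable w"
  using assms
proof (induction w rule: rev_induct)
  case Nil
  have "teq [] [] ((opens 0 @ [] @ vw []) @ replicate 0 (Close 0))"
    by (simp add: opens_def teq_refl)
  then show ?case by (rule nfableI) auto
next
  case (snoc p w)
  then obtain ds where ds: "run w [] = Some ds" by (cases "run w []") (auto simp: run_append)
  then have w: "nfable w" using snoc by (auto simp: cusp_free_def)
  show ?case
  proof (cases p)
    case (Cross c i)
    then show ?thesis using nfable_Cross[OF w ds] snoc.prems ds
      by (auto simp: run_append split: if_splits)
  qed (use snoc.prems w nfable_Open nfable_Close in \<open>auto simp: cusp_free_def\<close>)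
qed

lemma run_prefix: "run (u @ v) ds \<noteq> None \<Longrightarrow> \<exists>fs. run u ds = Some fs \<and> run v fs \<noteq> None"
  by (cases "run u ds") (auto simp: run_append)

section \<open>Nested closing arcs\<close>

definition closers :: "nat \<Rightarrow> piece list" where
  "closers n = map Close (rev [0..<n])"

lemma closers_Suc: "closers (Suc n) = Close n # closers n"
  by (simp add: closers_def)

fun past :: "nat \<Rightarrow> nat list" where
  "past 0 = []"
| "past (Suc n) = past n @ [Suc n, n]"

lemma vrun_past: "vrun (past n) (d # d' # replicate n e @ zs) = replicate n e @ d # d' # zs"
proof (induction n arbitrary: zs)
  case (Suc n)
  have "vrun (past n) (d # d' # replicate (Suc n) e @ zs) = replicate n e @ d # d' # e # zs"
    using Suc.IH[of "e # zs"] by (simp add: replicate_append_same[symmetric])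
  then show ?case
    by (simp add: nth_append list_update_append replicate_append_same[symmetric])
qed simp

lemma valid_past: "n + 2 \<le> N \<Longrightarrow> valid N (past n)"
  by (induction n) auto

lemma close_past:
  assumes "d \<noteq> d'" 
  shows "teq (d # d' # replicate n e @ zs) [Close 0] (vw (past n) @ [Close n])"
proof (induction n arbitrary: zs)
  case 0
  then show ?case using assms by (auto intro: teq_refl)
next
  case (Suc n)
  let ?es = "d # d' # replicate (Suc n) e @ zs"
  have es: "?es = d # d' # replicate n e @ e # zs" by (simp add: replicate_app_Cons_same)
  have 1: "teq ?es [Close 0] (vw (past n) @ [] @ [Close n])" using Suc.IH[of "e # zs"] es by simp
  let ?fs = "replicate n e @ d # d' # e # zs"
  have r: "run (vw (past n)) ?es = Some ?fs"
    using vrun_past[of n d d' e "e # zs"] valid_past[of n "length ?es"] unfolding es by (simp add: run_vw)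
  have "teq ?fs [Cross Virtual (Suc n), Cross Virtual (Suc n)] []" by (rule teq_r2) simp
  from teq_step[OF 1 r teq_sym[OF this]]
  have 2: "teq ?es [Close 0] ((vw (past n) @ [Cross Virtual (Suc n)]) @ [Cross Virtual (Suc n), Close n] @ [])" by simp
  have r2: "run (vw (past n) @ [Cross Virtual (Suc n)]) ?es = Some (replicate n e @ d # e # d' # zs)"
    using r by (simp add: run_append nth_append list_update_append)
  have "run [Cross Virtual (Suc n), Close n] (replicate n e @ d # e # d' # zs) \<noteq> None"
    using assms by (simp add: nth_append list_update_append)
  then have "teq (replicate n e @ d # e # d' # zs) [Cross Virtual (Suc n), Close n] [Cross Virtual n, Close (Suc n)]"
    by (intro teq_gmove[OF gmove.slide_close])
  from teq_step[OF 2 r2 this] show ?case by simp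
qed

lemma EW_Suc: "EW (Suc n) = replicate n East @ East # West # replicate n West"
  by (simp add: EW_def replicate_app_Cons_same)

lemma teq_shift_Close:
  "run (Close 0 # vw x) es \<noteq> None \<Longrightarrow> teq es (Close 0 # vw x) (vw (map (\<lambda>j. j + 2) x) @ [Close 0])"
proof (induction x arbitrary: es)
  case Nil
  then show ?case by (auto intro: teq_refl)
next
  case (Cons j x)
  have "teq es ([] @ [Close 0, Cross Virtual j] @ vw x) ([] @ [Cross Virtual (j + 2), Close 0] @ vw x)"
  proof (rule teq_context)
    show "teq es [Close 0, Cross Virtual j] [Cross Virtual (j + 2), Close 0]"
      using teq_exchange[of "Close 0" "Cross Virtual j" es] Cons.prems by (auto split: if_splits)
  qed (use Cons.prems in auto)
  then have 1: "teq es (Close 0 # vw (j # x)) ([Cross Virtual (j + 2)] @ (Close 0 # vw x) @ [])" by simp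
  have "run ([Cross Virtual (j + 2)] @ (Close 0 # vw x) @ []) es \<noteq> None" using teq_run[OF 1] Cons.prems by simp
  then obtain fs where fs: "run [Cross Virtual (j + 2)] es = Some fs" "run (Close 0 # vw x) fs \<noteq> None"
    using run_prefix[of "[Cross Virtual (j + 2)]" "Close 0 # vw x" es] by auto
  from teq_step[OF 1 fs(1) Cons.IH[OF fs(2)]] show ?case by simp
qed

text \<open>The pair that is closed first becomes the innermost closing arc. The crossings that
  order the remaining strands are moved in front of this closing, and then the pair is taken past
  the East strands into the middle.\<close>

lemma closing_normal:
  assumes "run (replicate n (Close 0)) es = Some []"
  shows "\<exists>x. valid (2 * n) x \<and> vrun x es = EW n \<and> length es = 2 * n \<and>
    teq es (replicate n (Close 0)) (vw x @ closers n)"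
  using assms
proof (induction n arbitrary: es)
  case 0
  then show ?case by (intro exI[of _ "[]"]) (auto simp: closers_def EW_def intro: teq_refl)
next
  case (Suc n)
  then obtain d d' es' where es: "es = d # d' # es'" "d \<noteq> d'"
    by (cases es; cases "tl es") (auto split: if_splits)
  have r: "run (replicate n (Close 0)) es' = Some []" using Suc.prems es by simp
  obtain x where x: "valid (2 * n) x" "vrun x es' = EW n" "length es' = 2 * n"
    "teq es' (replicate n (Close 0)) (vw x @ closers n)"
    using Suc.IH[OF r] by blast
  \<comment> \<open>A virtual kink, if necessary, puts the East strand of the pair below the West
    strand.\<close>
  define u where "u = (if d = East then [] else [0 :: nat])"
  have ru: "run (vw u) es = Some (East # West # es')" "valid (2 * Suc n) u" "vrun u es = East # West # es'"
    using es by (cases d; cases d'; auto simp: u_def)+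
  have e0: "teq es [Close 0] (vw u @ [Close 0])"
    using es by (auto simp: u_def intro!: teq_refl teq_sym[OF teq_gmove[OF gmove.r1_close]])
  have "teq es ([] @ [Close 0] @ replicate n (Close 0)) ([] @ (vw u @ [Close 0]) @ replicate n (Close 0))"
    by (rule teq_context[OF e0]) (use Suc.prems in auto)
  then have 1: "teq es (replicate (Suc n) (Close 0)) ((vw u @ [Close 0]) @ replicate n (Close 0) @ [])" by simp
  have "run (vw u @ [Close 0]) es = Some es'" using ru(1) by (simp add: run_append)
  from teq_step[OF 1 this x(4)]
  have 2: "teq es (replicate (Suc n) (Close 0)) (vw u @ (Close 0 # vw x) @ closers n)" by simp
  let ?x = "map (\<lambda>j. j + 2) x"
  have "run (Close 0 # vw x) (East # West # es') \<noteq> None" using x(1,3) by (simp add: run_vw)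
  from teq_step[OF 2 ru(1) teq_shift_Close[OF this]]
  have 3: "teq es (replicate (Suc n) (Close 0)) (vw (u @ ?x) @ [Close 0] @ closers n)" by simp
  have vx: "valid (2 * Suc n) (u @ ?x)" using ru(2) x(1) by (auto simp: valid_def)
  have vr: "vrun (map (\<lambda>j. j + 2) x) (a # b # fs) = a # b # vrun x fs" for a b fs
    by (induction x arbitrary: fs) auto
  have rx: "vrun (u @ ?x) es = East # West # EW n" using ru(3) vr x(2) by simp
  then have rx': "run (vw (u @ ?x)) es = Some (East # West # EW n)"
    using run_vw[of es "u @ ?x"] vx x(3) es by simp
  have "teq (East # West # replicate n East @ replicate n West) [Close 0] (vw (past n) @ [Close n])"
    by (rule close_past) simp
  then have "teq (East # West # EW n) [Close 0] (vw (past n) @ [Close n])" by (simp add: EW_def)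
  from teq_step[OF 3 rx' this]
  have "teq es (replicate (Suc n) (Close 0)) (vw (u @ ?x @ past n) @ closers (Suc n))"
    by (simp add: closers_Suc)
  moreover have "vrun (u @ ?x @ past n) es = EW (Suc n)"
    using rx vrun_past[of n East West East "replicate n West"] unfolding EW_Suc
    by (simp add: EW_def replicate_app_Cons_same[symmetric])
  moreover have "valid (2 * Suc n) (u @ ?x @ past n)" using vx valid_past[of n "2 * Suc n"] by simp
  ultimately show ?case using x(3) es by (intro exI[of _ "u @ ?x @ past n"]) auto
qed

text \<open>The crossing of the upper ends of two nested closing arcs slides around the first
  extremum; the two extrema are then exchanged, and a second slide brings it to the lower
  ends.\<close>

lemma reflect_core:
  assumes "run [Cross Virtual (h + 2), Close (Suc h), Close h] ds \<noteq> None"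
  shows "teq ds [Cross Virtual (h + 2), Close (Suc h), Close h] [Cross Virtual h, Close (Suc h), Close h]"
proof -
  let ?l = "[Cross Virtual (h + 2), Close (Suc h), Close h]"
  have 0: "teq ds ?l ([] @ [Cross Virtual (Suc (Suc h)), Close (Suc h)] @ [Close h])"
    using assms by (simp add: teq_refl)
  have "run [Cross Virtual (Suc (Suc h)), Close (Suc h)] ds \<noteq> None"
    using assms by (auto split: if_splits)
  from teq_step[OF 0 _ teq_gmove[OF gmove.slide_close this]]
  have 1: "teq ds ?l ([Cross Virtual (Suc h)] @ [Close (Suc (Suc h)), Close h] @ [])" by simp
  have "run ([Cross Virtual (Suc h)] @ [Close (Suc (Suc h)), Close h] @ []) ds \<noteq> None"
    using teq_run[OF 1] assms by simp
  then obtain fs where fs: "run [Cross Virtual (Suc h)] ds = Some fs" "run [Close (Suc (Suc h)), Close h] fs \<noteq> None"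
    using run_prefix[of "[Cross Virtual (Suc h)]" "[Close (Suc (Suc h)), Close h]" ds] by auto
  have "teq fs [Close (Suc (Suc h)), Close h] [Close h, Close h]"
    using teq_exchange_rev[of "Close h" "Close h" fs] fs(2) by simp
  from teq_step[OF 1 fs(1) this]
  have 2: "teq ds ?l ([] @ [Cross Virtual (Suc h), Close h] @ [Close h])" by simp
  have "run [Cross Virtual (Suc h), Close h] ds \<noteq> None"
    using teq_run[OF 2] assms by (auto split: if_splits)
  from teq_step[OF 2 _ teq_gmove[OF gmove.slide_close this]]
  show ?thesis by simp
qed

text \<open>The closing arcs join the positions \<open>i\<close> and \<open>2 * n - 1 - i\<close>.
  So a crossing of the West strands \<open>j\<close> and \<open>Suc j\<close> travels along two arcs
  and becomes a crossing of East strands, the lower of which is at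
  \<open>2 * n - 2 - j\<close>.\<close>

lemma reflect:
  assumes "n \<le> j" "Suc j < 2 * n" "run (Cross Virtual j # closers n) ds \<noteq> None"
  shows "teq ds (Cross Virtual j # closers n) (Cross Virtual (2 * n - 2 - j) # closers n)"
  using assms
proof (induction n arbitrary: j ds)
  case (Suc n)
  let ?l = "Cross Virtual j # closers (Suc n)"
  consider "j = Suc n" | "Suc n < j" using Suc.prems(1) by linarith
  then show ?case
  proof cases
    case 1
    then obtain h where n: "n = Suc h" using Suc.prems(2) by (cases n) auto
    have l: "teq ds ?l ([] @ [Cross Virtual (h + 2), Close (Suc h), Close h] @ closers h)"
      using Suc.prems(3) 1 n by (simp add: closers_Suc teq_refl)
    have "run ([] @ [Cross Virtual (h + 2), Close (Suc h), Close h] @ closers h) ds \<noteq> None"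
      using teq_run[OF l] Suc.prems(3) by simp
    then have "run [Cross Virtual (h + 2), Close (Suc h), Close h] ds \<noteq> None"
      using run_prefix[of "[Cross Virtual (h + 2), Close (Suc h), Close h]" "closers h" ds]
      by (metis append_Nil option.distinct(1))
    from teq_step[OF l _ reflect_core[OF this]]
    have "teq ds ?l (Cross Virtual h # Close (Suc h) # Close h # closers h)" by simp
    then show ?thesis using 1 n by (simp add: closers_Suc)
  next
    case 2
    define i where "i = j - 2"
    have i: "j = i + 2" "n \<le> i" "Suc i < 2 * n" using 2 Suc.prems(2) by (auto simp: i_def)
    have l: "teq ds ?l ([] @ [Cross Virtual (i + 2), Close n] @ closers n)"
      using Suc.prems(3) i by (simp add: closers_Suc teq_refl)
    have "run [Cross Virtual (i + 2), Close n] ds \<noteq> None"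
      using Suc.prems(3) i by (auto simp: closers_Suc split: if_splits)
    then have "teq ds [Cross Virtual (i + 2), Close n] [Close n, Cross Virtual i]"
      using teq_exchange_rev[of "Close n" "Cross Virtual i" ds] i by simp
    from teq_step[OF l _ this]
    have l2: "teq ds ?l ([Close n] @ (Cross Virtual i # closers n) @ [])" by simp
    have "run ([Close n] @ (Cross Virtual i # closers n) @ []) ds \<noteq> None"
      using teq_run[OF l2] Suc.prems(3) by simp
    then obtain fs where fs: "act (Close n) ds = Some fs" "run (Cross Virtual i # closers n) fs \<noteq> None"
      by (cases "act (Close n) ds") auto
    have rc: "run [Close n] ds = Some fs" using fs(1) by simp
    let ?k = "2 * n - 2 - i"
    from teq_step[OF l2 rc Suc.IH[OF i(2,3) fs(2)]]
    have l3: "teq ds ?l ([] @ [Close n, Cross Virtual ?k] @ closers n)" by simp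
    have "run ([] @ [Close n, Cross Virtual ?k] @ closers n) ds \<noteq> None"
      using teq_run[OF l3] Suc.prems(3) by simp
    then have "run [Close n, Cross Virtual ?k] ds \<noteq> None" by (auto split: if_splits)
    moreover have "Suc (Suc (n - 2)) = n" using i by simp
    ultimately have "teq ds [Close n, Cross Virtual ?k] [Cross Virtual ?k, Close n]"
      using teq_exchange_rev[of "Cross Virtual ?k" "Close n" ds] i by simp
    from teq_step[OF l3 _ this]
    have "teq ds ?l (Cross Virtual ?k # closers (Suc n))" by (simp add: closers_Suc)
    moreover have "2 * Suc n - 2 - j = ?k" using i by simp
    ultimately show ?thesis by simp
  qed
qed simp

lemma run_closers: "run (closers n) (EW n) = Some []"
proof (induction n)
  case (Suc n)
  have "act (Close n) (EW (Suc n)) = Some (EW n)"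
    unfolding EW_Suc by (simp add: nth_append EW_def)
  then show ?case using Suc.IH by (simp add: closers_Suc del: act.simps)
qed (simp add: closers_def EW_def)

lemma reflect_all:
  assumes "valid (2 * n) v" "\<forall>j\<in>set v. n \<le> j"
  shows "\<exists>v'. valid n v' \<and> teq (EW n) (vw v @ closers n) (vw v' @ closers n)"
  using assms
proof (induction v rule: rev_induct)
  case Nil
  then show ?case using run_closers by (intro exI[of _ "[]"]) (auto intro: teq_refl)
next
  case (snoc j v)
  then have j: "n \<le> j" "Suc j < 2 * n" and v: "valid (2 * n) v" "\<forall>i\<in>set v. n \<le> i" by auto
  let ?k = "2 * n - 2 - j"
  have const: "vrun w (EW n) = EW n" if "valid (2 * n) w" "\<forall>i\<in>set w. n \<le> i \<or> Suc i < n" for w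
  proof (rule vrun_const)
    show "\<forall>j\<in>set w. EW n ! j = EW n ! Suc j"
    proof
      fix j assume "j \<in> set w"
      then have "Suc j < 2 * n" "n \<le> j \<or> Suc j < n" using that by (auto simp: valid_def)
      then show "EW n ! j = EW n ! Suc j"
        using EW_nth(1)[of j n] EW_nth(1)[of "Suc j" n] EW_nth(2)[of n j] EW_nth(2)[of n "Suc j"] by auto
    qed
  qed (use that in simp)
  have rv: "run (vw v) (EW n) = Some (EW n)" using const[of v] v by (simp add: run_vw)
  have rj: "run [Cross Virtual j] (EW n) = Some (EW n)" using const[of "[j]"] j by simp
  have rc: "run (Cross Virtual j # closers n) (EW n) \<noteq> None"
    using const[of "[j]"] j run_closers[of n] by simp
  have 1: "teq (EW n) (vw (v @ [j]) @ closers n) (vw v @ (Cross Virtual j # closers n) @ [])"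
    using rv rc by (auto simp: run_append intro!: teq_refl)
  from teq_step[OF 1 rv reflect[OF j rc]]
  have 2: "teq (EW n) (vw (v @ [j]) @ closers n) ([] @ (vw v @ [Cross Virtual ?k]) @ closers n)" by simp
  have "crossings n [Cross Virtual ?k]" using j by auto
  from teq_virtual_pass[OF _ v(2) this, of "EW n"]
  have "teq (EW n) (vw v @ [Cross Virtual ?k]) ([Cross Virtual ?k] @ vw v)" using v(1) by simp
  from teq_step[OF 2 _ this]
  have 3: "teq (EW n) (vw (v @ [j]) @ closers n) ([Cross Virtual ?k] @ (vw v @ closers n) @ [])" by simp
  have k: "Suc ?k < n" using j by linarith
  then have "vrun [?k] (EW n) = EW n" by (intro const) (use k in auto)
  then have rk: "run [Cross Virtual ?k] (EW n) = Some (EW n)" using k run_vw[of "EW n" "[?k]"] by simp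
  obtain v' where v': "valid n v'" "teq (EW n) (vw v @ closers n) (vw v' @ closers n)"
    using snoc.IH v by blast
  from teq_step[OF 3 rk v'(2)]
  have "teq (EW n) (vw (v @ [j]) @ closers n) (vw (?k # v') @ closers n)" by simp
  then show ?case using v'(1) j by (intro exI[of _ "?k # v'"]) auto
qed

lemma crossings_letters:
  "crossings n b \<Longrightarrow> \<exists>u. u \<in> braid_words n \<and> map letter_piece u = b"
proof (induction b)
  case Nil
  then show ?case by (intro exI[of _ "[]"]) (simp add: braid_words_def)
next
  case (Cons p b)
  then obtain c i u where p: "p = Cross c i" "Suc i < n" and u: "u \<in> braid_words n" "map letter_piece u = b"
    by (auto simp: crossings_def)
  define l where "l = (case c of Under \<Rightarrow> Sigma (Suc i) | Over \<Rightarrow> SigmaInv (Suc i) | Virtual \<Rightarrow> Tau (Suc i))"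
  have "letter_piece l = p" "l \<in> (\<Union>i\<in>{1..<n}. {Sigma i, SigmaInv i, Tau i})"
    using p by (cases c; auto simp: l_def)+
  then show ?case using u by (intro exI[of _ "l # u"]) (auto simp: braid_words_def)
qed

theorem virtual_Alexander:
  assumes "link_diagram w"
  obtains n u where "n \<ge> 1" "u \<in> braid_words n" "teq [] w (closure_diagram n u)"
proof -
  have w: "run w [] = Some []" "cusp_free w" "w \<noteq> []"
    using assms by (auto simp: link_diagram_def arrow_diagram_def cusp_free_def)
  then obtain n b "is" k where *: "crossings n b" "valid (2 * n) is" "teq [] w (normal_form n b is k)"
    using nfable_all[of w] unfolding nfable_def by auto
  let ?u = "opens n @ b @ vw is" and ?es = "vrun is (EW n)"
  have ru: "run ?u [] = Some ?es" by (rule run_braid_part[OF *(1,2)])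
  have rr: "run (?u @ x) [] = run x ?es" for x
    by (subst run_append) (simp only: ru Option.bind.simps)
  have 1: "teq [] w (?u @ replicate k (Close 0) @ [])" using *(3) by (simp add: normal_form_def)
  have rk: "run (replicate k (Close 0)) ?es = Some []"
    using teq_run[OF 1] w(1) unfolding rr by simp
  have len: "length fs = 2 * k" if "run (replicate k (Close 0)) fs = Some []" for fs
    using that closing_normal by blast
  \<comment> \<open>The \<open>k\<close> right extrema consume all \<open>2 * n\<close>
    strands.\<close>
  have k: "k = n" using len[OF rk] by simp
  obtain x where x: "valid (2 * n) x" "vrun x ?es = EW n"
    "teq ?es (replicate n (Close 0)) (vw x @ closers n)"
    using closing_normal[OF rk[unfolded k]] by blast
  let ?rob = "opens n @ b"
  have rob: "run ?rob [] = Some (EW n)" by (simp add: run_append run_opens run_crossings *(1))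
  from teq_step[OF 1[unfolded k] ru x(3)]
  have 2: "teq [] w (?rob @ vw (is @ x) @ closers n)" by simp
  \<comment> \<open>The permutation in front of the closing arcs preserves the directions. Its part
    among the East strands joins the braid directly, and its part among the West strands is
    reflected into the braid.\<close>
  have "\<exists>vb vt. veq (2 * n) (is @ x) (vb @ vt) \<and> (\<forall>j\<in>set vb. Suc j < n) \<and> (\<forall>j\<in>set vt. n \<le> j)"
    by (rule split_blocks[where h = 0 and ds = "EW n"]) (use *(2) x(1,2) EW_nth in auto)
  then obtain vb vt where v: "veq (2 * n) (is @ x) (vb @ vt)" "\<forall>j\<in>set vb. Suc j < n" "\<forall>j\<in>set vt. n \<le> j"
    by blast
  have "teq (EW n) (vw (is @ x)) (vw (vb @ vt))" using v(1) unfolding veq_def by simp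
  from teq_step[OF 2 rob this]
  have 3: "teq [] w ((opens n @ b @ vw vb) @ (vw vt @ closers n) @ [])" by simp
  have vv: "valid (2 * n) vb" "valid (2 * n) vt" using v(1) by (auto simp: veq_def)
  have "vrun vb (EW n) = EW n"
    by (rule vrun_const) (use vv v(2) EW_nth in auto)
  then have rvb: "run (opens n @ b @ vw vb) [] = Some (EW n)"
    using run_braid_part[OF *(1) vv(1)] by simp
  obtain v' where v': "valid n v'" "teq (EW n) (vw vt @ closers n) (vw v' @ closers n)"
    using reflect_all[OF vv(2) v(3)] by blast
  from teq_step[OF 3 rvb v'(2)]
  have 4: "teq [] w (opens n @ (b @ vw vb @ vw v') @ closers n)" by simp
  have "crossings n (b @ vw vb @ vw v')" using *(1) v(2) v'(1) by (auto simp: valid_def)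
  then obtain u where u: "u \<in> braid_words n" "map letter_piece u = b @ vw vb @ vw v'"
    using crossings_letters by blast
  have 5: "teq [] w (closure_diagram n u)"
    using 4 u(2) by (simp add: closure_diagram_def opens_def closers_def)
  have "(w, closure_diagram n u) \<in> link_rel" by (rule teq_link[OF 5 assms])
  then have "closure_diagram n u \<noteq> []"
    by (auto simp: link_rel_def link_diagram_def arrow_diagram_def)
  \<comment> \<open>On no strands there are no letters, and the closure would be the empty word,
    which is not a link diagram.\<close>
  then have "n \<ge> 1" using u(1) by (cases n) (auto simp: closure_diagram_def braid_words_def)
  then show ?thesis using that u(1) 5 by blast
qed

section \<open>Loops of a pair of involutions\<close>

text \<open>\<open>A\<close> exchanges the ends of an elementary strand with label \<open>G\<close>,
  and \<open>B\<close> passes to the end glued to a given one. \<open>par\<close> says whether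
  travelling from an end agrees with an orientation, which is reversed by odd labels. The locale is
  used for the pieces of a diagram and for the edges of a tangle.\<close>

locale loops =
  fixes X :: "'a set" and A B :: "'a \<Rightarrow> 'a" and G :: "'a \<Rightarrow> int" and par :: "'a \<Rightarrow> bool"
  assumes finite: "finite X"
    and A: "x \<in> X \<Longrightarrow> A x \<in> X" "x \<in> X \<Longrightarrow> A (A x) = x" "x \<in> X \<Longrightarrow> A x \<noteq> x"
    and B: "x \<in> X \<Longrightarrow> B x \<in> X" "x \<in> X \<Longrightarrow> B (B x) = x" "x \<in> X \<Longrightarrow> B x \<noteq> x"
    and G: "x \<in> X \<Longrightarrow> G (A x) = drev (G x)"
    and par: "x \<in> X \<Longrightarrow> par (A x) = par x \<longleftrightarrow> odd (G x)" "x \<in> X \<Longrightarrow> par (B x) \<noteq> par x"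
begin

definition f :: "'a \<Rightarrow> 'a" where
  "f x = B (A x)"

primrec wsum :: "'a \<Rightarrow> nat \<Rightarrow> int" where
  "wsum x 0 = 0"
| "wsum x (Suc n) = G x \<oplus> wsum (f x) n"

definition period :: "'a \<Rightarrow> nat" where
  "period x = (LEAST n. 0 < n \<and> (f ^^ n) x = x)"

definition orb :: "'a \<Rightarrow> 'a set" where
  "orb x = range (\<lambda>n. (f ^^ n) x)"

definition loop_of :: "'a \<Rightarrow> 'a set" where
  "loop_of x = orb x \<union> orb (A x)"

text \<open>The holonomy of a loop. Its starting point and its direction of travel affect only the
  sign.\<close>

definition hol :: "'a \<Rightarrow> int" where
  "hol x = wsum x (period x)"

definition comps :: "'a set set" where
  "comps = loop_of ` X"

definition zcomp :: "'a set \<Rightarrow> ra" where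
  "zcomp C = zval (hol (SOME x. x \<in> C))"

definition val :: "'a set \<Rightarrow> ra" where
  "val S = (\<Prod>C | C \<in> comps \<and> C \<subseteq> S. zcomp C)"

lemma f_in: "x \<in> X \<Longrightarrow> f x \<in> X"
  using A B by (simp add: f_def)

lemma fn_in: "x \<in> X \<Longrightarrow> (f ^^ n) x \<in> X"
  by (induction n) (auto simp: f_in)

lemma f_inj: "x \<in> X \<Longrightarrow> y \<in> X \<Longrightarrow> f x = f y \<Longrightarrow> x = y"
  unfolding f_def using A B by metis

lemma fn_inj: "x \<in> X \<Longrightarrow> y \<in> X \<Longrightarrow> (f ^^ n) x = (f ^^ n) y \<Longrightarrow> x = y"
proof (induction n)
  case (Suc n)
  then show ?case using f_inj[OF fn_in fn_in] by simp
qed simp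

lemma period_ex:
  assumes "x \<in> X" shows "\<exists>n>0. (f ^^ n) x = x"
proof -
  have "\<not> inj_on (\<lambda>n. (f ^^ n) x) UNIV"
  proof
    assume "inj_on (\<lambda>n. (f ^^ n) x) UNIV"
    moreover have "range (\<lambda>n. (f ^^ n) x) \<subseteq> X" using fn_in assms by auto
    ultimately show False using finite finite_subset infinite_UNIV_nat finite_imageD by metis
  qed
  then obtain i j where "i \<noteq> j" "(f ^^ i) x = (f ^^ j) x" by (auto simp: inj_on_def)
  then obtain i d where d: "0 < d" "(f ^^ (i + d)) x = (f ^^ i) x"
    by (metis add_diff_inverse_nat linorder_neqE_nat not_less_iff_gr_or_eq zero_less_diff)
  then have "(f ^^ i) ((f ^^ d) x) = (f ^^ i) x" by (simp add: funpow_add)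
  then have "(f ^^ d) x = x" using fn_inj assms fn_in by blast
  then show ?thesis using d(1) by blast
qed

lemma period: assumes "x \<in> X" shows "0 < period x" "(f ^^ period x) x = x"
  using LeastI_ex[OF period_ex[OF assms]] unfolding period_def by blast+

lemma period_least: "0 < n \<Longrightarrow> (f ^^ n) x = x \<Longrightarrow> period x \<le> n"
  unfolding period_def by (rule Least_le) simp

lemma period_eqI: "0 < n \<Longrightarrow> (f ^^ n) x = x \<Longrightarrow> (\<And>j. 0 < j \<Longrightarrow> j < n \<Longrightarrow> (f ^^ j) x \<noteq> x) \<Longrightarrow> period x = n"
  unfolding period_def by (rule Least_equality) (auto simp: not_less[symmetric])

lemma fn_shift: "(f ^^ n) (f x) = f ((f ^^ n) x)"
  by (metis funpow_swap1)

lemma orb_f: assumes "x \<in> X" shows "orb (f x) = orb x"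
proof
  show "orb (f x) \<subseteq> orb x"
  proof -
    have "(f ^^ n) (f x) \<in> range (\<lambda>n. (f ^^ n) x)" for n
      using rangeI[of "\<lambda>n. (f ^^ n) x" "Suc n"] by (simp add: fn_shift)
    then show ?thesis unfolding orb_def by blast
  qed
  have "x = (f ^^ (period x - 1)) (f x)"
    using period[OF assms] by (metis Suc_diff_1 funpow_simps_right(2) o_apply)
  then have "(f ^^ n) x = (f ^^ (n + (period x - 1))) (f x)" for n
    by (metis funpow_add o_apply)
  then show "orb x \<subseteq> orb (f x)" unfolding orb_def by blast
qed

lemma orb_fn: "x \<in> X \<Longrightarrow> orb ((f ^^ n) x) = orb x"
  by (induction n) (auto simp: orb_f fn_in)

lemma f_A_f: "x \<in> X \<Longrightarrow> f (A (f x)) = A x"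
  unfolding f_def using A B by simp

lemma comp_f: assumes "x \<in> X" shows "loop_of (f x) = loop_of x"
proof -
  have "orb (A (f x)) = orb (A x)"
    using orb_f[of "A (f x)"] f_A_f[OF assms] A f_in assms by simp
  then show ?thesis unfolding loop_of_def using orb_f[OF assms] by simp
qed

lemma comp_fn: "x \<in> X \<Longrightarrow> loop_of ((f ^^ n) x) = loop_of x"
  by (induction n) (auto simp: comp_f fn_in)

lemma comp_A: "x \<in> X \<Longrightarrow> loop_of (A x) = loop_of x"
  unfolding loop_of_def using A by auto

lemma comp_B: "x \<in> X \<Longrightarrow> loop_of (B x) = loop_of x"
  using comp_f[of "A x"] comp_A[of x] A unfolding f_def by simp

lemma comp_self: "x \<in> loop_of x"
  unfolding loop_of_def orb_def by (auto intro: range_eqI[of _ _ 0])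

lemma comp_eq: assumes "y \<in> loop_of x" "x \<in> X" shows "loop_of y = loop_of x"
proof -
  obtain n where "y = (f ^^ n) x \<or> y = (f ^^ n) (A x)" using assms(1) unfolding loop_of_def orb_def by blast
  then show ?thesis using comp_fn comp_A A(1) assms(2) by metis
qed

lemma comp_subset: "x \<in> X \<Longrightarrow> loop_of x \<subseteq> X"
  unfolding loop_of_def orb_def using fn_in A by auto

lemma wsum_add: "wsum x (m + n) = wsum x m \<oplus> wsum ((f ^^ m) x) n"
  by (induction m arbitrary: x) (simp_all add: dop_assoc funpow_swap1)

lemma par_f: "x \<in> X \<Longrightarrow> par (f x) = par x \<longleftrightarrow> even (G x)"
  unfolding f_def using par A by metis

lemma wsum_even: "x \<in> X \<Longrightarrow> even (wsum x n) \<longleftrightarrow> par ((f ^^ n) x) = par x"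
proof (induction n arbitrary: x)
  case (Suc n)
  have "(f ^^ Suc n) x = (f ^^ n) (f x)" by (simp add: funpow_swap1)
  then show ?case using Suc.IH[OF f_in[OF Suc.prems]] par_f[OF Suc.prems] by auto
qed simp

lemma hol_even: "x \<in> X \<Longrightarrow> even (hol x)"
  unfolding hol_def using wsum_even period by metis

lemma period_f: assumes "x \<in> X" shows "period (f x) = period x"
proof (rule period_eqI)
  show "0 < period x" "(f ^^ period x) (f x) = f x" using period[OF assms] by (simp_all add: fn_shift)
  fix j assume j: "0 < j" "j < period x"
  show "(f ^^ j) (f x) \<noteq> f x"
  proof
    assume "(f ^^ j) (f x) = f x"
    then have "(f ^^ j) x = x" using f_inj fn_in assms by (simp add: fn_shift)
    then show False using period_least[OF j(1), of x] j(2) by simp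
  qed
qed

text \<open>Moving the starting point conjugates the holonomy by the label of one strand, and
  conjugation changes an even element of the dihedral group at most by a sign.\<close>

lemma abs_hol_f: assumes "x \<in> X" shows "\<bar>hol (f x)\<bar> = \<bar>hol x\<bar>"
proof -
  let ?n = "period x"
  have "G x \<oplus> wsum (f x) ?n = wsum x ?n \<oplus> G x"
    using wsum_add[of x ?n 1] wsum_add[of x 1 ?n] period[OF assms] by (simp add: add.commute)
  moreover have "even (wsum x ?n)" "even (wsum (f x) ?n)"
    using hol_even[OF assms] hol_even[OF f_in[OF assms]] period_f[OF assms] unfolding hol_def by simp_all
  ultimately have "wsum (f x) ?n = wsum x ?n \<or> wsum (f x) ?n = - wsum x ?n"
    by (auto simp: dop_def split: if_splits)
  then show ?thesis unfolding hol_def period_f[OF assms] by auto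
qed

lemma fn_A_fn: "x \<in> X \<Longrightarrow> (f ^^ n) (A ((f ^^ n) x)) = A x"
proof (induction n)
  case (Suc n)
  have "(f ^^ Suc n) (A ((f ^^ Suc n) x)) = (f ^^ n) (f (A (f ((f ^^ n) x))))"
    by (simp add: fn_shift)
  then show ?case using f_A_f[OF fn_in[OF Suc.prems]] Suc by simp
qed simp

text \<open>The way back from \<open>A ((f ^^ n) x)\<close> runs over the strands entered at
  \<open>f x\<close>, ..., \<open>(f ^^ n) x\<close>, which explains the shift by one on the
  right-hand side.\<close>

lemma wsum_A: "x \<in> X \<Longrightarrow> wsum (A ((f ^^ n) x)) n = drev (wsum (f x) n)"
proof (induction n)
  case (Suc n)
  have "wsum (A ((f ^^ Suc n) x)) (Suc n) = G (A (f ((f ^^ n) x))) \<oplus> wsum (A ((f ^^ n) x)) n"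
    using f_A_f[OF fn_in[OF Suc.prems], of n] by simp
  moreover have "wsum (f x) (Suc n) = wsum (f x) n \<oplus> G (f ((f ^^ n) x))"
    using wsum_add[of "f x" n 1] by (simp add: fn_shift)
  ultimately show ?case using Suc G[OF f_in[OF fn_in[OF Suc.prems]]] by (simp add: drev_dop)
qed simp

lemma period_A: assumes "x \<in> X" shows "period (A x) = period x"
proof -
  have le: "period (A x) \<le> period x" if "x \<in> X" for x
    by (rule period_least) (use fn_A_fn[OF that, of "period x"] period[OF that] in auto)
  show ?thesis using le[OF assms] le[OF A(1)[OF assms]] A(2)[OF assms] by simp
qed

lemma abs_hol_A: assumes "x \<in> X" shows "\<bar>hol (A x)\<bar> = \<bar>hol x\<bar>"
proof -
  have "hol (A x) = drev (wsum (f x) (period x))"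
    using wsum_A[OF assms, of "period x"] period[OF assms] period_A[OF assms] unfolding hol_def by simp
  then have "\<bar>hol (A x)\<bar> = \<bar>hol (f x)\<bar>" unfolding hol_def period_f[OF assms] by simp
  then show ?thesis using abs_hol_f[OF assms] by simp
qed

lemma abs_hol_comp: assumes "y \<in> loop_of x" "x \<in> X" shows "\<bar>hol y\<bar> = \<bar>hol x\<bar>"
proof -
  have n: "\<bar>hol ((f ^^ n) x)\<bar> = \<bar>hol x\<bar>" if "x \<in> X" for n x
    using that by (induction n) (auto simp: abs_hol_f fn_in)
  obtain n where "y = (f ^^ n) x \<or> y = (f ^^ n) (A x)" using assms(1) unfolding loop_of_def orb_def by blast
  then show ?thesis using n[OF assms(2)] n[OF A(1)[OF assms(2)]] abs_hol_A[OF assms(2)] by metis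
qed

lemma zcomp: "x \<in> X \<Longrightarrow> zcomp (loop_of x) = zval (hol x)"
  unfolding zcomp_def zval_def using abs_hol_comp someI[of "\<lambda>y. y \<in> loop_of x", OF comp_self] by metis

lemma val_empty: "val {} = 1"
proof -
  have "{C. C \<in> comps \<and> C \<subseteq> {}} = {}" unfolding comps_def using comp_self by fastforce
  then show ?thesis unfolding val_def by (simp only: prod.empty)
qed

lemma finite_comps: "finite comps"
  unfolding comps_def using finite by simp

lemma val_X: "val X = (\<Prod>C\<in>comps. zcomp C)"
proof -
  have "{C. C \<in> comps \<and> C \<subseteq> X} = comps" unfolding comps_def using comp_subset by auto
  then show ?thesis unfolding val_def by simp
qed

lemma val_cong: "(\<And>x. x \<in> X \<Longrightarrow> loop_of x \<subseteq> S \<longleftrightarrow> loop_of x \<subseteq> T) \<Longrightarrow> val S = val T"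
  unfolding val_def comps_def by (rule prod.cong) auto

text \<open>The part \<open>S\<close> of the loops has been traversed already; the remaining ends \<open>\<phi> x\<close> are joined in
  pairs by paths through \<open>S\<close>.\<close>
definition inv_at :: "(nat \<Rightarrow> 'a) \<Rightarrow> nat set \<Rightarrow> (nat \<Rightarrow> nat) \<Rightarrow> (nat \<Rightarrow> int) \<Rightarrow> 'a set \<Rightarrow> bool" where
  "inv_at \<phi> N A' g S \<longleftrightarrow> inj_on \<phi> N \<and> \<phi> ` N \<subseteq> X \<and> S \<subseteq> X \<and> \<phi> ` N \<inter> S = {} \<and>
     (\<forall>x\<in>N. A' x \<in> N \<and> A' (A' x) = x \<and> A' x \<noteq> x) \<and>
     (\<forall>x\<in>N. \<exists>n>0. (f ^^ n) (\<phi> x) = B (\<phi> (A' x)) \<and> (\<forall>j. 0 < j \<longrightarrow> j < n \<longrightarrow> (f ^^ j) (\<phi> x) \<in> S) \<and>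
       wsum (\<phi> x) n = g x)"

lemma inv_atD:
  assumes "inv_at \<phi> N A' g S" "x \<in> N"
  shows "\<phi> x \<in> X" "\<phi> x \<notin> S" "A' x \<in> N" "A' (A' x) = x" "A' x \<noteq> x"
  using assms unfolding inv_at_def by blast+

lemma inv_at_path:
  assumes "inv_at \<phi> N A' g S" "x \<in> N"
  obtains n where "0 < n" "(f ^^ n) (\<phi> x) = B (\<phi> (A' x))"
    "\<And>j. 0 < j \<Longrightarrow> j < n \<Longrightarrow> (f ^^ j) (\<phi> x) \<in> S" "wsum (\<phi> x) n = g x"
  using assms unfolding inv_at_def by blast

lemma comp_partner:
  assumes "inv_at \<phi> N A' g S" "x \<in> N"
  shows "loop_of (\<phi> (A' x)) = loop_of (\<phi> x)"
proof -
  obtain n where "(f ^^ n) (\<phi> x) = B (\<phi> (A' x))" using inv_at_path[OF assms] by blast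
  then show ?thesis
    using comp_fn[OF inv_atD(1)[OF assms], of n] comp_B inv_atD(1)[OF assms(1) inv_atD(3)[OF assms]] by metis
qed

lemma inv_at_open:
  assumes "inv_at \<phi> N A' g S" "a \<notin> N" "b \<notin> N" "a \<noteq> b" 
    and "p \<in> X" "A p = q" "p \<notin> \<phi> ` N" "q \<notin> \<phi> ` N" "p \<notin> S" "q \<notin> S" "G p = 0"
  shows "inv_at (\<phi>(a := p, b := q)) (insert a (insert b N)) (A'(a := b, b := a)) (g(a := 0, b := 0)) S"
proof -
  let ?\<phi> = "\<phi>(a := p, b := q)"
  have q: "q \<in> X" "A q = p" "q \<noteq> p" "G q = 0" using assms A G[of p] by auto
  have im: "?\<phi> ` insert a (insert b N) = insert p (insert q (\<phi> ` N))"
    using assms(2-4) by auto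
  have w: "x \<noteq> a" "x \<noteq> b" "A' x \<noteq> a" "A' x \<noteq> b" if "x \<in> N" for x
    using inv_atD(3)[OF assms(1) that] that assms(2,3) by auto
  have "inj_on \<phi> N" using assms(1) unfolding inv_at_def by blast
  then have inj: "inj_on ?\<phi> (insert a (insert b N))"
    using assms(2-4,7,8) q(3) by (auto simp: inj_on_def)
  show ?thesis unfolding inv_at_def im
  proof (intro conjI inj ballI)
    show "insert p (insert q (\<phi> ` N)) \<subseteq> X" "insert p (insert q (\<phi> ` N)) \<inter> S = {}" "S \<subseteq> X"
      using assms q unfolding inv_at_def by auto
    fix x assume "x \<in> insert a (insert b N)"
    then consider "x = a" | "x = b" | "x \<in> N" by blast
    note x = this
    show "(A'(a := b, b := a)) x \<in> insert a (insert b N)"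
      using x by cases (use assms(4) w inv_atD(3)[OF assms(1)] in auto)
    show "(A'(a := b, b := a)) ((A'(a := b, b := a)) x) = x"
      using x by cases (use assms(4) w inv_atD(4)[OF assms(1)] in auto)
    show "(A'(a := b, b := a)) x \<noteq> x"
      using x by cases (use assms(4) w inv_atD(5)[OF assms(1)] in auto)
    show "\<exists>n>0. (f ^^ n) (?\<phi> x) = B (?\<phi> ((A'(a := b, b := a)) x)) \<and>
        (\<forall>j. 0 < j \<longrightarrow> j < n \<longrightarrow> (f ^^ j) (?\<phi> x) \<in> S) \<and> wsum (?\<phi> x) n = (g(a := 0, b := 0)) x"
      using x
    proof cases
      case 3
      obtain n where "0 < n" "(f ^^ n) (\<phi> x) = B (\<phi> (A' x))"
        "\<And>j. 0 < j \<Longrightarrow> j < n \<Longrightarrow> (f ^^ j) (\<phi> x) \<in> S" "wsum (\<phi> x) n = g x"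
        using inv_at_path[OF assms(1) 3] by blast
      then show ?thesis using w[OF 3] by (intro exI[of _ n]) simp
    qed (use assms q in \<open>auto intro!: exI[of _ 1] simp: f_def\<close>)
  qed
qed

text \<open>Every path grows by one strand at both ends. A loop that meets the newly traversed part
  also contains some \<open>\<psi> x\<close>, which lies outside \<open>T\<close>; so no loop is
  completed.\<close>

lemma inv_at_extend:
  assumes i: "inv_at \<phi> N A' g S"
    and \<psi>: "\<And>x. x \<in> N \<Longrightarrow> \<psi> x \<in> X" "\<And>x. x \<in> N \<Longrightarrow> A (\<psi> x) = B (\<phi> x)" "inj_on \<psi> N"
    and T: "T = S \<union> \<phi> ` N \<union> (\<lambda>x. B (\<phi> x)) ` N" and d: "\<psi> ` N \<inter> T = {}"
  shows "inv_at \<psi> N A' (\<lambda>x. G (\<psi> x) \<oplus> (g x \<oplus> G (B (\<phi> (A' x))))) T"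
    and "val T = val S"
proof -
  have f\<psi>: "f (\<psi> x) = \<phi> x" if "x \<in> N" for x
    unfolding f_def using \<psi>(2)[OF that] B(2) inv_atD(1)[OF i that] by simp
  have A\<psi>: "A (B (\<phi> x)) = \<psi> x" if "x \<in> N" for x
    using \<psi>(1,2)[OF that] A(2) by metis
  show "inv_at \<psi> N A' (\<lambda>x. G (\<psi> x) \<oplus> (g x \<oplus> G (B (\<phi> (A' x))))) T"
    unfolding inv_at_def
  proof (intro conjI \<psi>(3) d ballI)
    show "\<psi> ` N \<subseteq> X" using \<psi>(1) by auto
    have "S \<subseteq> X" using i unfolding inv_at_def by blast
    then show "T \<subseteq> X" unfolding T using inv_atD(1)[OF i] B(1) by auto
    fix x assume x: "x \<in> N"
    show "A' x \<in> N" "A' (A' x) = x" "A' x \<noteq> x" using inv_atD[OF i x] by blast+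
    note x' = \<open>A' x \<in> N\<close>
    obtain n where n: "0 < n" "(f ^^ n) (\<phi> x) = B (\<phi> (A' x))"
        "\<And>j. 0 < j \<Longrightarrow> j < n \<Longrightarrow> (f ^^ j) (\<phi> x) \<in> S" "wsum (\<phi> x) n = g x"
      using inv_at_path[OF i x] by blast
    have Suc: "(f ^^ Suc j) (\<psi> x) = (f ^^ j) (\<phi> x)" for j
      using f\<psi>[OF x] by (simp add: fn_shift[symmetric])
    have last: "f (B (\<phi> (A' x))) = B (\<psi> (A' x))" unfolding f_def using A\<psi>[OF x'] by simp
    show "\<exists>n>0. (f ^^ n) (\<psi> x) = B (\<psi> (A' x)) \<and> (\<forall>j. 0 < j \<longrightarrow> j < n \<longrightarrow> (f ^^ j) (\<psi> x) \<in> T) \<and>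
        wsum (\<psi> x) n = G (\<psi> x) \<oplus> (g x \<oplus> G (B (\<phi> (A' x))))"
    proof (intro exI[of _ "Suc (Suc n)"] conjI allI impI)
      show "(f ^^ Suc (Suc n)) (\<psi> x) = B (\<psi> (A' x))" unfolding Suc using n(2) last by simp
      show "wsum (\<psi> x) (Suc (Suc n)) = G (\<psi> x) \<oplus> (g x \<oplus> G (B (\<phi> (A' x))))"
        using wsum_add[of "\<phi> x" n 1] n(2,4) f\<psi>[OF x] by simp
      fix j assume "0 < j" "j < Suc (Suc n)"
      then obtain k where k: "j = Suc k" "k \<le> n" by (cases j) auto
      consider "k = 0" | "0 < k" "k < n" | "k = n" using k by linarith
      then have "(f ^^ k) (\<phi> x) \<in> T"
        by cases (use x x' n in \<open>auto simp: T\<close>)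
      then show "(f ^^ j) (\<psi> x) \<in> T" unfolding k Suc .
    qed simp
  qed
  show "val T = val S"
  proof (rule val_cong)
    fix y assume y: "y \<in> X"
    show "loop_of y \<subseteq> T \<longleftrightarrow> loop_of y \<subseteq> S"
    proof
      assume *: "loop_of y \<subseteq> T"
      show "loop_of y \<subseteq> S"
      proof
        fix u assume u: "u \<in> loop_of y"
        show "u \<in> S"
        proof (rule ccontr)
          assume "u \<notin> S"
          then obtain x where x: "x \<in> N" "u = \<phi> x \<or> u = B (\<phi> x)" using * u unfolding T by blast
          have uX: "u \<in> X" using u y comp_subset by blast
          have c: "loop_of u = loop_of y" by (rule comp_eq[OF u y])
          have "loop_of (\<psi> x) = loop_of (\<phi> x)"
            using comp_f[OF \<psi>(1)[OF x(1)]] f\<psi>[OF x(1)] by simp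
          then have "loop_of (\<psi> x) = loop_of y" using x(2) c comp_B inv_atD(1)[OF i x(1)] by metis
          then show False using * comp_self[of "\<psi> x"] d x(1) by auto
        qed
      qed
    qed (auto simp: T)
  qed
qed

text \<open>Two ends are joined. The number \<open>r\<close> counts the strands between them: 0 if
  they are glued directly, as by the closing arcs of a tangle, and 1 if a right extremum of label 0
  lies between them.\<close>

lemma inv_at_close:
  assumes i: "inv_at \<phi> N A' g S" and xy: "x \<in> N" "y \<in> N" "x \<noteq> y"
    and r: "(f ^^ r) (B (\<phi> x)) = \<phi> y" "(f ^^ r) (B (\<phi> y)) = \<phi> x"
      "r = 0 \<or> r = 1 \<and> G (B (\<phi> x)) = 0 \<and> G (B (\<phi> y)) = 0 \<and> B (\<phi> x) \<notin> \<phi> ` N \<and> B (\<phi> y) \<notin> \<phi> ` N"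
    and T: "T = S \<union> {\<phi> x, \<phi> y, B (\<phi> x), B (\<phi> y)}"
  shows "inv_at \<phi> (N - {x, y}) (A'(A' x := A' y, A' y := A' x))
      (g(A' x := g (A' x) \<oplus> g y, A' y := g (A' y) \<oplus> g x)) T"
    and "val T = val S * (if A' x = y then zval (g x) else 1)"
proof -
  note D = inv_atD[OF i]
  have inj: "inj_on \<phi> N" using i unfolding inv_at_def by blast
  have w0: "wsum (B (\<phi> x)) r = 0" "wsum (B (\<phi> y)) r = 0" using r(3) by auto
  have MX: "T \<subseteq> X" unfolding T using i D(1) B(1) xy unfolding inv_at_def by auto
  have Bn: "B (\<phi> x) \<notin> \<phi> ` (N - {x, y})" "B (\<phi> y) \<notin> \<phi> ` (N - {x, y})"
    using r inj xy by (auto simp: inj_on_def)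
  have Tn: "\<phi> u \<notin> T" if "u \<in> N - {x, y}" for u
  proof -
    have "\<phi> u \<noteq> \<phi> x" "\<phi> u \<noteq> \<phi> y"
      using inj_onD[OF inj, of u x] inj_onD[OF inj, of u y] that xy by blast+
    moreover have "\<phi> u \<noteq> B (\<phi> x)" "\<phi> u \<noteq> B (\<phi> y)"
      using Bn that by (metis imageI)+
    moreover have "\<phi> u \<notin> S" using D(2) that by blast
    ultimately show ?thesis unfolding T by blast
  qed
  let ?A = "A'(A' x := A' y, A' y := A' x)"
  let ?g = "g(A' x := g (A' x) \<oplus> g y, A' y := g (A' y) \<oplus> g x)"
  have ne: "A' x \<noteq> A' y" using D(4) xy by metis
  \<comment> \<open>The merged path runs from the far end of the first arc to \<open>u\<close>,
    across the junction, and from \<open>v\<close> to the far end of the second arc.\<close>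
  have long: "\<exists>n>0. (f ^^ n) (\<phi> (A' u)) = B (\<phi> (A' v)) \<and>
      (\<forall>j. 0 < j \<longrightarrow> j < n \<longrightarrow> (f ^^ j) (\<phi> (A' u)) \<in> T) \<and> wsum (\<phi> (A' u)) n = g (A' u) \<oplus> g v"
    if uv: "u \<in> N" "v \<in> N" "(f ^^ r) (B (\<phi> u)) = \<phi> v" "wsum (B (\<phi> u)) r = 0" "\<phi> v \<in> T" "B (\<phi> u) \<in> T" for u v
  proof -
    obtain n where n: "0 < n" "(f ^^ n) (\<phi> (A' u)) = B (\<phi> u)"
        "\<And>j. 0 < j \<Longrightarrow> j < n \<Longrightarrow> (f ^^ j) (\<phi> (A' u)) \<in> S" "wsum (\<phi> (A' u)) n = g (A' u)"
      using inv_at_path[OF i D(3)[OF uv(1)]] D(4)[OF uv(1)] by metis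
    obtain m where m: "0 < m" "(f ^^ m) (\<phi> v) = B (\<phi> (A' v))"
        "\<And>j. 0 < j \<Longrightarrow> j < m \<Longrightarrow> (f ^^ j) (\<phi> v) \<in> S" "wsum (\<phi> v) m = g v"
      using inv_at_path[OF i uv(2)] by blast
    have nr: "(f ^^ (n + r)) (\<phi> (A' u)) = \<phi> v"
      using n(2) uv(3) by (metis add.commute funpow_add o_apply)
    have nrj: "(f ^^ (n + r + j)) (\<phi> (A' u)) = (f ^^ j) (\<phi> v)" for j
      using nr by (metis add.commute funpow_add o_apply)
    show ?thesis
    proof (intro exI[of _ "n + r + m"] conjI allI impI)
      show "0 < n + r + m" using n by simp
      show "(f ^^ (n + r + m)) (\<phi> (A' u)) = B (\<phi> (A' v))" unfolding nrj by (rule m(2))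
      show "wsum (\<phi> (A' u)) (n + r + m) = g (A' u) \<oplus> g v"
        unfolding wsum_add[of _ "n + r"] wsum_add[of _ n] nr n(2,4) uv(4) m(4) by simp
      fix j assume j: "0 < j" "j < n + r + m"
      consider "j < n" | "j = n" | "j = n + r" | k where "j = n + r + k" "0 < k" "k < m" 
        using j r(3) by (metis add_diff_inverse_nat linorder_neqE_nat nat_add_left_cancel_less
            neq0_conv add.right_neutral less_Suc_eq Suc_eq_plus1)
      then show "(f ^^ j) (\<phi> (A' u)) \<in> T"
      proof cases
        case 1
        then show ?thesis using n(3)[OF j(1)] T by simp
      next
        case 2
        then show ?thesis using n(2) uv(6) by simp
      next
        case 3
        then show ?thesis using nr uv(5) by simp
      next
        case (4 k)
        then show ?thesis using nrj m(3) T by simp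
      qed
    qed
  qed
  show "inv_at \<phi> (N - {x, y}) ?A ?g T"
    unfolding inv_at_def
  proof (intro conjI ballI)
    show "inj_on \<phi> (N - {x, y})" using inj by (rule inj_on_subset) auto
    show "\<phi> ` (N - {x, y}) \<subseteq> X" using D(1) by auto
    show "T \<subseteq> X" by (rule MX)
    show "\<phi> ` (N - {x, y}) \<inter> T = {}" using Tn by auto
    fix u assume u: "u \<in> N - {x, y}"
    then have uN: "u \<in> N" "u \<noteq> x" "u \<noteq> y" by auto
    consider "u = A' x" "A' x \<noteq> y" "A' y \<noteq> x" | "u = A' y" "A' x \<noteq> y" "A' y \<noteq> x"
      | "u \<noteq> A' x" "u \<noteq> A' y" "A' u \<noteq> x" "A' u \<noteq> y" "A' u \<noteq> A' x" "A' u \<noteq> A' y"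
      using D(4)[OF uN(1)] D(4)[OF xy(1)] D(4)[OF xy(2)] uN by metis
    note c = this
    show "?A u \<in> N - {x, y}"
      using c by cases (use D(3,5)[OF xy(1)] D(3,5)[OF xy(2)] D(3)[OF uN(1)] ne in auto)
    show "?A (?A u) = u"
      using c by cases (use D(4)[OF uN(1)] ne in auto)
    show "?A u \<noteq> u"
      using c by cases (use D(5)[OF uN(1)] ne in auto)
    show "\<exists>n>0. (f ^^ n) (\<phi> u) = B (\<phi> (?A u)) \<and>
        (\<forall>j. 0 < j \<longrightarrow> j < n \<longrightarrow> (f ^^ j) (\<phi> u) \<in> T) \<and> wsum (\<phi> u) n = ?g u"
      using c
    proof cases
      case 1
      then show ?thesis using long[OF xy(1,2) r(1) w0(1)] ne T by simp
    next
      case 2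
      then show ?thesis using long[OF xy(2,1) r(2) w0(2)] ne T by simp
    next
      case 3
      obtain n where "0 < n" "(f ^^ n) (\<phi> u) = B (\<phi> (A' u))"
          "\<And>j. 0 < j \<Longrightarrow> j < n \<Longrightarrow> (f ^^ j) (\<phi> u) \<in> S" "wsum (\<phi> u) n = g u"
        using inv_at_path[OF i uN(1)] by blast
      then show ?thesis using 3 T by (intro exI[of _ n]) auto
    qed
  qed
  \<comment> \<open>A loop completed by this junction passes through one of the two joined
    ends.\<close>
  have meet: "loop_of u = loop_of (\<phi> x) \<or> loop_of u = loop_of (\<phi> y)" if uT: "u \<in> X" "loop_of u \<subseteq> T" "\<not> loop_of u \<subseteq> S" for u
  proof -
    obtain v where v: "v \<in> loop_of u" "v \<in> {\<phi> x, \<phi> y, B (\<phi> x), B (\<phi> y)}" using uT T by blast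
    then show ?thesis using comp_eq[OF v(1) uT(1)] comp_B D(1) xy by auto
  qed
  have Tcases: "val T = val S" if *: "\<And>u. u \<in> X \<Longrightarrow> loop_of u \<subseteq> T \<Longrightarrow> loop_of u \<subseteq> S"
    by (rule val_cong) (use * T in auto)
  show "val T = val S * (if A' x = y then zval (g x) else 1)"
  proof (cases "A' x = y")
    case False
    have yx: "A' y \<noteq> x" using False D(4) xy by metis
    \<comment> \<open>If two different arcs are merged, such a loop would contain an outer end of
      the merged arc, and these ends are not yet traversed.\<close>
    have "loop_of u \<subseteq> S" if "u \<in> X" "loop_of u \<subseteq> T" for u
    proof (rule ccontr)
      assume "\<not> loop_of u \<subseteq> S"
      then have "\<phi> (A' x) \<in> loop_of u \<or> \<phi> (A' y) \<in> loop_of u"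
        using meet[OF that] comp_partner[OF i xy(1)] comp_partner[OF i xy(2)] comp_self by metis
      moreover have "A' x \<in> N - {x, y}" "A' y \<in> N - {x, y}"
        using False yx D(3,5) xy by auto
      ultimately show False using Tn that(2) by blast
    qed
    then show ?thesis using Tcases False by simp
  next
    case True
    have yx: "A' y = x" using True D(4) xy by metis
    \<comment> \<open>Here the arc and the junction form a loop. No earlier return is possible:
      inside the arc all points lie in \<open>S\<close>, while the starting end does not.\<close>
    have loop: "orb (\<phi> u) \<subseteq> T \<and> (\<exists>n>0. period (\<phi> u) = n + r \<and> wsum (\<phi> u) (n + r) = g u)"
      if uv: "u \<in> N" "v \<in> N" "u \<noteq> v" "A' u = v" "(f ^^ r) (B (\<phi> v)) = \<phi> u" "wsum (B (\<phi> v)) r = 0"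
        "\<phi> u \<in> T" "B (\<phi> v) \<in> T" "r = 1 \<longrightarrow> B (\<phi> v) \<noteq> \<phi> u" for u v
    proof -
      obtain n where n: "0 < n" "(f ^^ n) (\<phi> u) = B (\<phi> v)"
          "\<And>j. 0 < j \<Longrightarrow> j < n \<Longrightarrow> (f ^^ j) (\<phi> u) \<in> S" "wsum (\<phi> u) n = g u"
        using inv_at_path[OF i uv(1)] uv(4) by metis
      have nr: "(f ^^ (n + r)) (\<phi> u) = \<phi> u"
        using n(2) uv(5) by (metis add.commute funpow_add o_apply)
      have mid: "(f ^^ j) (\<phi> u) \<in> T \<and> (f ^^ j) (\<phi> u) \<noteq> \<phi> u" if "0 < j" "j < n + r" for j
      proof (cases "j < n")
        case True
        then show ?thesis using n(3)[OF that(1)] T D(2)[OF uv(1)] by auto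
      next
        case False
        then have "j = n" "r = 1" using that r(3) by auto
        then show ?thesis using n(2) uv by auto
      qed
      have p: "period (\<phi> u) = n + r"
        by (rule period_eqI) (use n(1) nr mid in auto)
      have "(f ^^ j) (\<phi> u) \<in> T" for j
      proof -
        have "(f ^^ j) (\<phi> u) = (f ^^ (j mod (n + r))) (\<phi> u)"
          by (rule funpow_mod_eq[OF nr, symmetric])
        moreover have "j mod (n + r) < n + r" using n(1) by simp
        ultimately show ?thesis using mid[of "j mod (n + r)"] uv(7)
          by (cases "j mod (n + r) = 0") auto
      qed
      moreover have "wsum (\<phi> u) (n + r) = g u" unfolding wsum_add n(2,4) uv(6) by simp
      ultimately show ?thesis using p n(1) unfolding orb_def by auto
    qed
    have r1: "r = 1 \<longrightarrow> B (\<phi> y) \<noteq> \<phi> x \<and> B (\<phi> x) \<noteq> \<phi> y" using r(3) xy by auto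
    have lx: "orb (\<phi> x) \<subseteq> T" "hol (\<phi> x) = g x"
      using loop[OF xy True r(2) w0(2)] r1 T unfolding hol_def by auto
    have ly: "orb (\<phi> y) \<subseteq> T"
      using loop[OF xy(2,1) _ yx r(1) w0(1)] r1 T xy by auto
    have "orb (A (\<phi> x)) = orb (\<phi> y)"
      using orb_f[OF A(1)[OF D(1)[OF xy(1)]]] orb_fn[OF B(1)[OF D(1)[OF xy(1)]], of r] r(1) A(2)[OF D(1)[OF xy(1)]]
      unfolding f_def by simp
    then have C: "loop_of (\<phi> x) \<subseteq> T" using lx ly unfolding loop_of_def by simp
    have nS: "\<not> loop_of (\<phi> x) \<subseteq> S" using comp_self D(2)[OF xy(1)] by blast
    have "loop_of (\<phi> y) = loop_of (\<phi> x)" using comp_partner[OF i xy(1)] True by simp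
    note yx = this
    have "{C. C \<in> comps \<and> C \<subseteq> T} = insert (loop_of (\<phi> x)) {C. C \<in> comps \<and> C \<subseteq> S}"
    proof (intro equalityI subsetI)
      fix C assume "C \<in> {C. C \<in> comps \<and> C \<subseteq> T}"
      then obtain u where u: "u \<in> X" "C = loop_of u" "loop_of u \<subseteq> T" unfolding comps_def by blast
      then show "C \<in> insert (loop_of (\<phi> x)) {C. C \<in> comps \<and> C \<subseteq> S}"
        using meet[OF u(1,3)] yx unfolding comps_def by auto
    next
      fix C assume "C \<in> insert (loop_of (\<phi> x)) {C. C \<in> comps \<and> C \<subseteq> S}"
      moreover have "loop_of (\<phi> x) \<in> comps" using D(1)[OF xy(1)] unfolding comps_def by blast
      moreover have "S \<subseteq> T" unfolding T by blast
      ultimately show "C \<in> {C. C \<in> comps \<and> C \<subseteq> T}" using \<open>loop_of (\<phi> x) \<subseteq> T\<close> by blast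
    qed
    then have "val T = zcomp (loop_of (\<phi> x)) * val S"
      unfolding val_def using finite_comps nS by simp
    then show ?thesis using True zcomp[OF D(1)[OF xy(1)]] lx(2) by simp
  qed
qed

end

section \<open>The loops of a diagram\<close>

fun piece_label :: "piece \<Rightarrow> bool \<times> nat \<Rightarrow> int" where
  "piece_label (Cusp j s) (r, i) = (if i = j then if (s = Above) \<noteq> r then 1 else -1 else 0)"
| "piece_label _ _ = 0"

text \<open>Whether a traveller who enters the piece at this end moves along the orientation of the
  strand.\<close>

fun forward :: "dir list \<Rightarrow> dir list \<Rightarrow> bool \<times> nat \<Rightarrow> bool" where
  "forward ds es (r, i) \<longleftrightarrow> (if r then es ! i = West else ds ! i = East)"

lemma other_end_props:
  assumes "act p ds = Some es" "i < length (if r then es else ds)" "other_end p (r, i) = (r', i')"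
  shows "i' < length (if r' then es else ds)" "other_end p (r', i') = (r, i)" "(r', i') \<noteq> (r, i)"
    "piece_label p (r', i') = drev (piece_label p (r, i))"
    "forward ds es (r', i') = forward ds es (r, i) \<longleftrightarrow> odd (piece_label p (r, i))"
proof -
  have EW: "d = West \<longleftrightarrow> d \<noteq> East" for d by (cases d) auto
  have "i' < length (if r' then es else ds) \<and> other_end p (r', i') = (r, i) \<and> (r', i') \<noteq> (r, i) \<and>
    piece_label p (r', i') = drev (piece_label p (r, i)) \<and>
    (forward ds es (r', i') = forward ds es (r, i) \<longleftrightarrow> odd (piece_label p (r, i)))"
  proof (cases p)
    case (Cross c j)
    then show ?thesis using assms
      by (cases r) (auto simp: drev_def EW nth_list_update split: if_splits)
  next
    case (Open j d)
    then show ?thesis using assms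
      by (cases r; cases d) (auto simp: drev_def EW nth_append nth_Cons' split: if_splits)
  next
    case (Close j)
    then have jd: "Suc j < length ds" "ds ! j \<noteq> ds ! Suc j" and es: "es = take j ds @ drop (j + 2) ds"
      using assms(1) by (auto split: if_splits)
    have len: "length es + 2 = length ds" and nth: "m < length es \<Longrightarrow> es ! m = (if m < j then ds ! m else ds ! Suc (Suc m))" for m
      using jd(1) unfolding es by (auto simp: nth_append)
    have dj: "(ds ! j = East) \<noteq> (ds ! Suc j = East)"
      using jd(2) by (cases "ds ! j"; cases "ds ! Suc j") simp_all
    have o: "other_end (Close j) (r, i) = (r', i')" using assms(3) Close by simp
    show ?thesis
    proof (cases r)
      case True
      then have i: "i < length es" using assms(2) by simp
      show ?thesis
      proof (cases "i < j")
        case True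
        then show ?thesis using o i len nth[OF i] \<open>r\<close> Close by (auto simp: EW)
      next
        case False
        then show ?thesis using o i len nth[OF i] \<open>r\<close> Close by (auto simp: EW)
      qed
    next
      case False
      then have i: "i < length ds" using assms(2) by simp
      have "i < j \<or> i = j \<or> i = Suc j \<or> (\<exists>l. i = Suc (Suc l) \<and> j \<le> l)" by presburger
      then consider (1) "i < j" | (2) "i = j" | (3) "i = Suc j" | (4) l where "i = Suc (Suc l)" "j \<le> l"
        by blast
      then show ?thesis
      proof cases
        case 1
        then show ?thesis using o i len nth[of i] jd(1) \<open>\<not> r\<close> Close by (auto simp: EW)
      next
        case 2
        then show ?thesis using o i jd(1) dj \<open>\<not> r\<close> Close by (auto simp: EW)
      next
        case 3
        then show ?thesis using o i jd(1) dj \<open>\<not> r\<close> Close by (auto simp: EW)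
      next
        case (4 l)
        then show ?thesis using o i len nth[of l] \<open>\<not> r\<close> Close by (auto simp: EW)
      qed
    qed
  next
    case (Cusp j s)
    have opp: "opp d = East \<longleftrightarrow> d \<noteq> East" for d by (cases d) auto
    have ri: "r' = (\<not> r)" "i' = i" using assms(3) Cusp by auto
    have es: "es = ds[j := opp (ds ! j)]" "j < length ds" using assms(1) Cusp by (auto split: if_splits)
    have il: "i < length ds" using assms(2) es by (cases r) auto
    show ?thesis
    proof (cases "i = j")
      case True
      then show ?thesis unfolding ri Cusp using es il
        by (cases r; cases s) (simp_all add: drev_def EW opp)
    next
      case False
      then show ?thesis unfolding ri Cusp using es il
        by (cases r) (simp_all add: EW)
    qed
  qed
  then show "i' < length (if r' then es else ds)" "other_end p (r', i') = (r, i)" "(r', i') \<noteq> (r, i)"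
    "piece_label p (r', i') = drev (piece_label p (r, i))"
    "forward ds es (r', i') = forward ds es (r, i) \<longleftrightarrow> odd (piece_label p (r, i))" by blast+
qed

text \<open>\<open>dgA\<close> goes through a piece and \<open>dgB\<close> steps from one piece to
  its neighbour, so \<open>travel\<close> is \<open>dgB\<close> after \<open>dgA\<close>.\<close>

fun dgA :: "piece list \<Rightarrow> state \<Rightarrow> state" where
  "dgA w (k, e) = (k, other_end (w ! k) e)"

fun dgB :: "state \<Rightarrow> state" where
  "dgB (k, r, i) = (if r then Suc k else k - 1, \<not> r, i)"

fun dgG :: "piece list \<Rightarrow> state \<Rightarrow> int" where
  "dgG w (k, e) = piece_label (w ! k) e"

fun dgpar :: "piece list \<Rightarrow> state \<Rightarrow> bool" where
  "dgpar w (k, e) = forward (dirs_at w k) (dirs_at w (Suc k)) e"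

lemma dirs_at_run:
  assumes "run w [] = Some ds" "k \<le> length w"
  shows "run (take k w) [] = Some (dirs_at w k)"
proof -
  have "run (take k w @ drop k w) [] \<noteq> None" using assms(1) by simp
  then show ?thesis unfolding dirs_at_def using run_prefix by fastforce
qed

lemma dirs_at_act:
  assumes "run w [] = Some ds" "k < length w"
  shows "act (w ! k) (dirs_at w k) = Some (dirs_at w (Suc k))"
  using dirs_at_run[OF assms(1), of k] dirs_at_run[OF assms(1), of "Suc k"] assms(2)
  by (auto simp: take_Suc_conv_app_nth run_append bind_eq_Some_conv)

lemma state_iff: "(k, r, i) \<in> states w \<longleftrightarrow> k < length w \<and> i < length (if r then dirs_at w (Suc k) else dirs_at w k)"
  by (auto simp: states_def)

locale diagram =
  fixes w :: "piece list"
  assumes closed: "run w [] = Some []"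
begin

lemma dirs_0: "dirs_at w 0 = []"
  by (simp add: dirs_at_def)

lemma dirs_last: "dirs_at w (length w) = []"
  using closed by (simp add: dirs_at_def)

lemma act: "k < length w \<Longrightarrow> act (w ! k) (dirs_at w k) = Some (dirs_at w (Suc k))"
  by (rule dirs_at_act[OF closed])

lemma dgB_in: "x \<in> states w \<Longrightarrow> dgB x \<in> states w \<and> dgB (dgB x) = x \<and> dgB x \<noteq> x \<and> dgpar w (dgB x) \<noteq> dgpar w x"
proof -
  obtain k r i where x: "x = (k, r, i)" by (cases x)
  assume "x \<in> states w"
  then have *: "k < length w" "i < length (if r then dirs_at w (Suc k) else dirs_at w k)"
    unfolding x state_iff by auto
  show ?thesis
  proof (cases r)
    case True
    then have "Suc k \<noteq> length w" using * dirs_last by auto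
    then show ?thesis using True * x by (auto simp: state_iff dir.exhaust) (metis dir.exhaust)
  next
    case False
    then have "k \<noteq> 0" using * dirs_0 by (cases k) auto
    then show ?thesis using False * x by (auto simp: state_iff) (metis dir.exhaust)
  qed
qed

lemma dgA_in:
  assumes "x \<in> states w"
  shows "dgA w x \<in> states w" "dgA w (dgA w x) = x" "dgA w x \<noteq> x" "dgG w (dgA w x) = drev (dgG w x)"
    "dgpar w (dgA w x) = dgpar w x \<longleftrightarrow> odd (dgG w x)"
proof -
  obtain k r i where x: "x = (k, r, i)" by (cases x)
  have *: "k < length w" "i < length (if r then dirs_at w (Suc k) else dirs_at w k)"
    using assms unfolding x state_iff by auto
  obtain r' i' where o: "other_end (w ! k) (r, i) = (r', i')" by (cases "other_end (w ! k) (r, i)")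
  note p = other_end_props[OF act[OF *(1)] *(2) o]
  show "dgA w x \<in> states w" "dgA w (dgA w x) = x" "dgA w x \<noteq> x" "dgG w (dgA w x) = drev (dgG w x)"
    "dgpar w (dgA w x) = dgpar w x \<longleftrightarrow> odd (dgG w x)"
    using p *(1) o by (simp_all add: x state_iff)
qed

lemma finite_states: "finite (states w)"
proof -
  have "states w = (SIGMA k:{..<length w}. SIGMA r:UNIV. {..<length (dirs_at w (if r then Suc k else k))})"
    by (auto simp: states_def)
  then show ?thesis by simp
qed

sublocale loops "states w" "dgA w" dgB "dgG w" "dgpar w"
  by unfold_locales (use finite_states dgA_in dgB_in in auto)

section \<open>Tracing a flat diagram from left to right\<close>

lemma inv_at_cong:
  "inv_at \<phi> N A' g S \<Longrightarrow> (\<And>x. x \<in> N \<Longrightarrow> g x = g' x) \<Longrightarrow> inv_at \<phi> N A' g' S"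
  unfolding inv_at_def by auto

text \<open>The right ends of the last piece are left out: they lie on the cut and are the ends from
  which the recorded paths start.\<close>

definition passed :: "nat \<Rightarrow> state set" where
  "passed k = {(j, r, i). (j, r, i) \<in> states w \<and> j < k \<and> \<not> (Suc j = k \<and> r)}"

text \<open>From each strand on the cut the traveller looks to the left, into the piece before the
  cut. At \<open>k = 0\<close> the truncated difference does no harm, since no strand meets the
  first line.\<close>

definition frontier :: "nat \<Rightarrow> state list" where
  "frontier k = map (\<lambda>i. (k - 1, True, i)) [0..<length (dirs_at w k)]"

lemma frontier_nth: "i < length (dirs_at w k) \<Longrightarrow> frontier k ! i = (k - 1, True, i)"
  by (simp add: frontier_def)

lemma length_frontier: "length (frontier k) = length (dirs_at w k)"
  by (simp add: frontier_def)

lemma dgB_frontier: "i < length (dirs_at w k) \<Longrightarrow> dgB (frontier k ! i) = (k, False, i)"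
  using dirs_0 by (cases k) (auto simp: frontier_nth)

lemma passed_Suc:
  assumes "k < length w"
  shows "passed (Suc k) = passed k \<union> set (frontier k) \<union> dgB ` set (frontier k)"
proof -
  have f: "set (frontier k) = {(k - 1, True, i) |i. i < length (dirs_at w k)}"
    unfolding frontier_def by auto
  have "dgB ` set (frontier k) = {(k, False, i) |i. i < length (dirs_at w k)}"
    using dgB_frontier unfolding set_conv_nth length_frontier by force
  then show ?thesis unfolding f passed_def using assms dirs_0
    by (cases k) (auto simp: state_iff less_Suc_eq)
qed

text \<open>The link between the two descriptions: names correspond to ends on the cut, arcs of the
  state to paths through the traversed part, and the accumulated factors to the loops completed so
  far.\<close>

definition traced :: "nat \<Rightarrow> lstate \<Rightarrow> ra \<Rightarrow> bool" where
  "traced k s c \<longleftrightarrow> good s \<and> dirs s = dirs_at w k \<and> val (passed k) = c \<and>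
     (case s of (xs, D, A', g) \<Rightarrow> \<exists>\<phi>. inv_at \<phi> (set xs) A' g (passed k) \<and> map \<phi> xs = frontier k)"

lemma frontier_in: "k < length w \<Longrightarrow> set (frontier (Suc k)) \<subseteq> states w"
  by (auto simp: frontier_def state_iff)

lemma frontier_passed: "set (frontier (Suc k)) \<inter> passed (Suc k) = {}"
  by (auto simp: frontier_def passed_def)

text \<open>All strands that run through the piece \<open>k\<close> are extended at once.\<close>
lemma extend:
  assumes i: "inv_at \<phi> N A' g S" and k: "k < length w"
    and N: "\<And>x. x \<in> N \<Longrightarrow> \<exists>i j. dgB (\<phi> x) = (k, False, i) \<and> other_end (w ! k) (False, i) = (True, j) \<and>
      i < length (dirs_at w k)"
    and T: "passed (Suc k) = S \<union> \<phi> ` N \<union> (\<lambda>x. dgB (\<phi> x)) ` N"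
  shows "inv_at (\<lambda>x. dgA w (dgB (\<phi> x))) N A'
      (\<lambda>x. dgG w (dgA w (dgB (\<phi> x))) \<oplus> (g x \<oplus> dgG w (dgB (\<phi> (A' x))))) (passed (Suc k))"
    and "val (passed (Suc k)) = val S"
proof -
  have X: "\<phi> x \<in> states w" if "x \<in> N" for x using inv_atD(1)[OF i that] .
  have inj: "inj_on \<phi> N" using i unfolding inv_at_def by blast
  have e: "(\<lambda>x. dgA w (dgB (\<phi> x))) ` N \<inter> passed (Suc k) = {}"
  proof -
    have "dgA w (dgB (\<phi> x)) \<notin> passed (Suc k)" if "x \<in> N" for x
      using N[OF that] by (auto simp: passed_def)
    then show ?thesis by auto
  qed
  have injA: "inj_on (\<lambda>x. dgA w (dgB (\<phi> x))) N"
  proof (rule inj_onI)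
    fix x y assume xy: "x \<in> N" "y \<in> N" "dgA w (dgB (\<phi> x)) = dgA w (dgB (\<phi> y))"
    then have "dgB (\<phi> x) = dgB (\<phi> y)" using A(2) B(1) X by metis
    then have "\<phi> x = \<phi> y" using B(2) X xy by metis
    then show "x = y" using inj xy by (auto dest: inj_onD)
  qed
  show "inv_at (\<lambda>x. dgA w (dgB (\<phi> x))) N A'
      (\<lambda>x. dgG w (dgA w (dgB (\<phi> x))) \<oplus> (g x \<oplus> dgG w (dgB (\<phi> (A' x))))) (passed (Suc k))"
    and "val (passed (Suc k)) = val S"
    using inv_at_extend[OF i, of "\<lambda>x. dgA w (dgB (\<phi> x))", OF _ _ injA T e] A B X by auto
qed

lemma traced_step:
  assumes t: "traced k s c" and k: "k < length w" and flat: "\<not> classical (w ! k)"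
  shows "traced (Suc k) (stp (w ! k) s) (c * fac (w ! k) s)"
proof -
  obtain xs D A' g where s: "s = (xs, D, A', g)" by (cases s)
  obtain \<phi> where i: "inv_at \<phi> (set xs) A' g (passed k)" and \<phi>: "map \<phi> xs = frontier k"
    using t unfolding traced_def s by auto
  have good: "good (xs, D, A', g)" and ds: "map D xs = dirs_at w k" and val: "val (passed k) = c"
    using t unfolding traced_def s by (auto simp: dirs.simps)
  note act = act[OF k]
  have gs: "good (stp (w ! k) s)" "dirs (stp (w ! k) s) = dirs_at w (Suc k)"
    using good_stp dirs_stp act ds good s by (auto simp: dirs.simps)
  have len: "length xs = length (dirs_at w k)" using ds by (metis length_map)
  have \<phi>n: "\<phi> (xs ! i) = (k - 1, True, i)" "dgB (\<phi> (xs ! i)) = (k, False, i)" if "i < length xs" for i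
  proof -
    have "\<phi> (xs ! i) = frontier k ! i" using \<phi> that by (metis nth_map)
    then show "\<phi> (xs ! i) = (k - 1, True, i)" "dgB (\<phi> (xs ! i)) = (k, False, i)"
      using that len frontier_nth dgB_frontier by auto
  qed
  have set\<phi>: "set (frontier k) = \<phi> ` set xs" using \<phi> by (metis set_map)
  have T: "passed (Suc k) = passed k \<union> \<phi> ` set xs \<union> (\<lambda>x. dgB (\<phi> x)) ` set xs"
    unfolding passed_Suc[OF k] set\<phi> by auto
  have dx: "distinct xs" by (rule good_distinct[OF good])
  note gA = goodD[OF good]
  let ?\<psi> = "\<lambda>x. dgA w (dgB (\<phi> x))"
  have \<psi>n: "?\<psi> (xs ! i) = (k, other_end (w ! k) (False, i))" if "i < length xs" for i
    using \<phi>n(2)[OF that] by simp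
  have idx: "\<exists>i<length xs. x = xs ! i" if "x \<in> set xs" for x using that by (metis in_set_conv_nth)
  have main: "\<exists>\<phi>'. inv_at \<phi>' (set (fst (stp (w ! k) s))) (fst (snd (snd (stp (w ! k) s))))
      (snd (snd (snd (stp (w ! k) s)))) (passed (Suc k)) \<and> map \<phi>' (fst (stp (w ! k) s)) = frontier (Suc k)
      \<and> val (passed (Suc k)) = c * fac (w ! k) s"
  proof (cases "w ! k")
    case (Cross cc j)
    then have j: "Suc j < length xs" "dirs_at w (Suc k) = (dirs_at w k)[j := dirs_at w k ! Suc j, Suc j := dirs_at w k ! j]"
      using act len by (auto split: if_splits)
    obtain us x y zs where xs: "xs = us @ x # y # zs" "length us = j" by (rule split_at2[OF j(1)])
    have "\<exists>i j. dgB (\<phi> x) = (k, False, i) \<and> other_end (w ! k) (False, i) = (True, j) \<and>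
      i < length (dirs_at w k)" if "x \<in> set xs" for x
      using idx[OF that] \<phi>n(2) len Cross by force
    note E = extend[OF i k this T]
    have l1: "length (dirs_at w (Suc k)) = length xs" using j len by simp
    have st: "stp (w ! k) s = (us @ y # x # zs, D, A', g)"
      unfolding Cross s xs(1) xs(2)[symmetric] by simp
    have "map ?\<psi> (us @ y # x # zs) = frontier (Suc k)"
    proof (rule nth_equalityI)
      show "length (map ?\<psi> (us @ y # x # zs)) = length (frontier (Suc k))"
        using l1 xs by (simp add: length_frontier)
      fix i assume "i < length (map ?\<psi> (us @ y # x # zs))"
      then have i: "i < length xs" using xs by simp
      define i' where "i' = (if i = j then Suc j else if i = Suc j then j else i)"
      have i': "i' < length xs" using i j i'_def by auto
      have "(us @ y # x # zs) ! i = xs ! i'"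
        using xs by (auto simp: i'_def nth_append nth_Cons')
      moreover have "other_end (w ! k) (False, i') = (True, i)" using Cross by (auto simp: i'_def)
      moreover have "map ?\<psi> (us @ y # x # zs) ! i = ?\<psi> ((us @ y # x # zs) ! i)"
        by (rule nth_map) (use i xs in simp)
      ultimately show "map ?\<psi> (us @ y # x # zs) ! i = frontier (Suc k) ! i"
        using \<psi>n[OF i'] i l1 by (simp add: frontier_nth)
    qed
    moreover have "set (us @ y # x # zs) = set xs" using xs by auto
    moreover have "inv_at ?\<psi> (set xs) A' g (passed (Suc k))"
    proof (rule inv_at_cong[OF E(1)])
      fix u assume u: "u \<in> set xs"
      have "dgG w v = 0" if "fst v = k" for v using that Cross by (cases v) auto
      moreover have "fst (?\<psi> u) = k" "fst (dgB (\<phi> (A' u))) = k"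
        using idx[OF u] idx[OF gA(1)[OF u]] \<phi>n(2) \<psi>n by (metis fst_conv)+
      ultimately show "dgG w (?\<psi> u) \<oplus> (g u \<oplus> dgG w (dgB (\<phi> (A' u)))) = g u" by simp
    qed
    ultimately show ?thesis using E(2) val st Cross by (intro exI[of _ ?\<psi>]) (simp add: s)
  next
    case (Cusp j sd)
    then have j: "j < length xs" "dirs_at w (Suc k) = (dirs_at w k)[j := opp (dirs_at w k ! j)]"
      using act len by (auto split: if_splits)
    obtain us x zs where xs: "xs = us @ x # zs" "length us = j" by (rule split_at1[OF j(1)])
    have xj: "x = xs ! j" "x \<in> set xs" using xs by auto
    have "\<exists>i j. dgB (\<phi> x) = (k, False, i) \<and> other_end (w ! k) (False, i) = (True, j) \<and>
      i < length (dirs_at w k)" if "x \<in> set xs" for x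
      using idx[OF that] \<phi>n(2) len Cusp by force
    note E = extend[OF i k this T]
    have l1: "length (dirs_at w (Suc k)) = length xs" using j len by simp
    let ?e = "cusp_label sd"
    have st: "stp (w ! k) s = (xs, D(x := opp (D x)), A', g(x := ?e \<oplus> g x, A' x := g (A' x) \<oplus> (- ?e)))"
      unfolding Cusp s xs(1) xs(2)[symmetric] by simp
    have "map ?\<psi> xs = frontier (Suc k)"
      by (rule nth_equalityI) (use l1 \<psi>n Cusp in \<open>auto simp: length_frontier frontier_nth\<close>)
    moreover have "inv_at ?\<psi> (set xs) A' (g(x := ?e \<oplus> g x, A' x := g (A' x) \<oplus> (- ?e))) (passed (Suc k))"
    proof (rule inv_at_cong[OF E(1)])
      fix u assume u: "u \<in> set xs"
      have 1: "dgG w (?\<psi> v) = (if v = x then ?e else 0) \<and> dgG w (dgB (\<phi> v)) = (if v = x then - ?e else 0)"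
        if v: "v \<in> set xs" for v
      proof -
        obtain i where iv: "i < length xs" "v = xs ! i" using idx[OF v] by blast
        have "v = x \<longleftrightarrow> i = j" using iv xj dx j(1) by (simp add: nth_eq_iff_index_eq)
        then show ?thesis using \<psi>n[OF iv(1)] \<phi>n(2)[OF iv(1)] iv Cusp by (cases sd) auto
      qed
      have 2: "A' u = x \<longleftrightarrow> u = A' x" using gA(2)[OF u] gA(2)[OF xj(2)] by metis
      show "dgG w (?\<psi> u) \<oplus> (g u \<oplus> dgG w (dgB (\<phi> (A' u)))) =
          (g(x := ?e \<oplus> g x, A' x := g (A' x) \<oplus> (- ?e))) u"
        unfolding 1[OF u, THEN conjunct1] 1[OF gA(1)[OF u], THEN conjunct2] 2
        using gA(3)[OF xj(2)] by auto
    qed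
    ultimately show ?thesis using E(2) val st Cusp by (intro exI[of _ ?\<psi>]) (simp add: s)
  next
    case (Open j d)
    then have j: "j \<le> length xs" "dirs_at w (Suc k) = take j (dirs_at w k) @ [d, opp d] @ drop j (dirs_at w k)"
      using act len by (auto split: if_splits)
    have "\<exists>i j. dgB (\<phi> x) = (k, False, i) \<and> other_end (w ! k) (False, i) = (True, j) \<and>
      i < length (dirs_at w k)" if "x \<in> set xs" for x
      using idx[OF that] \<phi>n(2) len Open by force
    note E = extend[OF i k this T]
    obtain us zs where xs: "xs = us @ zs" "length us = j"
      using j(1) by (metis append_take_drop_id length_take min.absorb2)
    have l1: "length (dirs_at w (Suc k)) = length xs + 2" using j len by simp
    define a where "a = fresh xs"
    have a: "a \<notin> set xs" "Suc a \<notin> set xs" using fresh_notin' unfolding a_def by blast+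
    have st: "stp (w ! k) s = (us @ a # Suc a # zs, D(a := d, Suc a := opp d), A'(a := Suc a, Suc a := a),
        g(a := 0, Suc a := 0))"
      unfolding Open s xs(1) xs(2)[symmetric] by (simp add: a_def xs(1))
    let ?p = "(k, True, j) :: state" and ?q = "(k, True, Suc j) :: state"
    let ?\<chi> = "?\<psi>(a := ?p, Suc a := ?q)"
    have m: "map ?\<chi> (us @ a # Suc a # zs) = frontier (Suc k)"
    proof (rule nth_equalityI)
      show "length (map ?\<chi> (us @ a # Suc a # zs)) = length (frontier (Suc k))"
        using l1 xs by (simp add: length_frontier)
      fix i assume "i < length (map ?\<chi> (us @ a # Suc a # zs))"
      then have i: "i < length xs + 2" using xs by simp
      consider "i = j" | "i = Suc j" | "i < j" | "Suc j < i" by linarith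
      then show "map ?\<chi> (us @ a # Suc a # zs) ! i = frontier (Suc k) ! i"
      proof cases
        case 1
        then show ?thesis using xs l1 i by (simp add: nth_append frontier_nth)
      next
        case 2
        then show ?thesis using xs l1 i by (simp add: nth_append frontier_nth)
      next
        case 3
        then have "us ! i = xs ! i" "xs ! i \<in> set xs" using xs by (simp_all add: nth_append)
        moreover have "?\<psi> (xs ! i) = (k, True, i)" using \<psi>n[of i] 3 j(1) Open by simp
        ultimately show ?thesis using 3 xs(2) l1 i a by (auto simp: nth_append frontier_nth)
      next
        case 4
        define l where "l = i - 2"
        have l: "i = l + 2" "j \<le> l" using 4 by (simp_all add: l_def)
        have "(us @ a # Suc a # zs) ! i = xs ! l" "xs ! l \<in> set xs"
          using l i xs by (simp_all add: nth_append)
        moreover have "?\<psi> (xs ! l) = (k, True, i)" using \<psi>n[of l] l i Open by simp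
        moreover have "map ?\<chi> (us @ a # Suc a # zs) ! i = ?\<chi> ((us @ a # Suc a # zs) ! i)"
          by (rule nth_map) (use i xs(1) in simp)
        moreover have "xs ! l \<noteq> a" "xs ! l \<noteq> Suc a" using \<open>xs ! l \<in> set xs\<close> a by metis+
        ultimately show ?thesis using l1 i by (simp add: frontier_nth)
      qed
    qed
    \<comment> \<open>The two right ends of the new extremum lie on the next cut, outside the
      traversed part.\<close>
    have fr: "?p \<in> set (frontier (Suc k))" "?q \<in> set (frontier (Suc k))"
      using l1 j(1) by (auto simp: frontier_def)
    have pn: "?p \<notin> ?\<psi> ` set xs" "?q \<notin> ?\<psi> ` set xs"
    proof -
      have *: "?\<psi> x \<noteq> ?p \<and> ?\<psi> x \<noteq> ?q" if xx: "x \<in> set xs" for x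
      proof -
        obtain i where "i < length xs" "x = xs ! i" using idx[OF xx] by blast
        then show ?thesis using \<psi>n[of i] Open by auto
      qed
      show "?p \<notin> ?\<psi> ` set xs"
      proof
        assume "?p \<in> ?\<psi> ` set xs"
        then obtain x where x: "?p = ?\<psi> x" "x \<in> set xs" by (rule imageE)
        show False using *[OF x(2)] x(1)[symmetric] by blast
      qed
      show "?q \<notin> ?\<psi> ` set xs"
      proof
        assume "?q \<in> ?\<psi> ` set xs"
        then obtain x where x: "?q = ?\<psi> x" "x \<in> set xs" by (rule imageE)
        show False using *[OF x(2)] x(1)[symmetric] by blast
      qed
    qed
    have "inv_at ?\<psi> (set xs) A' g (passed (Suc k))"
    proof (rule inv_at_cong[OF E(1)])
      fix u assume u: "u \<in> set xs"
      have "dgG w v = 0" if "fst v = k" for v using that Open by (cases v) auto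
      moreover have "fst (?\<psi> u) = k" "fst (dgB (\<phi> (A' u))) = k"
        using idx[OF u] idx[OF gA(1)[OF u]] \<phi>n(2) \<psi>n by (metis fst_conv)+
      ultimately show "dgG w (?\<psi> u) \<oplus> (g u \<oplus> dgG w (dgB (\<phi> (A' u)))) = g u" by simp
    qed
    then have "inv_at ?\<chi> (insert a (insert (Suc a) (set xs))) (A'(a := Suc a, Suc a := a))
        (g(a := 0, Suc a := 0)) (passed (Suc k))"
      by (rule inv_at_open) (use a pn fr frontier_in[OF k] frontier_passed[of k] Open in auto)
    moreover have "set (us @ a # Suc a # zs) = insert a (insert (Suc a) (set xs))" using xs by auto
    ultimately show ?thesis using E(2) val st m Open by (intro exI[of _ ?\<chi>]) (simp add: s)
  next
    case (Close j)
    then have j: "Suc j < length xs" "dirs_at w (Suc k) = take j (dirs_at w k) @ drop (j + 2) (dirs_at w k)"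
      using act len by (auto split: if_splits)
    obtain us x y zs where xs: "xs = us @ x # y # zs" "length us = j" by (rule split_at2[OF j(1)])
    have xy: "x = xs ! j" "y = xs ! Suc j" "x \<in> set xs" "y \<in> set xs" "x \<noteq> y"
      using xs dx by (auto simp: nth_append)
    have st: "stp (w ! k) s = (us @ zs, D, A'(A' x := A' y, A' y := A' x),
        g(A' x := g (A' x) \<oplus> g y, A' y := g (A' y) \<oplus> g x))"
      and fc: "fac (w ! k) s = (if A' x = y then zval (g x) else 1)"
      unfolding Close s xs(1) xs(2)[symmetric] by simp_all
    have Bx: "dgB (\<phi> x) = (k, False, j)" "dgB (\<phi> y) = (k, False, Suc j)"
      using \<phi>n(2) j(1) xy by auto
    have "\<phi> x = (k - 1, True, j)" "\<phi> y = (k - 1, True, Suc j)" using \<phi>n(1) j(1) xy by auto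
    have fB: "f (dgB (\<phi> x)) = \<phi> y" "f (dgB (\<phi> y)) = \<phi> x"
      unfolding Bx f_def using Close \<open>\<phi> x = _\<close> \<open>\<phi> y = _\<close> by auto
    have nB: "dgB (\<phi> x) \<notin> \<phi> ` set xs" "dgB (\<phi> y) \<notin> \<phi> ` set xs"
      unfolding Bx set\<phi>[symmetric] by (auto simp: frontier_def)
    let ?T = "passed k \<union> {\<phi> x, \<phi> y, dgB (\<phi> x), dgB (\<phi> y)}"
    \<comment> \<open>Between the two joined ends the traveller crosses the extremum itself, hence
      one extra strand. The remaining strands are extended afterwards.\<close>
    note C = inv_at_close[OF i xy(3-5), of 1 ?T]
    have C1: "inv_at \<phi> (set xs - {x, y}) (A'(A' x := A' y, A' y := A' x))
        (g(A' x := g (A' x) \<oplus> g y, A' y := g (A' y) \<oplus> g x)) ?T"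
      and C2: "val ?T = val (passed k) * (if A' x = y then zval (g x) else 1)"
      by (rule C; use fB nB Bx Close in simp)+
    have N: "set xs - {x, y} = set (us @ zs)" using xs dx by auto
    have idx': "\<exists>i. i < length xs \<and> u = xs ! i \<and> i \<noteq> j \<and> i \<noteq> Suc j" if "u \<in> set xs - {x, y}" for u
      using idx[of u] that xy by blast
    have "\<exists>i l. dgB (\<phi> u) = (k, False, i) \<and> other_end (w ! k) (False, i) = (True, l) \<and>
      i < length (dirs_at w k)" if "u \<in> set xs - {x, y}" for u
      using idx'[OF that] \<phi>n(2) len Close by force
    moreover have "passed (Suc k) = ?T \<union> \<phi> ` (set xs - {x, y}) \<union> (\<lambda>x. dgB (\<phi> x)) ` (set xs - {x, y})"
      unfolding T using xy by auto
    ultimately have E: "inv_at ?\<psi> (set xs - {x, y}) (A'(A' x := A' y, A' y := A' x))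
      (\<lambda>u. dgG w (?\<psi> u) \<oplus> ((g(A' x := g (A' x) \<oplus> g y, A' y := g (A' y) \<oplus> g x)) u \<oplus>
         dgG w (dgB (\<phi> ((A'(A' x := A' y, A' y := A' x)) u))))) (passed (Suc k))"
      "val (passed (Suc k)) = val ?T"
      using extend[OF C1 k] by blast+
    have l1: "length (dirs_at w (Suc k)) + 2 = length xs" using j len by simp
    have m: "map ?\<psi> (us @ zs) = frontier (Suc k)"
    proof (rule nth_equalityI)
      show "length (map ?\<psi> (us @ zs)) = length (frontier (Suc k))"
        using l1 xs by (simp add: length_frontier)
      fix i assume "i < length (map ?\<psi> (us @ zs))"
      then have i: "i + 2 < length xs" using xs by simp
      define i' where "i' = (if i < j then i else i + 2)"
      have i': "i' < length xs" using i by (auto simp: i'_def)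
      have "(us @ zs) ! i = xs ! i'" using xs by (auto simp: i'_def nth_append)
      moreover have "other_end (w ! k) (False, i') = (True, i)" using Close by (auto simp: i'_def)
      moreover have "map ?\<psi> (us @ zs) ! i = ?\<psi> ((us @ zs) ! i)"
        by (rule nth_map) (use i xs in simp)
      ultimately show "map ?\<psi> (us @ zs) ! i = frontier (Suc k) ! i"
        using \<psi>n[OF i'] i l1 by (simp add: frontier_nth)
    qed
    have "inv_at ?\<psi> (set xs - {x, y}) (A'(A' x := A' y, A' y := A' x))
       (g(A' x := g (A' x) \<oplus> g y, A' y := g (A' y) \<oplus> g x)) (passed (Suc k))"
    proof (rule inv_at_cong[OF E(1)])
      fix u assume u: "u \<in> set xs - {x, y}"
      let ?v = "(A'(A' x := A' y, A' y := A' x)) u"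
      have v: "?v \<in> set xs" using inv_atD(3)[OF C1 u] by blast
      have "dgG w v = 0" if "fst v = k" for v using that Close by (cases v) auto
      moreover have "fst (?\<psi> u) = k" "fst (dgB (\<phi> ?v)) = k"
        using idx[of u] u idx[OF v] \<phi>n(2) \<psi>n by (metis fst_conv DiffD1)+
      ultimately show "dgG w (?\<psi> u) \<oplus> ((g(A' x := g (A' x) \<oplus> g y, A' y := g (A' y) \<oplus> g x)) u \<oplus>
         dgG w (dgB (\<phi> ?v))) = (g(A' x := g (A' x) \<oplus> g y, A' y := g (A' y) \<oplus> g x)) u" by simp
    qed
    then show ?thesis using E(2) C2 val st fc m N by (intro exI[of _ ?\<psi>]) simp
  qed
  obtain xs' D' A'' g' where s': "stp (w ! k) s = (xs', D', A'', g')" by (cases "stp (w ! k) s")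
  show ?thesis using main gs unfolding traced_def s' by auto
qed

lemma traced_all:
  assumes "filter classical w = []" "k \<le> length w"
  shows "traced k (stps (take k w) ([], D, A', g)) (facs (take k w) ([], D, A', g))"
  using assms(2)
proof (induction k)
  case 0
  have "passed 0 = {}" by (auto simp: passed_def)
  then show ?case unfolding traced_def
    by (auto simp: good.simps dirs.simps dirs_0 val_empty inv_at_def frontier_def)
next
  case (Suc k)
  have st: "stps (u @ v) s = stps v (stps u s)" "facs (u @ v) s = facs u s * facs v (stps u s)" for u v s
    by (induction u arbitrary: s) (auto simp: mult.assoc)
  have "\<not> classical (w ! k)" using assms(1) Suc.prems by (metis Suc_le_eq filter_empty_conv nth_mem)
  then show ?case using traced_step[OF Suc.IH] Suc.prems by (simp add: take_Suc_conv_app_nth st)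
qed

lemma val_states:
  assumes "filter classical w = []"
  shows "val (states w) = facs w ([], D, A', g)"
proof -
  have "passed (length w) = states w"
    unfolding passed_def using dirs_last by (auto simp: state_iff)
  then show ?thesis using traced_all[OF assms, of "length w" D A' g] unfolding traced_def by simp
qed

end

subsection \<open>Zigzags\<close>

text \<open>The value of a cusp word in the dihedral group. Each letter is its own inverse, so
  cancelling equal neighbours keeps the value, and a cyclic rotation conjugates it.\<close>

definition wv :: "bool list \<Rightarrow> int" where
  "wv xs = foldr (\<lambda>b t. (if b then 1 else -1) \<oplus> t) xs 0"

lemma wv_simps [simp]: "wv [] = 0" "wv (b # xs) = (if b then 1 else -1) \<oplus> wv xs"
  by (simp_all add: wv_def)

lemma wv_append: "wv (xs @ ys) = wv xs \<oplus> wv ys"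
  by (induction xs) (simp_all add: dop_assoc del: if_split)

lemma even_wv: "even (wv xs) \<longleftrightarrow> even (length xs)"
  by (induction xs) auto

lemma wv_rotate: "even (length xs) \<Longrightarrow> \<bar>wv (rotate k xs)\<bar> = \<bar>wv xs\<bar>"
proof (induction k)
  case (Suc k)
  have "\<bar>wv (rotate1 ys)\<bar> = \<bar>wv ys\<bar>" if "even (length ys)" for ys
  proof (cases ys)
    case (Cons b bs)
    have "even (wv [b]) = even (wv bs)" using that Cons by (simp add: even_wv)
    then have "\<bar>wv [b] \<oplus> wv bs\<bar> = \<bar>wv bs \<oplus> wv [b]\<bar>" by (rule abs_dop_commute)
    then show ?thesis unfolding Cons by (simp add: wv_append)
  qed simp
  from this[of "rotate k xs"] Suc show ?case by simp
qed simp

lemma reduction_wv: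
  assumes "cusp_reduction xs ys" "even (length xs)"
  shows "\<bar>wv ys\<bar> = \<bar>wv xs\<bar>" "even (length ys)" "length ys < length xs"
proof -
  obtain k a where k: "rotate k xs = a # a # ys" using assms(1) by (auto elim: cusp_reduction.cases)
  then have "length xs = Suc (Suc (length ys))" by (metis length_Cons length_rotate)
  then show "even (length ys)" "length ys < length xs" using assms(2) by auto
  have "wv (a # a # ys) = wv ys" by (simp add: dop_def)
  then show "\<bar>wv ys\<bar> = \<bar>wv xs\<bar>" using wv_rotate[OF assms(2), of k] k by simp
qed

lemma reductions_wv:
  assumes "cusp_reduction\<^sup>*\<^sup>* xs ys" "even (length xs)"
  shows "\<bar>wv ys\<bar> = \<bar>wv xs\<bar> \<and> even (length ys)"
  using assms by (induction rule: rtranclp_induct) (auto dest: reduction_wv)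

lemma wv_alternating:
  assumes "\<forall>i. Suc i < length xs \<longrightarrow> xs ! i \<noteq> xs ! Suc i"
  shows "wv xs = (if xs \<noteq> [] \<and> hd xs then int (length xs) else - int (length xs))"
  using assms
proof (induction xs)
  case (Cons b xs)
  have "\<forall>i. Suc i < length xs \<longrightarrow> xs ! i \<noteq> xs ! Suc i"
    using Cons.prems by (metis Suc_less_eq length_Cons nth_Cons_Suc)
  moreover have "xs \<noteq> [] \<Longrightarrow> hd xs = (\<not> b)"
    using Cons.prems[rule_format, of 0] by (cases xs) auto
  ultimately show ?case using Cons.IH by (cases xs) (auto simp: dop_def)
qed simp

text \<open>An irreducible word alternates, so up to sign its value is its length.\<close>

lemma irreducible_wv:
  assumes "\<nexists>zs. cusp_reduction ys zs"
  shows "\<bar>wv ys\<bar> = int (length ys)"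
proof -
  \<comment> \<open>Equal neighbours could be rotated to the front and cancelled.\<close>
  have "ys ! i \<noteq> ys ! Suc i" if i: "Suc i < length ys" for i
  proof
    assume eq: "ys ! i = ys ! Suc i"
    have "drop i ys = ys ! i # drop (Suc i) ys" "drop (Suc i) ys = ys ! Suc i # drop (Suc (Suc i)) ys"
      using i by (simp_all only: Cons_nth_drop_Suc Suc_lessD)
    then have "drop i ys = ys ! i # ys ! i # drop (Suc (Suc i)) ys" by (simp only: eq)
    then have "rotate i ys = ys ! i # ys ! i # drop (Suc (Suc i)) ys @ take i ys"
      using i by (simp add: rotate_drop_take)
    then show False using assms cusp_reduction.intros by blast
  qed
  then show ?thesis using wv_alternating[of ys] by auto
qed

lemma reduce_ex: "\<exists>ys. cusp_reduction\<^sup>*\<^sup>* xs ys \<and> (\<nexists>zs. cusp_reduction ys zs)"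
proof (induction "length xs" arbitrary: xs rule: less_induct)
  case less
  show ?case
  proof (cases "\<exists>ys. cusp_reduction xs ys")
    case True
    then obtain ys where ys: "cusp_reduction xs ys" by blast
    then obtain k a where "rotate k xs = a # a # ys" by (auto elim: cusp_reduction.cases)
    then have "length xs = Suc (Suc (length ys))" by (metis length_Cons length_rotate)
    then obtain zs where "cusp_reduction\<^sup>*\<^sup>* ys zs" "\<nexists>us. cusp_reduction zs us" using less[of ys] by auto
    then show ?thesis using ys by (meson converse_rtranclp_into_rtranclp)
  qed blast
qed

context diagram
begin

lemma f_travel: "f = travel w"
  by (rule ext) (auto simp: f_def split: prod.splits)

lemma orb_orbit: "x \<in> states w \<Longrightarrow> orb x = orbit (travel w) x"
proof -
  assume x: "x \<in> states w"
  have "orbit (travel w) x = {(f ^^ n) x |n. 0 < n}"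
    unfolding f_travel by (rule orbit_altdef)
  moreover have "x = (f ^^ period x) x" "0 < period x" using period[OF x] by simp_all
  ultimately show ?thesis unfolding orb_def
    by (auto simp: image_def) (metis funpow_0 gr0I)
qed

definition strand :: "state \<Rightarrow> nat \<times> (bool \<times> nat) set" where
  "strand = (\<lambda>(k, e). (k, {e, other_end (w ! k) e}))"

lemma strand_A: "x \<in> states w \<Longrightarrow> strand (dgA w x) = strand x"
  using A(2)[of x] by (cases x) (auto simp: strand_def)

lemma strand_eq: "strand x = strand y \<Longrightarrow> y = x \<or> y = dgA w x"
  by (cases x; cases y) (auto simp: strand_def doubleton_eq_iff)

lemma orb_A: assumes "x \<in> states w" shows "orb (dgA w x) = dgA w ` orb x"
proof -
  have sub: "orb (dgA w x) \<subseteq> dgA w ` orb x" if x: "x \<in> states w" for x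
  proof
    fix y assume "y \<in> orb (dgA w x)"
    then obtain n where n: "y = (f ^^ n) (dgA w x)" unfolding orb_def by blast
    obtain m where m: "x = (f ^^ (n + m)) x"
    proof -
      have "(f ^^ (n * period x)) x = x" using period(2)[OF x] by (induction n) (auto simp: funpow_add)
      moreover have "n * period x = n + (n * period x - n)" using period(1)[OF x] by (cases "period x") auto
      ultimately show ?thesis using that by metis
    qed
    have "y = (f ^^ n) (dgA w ((f ^^ n) ((f ^^ m) x)))" using n m by (simp add: funpow_add)
    then have "y = dgA w ((f ^^ m) x)" using fn_A_fn[OF fn_in[OF x]] by simp
    then show "y \<in> dgA w ` orb x" unfolding orb_def by blast
  qed
  have "dgA w ` orb x \<subseteq> dgA w ` (dgA w ` orb (dgA w x))"
    using sub[OF A(1)[OF assms]] A(2)[OF assms] by auto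
  moreover have "dgA w ` (dgA w ` orb (dgA w x)) = orb (dgA w x)"
  proof -
    have *: "dgA w (dgA w y) = y" if yo: "y \<in> orb (dgA w x)" for y
    proof -
      obtain n where y: "y = (f ^^ n) (dgA w x)" using yo unfolding orb_def by blast
      show ?thesis unfolding y by (rule A(2)[OF fn_in[OF A(1)[OF assms]]])
    qed
    show ?thesis unfolding image_image using * by (simp del: dgA.simps)
  qed
  ultimately show ?thesis using sub[OF assms] by blast
qed

lemma strand_loop: assumes "x \<in> states w" shows "strand ` loop_of x = component w x"
proof -
  have "strand ` orb (dgA w x) = strand ` orb x"
    unfolding orb_A[OF assms] image_image
  proof (rule image_cong)
    fix y assume "y \<in> orb x"
    then obtain n where y: "y = (f ^^ n) x" unfolding orb_def by blast
    show "strand (dgA w y) = strand y" unfolding y by (rule strand_A[OF fn_in[OF assms]])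
  qed simp
  then have "strand ` loop_of x = strand ` orb x" unfolding loop_of_def by (simp add: image_Un)
  then show ?thesis unfolding component_def orb_orbit[OF assms] strand_def by simp
qed

text \<open>A strand determines its pair of ends, and both of them lie on the same loop; so loops
  with a common strand coincide.\<close>

lemma inj_strand: "inj_on (image strand) comps"
proof (rule inj_onI)
  fix C C' assume "C \<in> comps" "C' \<in> comps" and eq: "strand ` C = strand ` C'"
  then obtain x x' where x: "x \<in> states w" "C = loop_of x" "x' \<in> states w" "C' = loop_of x'"
    unfolding comps_def by blast
  have "strand x \<in> strand ` C'" using comp_self eq x(2) by blast
  then obtain y where y: "y \<in> C'" "y = x \<or> y = dgA w x" using strand_eq by (metis imageE)
  have "loop_of y = C'" using comp_eq y(1) x by simp
  then show "C = C'" using y(2) comp_A x by metis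
qed

lemma component_eq:
  assumes "x \<in> states w" "y \<in> states w" "component w x = component w y"
  shows "loop_of x = loop_of y"
  using inj_onD[OF inj_strand, of "loop_of x" "loop_of y"] strand_loop assms unfolding comps_def by auto

lemma wv_cusp_met: "wv (cusp_met w x) = dgG w x"
  by (cases x) (auto split: piece.splits)

lemma wv_cusp_word: assumes "x \<in> states w" shows "wv (cusp_word w x) = hol x"
proof -
  have *: "wv (concat (map (\<lambda>m. cusp_met w ((f ^^ m) x)) [0..<n])) = wsum x n" for n
  proof (induction n)
    case (Suc n)
    then show ?case using wsum_add[of x n 1] by (simp add: wv_append wv_cusp_met)
  qed simp
  have "funpow_dist1 (travel w) x x = period x"
  proof (rule antisym)
    obtain n where n: "period x = Suc n" using period(1)[OF assms] by (cases "period x") auto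
    have "(f ^^ n) (f x) = x" using period(2)[OF assms] n by (simp add: fn_shift)
    then have "funpow_dist f (f x) x \<le> n" using funpow_dist_least by (metis not_le)
    then show "funpow_dist1 (travel w) x x \<le> period x" using n f_travel by simp
    have "x \<in> orbit f x"
      using period[OF assms] unfolding orbit_altdef by (metis (mono_tags, lifting) mem_Collect_eq)
    then have "(f ^^ funpow_dist1 f x x) x = x" by (rule funpow_dist1_prop)
    then show "period x \<le> funpow_dist1 (travel w) x x" using period_least[of "funpow_dist1 f x x" x] f_travel by simp
  qed
  then show ?thesis unfolding cusp_word_def hol_def using * f_travel by simp
qed

text \<open>Whatever starting point, direction and sequence of reductions is chosen, the irreducible
  word has the absolute holonomy as its length. Hence the definite description is justified.\<close>

lemma zigzags: assumes "x \<in> states w" shows "zigzags w (component w x) = nat \<bar>hol x\<bar> div 2"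
  unfolding zigzags_def
proof (rule the_equality)
  have ev: "even (length (cusp_word w y))" if "y \<in> states w" for y
    using hol_even[OF that] wv_cusp_word[OF that] even_wv by metis
  obtain ys where ys: "cusp_reduction\<^sup>*\<^sup>* (cusp_word w x) ys" "\<nexists>zs. cusp_reduction ys zs"
    using reduce_ex by blast
  have "int (length ys) = \<bar>hol x\<bar>"
    using reductions_wv[OF ys(1) ev[OF assms]] irreducible_wv[OF ys(2)] wv_cusp_word[OF assms] by simp
  then have "length ys = 2 * (nat \<bar>hol x\<bar> div 2)" using reductions_wv[OF ys(1) ev[OF assms]] by auto
  then show "\<exists>y\<in>states w. \<exists>ys. component w y = component w x \<and> cusp_reduction\<^sup>*\<^sup>* (cusp_word w y) ys \<and>
      (\<nexists>ys'. cusp_reduction ys ys') \<and> length ys = 2 * (nat \<bar>hol x\<bar> div 2)"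
    using assms ys by blast
  fix c assume "\<exists>y\<in>states w. \<exists>ys. component w y = component w x \<and> cusp_reduction\<^sup>*\<^sup>* (cusp_word w y) ys \<and>
      (\<nexists>ys'. cusp_reduction ys ys') \<and> length ys = 2 * c"
  then obtain y ys where y: "y \<in> states w" "component w y = component w x"
    and r: "cusp_reduction\<^sup>*\<^sup>* (cusp_word w y) ys" "\<nexists>zs. cusp_reduction ys zs" "length ys = 2 * c" by blast
  have "y \<in> loop_of x" using component_eq[OF y(1) assms y(2)] comp_self by metis
  have "\<bar>hol y\<bar> = \<bar>hol x\<bar>" by (rule abs_hol_comp[OF \<open>y \<in> loop_of x\<close> assms])
  moreover have "int (length ys) = \<bar>hol y\<bar>"
    using reductions_wv[OF r(1) ev[OF y(1)]] irreducible_wv[OF r(2)] wv_cusp_word[OF y(1)] by simp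
  ultimately show "c = nat \<bar>hol x\<bar> div 2" using r(3) by auto
qed

lemma components_val: "(\<Prod>S\<in>components w. z (zigzags w S)) = val (states w)"
proof -
  have "components w = image strand ` comps"
    unfolding components_def comps_def image_image using strand_loop by (intro image_cong) auto
  moreover have "z (zigzags w (strand ` C)) = zcomp C" if "C \<in> comps" for C
  proof -
    obtain x where x: "x \<in> states w" "C = loop_of x" using \<open>C \<in> comps\<close> unfolding comps_def by blast
    then show ?thesis using zcomp[OF x(1)] zigzags[OF x(1)] strand_loop[OF x(1)] by (simp add: zval_def)
  qed
  ultimately show ?thesis unfolding val_X by (simp add: prod.reindex[OF inj_strand])
qed

end

section \<open>The arrow polynomial as a state sum\<close>

abbreviation s0 :: lstate where
  "s0 \<equiv> ([], undefined, undefined, undefined)"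

lemma good_s0: "good s0" "dirs s0 = []"
  by (simp_all add: good.simps dirs.simps)

primrec wr :: "piece list \<Rightarrow> dir list \<Rightarrow> int" where
  "wr [] ds = 0"
| "wr (p # w) ds = piece_sign p ds + wr w (the (act p ds))"

lemma wr_append: "run u ds = Some es \<Longrightarrow> wr (u @ v) ds = wr u ds + wr v es"
  by (induction u arbitrary: ds) (auto simp: bind_eq_Some_conv)

lemma wr_flat: "filter classical w = [] \<Longrightarrow> wr w ds = 0"
proof (induction w arbitrary: ds)
  case (Cons p w)
  have "piece_sign p ds = 0" if "\<not> classical p" using that by (cases p) auto
  then show ?case using Cons by (auto split: if_splits)
qed simp

lemma writhe_wr: assumes "run w [] = Some ds" shows "writhe w = wr w []"
proof -
  have "(\<Sum>j<k. sign_at w j) = wr (take k w) []" if "k \<le> length w" for k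
    using that
  proof (induction k)
    case (Suc k)
    have "sign_at w k = piece_sign (w ! k) (dirs_at w k)"
      by (cases "w ! k") (simp_all add: sign_at_def)
    moreover have "run (take k w) [] = Some (dirs_at w k)" using dirs_at_run[OF assms] Suc.prems by simp
    ultimately show ?case using Suc by (simp add: take_Suc_conv_app_nth wr_append)
  qed simp
  then show ?thesis unfolding writhe_def by simp
qed

text \<open>The power (-A^3)^(-k) for an arbitrary integer k; the natural exponent of the sign only
  needs the parity of k.\<close>

definition unit_of :: "int \<Rightarrow> ra" where
  "unit_of k = (-1) ^ nat \<bar>k\<bar> * A_pow (- 3 * k)"

lemma A_pow_add: "A_pow (k + l) = A_pow k * A_pow l"
  by (simp add: A_pow_def mult_single)

lemma A_pow_0 [simp]: "A_pow 0 = 1"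
  by (simp add: A_pow_def single_one[symmetric] zero_prod_def)

lemma unit_of_add: "unit_of (k + l) = unit_of k * unit_of l"
proof -
  have s: "(-1 :: ra) ^ nat \<bar>k\<bar> = (if even k then 1 else -1)" for k :: int
    by (simp add: even_nat_iff minus_one_power_iff)
  have "(-1 :: ra) ^ nat \<bar>k + l\<bar> = (-1) ^ nat \<bar>k\<bar> * (-1) ^ nat \<bar>l\<bar>"
    unfolding s by auto
  moreover have "A_pow (- 3 * (k + l)) = A_pow (- 3 * k) * A_pow (- 3 * l)"
    unfolding A_pow_add[symmetric] by (simp add: algebra_simps)
  ultimately show ?thesis unfolding unit_of_def by (simp only: mult_ac)
qed

lemma unit_of_sign: "unit_of 0 = 1" "e = 1 \<or> e = -1 \<Longrightarrow> unit_of e = - A_pow (- 3 * e)"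
  by (auto simp: unit_of_def)

lemma piece_sign_classical: "classical p \<Longrightarrow> piece_sign p ds = 1 \<or> piece_sign p ds = -1"
proof (cases p)
  case (Cross c i)
  moreover assume "classical p"
  ultimately show ?thesis by (cases c) auto
qed auto

text \<open>The induction follows the recursion of the bracket. The first classical crossing has a
  flat prefix, so it is also the first one that the state sum expands, and \<open>cont\<close>
  supplies the part of the unit that belongs to its sign.\<close>

lemma bracket_ev:
  assumes "run w [] = Some []"
  shows "unit_of (wr w []) * arrow_bracket w = ev w s0"
  using assms
proof (induction w rule: arrow_bracket.induct)
  case (1 w)
  show ?case
  proof (cases "\<exists>k<length w. classical (w ! k)")
    case False
    then have flat: "filter classical w = []" by (auto simp: filter_empty_conv in_set_conv_nth)
    interpret diagram w by unfold_locales (rule 1(3))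
    have "arrow_bracket w = (\<Prod>S\<in>components w. z (zigzags w S))"
      by (subst arrow_bracket.simps) (simp only: False if_False)
    then have "arrow_bracket w = facs w s0" using components_val val_states[OF flat] by simp
    then show ?thesis using wr_flat[OF flat, of "[]"] unit_of_sign
      by (simp add: ev_def foldr_flat[OF flat] flat_def)
  next
    case True
    define k where "k = (LEAST k. k < length w \<and> classical (w ! k))"
    have k: "k < length w" "classical (w ! k)" using LeastI_ex[of "\<lambda>k. k < length w \<and> classical (w ! k)"] True unfolding k_def by blast+
    have least: "\<not> classical (w ! j)" if "j < k" for j
      using not_less_Least[of j "\<lambda>k. k < length w \<and> classical (w ! k)"] that k(1) unfolding k_def by auto
    obtain c i where p: "w ! k = Cross c i" using k(2) by (cases "w ! k") auto
    have c: "c \<noteq> Virtual" using k(2) p by simp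
    let ?u = "take k w" and ?v = "drop (Suc k) w" and ?es = "dirs_at w k"
    have u: "filter classical ?u = []" using least by (auto simp: filter_empty_conv in_set_conv_nth)
    have w: "w = ?u @ [Cross c i] @ ?v" using id_take_nth_drop[OF k(1)] p by simp
    have ru: "run ?u [] = Some ?es" using dirs_at_run[OF 1(3)] k by simp
    obtain fs where fs: "act (Cross c i) ?es = Some fs" using dirs_at_act[OF 1(3) k(1)] p by simp
    let ?e = "piece_sign (Cross c i) ?es"
    have sg: "sign_at w k = ?e" using p by (simp add: sign_at_def)
    let ?s1 = "smoothing1 i (?es ! i) (?es ! Suc i)" and ?s2 = "smoothing2 i (?es ! i) (?es ! Suc i)"
    have sm: "smooth_at smoothing1 w k = ?u @ ?s1 @ ?v" "smooth_at smoothing2 w k = ?u @ ?s2 @ ?v"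
      using p by (simp_all add: smooth_at_def)
    have "run w [] = run ?v fs" by (subst w) (simp add: run_append ru fs del: act.simps)
    then have rv: "run ?v fs = Some []" using 1(3) by simp
    have r: "run (?u @ ?s1 @ ?v) [] = Some []" "run (?u @ ?s2 @ ?v) [] = Some []"
      using run_smoothing[OF fs] rv by (simp_all add: run_append ru)
    have ww: "wr w [] = wr ?u [] + (?e + wr ?v fs)"
      by (subst w) (simp add: wr_append[OF ru] fs del: act.simps piece_sign.simps)
    \<comment> \<open>The smoothings contain no classical crossing, so the writhe loses exactly the
      sign of the expanded one.\<close>
    have ws: "wr (?u @ ?s1 @ ?v) [] = wr ?u [] + wr ?v fs" "wr (?u @ ?s2 @ ?v) [] = wr ?u [] + wr ?v fs"
      using wr_flat[OF classical_smoothing(1)] wr_flat[OF classical_smoothing(2)]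
      by (simp_all add: wr_append[OF ru] wr_append[OF run_smoothing(1)[OF fs]] wr_append[OF run_smoothing(2)[OF fs]])
    have IH: "unit_of (wr ?u [] + wr ?v fs) * arrow_bracket (?u @ ?s1 @ ?v) = ev (?u @ ?s1 @ ?v) s0"
      "unit_of (wr ?u [] + wr ?v fs) * arrow_bracket (?u @ ?s2 @ ?v) = ev (?u @ ?s2 @ ?v) s0"
      using 1(1)[OF True k_def] 1(2)[OF True k_def] r unfolding sm ws by simp_all
    have b: "arrow_bracket w = A_pow ?e * arrow_bracket (?u @ ?s1 @ ?v) + A_pow (- ?e) * arrow_bracket (?u @ ?s2 @ ?v)"
      by (subst arrow_bracket.simps) (simp only: True if_True Let_def k_def[symmetric] sg sm)
    have "ev w s0 = foldr cont (?u @ [Cross c i] @ ?v) (\<lambda>_. 1) s0"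
      using arg_cong[OF w, of "\<lambda>w. ev w s0"] by (simp only: ev_def)
    also have "\<dots> = - A_pow (- 3 * ?e) * (A_pow ?e * ev (?u @ ?s1 @ ?v) s0 + A_pow (- ?e) * ev (?u @ ?s2 @ ?v) s0)"
      unfolding ev_def by (rule foldr_expand[OF u c ru good_s0])
    also have "- A_pow (- 3 * ?e) = unit_of ?e"
      using unit_of_sign(2) piece_sign_classical[of "Cross c i" ?es] c by simp
    also have "unit_of ?e * (A_pow ?e * ev (?u @ ?s1 @ ?v) s0 + A_pow (- ?e) * ev (?u @ ?s2 @ ?v) s0) =
        unit_of (wr w []) * arrow_bracket w"
      unfolding b ww IH[symmetric] unit_of_add by (simp add: algebra_simps)
    finally show ?thesis by simp
  qed
qed

theorem arrow_polynomial_ev: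
  assumes "link_diagram w"
  shows "arrow_polynomial w = ev w s0"
proof -
  have r: "run w [] = Some []" using assms by (simp add: link_diagram_def arrow_diagram_def)
  show ?thesis
    using bracket_ev[OF r] writhe_wr[OF r] unfolding arrow_polynomial_def unit_of_def by simp
qed

section \<open>Arrow flat tangles as states\<close>

lemma V_iff: "(a, k) \<in> V n \<longleftrightarrow> (a = 0 \<or> a = 1) \<and> 1 \<le> k \<and> k \<le> n"
  by (auto simp: V_def)

text \<open>The position of a vertex on a vertical line just to the right of the tangle, cut by the
  \<open>n\<close> strands that leave it and, above them, by the \<open>n\<close> closing arcs,
  which come from the left vertices in reversed order. The positions run opposite to the order
  \<open>vless\<close>.\<close>

fun enc :: "nat \<Rightarrow> vertex \<Rightarrow> nat" where
  "enc n (a, k) = (if a = 1 then k - 1 else 2 * n - k)"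

definition dec :: "nat \<Rightarrow> nat \<Rightarrow> vertex" where
  "dec n j = (if j < n then (1, Suc j) else (0, 2 * n - j))"

lemma dec_V: "j < 2 * n \<Longrightarrow> dec n j \<in> V n"
  by (auto simp: dec_def V_iff)

lemma enc_lt: "p \<in> V n \<Longrightarrow> enc n p < 2 * n"
  by (cases p) (auto simp: V_iff)

lemma dec_enc [simp]: "p \<in> V n \<Longrightarrow> dec n (enc n p) = p"
  by (cases p) (auto simp: V_iff dec_def)

lemma enc_dec [simp]: "j < 2 * n \<Longrightarrow> enc n (dec n j) = j"
  by (auto simp: dec_def)

lemma dec_inj: "inj_on (dec n) {..<2 * n}"
  by (rule inj_on_inverseI[of _ "enc n"]) simp

lemma dec_image: "dec n ` {..<2 * n} = V n"
proof
  show "V n \<subseteq> dec n ` {..<2 * n}"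
    using enc_lt dec_enc by (metis imageI lessThan_iff subsetI)
qed (use dec_V in auto)

lemma vless_linear: "p \<in> V n \<Longrightarrow> q \<in> V n \<Longrightarrow> p \<noteq> q \<Longrightarrow> vless q p \<longleftrightarrow> \<not> vless p q"
  by (cases p; cases q) (auto simp: V_iff)

definition partner :: "flat_tangle \<Rightarrow> vertex \<Rightarrow> vertex" where
  "partner E p = (THE q. {p, q} \<in> E)"

text \<open>The label of an edge is stated for the reading from its smaller to its larger vertex;
  the opposite reading is obtained by \<open>drev\<close>.\<close>

definition olab :: "(vertex set \<Rightarrow> int) \<Rightarrow> vertex \<Rightarrow> vertex \<Rightarrow> int" where
  "olab f p q = (if vless p q then f {p, q} else drev (f {p, q}))"

fun tangle_state :: "nat \<Rightarrow> arrow_tangle \<Rightarrow> lstate" where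
  "tangle_state n (E, f) = ([0..<2 * n], \<lambda>j. if j < n then East else West,
     \<lambda>j. enc n (partner E (dec n j)), \<lambda>j. olab f (dec n j) (partner E (dec n j)))"

lemma flat_tangle_ex:
  assumes "E \<in> flat_tangles n" "p \<in> V n"
  shows "\<exists>!q. {p, q} \<in> E" and "{p, q} \<in> E \<Longrightarrow> q \<noteq> p \<and> q \<in> V n"
proof -
  have E: "\<Union> E = V n" "disjoint E" "\<forall>\<alpha>\<in>E. card \<alpha> = 2"
    using assms(1) by (auto simp: flat_tangles_def partition_on_def)
  obtain \<alpha> where \<alpha>: "\<alpha> \<in> E" "p \<in> \<alpha>" using E(1) assms(2) by blast
  then obtain u v where "\<alpha> = {u, v}" "u \<noteq> v" using E(3) by (meson card_2_iff)
  then obtain r where q: "\<alpha> = {p, r}" using \<alpha>(2) by blast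
  have "q' = r" if "{p, q'} \<in> E" for q'
  proof -
    have "{p, q'} = {p, r}" using E(2) that \<alpha> q by (metis disjointD disjoint_iff insertI1)
    then show ?thesis by (auto simp: doubleton_eq_iff)
  qed
  then show "\<exists>!q. {p, q} \<in> E" using \<alpha> q by blast
  assume *: "{p, q} \<in> E"
  then have "card {p, q} = 2" using E(3) by blast
  then show "q \<noteq> p \<and> q \<in> V n" using E(1) * by (auto split: if_splits)
qed

lemma partner:
  assumes "E \<in> flat_tangles n" "p \<in> V n"
  shows "{p, partner E p} \<in> E" "partner E p \<in> V n" "partner E p \<noteq> p" "partner E (partner E p) = p"
proof -
  show a: "{p, partner E p} \<in> E" unfolding partner_def by (rule theI'[OF flat_tangle_ex(1)[OF assms]])
  show b: "partner E p \<in> V n" "partner E p \<noteq> p" using flat_tangle_ex(2)[OF assms a] by blast+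
  have "{partner E p, p} \<in> E" using a by (simp add: insert_commute)
  then show "partner E (partner E p) = p"
    unfolding partner_def[of E "partner E p"] using flat_tangle_ex(1)[OF assms(1) b(1)] by (rule the1_equality[rotated])
qed

lemma partner_eq: "E \<in> flat_tangles n \<Longrightarrow> p \<in> V n \<Longrightarrow> {p, q} \<in> E \<Longrightarrow> partner E p = q"
  using partner(1)[of E n p] flat_tangle_ex(1)[of E n p] by blast

lemma olab_rev: "p \<in> V n \<Longrightarrow> q \<in> V n \<Longrightarrow> p \<noteq> q \<Longrightarrow> olab f q p = drev (olab f p q)"
  using vless_linear[of p n q] by (auto simp: olab_def insert_commute)

lemma arrow_tangleD:
  assumes "(E, f) \<in> arrow_tangles n"
  shows "E \<in> flat_tangles n" "{p, q} \<in> E \<Longrightarrow> odd (f {p, q}) \<longleftrightarrow> fst p = fst q"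
    "{p, q} \<in> E \<Longrightarrow> odd (olab f p q) \<longleftrightarrow> fst p = fst q"
proof -
  show E: "E \<in> flat_tangles n" using assms by (simp add: arrow_tangles_def)
  show *: "odd (f {p, q}) \<longleftrightarrow> fst p = fst q" if "{p, q} \<in> E"
    using assms that by (auto simp: arrow_tangles_def split: if_splits)
  show "odd (olab f p q) \<longleftrightarrow> fst p = fst q" if "{p, q} \<in> E"
    using *[OF that] by (simp add: olab_def)
qed

lemma good_tangle_state:
  assumes "(E, f) \<in> arrow_tangles n"
  shows "good (tangle_state n (E, f))" "dirs (tangle_state n (E, f)) = EW n"
proof -
  note E = arrow_tangleD[OF assms]
  show "good (tangle_state n (E, f))" unfolding tangle_state.simps
  proof (rule goodI)
    fix u assume "u \<in> set [0..<2 * n]"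
    then have u: "u < 2 * n" by simp
    let ?q = "partner E (dec n u)"
    note p = partner(1-4)[OF E(1) dec_V[OF u]]
    have q: "dec n (enc n ?q) = ?q" "enc n ?q < 2 * n" using dec_enc[OF p(2)] enc_lt[OF p(2)] .
    have ne: "dec n u \<noteq> ?q" using p(3) by metis
    have d: "(if u < n then East else West) \<noteq> (if enc n ?q < n then East else West) \<longleftrightarrow> fst (dec n u) \<noteq> fst ?q"
      using p(2) u by (cases ?q) (auto simp: dec_def V_iff)
    have "enc n ?q \<noteq> u" using p(3) q(1) by metis
    then show "enc n ?q \<in> set [0..<2 * n] \<and> enc n (partner E (dec n (enc n ?q))) = u \<and> enc n ?q \<noteq> u \<and>
       olab f (dec n (enc n ?q)) (partner E (dec n (enc n ?q))) = drev (olab f (dec n u) ?q) \<and>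
       even (olab f (dec n u) ?q) = ((if u < n then East else West) \<noteq> (if enc n ?q < n then East else West))"
      unfolding q(1) p(4) d using q(2) u olab_rev[OF dec_V[OF u] p(2) ne, of f] E(3)[OF p(1)] by auto
  qed simp
  show "dirs (tangle_state n (E, f)) = EW n"
    by (auto simp: dirs.simps EW_def list_eq_iff_nth_eq nth_append)
qed

lemma cumulated_parity_Cons:
  "cumulated_parity (e # xs) (Suc i) = parity e * cumulated_parity xs i"
  "cumulated_parity (e # xs) 0 = (if vless (fst e) (snd e) then 1 else parity e)"
proof -
  have "(\<Prod>j<Suc k. parity ((e # xs) ! j)) = parity e * (\<Prod>j<k. parity (xs ! j))" for k
    by (simp add: prod.lessThan_Suc_shift del: prod.lessThan_Suc)
  from this[of i] this[of "Suc i"]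
  show "cumulated_parity (e # xs) (Suc i) = parity e * cumulated_parity xs i"
    unfolding cumulated_parity_def lessThan_Suc_atMost[symmetric] by simp
qed (simp add: cumulated_parity_def)

text \<open>The signed sum of labels is a composition by \<open>\<oplus>\<close>. The parities of
  the preceding edges are the signs produced by \<open>\<oplus>\<close>, and an edge read against
  the order also counts its own parity, which is the sign in \<open>drev\<close>.\<close>

lemma cumulated_sum:
  assumes "\<forall>i<length xs. odd (l i) \<longleftrightarrow> fst (fst (xs ! i)) = fst (snd (xs ! i))"
  shows "(\<Sum>i<length xs. cumulated_parity xs i * l i) =
    foldr (\<lambda>i t. (if vless (fst (xs ! i)) (snd (xs ! i)) then l i else drev (l i)) \<oplus> t) [0..<length xs] 0"
  using assms
proof (induction xs arbitrary: l)
  case (Cons e xs)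
  let ?o = "if vless (fst e) (snd e) then l 0 else drev (l 0)"
  have par: "parity e = (if even (l 0) then 1 else -1)"
    using Cons.prems[rule_format, of 0] by (cases e) auto
  have *: "cumulated_parity (e # xs) 0 * l 0 + parity e * t = ?o \<oplus> t" for t
    unfolding cumulated_parity_Cons par by (auto simp: dop_def drev_def)
  have "(\<Sum>i<length xs. cumulated_parity xs i * l (Suc i)) =
      foldr (\<lambda>i t. (if vless (fst (xs ! i)) (snd (xs ! i)) then l (Suc i) else drev (l (Suc i))) \<oplus> t) [0..<length xs] 0"
    by (rule Cons.IH) (use Cons.prems in auto)
  moreover have "[0..<length (e # xs)] = 0 # map Suc [0..<length xs]"
    by (simp add: map_Suc_upt upt_conv_Cons del: upt_Suc)
  ultimately show ?case using *
    by (simp add: sum.lessThan_Suc_shift cumulated_parity_Cons(1) mult.assoc sum_distrib_left[symmetric]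
        foldr_map o_def del: sum.lessThan_Suc upt_Suc)
qed simp

subsection \<open>The trace\<close>

context loops
begin

text \<open>A traveller never comes back along the same loop in the opposite direction: moving
  inwards from both ends of such a path would finally give a fixed point of \<open>A\<close> or
  \<open>B\<close>.\<close>

lemma f_ne_B: "x \<in> X \<Longrightarrow> (f ^^ n) x \<noteq> B x"
proof (induction n arbitrary: x rule: less_induct)
  case (less n)
  show ?case
  proof
    assume *: "(f ^^ n) x = B x"
    consider "n = 0" | "n = 1" | m where "n = Suc (Suc m)" by (metis One_nat_def old.nat.exhaust)
    then show False
    proof cases
      case 1
      then show ?thesis using * B(3)[OF less.prems] by simp
    next
      case 2
      then have "B (A x) = B x" using * by (simp add: f_def)
      then have "A x = x" using B(2) A(1) less.prems by metis
      then show ?thesis using A(3)[OF less.prems] by simp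
    next
      case (3 m)
      have "(f ^^ n) x = f ((f ^^ m) (f x))" unfolding 3 by (simp add: funpow_swap1)
      moreover have "f (A x) = B x" using A(2)[OF less.prems] by (simp add: f_def)
      ultimately have "f ((f ^^ m) (f x)) = f (A x)" using * by simp
      then have "(f ^^ m) (f x) = A x"
        using f_inj fn_in f_in A(1) less.prems by blast
      moreover have "B (f x) = A x" using B(2) A(1) less.prems by (simp add: f_def)
      ultimately show ?thesis using less.IH[of m "f x"] 3 f_in[OF less.prems] by simp
    qed
  qed
qed

lemma wsum_foldr: "wsum x n = foldr (\<lambda>i t. G ((f ^^ i) x) \<oplus> t) [0..<n] 0"
proof (induction n arbitrary: x)
  case (Suc n)
  have "[0..<Suc n] = 0 # map Suc [0..<n]"
    by (simp add: map_Suc_upt upt_conv_Cons del: upt_Suc)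
  then show ?case using Suc[of "f x"] by (simp add: foldr_map o_def fn_shift del: upt_Suc)
qed simp

text \<open>The innermost closing arc joins the last strand of \<open>us\<close> to the first one of
  \<open>vs\<close>. The ends are glued directly, so this is \<open>inv_at_close\<close> with no
  strand in between.\<close>

lemma facs_closers:
  assumes "inv_at \<phi> (set (us @ vs)) A' g S" "distinct (us @ vs)" "length us = k" "length vs = k"
    and "\<forall>i<k. B (\<phi> (us ! i)) = \<phi> (vs ! (k - Suc i))"
  shows "val (S \<union> \<phi> ` set (us @ vs)) = val S * facs (closers k) (us @ vs, D, A', g)"
  using assms
proof (induction k arbitrary: us vs A' g S)
  case 0
  then show ?case by (simp add: closers_def)
next
  case (Suc k)
  obtain us' x where us: "us = us' @ [x]" "length us' = k"
    using Suc.prems(3) by (metis length_Suc_conv_rev)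
  obtain y vs' where vs: "vs = y # vs'" "length vs' = k" using Suc.prems(4) by (cases vs) auto
  have Bx: "B (\<phi> x) = \<phi> y" using Suc.prems(5)[rule_format, of k] us vs by (simp add: nth_append)
  have xy: "x \<in> set (us @ vs)" "y \<in> set (us @ vs)" "x \<noteq> y" using Suc.prems(2) us vs by auto
  have By: "B (\<phi> y) = \<phi> x" using Bx B(2) inv_atD(1)[OF Suc.prems(1) xy(1)] by metis
  let ?A = "A'(A' x := A' y, A' y := A' x)"
  let ?g = "g(A' x := g (A' x) \<oplus> g y, A' y := g (A' y) \<oplus> g x)"
  let ?T = "S \<union> {\<phi> x, \<phi> y}"
  have T: "?T = S \<union> {\<phi> x, \<phi> y, B (\<phi> x), B (\<phi> y)}" using Bx By by auto
  have C: "inv_at \<phi> (set (us @ vs) - {x, y}) ?A ?g ?T"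
    "val ?T = val S * (if A' x = y then zval (g x) else 1)"
    using inv_at_close[OF Suc.prems(1) xy, of 0, OF _ _ _ T] Bx By by simp_all
  have st: "stp (Close k) (us @ vs, D, A', g) = (us' @ vs', D, ?A, ?g)"
    "fac (Close k) (us @ vs, D, A', g) = (if A' x = y then zval (g x) else 1)"
    using us vs by (simp_all add: us(2)[symmetric])
  have N: "set (us @ vs) - {x, y} = set (us' @ vs')" using Suc.prems(2) us vs by auto
  have "val (?T \<union> \<phi> ` set (us' @ vs')) = val ?T * facs (closers k) (us' @ vs', D, ?A, ?g)"
  proof (rule Suc.IH)
    show "inv_at \<phi> (set (us' @ vs')) ?A ?g ?T" using C(1) unfolding N .
    show "\<forall>i<k. B (\<phi> (us' ! i)) = \<phi> (vs' ! (k - Suc i))"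
    proof (intro allI impI)
      fix i assume "i < k"
      then show "B (\<phi> (us' ! i)) = \<phi> (vs' ! (k - Suc i))"
        using Suc.prems(5)[rule_format, of i] us vs by (simp add: nth_append Suc_diff_Suc[symmetric])
    qed
  qed (use Suc.prems(2) us vs in simp_all)
  moreover have "?T \<union> \<phi> ` set (us' @ vs') = S \<union> \<phi> ` set (us @ vs)" using us vs by auto
  ultimately show ?case using C(2) st by (simp add: closers_Suc mult.assoc)
qed

end

text \<open>The gluing by a closing arc and, in a product, of the right side of one tangle to the
  left side of the other.\<close>

fun switch :: "vertex \<Rightarrow> vertex" where
  "switch (a, k) = (1 - a, k)"

locale tangle =
  fixes n :: nat and E :: flat_tangle and f :: "vertex set \<Rightarrow> int"
  assumes tangle: "(E, f) \<in> arrow_tangles n"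
begin

sublocale lp: loops "V n" "partner E" switch "\<lambda>p. olab f p (partner E p)" "\<lambda>p. fst p = 0"
proof
  note p = partner[OF arrow_tangleD(1)[OF tangle]]
  show "finite (V n)" by (simp add: V_def)
  fix x assume x: "x \<in> V n"
  show "partner E x \<in> V n" "partner E (partner E x) = x" "partner E x \<noteq> x" using p[OF x] by simp_all
  show "switch x \<in> V n" "switch (switch x) = x" "switch x \<noteq> x" using x by (cases x; auto simp: V_iff)+
  show "(fst (switch x) = 0) \<noteq> (fst x = 0)" using x by (cases x; auto simp: V_iff)
  have "x \<noteq> partner E x" using p(3)[OF x] by metis
  then show "olab f (partner E x) (partner E (partner E x)) = drev (olab f x (partner E x))"
    using olab_rev[OF x p(2)[OF x]] p(4)[OF x] by simp
  have "(fst (partner E x) = 0) = (fst x = 0) \<longleftrightarrow> fst x = fst (partner E x)"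
    using x p(2)[OF x] by (cases x; cases "partner E x") (auto simp: V_iff)
  then show "(fst (partner E x) = 0) = (fst x = 0) \<longleftrightarrow> odd (olab f x (partner E x))"
    using arrow_tangleD(3)[OF tangle p(1)[OF x]] by simp
qed

lemmas pt = partner[OF arrow_tangleD(1)[OF tangle]]

text \<open>At the start nothing has been traversed, and each edge of the tangle is a recorded path
  of one strand.\<close>

lemma trace_val: "lp.val (V n) = facs (closers n) (tangle_state n (E, f))"
proof -
  let ?A = "\<lambda>j. enc n (partner E (dec n j))" and ?g = "\<lambda>j. olab f (dec n j) (partner E (dec n j))"
  let ?us = "[0..<n]" and ?vs = "[n..<2 * n]"
  have uv: "?us @ ?vs = [0..<2 * n]" using upt_add_eq_append[of 0 n n] by (simp add: mult_2)
  have sw: "switch (dec n i) = dec n (2 * n - Suc i)" if "i < n" for i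
    using that by (auto simp: dec_def)
  have i: "lp.inv_at (dec n) (set (?us @ ?vs)) ?A ?g {}"
    unfolding lp.inv_at_def uv
  proof (intro conjI ballI)
    have "set [0..<2 * n] = {..<2 * n}" by auto
    then show "inj_on (dec n) (set [0..<2 * n])" "dec n ` set [0..<2 * n] \<subseteq> V n"
      using dec_inj[of n] dec_image[of n] by simp_all
    fix j assume "j \<in> set [0..<2 * n]"
    then have j: "j < 2 * n" by simp
    note p = pt[OF dec_V[OF j]]
    show "?A j \<in> set [0..<2 * n]" "?A (?A j) = j" "?A j \<noteq> j"
      using p j enc_lt[OF p(2)] by (auto, metis dec_enc)
    show "\<exists>m>0. (lp.f ^^ m) (dec n j) = switch (dec n (?A j)) \<and> (\<forall>i. 0 < i \<longrightarrow> i < m \<longrightarrow> (lp.f ^^ i) (dec n j) \<in> {}) \<and>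
        lp.wsum (dec n j) m = ?g j"
      using p by (intro exI[of _ 1]) (simp add: lp.f_def)
  qed simp_all
  have "lp.val ({} \<union> dec n ` set (?us @ ?vs)) =
      lp.val {} * facs (closers n) (?us @ ?vs, \<lambda>j. if j < n then East else West, ?A, ?g)"
    by (rule lp.facs_closers[OF i]) (use sw in \<open>auto simp: mult_2\<close>)
  moreover have "dec n ` set (?us @ ?vs) = V n" unfolding uv using dec_image[of n] by (simp add: atLeast0LessThan)
  ultimately show ?thesis by (simp add: lp.val_empty uv)
qed

definition cycle :: "vertex \<Rightarrow> (vertex \<times> vertex) list" where
  "cycle x = map (\<lambda>i. ((lp.f ^^ i) x, partner E ((lp.f ^^ i) x))) [0..<lp.period x]"

text \<open>The starting vertices singled out in the definition of the cycles of a closure: on the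
  left side, with a number smaller than at all later stages. They provide one representative for
  each unoriented loop.\<close>

definition least :: "vertex \<Rightarrow> bool" where
  "least x \<longleftrightarrow> x \<in> V n \<and> fst x = 0 \<and> (\<forall>i. 0 < i \<longrightarrow> i < lp.period x \<longrightarrow> snd x < snd ((lp.f ^^ i) x))"

lemma snd_switch: "snd (switch p) = snd p"
  by (cases p) simp

lemma same_snd: "p \<in> V n \<Longrightarrow> q \<in> V n \<Longrightarrow> snd p = snd q \<Longrightarrow> q = p \<or> q = switch p"
  by (cases p; cases q) (auto simp: V_iff)

lemma cycle_least: assumes "least x" shows "is_closure_cycle E (cycle x)"
proof -
  have x: "x \<in> V n" and fx: "fst x = 0" using assms by (auto simp: least_def)
  let ?n = "lp.period x"
  have n: "0 < ?n" "(lp.f ^^ ?n) x = x" using lp.period[OF x] by simp_all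
  have in': "(lp.f ^^ i) x \<in> V n" for i by (rule lp.fn_in[OF x])
  have nth: "cycle x ! i = ((lp.f ^^ i) x, partner E ((lp.f ^^ i) x))" if "i < ?n" for i
    using that by (simp add: cycle_def)
  have len: "length (cycle x) = ?n" by (simp add: cycle_def)
  have next': "(lp.f ^^ Suc i) x = switch (partner E ((lp.f ^^ i) x))" for i by (simp add: lp.f_def)
  have sw: "a = (if c = 0 then 1 else 0) \<and> b' = b" if "switch (c, b) = (a, b')" "(c, b) \<in> V n" for a b b' c
    using that by (auto simp: V_iff)
  have hd: "hd (cycle x) = (x, partner E x)" using nth[of 0] n(1) len by (metis funpow_0 hd_conv_nth length_0_conv not_less_zero)
  have last: "last (cycle x) = ((lp.f ^^ (?n - 1)) x, partner E ((lp.f ^^ (?n - 1)) x))"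
    using nth[of "?n - 1"] n(1) len by (metis One_nat_def diff_less last_conv_nth length_0_conv not_less_zero zero_less_one)
  have end': "switch (partner E ((lp.f ^^ (?n - 1)) x)) = x" using next'[of "?n - 1"] n by simp
  have 1: "cycle x \<noteq> []" using len n(1) by auto
  have 2: "\<forall>(p, q)\<in>set (cycle x). {p, q} \<in> E" using pt(1)[OF in'] by (auto simp: cycle_def)
  have 3: "\<forall>i. Suc i < length (cycle x) \<longrightarrow>
     (case (cycle x ! i, cycle x ! Suc i) of ((_, (c, b)), ((a, b'), _)) \<Rightarrow> b' = b \<and> a = (if c = 0 then 1 else 0))"
  proof (intro allI impI)
    fix i assume i: "Suc i < length (cycle x)"
    obtain c b where q: "partner E ((lp.f ^^ i) x) = (c, b)" by (metis prod.exhaust)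
    obtain a b' where r: "(lp.f ^^ Suc i) x = (a, b')" by (metis prod.exhaust)
    have "switch (c, b) = (a, b')" using next'[of i] unfolding q r by (rule sym)
    moreover have "(c, b) \<in> V n" using pt(2)[OF in'[of i]] unfolding q .
    ultimately have sw': "b' = b \<and> a = (if c = 0 then 1 else 0)" using sw by blast
    have e: "cycle x ! i = ((lp.f ^^ i) x, (c, b))" using nth[of i] i len unfolding q by simp
    obtain y where e': "cycle x ! Suc i = ((a, b'), y)" using nth[of "Suc i"] i len unfolding r by simp
    show "case (cycle x ! i, cycle x ! Suc i) of ((_, (c, b)), ((a, b'), _)) \<Rightarrow> b' = b \<and> a = (if c = 0 then 1 else 0)"
      unfolding e e' prod.case by (rule sw')
  qed
  have 4: "case (hd (cycle x), last (cycle x)) of (((a, b\<^sub>0), _), (_, (c, b))) \<Rightarrow> b\<^sub>0 = b \<and> a = 0 \<and> c = 1"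
  proof -
    obtain c b where q: "partner E ((lp.f ^^ (?n - 1)) x) = (c, b)" by (metis prod.exhaust)
    obtain a b' where r: "x = (a, b')" by (metis prod.exhaust)
    have "switch (c, b) = (a, b')" using end' unfolding q using r by metis
    moreover have "(c, b) \<in> V n" using pt(2)[OF in'[of "?n - 1"]] unfolding q .
    ultimately have "a = (if c = 0 then 1 else 0) \<and> b' = b" using sw by blast
    moreover have "a = 0" using fx r by simp
    moreover have "c = 0 \<or> c = 1" using \<open>(c, b) \<in> V n\<close> unfolding V_iff by blast
    ultimately have c: "b' = b \<and> a = 0 \<and> c = 1" by (auto split: if_splits)
    obtain u v where e: "hd (cycle x) = ((a, b'), u)" "last (cycle x) = (v, (c, b))"
      using hd last unfolding q using r by metis
    show ?thesis unfolding e prod.case by (rule c)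
  qed
  have 5: "\<forall>i. Suc i < length (cycle x) \<longrightarrow> snd (fst (hd (cycle x))) < snd (snd (cycle x ! i))"
  proof (intro allI impI)
    fix i assume i: "Suc i < length (cycle x)"
    have L: "\<forall>i. 0 < i \<longrightarrow> i < ?n \<longrightarrow> snd x < snd ((lp.f ^^ i) x)"
      using assms unfolding least_def by (elim conjE) assumption
    have "snd x < snd ((lp.f ^^ Suc i) x)"
      by (rule spec[OF L, of "Suc i", THEN mp, THEN mp]) (use i len in simp_all)
    then have "snd x < snd (partner E ((lp.f ^^ i) x))" unfolding next' snd_switch .
    moreover have "snd (cycle x ! i) = partner E ((lp.f ^^ i) x)" using nth[of i] i len by simp
    moreover have "fst (hd (cycle x)) = x" using hd by simp
    ultimately show "snd (fst (hd (cycle x))) < snd (snd (cycle x ! i))" by metis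
  qed
  show ?thesis unfolding is_closure_cycle_def by (intro conjI 1 2 3 4 5)
qed

lemma closure_cycleD:
  assumes "is_closure_cycle E \<gamma>"
  shows "\<exists>x. least x \<and> \<gamma> = cycle x"
proof -
  define x where "x = fst (hd \<gamma>)"
  have ne: "\<gamma> \<noteq> []" using assms by (simp add: is_closure_cycle_def)
  have edge: "{fst (\<gamma> ! i), snd (\<gamma> ! i)} \<in> E" if "i < length \<gamma>" for i
    using assms nth_mem[OF that] unfolding is_closure_cycle_def
    by (elim conjE) (drule (1) bspec, simp add: case_prod_beta)
  have UE: "\<Union> E = V n" using arrow_tangleD(1)[OF tangle] by (auto simp: flat_tangles_def partition_on_def)
  have in': "fst (\<gamma> ! i) \<in> V n" "snd (\<gamma> ! i) \<in> V n" "snd (\<gamma> ! i) = partner E (fst (\<gamma> ! i))" if "i < length \<gamma>" for i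
  proof -
    show 1: "fst (\<gamma> ! i) \<in> V n" "snd (\<gamma> ! i) \<in> V n" using edge[OF that] UE by blast+
    show "snd (\<gamma> ! i) = partner E (fst (\<gamma> ! i))" using partner_eq[OF arrow_tangleD(1)[OF tangle] 1(1) edge[OF that]] by simp
  qed
  have step: "fst (\<gamma> ! Suc i) = switch (snd (\<gamma> ! i))" if "Suc i < length \<gamma>" for i
  proof -
    have A: "\<forall>i. Suc i < length \<gamma> \<longrightarrow>
        (case (\<gamma> ! i, \<gamma> ! Suc i) of ((_, (c, b)), ((a, b'), _)) \<Rightarrow> b' = b \<and> a = (if c = 0 then 1 else 0))"
      using assms unfolding is_closure_cycle_def by (elim conjE) assumption
    note mp[OF spec[OF A, of i] that]
    moreover have "fst (snd (\<gamma> ! i)) = 0 \<or> fst (snd (\<gamma> ! i)) = 1"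
      using in'(2)[of i] that by (cases "snd (\<gamma> ! i)") (auto simp: V_iff)
    ultimately show ?thesis by (cases "\<gamma> ! i"; cases "\<gamma> ! Suc i"; cases "snd (\<gamma> ! i)") auto
  qed
  have it: "fst (\<gamma> ! i) = (lp.f ^^ i) x" if "i < length \<gamma>" for i
    using that
  proof (induction i)
    case 0
    then show ?case using ne by (simp add: x_def hd_conv_nth)
  next
    case (Suc i)
    then show ?case using step[of i] in'(3)[of i] by (simp add: lp.f_def)
  qed
  let ?n = "length \<gamma>"
  have x: "x \<in> V n" using in'(1)[of 0] it[of 0] ne by auto
  have ends: "snd x = snd (snd (last \<gamma>))" "fst x = 0" "fst (snd (last \<gamma>)) = 1"
    using assms unfolding is_closure_cycle_def x_def by (simp_all add: case_prod_beta)
  have last: "last \<gamma> = \<gamma> ! (?n - 1)" using ne by (rule last_conv_nth)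
  have "switch (snd (last \<gamma>)) = x" using ends by (cases x; cases "snd (last \<gamma>)") auto
  then have "switch (partner E ((lp.f ^^ (?n - 1)) x)) = x" using last in'(3)[of "?n - 1"] it[of "?n - 1"] ne by simp
  then have "(lp.f ^^ Suc (?n - 1)) x = x" by (simp add: lp.f_def)
  then have per: "(lp.f ^^ ?n) x = x" using ne by simp
  have min: "snd x < snd ((lp.f ^^ i) x)" if i: "0 < i" "i < ?n" for i
  proof -
    obtain j where j: "i = Suc j" using i by (cases i) auto
    have "snd (fst (hd \<gamma>)) < snd (snd (\<gamma> ! j))"
      using assms i j unfolding is_closure_cycle_def by blast
    then have "snd x < snd (switch (snd (\<gamma> ! j)))" unfolding x_def snd_switch .
    then show ?thesis using step[of j] it[of i] i j by simp
  qed
  have p: "lp.period x = ?n"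
  proof (rule lp.period_eqI)
    fix j assume j: "0 < j" "j < ?n"
    show "(lp.f ^^ j) x \<noteq> x"
    proof
      assume "(lp.f ^^ j) x = x"
      then show False using min[OF j] by simp
    qed
  qed (use ne per in simp_all)
  have "\<gamma> = cycle x"
  proof (rule nth_equalityI)
    fix i assume "i < ?n"
    then have "fst (\<gamma> ! i) = (lp.f ^^ i) x" "snd (\<gamma> ! i) = partner E ((lp.f ^^ i) x)" "i < lp.period x"
      using p it[of i] in'(3)[of i] by simp_all
    then show "\<gamma> ! i = cycle x ! i" unfolding cycle_def by (cases "\<gamma> ! i") simp
  qed (simp add: p cycle_def)
  moreover have "least x" unfolding least_def p using x ends(2) min by blast
  ultimately show ?thesis by blast
qed

lemma cycle_label: assumes "x \<in> V n" shows "closure_cycle_label f (cycle x) = lp.hol x"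
proof -
  have len: "length (cycle x) = lp.period x" by (simp add: cycle_def)
  have nth: "cycle x ! i = ((lp.f ^^ i) x, partner E ((lp.f ^^ i) x))" if "i < lp.period x" for i
    using that by (simp add: cycle_def)
  let ?l = "\<lambda>i. case cycle x ! i of (p, q) \<Rightarrow> f {p, q}"
  have "closure_cycle_label f (cycle x) = foldr (\<lambda>i t. (if vless (fst (cycle x ! i)) (snd (cycle x ! i)) then ?l i else drev (?l i)) \<oplus> t)
      [0..<length (cycle x)] 0"
    unfolding closure_cycle_label_def
    by (rule cumulated_sum) (use nth len arrow_tangleD(2)[OF tangle pt(1)[OF lp.fn_in[OF assms]]] in simp)
  also have "\<dots> = foldr (\<lambda>i t. olab f ((lp.f ^^ i) x) (partner E ((lp.f ^^ i) x)) \<oplus> t) [0..<lp.period x] 0"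
    by (rule foldr_cong) (use nth len in \<open>auto simp: olab_def\<close>)
  also have "\<dots> = lp.hol x" unfolding lp.hol_def by (rule lp.wsum_foldr[symmetric])
  finally show ?thesis .
qed

text \<open>The definition of \<open>least\<close> compares along one direction of travel. In the
  other direction the traveller meets the same numbers, as vertices are only replaced by their
  partners under \<open>switch\<close>.\<close>

lemma least_le: assumes "least x" "y \<in> lp.loop_of x" shows "snd x \<le> snd y"
proof -
  have x: "x \<in> V n" using assms by (simp add: least_def)
  have L: "snd x < snd ((lp.f ^^ i) x)" if "0 < i" "i < lp.period x" for i
    using assms(1) that unfolding least_def by (elim conjE) (erule allE[of _ i], simp)
  have orb: "snd x \<le> snd ((lp.f ^^ i) x)" for i
  proof -
    have "(lp.f ^^ i) x = (lp.f ^^ (i mod lp.period x)) x"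
      by (rule funpow_mod_eq[symmetric]) (rule lp.period(2)[OF x])
    moreover have "i mod lp.period x < lp.period x" using lp.period(1)[OF x] by simp
    ultimately show ?thesis using L[of "i mod lp.period x"] by (cases "i mod lp.period x = 0") auto
  qed
  have rev: "snd ((lp.f ^^ i) (partner E x)) \<ge> snd x" for i
  proof -
    have "(lp.f ^^ (i * lp.period x)) x = x"
      using lp.period(2)[OF x] by (induction i) (auto simp: funpow_add)
    moreover have "i * lp.period x = i + (i * lp.period x - i)" using lp.period(1)[OF x] by (cases "lp.period x") auto
    ultimately obtain m where m: "(lp.f ^^ i) ((lp.f ^^ m) x) = x" by (metis funpow_add o_apply)
    have "(lp.f ^^ i) (partner E x) = partner E ((lp.f ^^ m) x)"
      using lp.fn_A_fn[OF lp.fn_in[OF x], of i m] m by simp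
    moreover have "snd (partner E ((lp.f ^^ m) x)) = snd ((lp.f ^^ Suc m) x)" by (simp add: lp.f_def snd_switch)
    ultimately show ?thesis using orb[of "Suc m"] by simp
  qed
  consider i where "y = (lp.f ^^ i) x" | i where "y = (lp.f ^^ i) (partner E x)"
    using assms(2) unfolding lp.loop_of_def lp.orb_def by blast
  then show ?thesis using orb rev by cases simp_all
qed

lemma obtain_min:
  fixes C :: "vertex set"
  assumes "finite C" "C \<noteq> {}" "\<And>u. u \<in> C \<Longrightarrow> \<forall>v\<in>C. snd u \<le> snd v \<Longrightarrow> thesis"
  shows thesis
proof -
  have fin: "finite (snd ` C)" "snd ` C \<noteq> {}" using assms by simp_all
  obtain u where u: "u \<in> C" "snd u = Min (snd ` C)" using Min_in[OF fin] by auto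
  have "\<forall>v\<in>C. snd u \<le> snd v" using Min_le[OF fin(1)] u(2) by simp
  then show ?thesis using assms(3) u(1) by blast
qed

lemma least_ex: assumes "C \<in> lp.comps" shows "\<exists>x. least x \<and> lp.loop_of x = C"
proof -
  obtain y where y: "y \<in> V n" "C = lp.loop_of y" using assms unfolding lp.comps_def by blast
  have CV: "C \<subseteq> V n" using y lp.comp_subset by simp
  then have "finite C" using lp.finite finite_subset by blast
  moreover have "C \<noteq> {}" using y(2) lp.comp_self[of y] by blast
  ultimately obtain u where u: "u \<in> C" "\<forall>v\<in>C. snd u \<le> snd v"
    by (rule obtain_min) auto
  have cu: "lp.loop_of u = C" using lp.comp_eq u(1) y by simp
  \<comment> \<open>A vertex with the smallest number may lie on the right side;
    \<open>switch\<close> then gives a left vertex of the same loop with the same number.\<close>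
  define x where "x = (if fst u = 0 then u else switch u)"
  have uV: "u \<in> V n" using u CV by blast
  have x: "x \<in> V n" "fst x = 0" "lp.loop_of x = C" "snd x = snd u"
  proof -
    have "fst (switch u) = 0" if "fst u \<noteq> 0" using that uV by (cases u) (auto simp: V_iff)
    then show "x \<in> V n" "fst x = 0" "lp.loop_of x = C" "snd x = snd u"
      unfolding x_def using uV lp.B(1)[OF uV] lp.comp_B[OF uV] cu snd_switch[of u] by (simp_all split: if_split)
  qed
  have "least x" unfolding least_def
  proof (intro conjI x(1,2) allI impI)
    fix i assume i: "0 < i" "i < lp.period x"
    let ?v = "(lp.f ^^ i) x"
    have v: "?v \<in> C" using lp.comp_self[of ?v] lp.comp_fn[OF x(1), of i] x(3) by simp
    have vV: "?v \<in> V n" by (rule lp.fn_in[OF x(1)])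
    have "?v \<noteq> x" using lp.period_least[OF i(1)] i(2) by (metis not_le)
    \<comment> \<open>The two vertices with a given number are exchanged by \<open>switch\<close>,
      so this makes the inequality strict.\<close>
    moreover have "?v \<noteq> switch x" by (rule lp.f_ne_B[OF x(1)])
    ultimately have "snd ?v \<noteq> snd x" using same_snd[OF x(1) vV] by metis
    then show "snd x < snd ?v" using u(2) v x(4) by (metis le_neq_implies_less)
  qed
  then show ?thesis using x(3) by blast
qed

lemma least_unique: assumes "least x" "least y" "lp.loop_of x = lp.loop_of y" shows "x = y"
proof -
  have "snd x \<le> snd y" using least_le[OF assms(1), of y] assms(3) lp.comp_self[of y] by simp
  moreover have "snd y \<le> snd x" using least_le[OF assms(2), of x] assms(3) lp.comp_self[of x] by simp
  ultimately show ?thesis using assms(1,2) by (simp add: least_def prod_eq_iff)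
qed

theorem basis_trace_facs: "basis_trace (E, f) = facs (closers n) (tangle_state n (E, f))"
proof -
  have bij: "bij_betw (\<lambda>x. cycle x) {x. least x} {\<gamma>. is_closure_cycle E \<gamma>}"
  proof (rule bij_betwI')
    fix x y assume "x \<in> {x. least x}" "y \<in> {x. least x}"
    then have *: "x \<in> V n" "y \<in> V n" by (simp_all add: least_def)
    have hd: "fst (hd (cycle u)) = u" if "u \<in> V n" for u
      using lp.period(1)[OF that] by (simp add: cycle_def hd_map)
    show "(cycle x = cycle y) = (x = y)" using hd[OF *(1)] hd[OF *(2)] by metis
  next
    fix x assume "x \<in> {x. least x}"
    then show "cycle x \<in> {\<gamma>. is_closure_cycle E \<gamma>}" using cycle_least by blast
  next
    fix \<gamma> assume "\<gamma> \<in> {\<gamma>. is_closure_cycle E \<gamma>}"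
    then show "\<exists>x\<in>{x. least x}. \<gamma> = cycle x" using closure_cycleD by blast
  qed
  have bij2: "bij_betw lp.loop_of {x. least x} lp.comps"
  proof (rule bij_betwI')
    fix x y assume "x \<in> {x. least x}" "y \<in> {x. least x}"
    then show "(lp.loop_of x = lp.loop_of y) = (x = y)" using least_unique[of x y] by blast
  next
    fix x assume "x \<in> {x. least x}"
    then have "x \<in> V n" by (simp add: least_def)
    then show "lp.loop_of x \<in> lp.comps" unfolding lp.comps_def by blast
  next
    fix C assume "C \<in> lp.comps"
    then show "\<exists>x\<in>{x. least x}. C = lp.loop_of x" using least_ex by blast
  qed
  have "basis_trace (E, f) = (\<Prod>\<gamma> | is_closure_cycle E \<gamma>. zval (closure_cycle_label f \<gamma>))"
    by (simp add: zval_def)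
  also have "\<dots> = (\<Prod>x | least x. zval (closure_cycle_label f (cycle x)))"
    by (rule prod.reindex_bij_betw[OF bij, symmetric])
  also have "\<dots> = (\<Prod>x | least x. lp.zcomp (lp.loop_of x))"
  proof (rule prod.cong)
    fix x assume "x \<in> {x. least x}"
    then have "x \<in> V n" by (simp add: least_def)
    then show "zval (closure_cycle_label f (cycle x)) = lp.zcomp (lp.loop_of x)"
      using cycle_label lp.zcomp by simp
  qed simp
  also have "\<dots> = lp.val (V n)" unfolding lp.val_X by (rule prod.reindex_bij_betw[OF bij2])
  finally show ?thesis using trace_val by simp
qed

end

section \<open>Products with the generators\<close>

text \<open>A recursive form of arcs without the condition \<open>vless\<close> on their ends, so
  that an arc can be read from either end and composed of smaller pieces. The flag tells in which
  tangle it begins.\<close>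

fun chain :: "flat_tangle \<Rightarrow> flat_tangle \<Rightarrow> bool \<Rightarrow> vertex \<Rightarrow> tagged list \<Rightarrow> vertex \<Rightarrow> bool" where
  "chain E E' t p [] q \<longleftrightarrow> False"
| "chain E E' t p ((t', p', r) # \<alpha>) q \<longleftrightarrow> t' = t \<and> p' = p \<and> {p, r} \<in> (if t then E' else E) \<and>
     (if \<alpha> = [] then r = q \<and> fst q = (if t then 1 else 0)
      else fst r = (if t then 0 else 1) \<and> chain E E' (\<not> t) (switch r) \<alpha> q)"

lemma chain_iff:
  "chain E E' t p \<alpha> q \<longleftrightarrow> \<alpha> \<noteq> [] \<and> (\<forall>i<length \<alpha>. tagged_in E E' (\<alpha> ! i)) \<and>
     (\<forall>i. Suc i < length \<alpha> \<longrightarrow>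
        (case (\<alpha> ! i, \<alpha> ! Suc i) of ((t, _, (c, b)), (t', (a, b'), _)) \<Rightarrow>
           b' = b \<and> (if \<not> t then c = 1 \<and> t' \<and> a = 0 else c = 0 \<and> \<not> t' \<and> a = 1))) \<and>
     fst (hd \<alpha>) = t \<and> fst (snd (hd \<alpha>)) = p \<and> snd (snd (last \<alpha>)) = q \<and>
     fst q = (if fst (last \<alpha>) then 1 else 0)"
proof (induction \<alpha> arbitrary: t p)
  case (Cons e \<alpha>)
  obtain t' p' r where e': "e = (t', p', r)" by (cases e) auto
  obtain c b where r: "r = (c, b)" by (cases r) auto
  note e = e'[unfolded r]
  show ?case
  proof (cases \<alpha>)
    case Nil
    then show ?thesis using e by auto
  next
    case \<alpha>: (Cons e2 \<alpha>2)
    obtain t2 p2 r2 where e2': "e2 = (t2, p2, r2)" by (cases e2) auto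
    obtain a b' where p2: "p2 = (a, b')" by (cases p2) auto
    note e2 = e2'[unfolded p2]
    define X where "X = (\<forall>i<length \<alpha>. tagged_in E E' (\<alpha> ! i))"
    define R where "R = (\<lambda>(x :: tagged) (y :: tagged). case (x, y) of ((t, _, (c, b)), (t', (a, b'), _)) \<Rightarrow>
           b' = b \<and> (if \<not> t then c = (1::nat) \<and> t' \<and> a = (0::nat) else c = 0 \<and> \<not> t' \<and> a = 1))"
    define Y where "Y = (\<forall>i. Suc i < length \<alpha> \<longrightarrow> R (\<alpha> ! i) (\<alpha> ! Suc i))"
    define Z where "Z = (snd (snd (last \<alpha>)) = q \<and> fst q = (if fst (last \<alpha>) then 1 else 0))"
    have ne: "\<alpha> \<noteq> []" and h: "hd \<alpha> = e2" and last: "last (e # \<alpha>) = last \<alpha>" using \<alpha> by simp_all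
    have IH: "chain E E' (\<not> t) (switch (c, b)) \<alpha> q \<longleftrightarrow> X \<and> Y \<and> t2 = (\<not> t) \<and> (a, b') = switch (c, b) \<and> Z"
    proof -
      have h1: "fst (hd \<alpha>) = t2" and h2: "fst (snd (hd \<alpha>)) = (a, b')" using h e2 by simp_all
      show ?thesis
        unfolding Cons.IH[of "\<not> t" "switch (c, b)"] X_def Y_def Z_def R_def h1 h2 by (simp only: ne simp_thms)
    qed
    have A: "(\<forall>i<length (e # \<alpha>). tagged_in E E' ((e # \<alpha>) ! i)) \<longleftrightarrow> tagged_in E E' e \<and> X"
      unfolding X_def length_Cons All_less_Suc2 by simp
    have B: "(\<forall>i. Suc i < length (e # \<alpha>) \<longrightarrow> R ((e # \<alpha>) ! i) ((e # \<alpha>) ! Suc i)) \<longleftrightarrow> R e e2 \<and> Y"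
      unfolding Y_def \<alpha> by (simp add: All_less_Suc2)
    have Re: "R e e2 \<longleftrightarrow> b' = b \<and> (if \<not> t' then c = 1 \<and> t2 \<and> a = 0 else c = 0 \<and> \<not> t2 \<and> a = 1)"
      unfolding R_def e e2 by simp
    have L: "chain E E' t p (e # \<alpha>) q \<longleftrightarrow> t' = t \<and> p' = p \<and> {p, (c, b)} \<in> (if t then E' else E) \<and>
        c = (if t then 0 else 1) \<and> chain E E' (\<not> t) (switch (c, b)) \<alpha> q"
      unfolding e chain.simps using ne by simp
    have "chain E E' t p (e # \<alpha>) q \<longleftrightarrow> (tagged_in E E' e \<and> X) \<and> (R e e2 \<and> Y) \<and> t' = t \<and> p' = p \<and> Z"
      unfolding L IH Re unfolding e by (cases t; cases t') auto
    also have "\<dots> \<longleftrightarrow> e # \<alpha> \<noteq> [] \<and> (\<forall>i<length (e # \<alpha>). tagged_in E E' ((e # \<alpha>) ! i)) \<and>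
       (\<forall>i. Suc i < length (e # \<alpha>) \<longrightarrow> R ((e # \<alpha>) ! i) ((e # \<alpha>) ! Suc i)) \<and>
       fst (hd (e # \<alpha>)) = t \<and> fst (snd (hd (e # \<alpha>))) = p \<and> snd (snd (last (e # \<alpha>))) = q \<and>
       fst q = (if fst (last (e # \<alpha>)) then 1 else 0)"
      unfolding A B last unfolding Z_def e by simp
    finally show ?thesis unfolding R_def .
  qed
qed simp

lemma is_arc_iff:
  "is_arc E E' \<alpha> \<longleftrightarrow> (\<exists>t p q. chain E E' t p \<alpha> q \<and> fst p = (if t then 1 else 0) \<and> vless p q)"
proof (cases "\<alpha> = []")
  case False
  obtain t p r where h: "hd \<alpha> = (t, p, r)" by (cases "hd \<alpha>") auto
  obtain t' r' q where l: "last \<alpha> = (t', r', q)" by (cases "last \<alpha>") auto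
  show ?thesis using False unfolding is_arc_def chain_iff h l by auto
qed (simp add: is_arc_def chain_iff)

lemma chain_boundary: "chain E E' t p \<alpha> q \<Longrightarrow> boundary \<alpha> = {p, q}"
  by (simp add: chain_iff boundary_def)

lemma flat_Union: "E \<in> flat_tangles n \<Longrightarrow> {p, q} \<in> E \<Longrightarrow> p \<in> V n"
  by (auto simp: flat_tangles_def partition_on_def)

lemma edge_unique: "E \<in> flat_tangles n \<Longrightarrow> {p, q} \<in> E \<Longrightarrow> {p, r} \<in> E \<Longrightarrow> q = r"
  using flat_tangle_ex(1)[of E n p] flat_Union by blast

lemma path_label_Nil [simp]: "path_label f f' [] = 0"
  by (simp add: path_label_def)

locale tangle_pair =
  fixes n :: nat and E E' :: flat_tangle and f f' :: "vertex set \<Rightarrow> int"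
  assumes tangles: "(E, f) \<in> arrow_tangles n" "(E', f') \<in> arrow_tangles n"
begin

lemma flats: "(if t then E' else E) \<in> flat_tangles n"
  using arrow_tangleD(1) tangles by simp

lemma chain_unique:
  assumes "chain E E' t p \<alpha> q" "chain E E' t p \<beta> q'" shows "\<alpha> = \<beta> \<and> q = q'"
  using assms
proof (induction \<alpha> arbitrary: t p \<beta>)
  case (Cons e \<alpha>)
  obtain t1 p1 r where e: "e = (t1, p1, r)" by (metis prod.exhaust)
  obtain t2 p2 r2 \<beta>2 where b: "\<beta> = (t2, p2, r2) # \<beta>2"
    using Cons.prems(2) by (metis chain.simps(1) list.exhaust prod.exhaust)
  have r: "r = r2" using edge_unique[OF flats[of t]] Cons.prems unfolding e b chain.simps by metis
  have tp: "t1 = t2" "p1 = p2" using Cons.prems unfolding e b by auto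
  show ?case
  proof (cases "\<alpha> = [] \<or> \<beta>2 = []")
    case True
    then have "\<alpha> = [] \<and> \<beta>2 = []" using Cons.prems r unfolding e b by (auto split: if_splits)
    then show ?thesis using Cons.prems r tp unfolding e b by auto
  next
    case False
    then show ?thesis using Cons.IH[of "\<not> t" "switch r" \<beta>2] Cons.prems r tp unfolding e b by simp
  qed
qed simp

lemma path_label_Cons:
  assumes "tagged_in E E' (t, p, q)"
  shows "path_label f f' ((t, p, q) # \<alpha>) = olab (if t then f' else f) p q \<oplus> path_label f f' \<alpha>"
proof -
  let ?l = "(if t then f' else f) {p, q}"
  have par: "parity (p, q) = (if even ?l then 1 else -1)"
    using arrow_tangleD(2)[OF tangles(1), of p q] arrow_tangleD(2)[OF tangles(2), of p q] assms by (cases t) auto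
  have "path_label f f' ((t, p, q) # \<alpha>) =
      (if vless p q then 1 else parity (p, q)) * ?l + parity (p, q) * path_label f f' \<alpha>"
    unfolding path_label_def
    by (simp add: sum.lessThan_Suc_shift cumulated_parity_Cons mult.assoc sum_distrib_left
        del: sum.lessThan_Suc parity.simps)
  then show ?thesis unfolding par by (auto simp: dop_def drev_def olab_def)
qed

text \<open>A criterion for recognising the product: it suffices that every arc of the state is
  realised by a chain with the right label. Uniqueness of chains ensures that there are no other
  arcs, and that the choice of the arc in the definition of the product is well determined.\<close>

lemma product_rn:
  assumes good: "good (xs, D, A, g)" and dirs: "map D xs = EW n"
    and \<phi>: "inj_on \<phi> (set xs)" "map \<phi> xs = [0..<2 * n]"
    and ch: "\<And>x. x \<in> set xs \<Longrightarrow> \<exists>\<alpha>. chain E E' (\<phi> x < n) (dec n (\<phi> x)) \<alpha> (dec n (\<phi> (A x))) \<and> path_label f f' \<alpha> = g x"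
  shows "rn (xs, D, A, g) (tangle_state n (arrow_product (E, f) (E', f')))"
proof -
  let ?P = "flat_product E E'" and ?v = "\<lambda>x. dec n (\<phi> x)"
  have img: "\<phi> ` set xs = {..<2 * n}" using \<phi>(2) by (metis atLeast_upt list.set_map)
  note I = goodD[OF good]
  have lt: "\<phi> x < 2 * n" if "x \<in> set xs" for x using img that by auto
  have V: "?v x \<in> V n" if "x \<in> set xs" for x using dec_V lt that by blast
  have inj: "?v x = ?v y \<longleftrightarrow> x = y" if "x \<in> set xs" "y \<in> set xs" for x y
    using that lt \<phi>(1) by (metis enc_dec inj_onD)
  have ne: "?v x \<noteq> ?v (A x)" if "x \<in> set xs" for x using I(1,3) inj that by metis
  have surj: "\<exists>x\<in>set xs. p = ?v x \<and> (\<phi> x < n \<longleftrightarrow> fst p = 1)" if "p \<in> V n" for p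
  proof -
    obtain j where j: "j < 2 * n" "p = dec n j" using \<open>p \<in> V n\<close> dec_image[of n] by auto
    then obtain x where "x \<in> set xs" "\<phi> x = j" using img by (metis imageE lessThan_iff)
    then show ?thesis using j by (auto simp: dec_def)
  qed
  \<comment> \<open>An arc starts at an end that also starts the chain of some strand, and chains
    with the same start coincide.\<close>
  have arc: "\<exists>x\<in>set xs. chain E E' (\<phi> x < n) (?v x) \<alpha> (?v (A x)) \<and> vless (?v x) (?v (A x)) \<and>
      path_label f f' \<alpha> = g x \<and> boundary \<alpha> = {?v x, ?v (A x)}" if a: "is_arc E E' \<alpha>" for \<alpha>
  proof -
    obtain t p q where c: "chain E E' t p \<alpha> q" "fst p = (if t then 1 else 0)" "vless p q"
      using a is_arc_iff by blast
    obtain t' p' r \<alpha>' where al: "\<alpha> = (t', p', r) # \<alpha>'" using c(1) by (metis chain.simps(1) list.exhaust prod.exhaust)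
    have "p \<in> V n" using c(1) flat_Union[OF flats[of t], of p r] unfolding al by simp
    then obtain x where x: "x \<in> set xs" "p = ?v x" "\<phi> x < n \<longleftrightarrow> t"
      using surj[of p] c(2) by (auto split: if_splits)
    obtain \<beta> where b: "chain E E' (\<phi> x < n) (?v x) \<beta> (?v (A x))" "path_label f f' \<beta> = g x"
      using ch[OF x(1)] by blast
    have "\<alpha> = \<beta> \<and> q = ?v (A x)" by (rule chain_unique[of t p]) (use c b x in simp_all)
    then show ?thesis using b x c(3) chain_boundary by (metis (no_types))
  qed
  have ex: "\<exists>\<alpha>. is_arc E E' \<alpha> \<and> boundary \<alpha> = {?v x, ?v (A x)}"
    if x: "x \<in> set xs" "vless (?v x) (?v (A x))" for x
  proof -
    obtain \<alpha> where a: "chain E E' (\<phi> x < n) (?v x) \<alpha> (?v (A x))" using ch[OF x(1)] by blast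
    have "fst (?v x) = (if \<phi> x < n then 1 else 0)" by (simp add: dec_def)
    then show ?thesis using is_arc_iff a x(2) chain_boundary[OF a] by blast
  qed
  have mem: "{?v x, ?v (A x)} \<in> ?P" if x: "x \<in> set xs" for x
  proof (cases "vless (?v x) (?v (A x))")
    case True
    then show ?thesis using ex[OF x] unfolding flat_product_def by blast
  next
    case False
    then have "vless (?v (A x)) (?v (A (A x)))"
      using vless_linear[OF V[OF x] V[OF I(1)[OF x]] ne[OF x]] I(2)[OF x] by simp
    from ex[OF I(1)[OF x] this] show ?thesis
      unfolding flat_product_def using I(2)[OF x] by (auto simp: insert_commute)
  qed
  have sub: "\<exists>x\<in>set xs. B = {?v x, ?v (A x)}" if "B \<in> ?P" for B
    using that arc unfolding flat_product_def by blast
  have eqA: "q = ?v (A x)" if "{?v x, q} \<in> ?P" "x \<in> set xs" for x q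
  proof -
    obtain y where y: "y \<in> set xs" "{?v x, q} = {?v y, ?v (A y)}" using sub \<open>{?v x, q} \<in> ?P\<close> by blast
    then consider "?v x = ?v y" "q = ?v (A y)" | "?v x = ?v (A y)" "q = ?v y"
      by (auto simp: doubleton_eq_iff)
    then show ?thesis
    proof cases
      case 1
      then show ?thesis using inj[of x y] y(1) \<open>x \<in> set xs\<close> by simp
    next
      case 2
      then have "x = A y" using inj[of x "A y"] I(1)[OF y(1)] \<open>x \<in> set xs\<close> by simp
      then show ?thesis using 2 I(2)[OF y(1)] by simp
    qed
  qed
  have part: "partner ?P (?v x) = ?v (A x)" if "x \<in> set xs" for x
    unfolding partner_def by (rule the_equality) (use mem eqA that in blast)+
  define l where "l = (\<lambda>B\<in>?P. path_label f f' (THE \<alpha>. is_arc E E' \<alpha> \<and> boundary \<alpha> = B))"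
  have lab: "l {?v x, ?v (A x)} = g x" if x: "x \<in> set xs" "vless (?v x) (?v (A x))" for x
  proof -
    obtain \<alpha> where a: "is_arc E E' \<alpha>" "boundary \<alpha> = {?v x, ?v (A x)}" using ex[OF x] by blast
    have un: "chain E E' (\<phi> x < n) (?v x) \<beta> (?v (A x)) \<and> path_label f f' \<beta> = g x"
      if b: "is_arc E E' \<beta>" "boundary \<beta> = {?v x, ?v (A x)}" for \<beta>
    proof -
      obtain y where y: "y \<in> set xs" "chain E E' (\<phi> y < n) (?v y) \<beta> (?v (A y))" "vless (?v y) (?v (A y))"
        "path_label f f' \<beta> = g y" "{?v x, ?v (A x)} = {?v y, ?v (A y)}"
        using arc[OF b(1)] b(2) by auto
      have "?v x = ?v y"
      proof (rule ccontr)
        assume "?v x \<noteq> ?v y"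
        then have "?v x = ?v (A y)" "?v (A x) = ?v y" using y(5) by (auto simp: doubleton_eq_iff)
        then show False using y(3) x(2) vless_linear[OF V[OF x(1)] V[OF I(1)[OF x(1)]] ne[OF x(1)]] by simp
      qed
      then have "x = y" using inj x y by blast
      then show ?thesis using y by simp
    qed
    have "(THE \<alpha>. is_arc E E' \<alpha> \<and> boundary \<alpha> = {?v x, ?v (A x)}) = \<alpha>"
    proof (rule the_equality)
      fix \<beta> assume "is_arc E E' \<beta> \<and> boundary \<beta> = {?v x, ?v (A x)}"
      then show "\<beta> = \<alpha>" using un[of \<alpha>] un[of \<beta>] a chain_unique by blast
    qed (use a in blast)
    then show ?thesis unfolding l_def using mem[OF x(1)] un[OF a] by simp
  qed
  have olab: "olab l (?v x) (?v (A x)) = g x" if x: "x \<in> set xs" for x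
  proof (cases "vless (?v x) (?v (A x))")
    case True
    then show ?thesis using lab[OF x] by (simp add: olab_def)
  next
    case False
    then have "vless (?v (A x)) (?v (A (A x)))"
      using vless_linear[OF V[OF x] V[OF I(1)[OF x]] ne[OF x]] I(2)[OF x] by simp
    from lab[OF I(1)[OF x] this] show ?thesis
      using False I(2,4)[OF x] by (simp add: olab_def insert_commute)
  qed
  have D: "(if \<phi> x < n then East else West) = D x" if x: "x \<in> set xs" for x
  proof -
    obtain k where k: "k < length xs" "xs ! k = x" using x by (metis in_set_conv_nth)
    have len: "length xs = 2 * n" using arg_cong[OF dirs, of length] by simp
    have "\<phi> x = k" using arg_cong[OF \<phi>(2), of "\<lambda>l. l ! k"] k len by simp
    moreover have "D x = EW n ! k" using arg_cong[OF dirs, of "\<lambda>l. l ! k"] k by simp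
    ultimately show ?thesis using EW_nth(1)[of k n] EW_nth(2)[of n k] k len by (cases "k < n") auto
  qed
  have "rnf \<phi> (xs, D, A, g) ([0..<2 * n], \<lambda>j. if j < n then East else West,
     \<lambda>j. enc n (partner ?P (dec n j)), \<lambda>j. olab l (dec n j) (partner ?P (dec n j)))"
    unfolding rnf.simps using \<phi> D part olab lt I(1) by simp
  then show ?thesis unfolding arrow_product.simps tangle_state.simps l_def by (rule rnI)
qed

abbreviation "Ai j \<equiv> enc n (partner E (dec n j))"
abbreviation "gi j \<equiv> olab f (dec n j) (partner E (dec n j))"

lemmas pt = partner[OF arrow_tangleD(1)[OF tangles(1)] dec_V]

lemma dec_Ai: "j < 2 * n \<Longrightarrow> dec n (Ai j) = partner E (dec n j)"
  using pt(2) by simp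

lemma Ai: "j < 2 * n \<Longrightarrow> Ai j < 2 * n" "j < 2 * n \<Longrightarrow> Ai (Ai j) = j" "j < 2 * n \<Longrightarrow> Ai j \<noteq> j"
  using enc_lt pt dec_Ai enc_dec by metis+

text \<open>The positions below \<open>n\<close> are right vertices of the first tangle and must be
  continued by an edge of label 0 across the second one, which may change the position. The
  positions from \<open>n\<close> on are left vertices and are not affected.\<close>

definition through :: "(nat \<Rightarrow> nat) \<Rightarrow> nat \<Rightarrow> bool" where
  "through \<phi> k \<longleftrightarrow> k < 2 * n \<and> (if k < n then \<phi> k < n \<and>
     {(0, Suc k), (1, Suc (\<phi> k))} \<in> E' \<and> f' {(0, Suc k), (1, Suc (\<phi> k))} = 0 else \<phi> k = k)"

lemma chain_suffix:
  assumes "j < 2 * n" "through \<phi> (Ai j)"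
  shows "\<exists>\<alpha>. chain E E' False (dec n j) \<alpha> (dec n (\<phi> (Ai j))) \<and> path_label f f' \<alpha> = gi j"
proof -
  define m where "m = Ai j"
  let ?p = "dec n j"
  have e: "{?p, dec n m} \<in> E" using pt(1)[OF assms(1)] dec_Ai[OF assms(1)] unfolding m_def by simp
  have g: "gi j = olab f ?p (dec n m)" using dec_Ai[OF assms(1)] unfolding m_def by simp
  have th: "through \<phi> m" using assms(2) unfolding m_def .
  show ?thesis unfolding g unfolding m_def[symmetric]
  proof (cases "m < n")
    case True
    then have q: "dec n m = (1, Suc m)" by (simp add: dec_def)
    let ?r = "(1, Suc (\<phi> m))"
    have t: "\<phi> m < n" "{(0, Suc m), ?r} \<in> E'" "f' {(0, Suc m), ?r} = 0"
      using th True unfolding through_def by simp_all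
    have r: "dec n (\<phi> m) = ?r" using t(1) by (simp add: dec_def)
    have l: "olab f' (0, Suc m) ?r = 0" using t(3) by (simp add: olab_def)
    have "chain E E' False ?p [(False, ?p, (1, Suc m)), (True, (0, Suc m), ?r)] ?r"
      using e t(2) unfolding q by simp
    moreover have "path_label f f' [(False, ?p, (1, Suc m)), (True, (0, Suc m), ?r)] = olab f ?p (1, Suc m)"
      using e t(2) l unfolding q by (simp add: path_label_Cons)
    ultimately show "\<exists>\<alpha>. chain E E' False ?p \<alpha> (dec n (\<phi> m)) \<and> path_label f f' \<alpha> = olab f ?p (dec n m)"
      unfolding r q by blast
  next
    case False
    then have "\<phi> m = m" "fst (dec n m) = 0" using th by (auto simp: through_def dec_def)
    then have "chain E E' False ?p [(False, ?p, dec n m)] (dec n (\<phi> m))" using e by simp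
    moreover have "path_label f f' [(False, ?p, dec n m)] = olab f ?p (dec n m)" using e by (simp add: path_label_Cons)
    ultimately show "\<exists>\<alpha>. chain E E' False ?p \<alpha> (dec n (\<phi> m)) \<and> path_label f f' \<alpha> = olab f ?p (dec n m)" by blast
  qed
qed

lemma chain_prefix:
  assumes "through \<phi> j" "chain E E' False (dec n j) \<alpha> q"
  shows "\<exists>\<beta>. chain E E' (\<phi> j < n) (dec n (\<phi> j)) \<beta> q \<and> path_label f f' \<beta> = path_label f f' \<alpha>"
proof (cases "j < n")
  case True
  let ?p = "(0, Suc j)" and ?r = "(1, Suc (\<phi> j))"
  have t: "\<phi> j < n" "{?p, ?r} \<in> E'" "f' {?p, ?r} = 0" using assms(1) True unfolding through_def by simp_all
  have l: "olab f' ?r ?p = 0" using t(3) by (simp add: olab_def insert_commute)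
  have d: "dec n (\<phi> j) = ?r" "switch ?p = dec n j" using t(1) True by (simp_all add: dec_def)
  have e: "{?r, ?p} \<in> E'" using t(2) by (simp add: insert_commute)
  have ne: "\<alpha> \<noteq> []" using assms(2) by auto
  have "chain E E' True ?r ((True, ?r, ?p) # \<alpha>) q"
    unfolding chain.simps d(2) using assms(2) e ne by simp
  moreover have "path_label f f' ((True, ?r, ?p) # \<alpha>) = path_label f f' \<alpha>"
    using e l by (simp add: path_label_Cons)
  ultimately show ?thesis using t(1) d by (metis (full_types))
next
  case False
  then show ?thesis using assms unfolding through_def by (intro exI[of _ \<alpha>]) simp
qed

lemma product_through:
  assumes \<phi>: "inj_on \<phi> {..<2 * n}" "map \<phi> xs = [0..<2 * n]" "set xs = {..<2 * n}"
    and th: "\<And>k. k < 2 * n \<Longrightarrow> through \<phi> k"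
    and D: "map D xs = EW n" "good (xs, D, Ai, gi)"
  shows "rn (xs, D, Ai, gi) (tangle_state n (arrow_product (E, f) (E', f')))"
proof (rule product_rn[OF D(2,1)])
  fix x assume "x \<in> set xs"
  then have x: "x < 2 * n" using \<phi> by simp
  obtain \<alpha> where "chain E E' False (dec n x) \<alpha> (dec n (\<phi> (Ai x)))" "path_label f f' \<alpha> = gi x"
    using chain_suffix[OF x th[OF Ai(1)[OF x]]] by blast
  then show "\<exists>\<alpha>. chain E E' (\<phi> x < n) (dec n (\<phi> x)) \<alpha> (dec n (\<phi> (Ai x))) \<and> path_label f f' \<alpha> = gi x"
    using chain_prefix[OF th[OF x], of \<alpha>] by metis
qed (use \<phi> in auto)

text \<open>The second edge of a cycle joins two left vertices of the second tangle.\<close>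

lemma no_cycle:
  assumes "\<And>b c. {(0, b), (0, c)} \<notin> E'"
  shows "cycle_factor (E, f) (E', f') = 1"
proof -
  have none: "\<not> is_cycle E E' \<gamma>" for \<gamma>
  proof
    assume c: "is_cycle E E' \<gamma>"
    then have l: "1 < length \<gamma>" by (simp add: is_cycle_def)
    have t: "\<forall>j<length \<gamma>. tagged_in E E' (\<gamma> ! j)" using c by (simp add: is_cycle_def)
    have k: "\<forall>j<length \<gamma>. if even j then \<not> fst (\<gamma> ! j) \<and> fst (fst (snd (\<gamma> ! j))) = 1 \<and> fst (snd (snd (\<gamma> ! j))) = 1
        else fst (\<gamma> ! j) \<and> fst (fst (snd (\<gamma> ! j))) = 0 \<and> fst (snd (snd (\<gamma> ! j))) = 0"
      using c unfolding is_cycle_def by (simp add: case_prod_beta)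
    obtain t' p q where g: "\<gamma> ! 1 = (t', p, q)" by (cases "\<gamma> ! 1") auto
    obtain b c where "t'" "p = (0, b)" "q = (0, c)" using k[rule_format, OF l] unfolding g by (cases p; cases q) auto
    then show False using t[rule_format, OF l] assms[of b c] unfolding g by simp
  qed
  have e: "{\<gamma>. is_cycle E E' \<gamma>} = {}" using none by blast
  show ?thesis unfolding cycle_factor.simps e by (rule prod.empty)
qed

lemma chain_cap:
  assumes "u < 2 * n" "Ai u = k" "k < n" "l < n" "{(0, Suc k), (0, Suc l)} \<in> E'"
    and "olab f' (0, Suc k) (0, Suc l) = c" "chain E E' False (dec n l) \<alpha> q"
  shows "\<exists>\<beta>. chain E E' False (dec n u) \<beta> q \<and> path_label f f' \<beta> = gi u \<oplus> (c \<oplus> path_label f f' \<alpha>)"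
proof -
  have q: "partner E (dec n u) = (1, Suc k)" using dec_Ai[OF assms(1)] assms(2,3) by (simp add: dec_def)
  have e: "{dec n u, (1, Suc k)} \<in> E" using pt(1)[OF assms(1)] unfolding q .
  have l: "dec n l = (1, Suc l)" using assms(4) by (simp add: dec_def)
  have ne: "\<alpha> \<noteq> []" using assms(7) by auto
  let ?\<beta> = "(False, dec n u, (1, Suc k)) # (True, (0, Suc k), (0, Suc l)) # \<alpha>"
  have "chain E E' False (dec n u) ?\<beta> q"
    using e ne assms(5,7) unfolding l by simp
  moreover have "path_label f f' ?\<beta> = gi u \<oplus> (c \<oplus> path_label f f' \<alpha>)"
    using e assms(5,6) by (simp add: path_label_Cons q)
  ultimately show ?thesis by blast
qed

text \<open>With one cap available on the left side of the second tangle, a cycle uses it once; the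
  condition on the least number fixes its starting point and its direction.\<close>

lemma cycle_caps:
  assumes cyc: "is_cycle E E' \<gamma>"
    and caps: "\<And>b c. {(0, b), (0, c)} \<in> E' \<Longrightarrow> {b, c} = {i, Suc i}"
  shows "\<gamma> = [(False, (1, i), (1, Suc i)), (True, (0, Suc i), (0, i))]" "{(1, i), (1, Suc i)} \<in> E"
proof -
  define b where "b = (\<lambda>j. snd (fst (snd (\<gamma> ! j))))"
  define d where "d = (\<lambda>j. snd (snd (snd (\<gamma> ! j))))"
  have len: "2 \<le> length \<gamma>" "even (length \<gamma>)" using cyc by (simp_all add: is_cycle_def)
  have t: "\<forall>j<length \<gamma>. tagged_in E E' (\<gamma> ! j)" using cyc by (simp add: is_cycle_def)
  have k: "\<forall>j<length \<gamma>. if even j then \<not> fst (\<gamma> ! j) \<and> fst (fst (snd (\<gamma> ! j))) = 1 \<and> fst (snd (snd (\<gamma> ! j))) = 1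
      else fst (\<gamma> ! j) \<and> fst (fst (snd (\<gamma> ! j))) = 0 \<and> fst (snd (snd (\<gamma> ! j))) = 0"
    using cyc unfolding is_cycle_def by (simp add: case_prod_beta)
  have s: "\<forall>j. Suc j < length \<gamma> \<longrightarrow> b (Suc j) = d j"
    using cyc unfolding is_cycle_def b_def d_def by (simp add: case_prod_beta)
  have h: "snd (fst (snd (hd \<gamma>))) = snd (snd (snd (last \<gamma>)))"
    using cyc unfolding is_cycle_def by (simp add: case_prod_beta)
  have m: "\<forall>j. Suc j < length \<gamma> \<longrightarrow> snd (fst (snd (hd \<gamma>))) < d j"
    unfolding d_def using cyc[unfolded is_cycle_def case_prod_beta fst_conv snd_conv,
      THEN conjunct2, THEN conjunct2, THEN conjunct2, THEN conjunct2, THEN conjunct2, THEN conjunct2] .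
  have ne: "\<gamma> \<noteq> []" using len by auto
  have hd: "hd \<gamma> = \<gamma> ! 0" using ne by (rule hd_conv_nth)
  have el: "\<gamma> ! j = (odd j, (if even j then 1 else 0, b j), (if even j then 1 else 0, d j))" if "j < length \<gamma>" for j
    using k[rule_format, OF that] unfolding b_def d_def by (cases "even j") (simp_all add: prod_eq_iff)
  have inE: "{(1, b j), (1, d j)} \<in> E" if "j < length \<gamma>" "even j" for j
    using t[rule_format, OF that(1)] that(2) unfolding el[OF that(1)] by simp
  have inE': "{b j, d j} = {i, Suc i}" if "j < length \<gamma>" "odd j" for j
  proof (rule caps)
    show "{(0, b j), (0, d j)} \<in> E'"
      using t[rule_format, OF that(1)] that(2) unfolding el[OF that(1)] by simp
  qed
  have E: "E \<in> flat_tangles n" using flats[of False] by simp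
  \<comment> \<open>A second passage through the cap would have to be in the opposite direction,
    which leads back to the starting number too early.\<close>
  have "\<not> 3 < length \<gamma>"
  proof
    assume l: "3 < length \<gamma>"
    have c1: "{b 1, d 1} = {i, Suc i}" and c3: "{b 3, d 3} = {i, Suc i}"
      using inE'[of 1] inE'[of 3] l by simp_all
    have st: "b 1 = d 0" "b 2 = d 1" "b 3 = d 2"
      using s[rule_format, of 0] s[rule_format, of 1] s[rule_format, of 2] l by (simp_all add: numeral_2_eq_2 numeral_3_eq_3)
    have e0: "{(1, b 0), (1, d 0)} \<in> E" and e2: "{(1, b 2), (1, d 2)} \<in> E"
      using inE[of 0] inE[of 2] l ne by simp_all
    have "(1::nat, d 2) \<noteq> (1, b 2)" using flat_tangle_ex(2)[OF E flat_Union[OF E e2] e2] by blast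
    then have "d 2 \<noteq> d 1" using st by simp
    moreover have "b 3 \<in> {i, Suc i}" unfolding c3[symmetric] by simp
    then have "d 2 \<in> {b 1, d 1}" unfolding c1 st(3) .
    ultimately have "d 2 = b 1" by blast
    then have "{(1, d 0), (1, b 2)} \<in> E" "{(1, d 0), (1, b 0)} \<in> E"
      using e0 e2 st by (simp_all add: insert_commute)
    then have "(1::nat, b 2) = (1, b 0)" by (rule edge_unique[OF E])
    then have "d 1 = b 0" using st by simp
    moreover have "b 0 < d 1" using m[rule_format, of 1] l unfolding hd b_def by simp
    ultimately show False by simp
  qed
  then have len2: "length \<gamma> = 2" using len by presburger
  have l: "0 < length \<gamma>" "1 < length \<gamma>" "Suc 0 < length \<gamma>" using len2 by simp_all
  have b1: "b 1 = d 0" using s[rule_format, of 0] len2 by simp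
  have last: "last \<gamma> = \<gamma> ! 1" using last_conv_nth[OF ne] len2 by simp
  have d1: "d 1 = b 0" using h unfolding hd last b_def d_def by simp
  have "b 0 < d 0" using m[rule_format, OF l(3)] unfolding hd b_def .
  moreover have "{d 0, b 0} = {i, Suc i}" using inE'[OF l(2)] b1 d1 by simp
  ultimately have bd: "b 0 = i" "d 0 = Suc i" by (auto simp: doubleton_eq_iff)
  have "\<gamma> = [\<gamma> ! 0, \<gamma> ! 1]" using len2 by (auto simp: list_eq_iff_nth_eq less_2_cases_iff nth_Cons')
  also have "\<dots> = [(False, (1, i), (1, Suc i)), (True, (0, Suc i), (0, i))]"
    unfolding el[OF l(1)] el[OF l(2)] using bd b1 d1 by simp
  finally show "\<gamma> = [(False, (1, i), (1, Suc i)), (True, (0, Suc i), (0, i))]" .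
  show "{(1, i), (1, Suc i)} \<in> E" using inE[OF l(1)] bd by simp
qed

end

section \<open>The generators as arrow flat tangles\<close>

lemma flat_tanglesI:
  assumes "\<And>p. p \<in> V n \<Longrightarrow> P p \<in> V n" "\<And>p. p \<in> V n \<Longrightarrow> P (P p) = p" "\<And>p. p \<in> V n \<Longrightarrow> P p \<noteq> p"
  shows "(\<lambda>p. {p, P p}) ` V n \<in> flat_tangles n"
proof -
  have dis: "A = B" if AB: "A \<in> (\<lambda>p. {p, P p}) ` V n" "B \<in> (\<lambda>p. {p, P p}) ` V n" "A \<inter> B \<noteq> {}" for A B
  proof -
    obtain p q where pq: "p \<in> V n" "q \<in> V n" "A = {p, P p}" "B = {q, P q}" using AB(1,2) by blast
    have "p = q \<or> p = P q \<or> P p = q \<or> P p = P q" using AB(3) unfolding pq(3,4) by auto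
    then consider "p = q" | "p = P q" | "P p = q" | "P p = P q" by metis
    then show ?thesis
    proof cases
      case 2
      then have "P p = q" using assms(2)[OF pq(2)] by simp
      then show ?thesis using 2 pq by (simp add: insert_commute)
    next
      case 3
      then have "P q = p" using assms(2)[OF pq(1)] by simp
      then show ?thesis using 3 pq by (simp add: insert_commute)
    next
      case 4
      then have "p = q" using assms(2)[OF pq(1)] assms(2)[OF pq(2)] by metis
      then show ?thesis using pq by simp
    qed (use pq in simp)
  qed
  have "disjoint ((\<lambda>p. {p, P p}) ` V n)"
    unfolding disjoint_def using dis by blast
  moreover have "\<Union> ((\<lambda>p. {p, P p}) ` V n) = V n" using assms(1) by blast
  moreover have "card {p, P p} = 2" if "p \<in> V n" for p using assms(3)[OF that] by (metis card_2_iff)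
  ultimately show ?thesis unfolding flat_tangles_def partition_on_def by auto
qed

text \<open>The pairs are those of an involution without fixed points that acts by \<open>P\<close>
  on the four vertices in \<open>Q\<close> and by \<open>switch\<close> elsewhere.\<close>

lemma generator_flat:
  assumes i: "1 \<le> i" "i < n" and Q: "Q = {(0, i), (0, Suc i), (1, i), (1, Suc i)}"
    and P: "\<And>p. p \<in> Q \<Longrightarrow> P p \<in> Q \<and> P (P p) = p \<and> P p \<noteq> p"
  shows "(\<lambda>p. {p, P p}) ` Q \<union> (\<lambda>k. {(0, k), (1, k)}) ` ({1..n} - {i, Suc i}) \<in> flat_tangles n"
proof -
  define P' where "P' = (\<lambda>p. if p \<in> Q then P p else switch p)"
  have QV: "Q \<subseteq> V n" using i unfolding Q by (auto simp: V_iff)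
  have sw: "switch p \<in> V n - Q" "switch (switch p) = p" "switch p \<noteq> p" if "p \<in> V n - Q" for p
    using that unfolding Q by (cases p; auto simp: V_iff)+
  have "(\<lambda>p. {p, P' p}) ` V n \<in> flat_tangles n"
  proof (rule flat_tanglesI)
    fix p assume p: "p \<in> V n"
    have "P' p \<in> V n \<and> P' (P' p) = p \<and> P' p \<noteq> p"
    proof (cases "p \<in> Q")
      case True
      then have "P' p = P p" "P' (P p) = P (P p)" using P by (simp_all add: P'_def)
      then show ?thesis using P[OF True] QV by auto
    next
      case False
      then have *: "p \<in> V n - Q" using p by blast
      have "P' p = switch p" "P' (switch p) = switch (switch p)"
        using False sw(1)[OF *] by (simp_all add: P'_def)
      then show ?thesis using sw[OF *] by auto
    qed
    then show "P' p \<in> V n" "P' (P' p) = p" "P' p \<noteq> p" by blast+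
  qed
  moreover have "(\<lambda>p. {p, P' p}) ` V n = (\<lambda>p. {p, P' p}) ` Q \<union> (\<lambda>p. {p, P' p}) ` (V n - Q)"
    using QV by (subst image_Un[symmetric]) (simp add: Un_absorb1)
  moreover have "(\<lambda>p. {p, P' p}) ` Q = (\<lambda>p. {p, P p}) ` Q"
    by (rule image_cong) (simp_all add: P'_def)
  moreover have "(\<lambda>p. {p, P' p}) ` (V n - Q) = (\<lambda>k. {(0, k), (1, k)}) ` ({1..n} - {i, Suc i})"
  proof -
    have "V n - Q = Pair 0 ` ({1..n} - {i, Suc i}) \<union> Pair 1 ` ({1..n} - {i, Suc i})"
      unfolding Q by (auto simp: V_def)
    moreover have "(\<lambda>p. {p, P' p}) ` Pair 0 ` ({1..n} - {i, Suc i}) = (\<lambda>k. {(0, k), (1, k)}) ` ({1..n} - {i, Suc i})"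
      unfolding image_image by (rule image_cong) (auto simp: P'_def Q)
    moreover have "(\<lambda>p. {p, P' p}) ` Pair 1 ` ({1..n} - {i, Suc i}) = (\<lambda>k. {(0, k), (1, k)}) ` ({1..n} - {i, Suc i})"
      unfolding image_image by (rule image_cong) (auto simp: P'_def Q)
    ultimately show ?thesis by (simp add: image_Un)
  qed
  ultimately show ?thesis by simp
qed

lemma arrow_tanglesI:
  assumes "E \<in> flat_tangles n" "\<And>\<alpha>. \<alpha> \<in> E \<Longrightarrow> \<exists>p q. \<alpha> = {p, q} \<and> (fst p = fst q \<longleftrightarrow> odd (l \<alpha>))"
  shows "(E, \<lambda>\<alpha>\<in>E. l \<alpha>) \<in> arrow_tangles n"
proof -
  have "if fst p = fst q then odd ((\<lambda>\<alpha>\<in>E. l \<alpha>) {p, q}) else even ((\<lambda>\<alpha>\<in>E. l \<alpha>) {p, q})" if pq: "{p, q} \<in> E" for p q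
  proof -
    obtain p' q' where a: "{p, q} = {p', q'}" "fst p' = fst q' \<longleftrightarrow> odd (l {p, q})" using assms(2)[OF pq] by blast
    have "fst p = fst q \<longleftrightarrow> fst p' = fst q'" using a(1) unfolding doubleton_eq_iff by metis
    then show ?thesis using a(2) pq by simp
  qed
  note labels = this
  show ?thesis unfolding arrow_tangles_def mem_Collect_eq prod.case
  proof (intro conjI allI impI)
    fix p q assume "{p, q} \<in> E"
    then show "if fst p = fst q then odd ((\<lambda>\<alpha>\<in>E. l \<alpha>) {p, q}) else even ((\<lambda>\<alpha>\<in>E. l \<alpha>) {p, q})" by (rule labels)
  qed (use assms(1) in simp_all)
qed

lemma tangle_id_in: "tangle_id n \<in> arrow_tangles n"
proof -
  have e: "(\<lambda>p. {p, switch p}) ` V n = (\<lambda>k. {(0, k), (1, k)}) ` {1..n}"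
  proof -
    have "V n = Pair 0 ` {1..n} \<union> Pair 1 ` {1..n}" by (auto simp: V_def)
    then show ?thesis by (simp add: image_Un image_image insert_commute)
  qed
  have "(\<lambda>p. {p, switch p}) ` V n \<in> flat_tangles n"
  proof (rule flat_tanglesI)
    fix p assume "p \<in> V n"
    then show "switch p \<in> V n" "switch (switch p) = p" "switch p \<noteq> p" by (cases p; auto simp: V_iff)+
  qed
  then show ?thesis unfolding e tangle_id_def Let_def
  proof (rule arrow_tanglesI)
    fix \<alpha> :: "vertex set" assume "\<alpha> \<in> (\<lambda>k. {(0, k), (1, k)}) ` {1..n}"
    then obtain k where "\<alpha> = {(0, k), (1, k)}" by blast
    then show "\<exists>p q. \<alpha> = {p, q} \<and> (fst p = fst q \<longleftrightarrow> odd (0::int))"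
      by (intro exI[of _ "(0, k)"] exI[of _ "(1, k)"]) simp
  qed
qed

lemma tangle_w_in: assumes "1 \<le> i" "i < n" shows "tangle_w n i \<in> arrow_tangles n"
proof -
  let ?P = "\<lambda>(a, k). (1 - a, if k = i then Suc i else i) :: vertex"
  have "(\<lambda>p. {p, ?P p}) ` {(0, i), (0, Suc i), (1, i), (1, Suc i)} \<union> (\<lambda>k. {(0, k), (1, k)}) ` ({1..n} - {i, Suc i}) \<in> flat_tangles n"
    by (rule generator_flat[OF assms refl]) auto
  moreover have e: "(\<lambda>p. {p, ?P p}) ` {(0, i), (0, Suc i), (1, i), (1, Suc i)} = {{(0, i), (1, Suc i)}, {(0, Suc i), (1, i)}}"
    by (simp add: insert_commute)
  ultimately show ?thesis unfolding e tangle_w_def Let_def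
  proof (rule_tac arrow_tanglesI)
    fix \<alpha> :: "vertex set"
    assume "\<alpha> \<in> {{(0, i), (1, Suc i)}, {(0, Suc i), (1, i)}} \<union> (\<lambda>k. {(0, k), (1, k)}) ` ({1..n} - {i, Suc i})"
    then obtain k m where "\<alpha> = {(0, k), (1, m)}" by blast
    then show "\<exists>p q. \<alpha> = {p, q} \<and> (fst p = fst q \<longleftrightarrow> odd (0::int))"
      by (intro exI[of _ "(0, k)"] exI[of _ "(1, m)"]) simp
  qed assumption
qed

lemma tangle_F_in: assumes "1 \<le> i" "i < n" shows "tangle_F n i \<in> arrow_tangles n"
proof -
  let ?P = "\<lambda>(a, k). (a, if k = i then Suc i else i) :: vertex"
  have "(\<lambda>p. {p, ?P p}) ` {(0, i), (0, Suc i), (1, i), (1, Suc i)} \<union> (\<lambda>k. {(0, k), (1, k)}) ` ({1..n} - {i, Suc i}) \<in> flat_tangles n"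
    by (rule generator_flat[OF assms refl]) auto
  moreover have e: "(\<lambda>p. {p, ?P p}) ` {(0, i), (0, Suc i), (1, i), (1, Suc i)} = {{(0, i), (0, Suc i)}, {(1, i), (1, Suc i)}}"
    by (simp add: insert_commute)
  ultimately show ?thesis unfolding e tangle_F_def Let_def
  proof (rule_tac arrow_tanglesI)
    let ?E1 = "{{(0, i), (0, Suc i)}, {(1, i), (1, Suc i)}} :: flat_tangle"
    fix \<alpha> :: "vertex set"
    assume "\<alpha> \<in> ?E1 \<union> (\<lambda>k. {(0, k), (1, k)}) ` ({1..n} - {i, Suc i})"
    then consider "\<alpha> = {(0, i), (0, Suc i)}" | "\<alpha> = {(1, i), (1, Suc i)}" | k where "\<alpha> = {(0, k), (1, k)}" by blast
    then show "\<exists>p q. \<alpha> = {p, q} \<and> (fst p = fst q \<longleftrightarrow> odd (if \<alpha> \<in> ?E1 then 1 else 0 :: int))"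
    proof cases
      case 1
      then show ?thesis by (intro exI[of _ "(0, i)"] exI[of _ "(0, Suc i)"]) simp
    next
      case 2
      then show ?thesis by (intro exI[of _ "(1, i)"] exI[of _ "(1, Suc i)"]) simp
    next
      case (3 k)
      have "\<alpha> \<notin> ?E1" unfolding 3 by (simp add: doubleton_eq_iff)
      then show ?thesis using 3 by (intro exI[of _ "(0, k)"] exI[of _ "(1, k)"]) simp
    qed
  qed assumption
qed

lemma product_id:
  assumes "T \<in> arrow_tangles n"
  shows "cycle_factor T (tangle_id n) = 1" "rn (tangle_state n T) (tangle_state n (arrow_product T (tangle_id n)))"
proof -
  obtain E f where T: "T = (E, f)" by (cases T)
  obtain E' f' where G: "tangle_id n = (E', f')" by (cases "tangle_id n")
  interpret tangle_pair n E E' f f' using assms tangle_id_in[of n] unfolding T G by unfold_locales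
  have E': "E' = (\<lambda>k. {(0, k), (1, k)}) ` {1..n}"
    using G by (simp add: tangle_id_def Let_def)
  have f': "f' = (\<lambda>\<alpha>\<in>E'. 0)" using G unfolding E' by (simp add: tangle_id_def Let_def)
  show "cycle_factor T (tangle_id n) = 1" unfolding T G
    by (rule no_cycle) (auto simp: E' doubleton_eq_iff)
  have th: "through id k" if k: "k < 2 * n" for k
  proof (cases "k < n")
    case True
    then have mem: "{(0, Suc k), (1, Suc k)} \<in> E'" unfolding E' by auto
    then have "f' {(0, Suc k), (1, Suc k)} = 0" by (simp add: f')
    then show ?thesis unfolding through_def using k True mem by simp
  next
    case False
    then show ?thesis unfolding through_def using k by simp
  qed
  have g: "good ([0..<2 * n], \<lambda>j. if j < n then East else West, Ai, gi)"
    "map (\<lambda>j. if j < n then East else West) [0..<2 * n] = EW n"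
    using good_tangle_state[OF tangles(1)] by (simp_all add: dirs.simps)
  show "rn (tangle_state n T) (tangle_state n (arrow_product T (tangle_id n)))"
    unfolding T G tangle_state.simps
    by (rule product_through[OF _ _ _ th g(2,1)]) auto
qed

lemma split_upt: "Suc h < m \<Longrightarrow> [0..<m] = [0..<h] @ h # Suc h # [Suc (Suc h)..<m]"
  by (metis Suc_lessD less_imp_add_positive less_nat_zero_code not_less upt_add_eq_append upt_conv_Cons zero_le add_0)

lemma act_EW: "Suc h < n \<Longrightarrow> act (Cross c h) (EW n) = Some (EW n)"
  using EW_nth(1)[of h n] EW_nth(1)[of "Suc h" n] by (simp, metis list_update_id)

lemma product_w:
  assumes "T \<in> arrow_tangles n" and i: "Suc h < n"
  shows "cycle_factor T (tangle_w n (Suc h)) = 1"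
    "rn (stp (Cross Virtual h) (tangle_state n T)) (tangle_state n (arrow_product T (tangle_w n (Suc h))))"
proof -
  obtain E f where T: "T = (E, f)" by (cases T)
  obtain E' f' where G: "tangle_w n (Suc h) = (E', f')" by (cases "tangle_w n (Suc h)")
  have "(E', f') \<in> arrow_tangles n" using tangle_w_in[of "Suc h" n] i G by simp
  then interpret tangle_pair n E E' f f' using assms(1) unfolding T by unfold_locales
  have E': "E' = {{(0, Suc h), (1, Suc (Suc h))}, {(0, Suc (Suc h)), (1, Suc h)}} \<union>
      (\<lambda>k. {(0, k), (1, k)}) ` ({1..n} - {Suc h, Suc (Suc h)})"
    using G by (simp add: tangle_w_def Let_def)
  have f': "f' = (\<lambda>\<alpha>\<in>E'. 0)" using G unfolding E' by (simp add: tangle_w_def Let_def)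
  show "cycle_factor T (tangle_w n (Suc h)) = 1" unfolding T G
    by (rule no_cycle) (auto simp: E' doubleton_eq_iff)
  define \<phi> where "\<phi> = (\<lambda>k. if k = h then Suc h else if k = Suc h then h else k)"
  have th: "through \<phi> k" if k: "k < 2 * n" for k
  proof (cases "k < n")
    case True
    have mem: "{(0, Suc k), (1, Suc (\<phi> k))} \<in> E'" using True unfolding E' \<phi>_def by auto
    then have "f' {(0, Suc k), (1, Suc (\<phi> k))} = 0" by (simp add: f')
    moreover have "\<phi> k < n" using True i by (simp add: \<phi>_def)
    ultimately show ?thesis unfolding through_def using k True mem by simp
  next
    case False
    then have "\<phi> k = k" using i by (simp add: \<phi>_def)
    then show ?thesis unfolding through_def using k False by simp
  qed
  let ?D = "\<lambda>j. if j < n then East else West"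
  let ?xs = "[0..<h] @ Suc h # h # [Suc (Suc h)..<2 * n]"
  have sp: "[0..<2 * n] = [0..<h] @ h # Suc h # [Suc (Suc h)..<2 * n]" by (rule split_upt) (use i in simp)
  have st: "stp (Cross Virtual h) (tangle_state n T) = (?xs, ?D, Ai, gi)"
    unfolding T tangle_state.simps sp using stp_Cross(1)[of Virtual "[0..<h]"] by simp
  note g = good_tangle_state[OF tangles(1), folded T]
  have act: "act (Cross Virtual h) (dirs (tangle_state n T)) = Some (EW n)" unfolding g(2) by (rule act_EW[OF i])
  have g': "good (?xs, ?D, Ai, gi)" "map ?D ?xs = EW n"
    using good_stp[OF g(1) act] dirs_stp[OF g(1) act] unfolding st by (simp_all only: dirs.simps)
  show "rn (stp (Cross Virtual h) (tangle_state n T)) (tangle_state n (arrow_product T (tangle_w n (Suc h))))"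
    unfolding st G unfolding T
  proof (rule product_through[OF _ _ _ th g'(2,1)])
    show "inj_on \<phi> {..<2 * n}" by (auto simp: inj_on_def \<phi>_def split: if_splits)
    have m: "map \<phi> [0..<h] = [0..<h]" "map \<phi> [Suc (Suc h)..<2 * n] = [Suc (Suc h)..<2 * n]"
      by (auto simp: \<phi>_def intro!: map_idI)
    show "map \<phi> ?xs = [0..<2 * n]" unfolding sp map_append list.map m by (simp add: \<phi>_def)
    have "set ?xs = set ([0..<h] @ h # Suc h # [Suc (Suc h)..<2 * n])" by (simp add: insert_commute)
    also have "\<dots> = set [0..<2 * n]" unfolding sp ..
    also have "\<dots> = {..<2 * n}" by (simp add: atLeast_upt)
    finally show "set ?xs = {..<2 * n}" .
  qed
qed

text \<open>The second smoothing of a crossing of two East strands, which plays the part of the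
  generator F.\<close>

abbreviation cup_cap :: "nat \<Rightarrow> piece list" where
  "cup_cap h \<equiv> [Cusp h Above, Close h, Open h West, Cusp h Above]"

text \<open>The arcs ending in \<open>x\<close> and \<open>y\<close> are joined through one cusp,
  which contributes 1 or -1 according to the direction of reading, and a new arc with one cusp is
  created.\<close>

lemma cup_cap_steps:
  assumes g: "good (us @ x # y # zs, D, A, g)" and l: "length us = h"
  obtains a b D' A' g' where "a \<noteq> b" "a \<notin> set (us @ zs)" "b \<notin> set (us @ zs)"
    "stps (cup_cap h) (us @ x # y # zs, D, A, g) = (us @ a # b # zs, D', A', g')"
    "A' a = b" "A' b = a" "g' a = - 1" "g' b = 1"
    "\<And>u. u \<in> set (us @ zs) \<Longrightarrow> A' u = (if A u = x then A y else if A u = y then A x else A u) \<and>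
       g' u = (if A u = x then g u \<oplus> 1 \<oplus> g y else if A u = y then g u \<oplus> (- 1 \<oplus> g x) else g u)"
    "facs (cup_cap h) (us @ x # y # zs, D, A, g) = (if A x = y then zval (- 1 \<oplus> g x) else 1)"
proof -
  define a where "a = fresh (us @ zs)"
  have ab: "a \<notin> set (us @ zs)" "Suc a \<notin> set (us @ zs)" "a \<noteq> Suc a" unfolding a_def using fresh_notin'[of "us @ zs"] by simp_all
  let ?g1 = "g(x := - 1 \<oplus> g x, A x := g (A x) \<oplus> 1)"
  let ?A2 = "A(A x := A y, A y := A x)"
  let ?g2 = "?g1(A x := ?g1 (A x) \<oplus> ?g1 y, A y := ?g1 (A y) \<oplus> ?g1 x)"
  let ?A3 = "?A2(a := Suc a, Suc a := a)"
  let ?g3 = "?g2(a := 0, Suc a := 0)"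
  let ?g4 = "?g3(a := - 1 \<oplus> ?g3 a, ?A3 a := ?g3 (?A3 a) \<oplus> 1)"
  define S where "S = stps (cup_cap h) (us @ x # y # zs, D, A, g)"
  have st: "fst S = us @ a # Suc a # zs" "fst (snd (snd S)) = ?A3" "snd (snd (snd S)) = ?g4"
    unfolding S_def l[symmetric] a_def by simp_all
  have I: "A u \<in> set (us @ x # y # zs) \<and> A (A u) = u \<and> A u \<noteq> u" if "u \<in> set (us @ x # y # zs)" for u
    using goodD(1-3)[OF g that] by blast
  have d: "x \<noteq> y" "x \<notin> set (us @ zs)" "y \<notin> set (us @ zs)" using good_distinct[OF g] by auto
  have ix: "A (A x) = x" "A x \<noteq> x" "A (A y) = y" "A y \<noteq> y" using I[of x] I[of y] by auto
  have fac: "facs (cup_cap h) (us @ x # y # zs, D, A, g) = (if A x = y then zval (- 1 \<oplus> g x) else 1)"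
    unfolding l[symmetric] using ix(2) by simp
  have step: "?A3 u = (if A u = x then A y else if A u = y then A x else A u) \<and>
       ?g4 u = (if A u = x then g u \<oplus> 1 \<oplus> g y else if A u = y then g u \<oplus> (- 1 \<oplus> g x) else g u)"
    if u: "u \<in> set (us @ zs)" for u
  proof -
    have iu: "A (A u) = u" using I[of u] u by auto
    have nu: "u \<noteq> a" "u \<noteq> Suc a" "u \<noteq> x" "u \<noteq> y" using u ab d by auto
    have A3: "?A3 u = ?A2 u" "?g4 u = ?g2 u" using nu by simp_all
    consider (1) "A u = x" | (2) "A u = y" | (3) "A u \<noteq> x" "A u \<noteq> y" by blast
    then show ?thesis
    proof cases
      case 1
      then have ux: "u = A x" using iu by simp
      have ne: "A x \<noteq> A y" "A x \<noteq> y" using ix(1,3) d(1) nu(4) ux by metis+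
      have "?A2 u = A y" "?g2 u = g u \<oplus> 1 \<oplus> g y" unfolding ux using ne ix d(1) by simp_all
      then show ?thesis using 1 A3 by simp
    next
      case 2
      then have uy: "u = A y" using iu by simp
      have ne: "A x \<noteq> A y" "A y \<noteq> x" using ix(1,3) d(1) nu(3) uy by metis+
      have "?A2 u = A x" "?g2 u = g u \<oplus> (- 1 \<oplus> g x)" unfolding uy using ne ix d(1) by simp_all
      moreover have "A u \<noteq> x" using 2 d(1) by simp
      ultimately show ?thesis using 2 A3 by simp
    next
      case 3
      then have "u \<noteq> A x" "u \<noteq> A y" using ix by metis+
      then show ?thesis using 3 A3 nu by simp
    qed
  qed
  obtain D' where "S = (us @ a # Suc a # zs, D', ?A3, ?g4)" using st by (metis prod.collapse)
  then have S: "stps (cup_cap h) (us @ x # y # zs, D, A, g) = (us @ a # Suc a # zs, D', ?A3, ?g4)" unfolding S_def .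
  show ?thesis
    by (rule that[OF ab(3,1,2) S _ _ _ _ step fac]) simp_all
qed

lemma run_cup_cap: "Suc h < n \<Longrightarrow> run (cup_cap h) (EW n) = Some (EW n)"
  using run_smoothing(2)[OF act_EW[of h n Over]] EW_nth(1)[of h n] EW_nth(1)[of "Suc h" n]
  by (simp add: smoothing2_def)

text \<open>The cusps of the smoothing match the labels 1 of the two caps. Among right vertices the
  larger number comes first in the order, so the new arc is read as -1 from its lower end and as 1
  from its upper end.\<close>

lemma product_F:
  assumes "T \<in> arrow_tangles n" and i: "Suc h < n"
  shows "facs (cup_cap h) (tangle_state n T) = cycle_factor T (tangle_F n (Suc h))"
    "rn (stps (cup_cap h) (tangle_state n T)) (tangle_state n (arrow_product T (tangle_F n (Suc h))))"
proof -
  obtain E f where T: "T = (E, f)" by (cases T)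
  obtain E' f' where G: "tangle_F n (Suc h) = (E', f')" by (cases "tangle_F n (Suc h)")
  have "(E', f') \<in> arrow_tangles n" using tangle_F_in[of "Suc h" n] i G by simp
  then interpret tangle_pair n E E' f f' using assms(1) unfolding T by unfold_locales
  let ?i = "Suc h" and ?j = "Suc (Suc h)"
  let ?E1 = "{{(0, ?i), (0, ?j)}, {(1, ?i), (1, ?j)}} :: flat_tangle"
  have E': "E' = ?E1 \<union> (\<lambda>k. {(0, k), (1, k)}) ` ({1..n} - {?i, ?j})" 
    using G by (simp add: tangle_F_def Let_def)
  have f': "f' = (\<lambda>\<alpha>\<in>E'. if \<alpha> \<in> ?E1 then 1 else 0)" using G unfolding E' by (simp add: tangle_F_def Let_def)
  have cap: "{(0, ?i), (0, ?j)} \<in> E'" "{(1, ?i), (1, ?j)} \<in> E'" "f' {(0, ?i), (0, ?j)} = 1" "f' {(1, ?i), (1, ?j)} = 1"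
    unfolding f' unfolding E' by simp_all
  have cap': "{(0, ?j), (0, ?i)} \<in> E'" "{(1, ?j), (1, ?i)} \<in> E'" using cap by (simp_all add: insert_commute)
  have lab: "olab f' (0, ?i) (0, ?j) = 1" "olab f' (0, ?j) (0, ?i) = - 1"
    "olab f' (1, ?i) (1, ?j) = - 1" "olab f' (1, ?j) (1, ?i) = 1"
    using cap(3,4) by (simp_all add: olab_def drev_def insert_commute)
  let ?us = "[0..<h]" and ?zs = "[?j..<2 * n]" and ?D = "\<lambda>j. if j < n then East else West"
  have sp: "[0..<2 * n] = ?us @ h # ?i # ?zs" by (rule split_upt) (use i in simp)
  have s: "tangle_state n T = (?us @ h # ?i # ?zs, ?D, Ai, gi)" unfolding T tangle_state.simps sp ..
  note gd = good_tangle_state[OF tangles(1), folded T]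
  have hn: "h < 2 * n" "?i < 2 * n" "h < n" "?i < n" using i by simp_all
  have us: "set (?us @ ?zs) = {..<2 * n} - {h, ?i}" using hn by auto
  obtain a b D' A' g' where st: "a \<noteq> b" "a \<notin> set (?us @ ?zs)" "b \<notin> set (?us @ ?zs)"
    "stps (cup_cap h) (?us @ h # ?i # ?zs, ?D, Ai, gi) = (?us @ a # b # ?zs, D', A', g')"
    "A' a = b" "A' b = a" "g' a = - 1" "g' b = 1"
    "\<And>u. u \<in> set (?us @ ?zs) \<Longrightarrow> A' u = (if Ai u = h then Ai ?i else if Ai u = ?i then Ai h else Ai u) \<and>
       g' u = (if Ai u = h then gi u \<oplus> 1 \<oplus> gi ?i else if Ai u = ?i then gi u \<oplus> (- 1 \<oplus> gi h) else gi u)"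
    "facs (cup_cap h) (?us @ h # ?i # ?zs, ?D, Ai, gi) = (if Ai h = ?i then zval (- 1 \<oplus> gi h) else 1)"
    by (rule cup_cap_steps[OF gd(1)[unfolded s], of h]) auto
  have dech: "dec n h = (1, ?i)" "dec n ?i = (1, ?j)" using hn by (simp_all add: dec_def)
  have caps: "{b, c} = {?i, ?j}" if "{(0, b), (0, c)} \<in> E'" for b c
    using that unfolding E' by (auto simp: doubleton_eq_iff)
  let ?\<gamma> = "[(False, (1, ?i), (1, ?j)), (True, (0, ?j), (0, ?i))] :: tagged list"
  have Ah: "Ai h = ?i \<longleftrightarrow> {(1, ?i), (1, ?j)} \<in> E"
  proof
    assume "Ai h = ?i"
    then have "partner E (1, ?i) = (1, ?j)" using dec_Ai[OF hn(1)] dech by simp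
    then show "{(1, ?i), (1, ?j)} \<in> E" using pt(1)[OF hn(1)] dech by simp
  next
    assume "{(1, ?i), (1, ?j)} \<in> E"
    then have "partner E (1, ?i) = (1, ?j)"
      using partner_eq[OF arrow_tangleD(1)[OF tangles(1)] dec_V[OF hn(1)]] dech by simp
    then show "Ai h = ?i" using dech by simp
  qed
  have cyc: "{\<gamma>. is_cycle E E' \<gamma>} = (if Ai h = ?i then {?\<gamma>} else {})"
  proof (cases "Ai h = ?i")
    case True
    have e: "{(1, ?i), (1, ?j)} \<in> E" using True Ah by (rule iffD1[rotated])
    have c: "is_cycle E E' ?\<gamma>" using e cap'(1) unfolding is_cycle_def
      by (simp add: All_less_Suc2 numeral_2_eq_2)
    have "{\<gamma>. is_cycle E E' \<gamma>} = {?\<gamma>}"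
    proof (rule Set.set_eqI)
      fix \<gamma>
      show "\<gamma> \<in> {\<gamma>. is_cycle E E' \<gamma>} \<longleftrightarrow> \<gamma> \<in> {?\<gamma>}" unfolding mem_Collect_eq singleton_iff
      proof
        assume "is_cycle E E' \<gamma>"
        then show "\<gamma> = ?\<gamma>" by (rule cycle_caps(1)[OF _ caps])
      next
        assume "\<gamma> = ?\<gamma>"
        then show "is_cycle E E' \<gamma>" using c by (rule ssubst)
      qed
    qed
    then show ?thesis unfolding if_P[OF True] .
  next
    case False
    have "\<not> is_cycle E E' \<gamma>" for \<gamma>
    proof
      assume "is_cycle E E' \<gamma>"
      then have "{(1, ?i), (1, ?j)} \<in> E" by (rule cycle_caps(2)[OF _ caps])
      then show False using False Ah by blast
    qed
    then show ?thesis unfolding if_not_P[OF False] by blast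
  qed
  have lg: "path_label f f' ?\<gamma> = gi h \<oplus> - 1" if "Ai h = ?i"
  proof -
    have "partner E (1, ?i) = (1, ?j)" using dec_Ai[OF hn(1)] dech that by simp
    then show ?thesis using that Ah cap'(1) lab(2) dech by (simp add: path_label_Cons)
  qed
  have par: "odd (gi h)" if "Ai h = ?i"
  proof -
    have pr: "partner E (1, ?i) = (1, ?j)" using dec_Ai[OF hn(1)] dech that by simp
    show ?thesis using arrow_tangleD(3)[OF tangles(1) pt(1)[OF hn(1)]] unfolding dech pr by simp
  qed
  show "facs (cup_cap h) (tangle_state n T) = cycle_factor T (tangle_F n (Suc h))"
  proof (cases "Ai h = ?i")
    case True
    have "cycle_factor T (tangle_F n (Suc h)) = zval (gi h \<oplus> - 1)"
      unfolding G unfolding T using True lg[OF True] by (simp add: cyc zval_def)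
    also have "\<dots> = zval (- 1 \<oplus> gi h)" by (rule zval_dop_commute) (use par[OF True] in simp)
    finally show ?thesis unfolding s st(10) using True by simp
  next
    case False
    then show ?thesis unfolding s st(10) G unfolding T by (simp add: cyc)
  qed
  have r: "run (cup_cap h) (dirs (tangle_state n T)) = Some (EW n)" unfolding gd(2) by (rule run_cup_cap[OF i])
  have g': "good (?us @ a # b # ?zs, D', A', g')" "map D' (?us @ a # b # ?zs) = EW n"
    using good_stps[OF gd(1) r] unfolding s st(4) by (simp_all only: dirs.simps)
  \<comment> \<open>The new names take over the positions of the two strands that were
    closed.\<close>
  define \<phi> where "\<phi> = (\<lambda>u. if u = a then h else if u = b then ?i else u)"
  have \<phi>: "\<phi> a = h" "\<phi> b = ?i" "\<And>u. u \<in> set (?us @ ?zs) \<Longrightarrow> \<phi> u = u"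
    using st(1-3) by (auto simp: \<phi>_def)
  have th: "through \<phi>' k" if k: "k < 2 * n" "k \<noteq> h" "k \<noteq> ?i" "\<phi>' k = k" for \<phi>' k
  proof (cases "k < n")
    case True
    then have mem: "{(0, Suc k), (1, Suc k)} \<in> E'" using k(2,3) unfolding E' by auto
    then have "f' {(0, Suc k), (1, Suc k)} = 0" by (simp add: f' doubleton_eq_iff)
    then show ?thesis unfolding through_def k(4) using k(1) True mem by simp
  next
    case False
    then show ?thesis unfolding through_def using k(1,4) by simp
  qed
  \<comment> \<open>The arcs of the old strands: one that ended at the cap is continued through it
    along the arc of the other strand, and all others go straight through.\<close>
  have inner: "\<exists>\<alpha>. chain E E' False (dec n u) \<alpha> (dec n (A' u)) \<and> path_label f f' \<alpha> = g' u \<and> A' u \<in> set (?us @ ?zs)"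
    if u: "u \<in> set (?us @ ?zs)" for u
  proof -
    have un: "u < 2 * n" "u \<noteq> h" "u \<noteq> ?i" using u unfolding us by auto
    note AA = Ai(2)[OF un(1)] Ai(2)[OF hn(1)] Ai(2)[OF hn(2)]
    note step = st(9)[OF u]
    have suf: "\<exists>\<alpha>. chain E E' False (dec n v) \<alpha> (dec n (Ai v)) \<and> path_label f f' \<alpha> = gi v"
      if v: "v < 2 * n" "Ai v \<noteq> h" "Ai v \<noteq> ?i" for v
      using chain_suffix[OF v(1) th[OF Ai(1)[OF v(1)] v(2,3), of id]] by simp
    consider (1) "Ai u = h" | (2) "Ai u = ?i" | (3) "Ai u \<noteq> h" "Ai u \<noteq> ?i" by blast
    then show ?thesis
    proof cases
      case 1
      have v: "Ai ?i \<noteq> h" "Ai ?i \<noteq> ?i"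
      proof -
        have "Ai h = u" using AA(1) 1 by metis
        then show "Ai ?i \<noteq> h" using AA(3) un(3) by metis
        show "Ai ?i \<noteq> ?i" by (rule Ai(3)[OF hn(2)])
      qed
      obtain \<alpha> where al: "chain E E' False (dec n ?i) \<alpha> (dec n (Ai ?i))" "path_label f f' \<alpha> = gi ?i"
        using suf[OF hn(2) v] by blast
      obtain \<beta> where "chain E E' False (dec n u) \<beta> (dec n (Ai ?i))" "path_label f f' \<beta> = gi u \<oplus> (1 \<oplus> path_label f f' \<alpha>)"
        using chain_cap[OF un(1) 1 hn(3,4) cap(1) lab(1) al(1)] by blast
      moreover have "Ai ?i \<in> set (?us @ ?zs)" using v Ai(1)[OF hn(2)] unfolding us by simp
      moreover have "A' u = Ai ?i" "g' u = gi u \<oplus> (1 \<oplus> gi ?i)" using step 1 by (simp_all add: dop_assoc)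
      ultimately show ?thesis using al(2) by metis
    next
      case 2
      have v: "Ai h \<noteq> h" "Ai h \<noteq> ?i"
      proof -
        have "Ai ?i = u" using AA(1) 2 by metis
        then show "Ai h \<noteq> ?i" using AA(2) un(2) by metis
        show "Ai h \<noteq> h" by (rule Ai(3)[OF hn(1)])
      qed
      obtain \<alpha> where al: "chain E E' False (dec n h) \<alpha> (dec n (Ai h))" "path_label f f' \<alpha> = gi h"
        using suf[OF hn(1) v] by blast
      obtain \<beta> where "chain E E' False (dec n u) \<beta> (dec n (Ai h))" "path_label f f' \<beta> = gi u \<oplus> (- 1 \<oplus> path_label f f' \<alpha>)"
        using chain_cap[OF un(1) 2 hn(4,3) cap'(1) lab(2) al(1)] by blast
      moreover have "Ai h \<in> set (?us @ ?zs)" using v Ai(1)[OF hn(1)] unfolding us by simp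
      moreover have "Ai u \<noteq> h" using 2 by simp
      then have "A' u = Ai h" "g' u = gi u \<oplus> (- 1 \<oplus> gi h)" using step 2 by simp_all
      ultimately show ?thesis using al(2) by metis
    next
      case 3
      then have "A' u = Ai u" "g' u = gi u" using step by simp_all
      moreover have "Ai u \<in> set (?us @ ?zs)" using 3 Ai(1)[OF un(1)] unfolding us by simp
      ultimately show ?thesis using suf[OF un(1) 3] by metis
    qed
  qed
  have "rn (?us @ a # b # ?zs, D', A', g') (tangle_state n (arrow_product (E, f) (E', f')))"
  proof (rule product_rn[OF g'])
    show "inj_on \<phi> (set (?us @ a # b # ?zs))"
    proof (rule inj_onI)
      fix u v assume "u \<in> set (?us @ a # b # ?zs)" "v \<in> set (?us @ a # b # ?zs)" and e: "\<phi> u = \<phi> v"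
      then have u: "u = a \<or> u = b \<or> u \<in> set (?us @ ?zs)" and v: "v = a \<or> v = b \<or> v \<in> set (?us @ ?zs)" by auto
      have no: "w \<noteq> h \<and> w \<noteq> ?i" if "w \<in> set (?us @ ?zs)" for w using that unfolding us by simp
      show "u = v" using u v e \<phi>(1,2) \<phi>(3)[of u] \<phi>(3)[of v] no[of u] no[of v] n_not_Suc_n by metis
    qed
    have m: "map \<phi> ?us = ?us" "map \<phi> ?zs = ?zs" by (rule map_idI, rule \<phi>(3), simp)+
    show "map \<phi> (?us @ a # b # ?zs) = [0..<2 * n]" unfolding sp map_append list.map m \<phi>(1,2) ..
  next
    fix u assume "u \<in> set (?us @ a # b # ?zs)"
    then consider (1) "u = a" | (2) "u = b" | (3) "u \<in> set (?us @ ?zs)" by auto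
    then show "\<exists>\<alpha>. chain E E' (\<phi> u < n) (dec n (\<phi> u)) \<alpha> (dec n (\<phi> (A' u))) \<and> path_label f f' \<alpha> = g' u"
    proof cases
      case 1
      have "chain E E' True (1, ?i) [(True, (1, ?i), (1, ?j))] (1, ?j)" using cap(2) by simp
      moreover have "path_label f f' [(True, (1, ?i), (1, ?j))] = - 1" using cap(2) lab(3) by (simp add: path_label_Cons)
      moreover have "(\<phi> u < n) = True" using 1 \<phi> hn by simp
      ultimately show ?thesis using 1 \<phi>(1,2) dech st(5,7) by metis
    next
      case 2
      have "chain E E' True (1, ?j) [(True, (1, ?j), (1, ?i))] (1, ?i)" using cap'(2) by simp
      moreover have "path_label f f' [(True, (1, ?j), (1, ?i))] = 1" using cap'(2) lab(4) by (simp add: path_label_Cons)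
      moreover have "(\<phi> u < n) = True" using 2 \<phi> hn by simp
      ultimately show ?thesis using 2 \<phi>(1,2) dech st(6,8) by metis
    next
      case 3
      obtain \<alpha> where al: "chain E E' False (dec n u) \<alpha> (dec n (A' u))" "path_label f f' \<alpha> = g' u" "A' u \<in> set (?us @ ?zs)"
        using inner[OF 3] by blast
      have "through \<phi> u" using th[of u \<phi>] 3 \<phi>(3)[OF 3] unfolding us by simp
      from chain_prefix[OF this al(1)] show ?thesis using al(2) \<phi>(3)[OF al(3)] by metis
    qed
  qed
  then show "rn (stps (cup_cap h) (tangle_state n T)) (tangle_state n (arrow_product T (tangle_F n (Suc h))))"
    unfolding s st(4) G unfolding T .
qed

section \<open>Linear functionals on the tangle algebra\<close>

definition lin :: "('b \<Rightarrow> ra) \<Rightarrow> ('b \<Rightarrow>\<^sub>0 ra) \<Rightarrow> ra" where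
  "lin \<phi> x = (\<Sum>F\<in>Poly_Mapping.keys x. Poly_Mapping.lookup x F * \<phi> F)"

lemma lin_superset:
  assumes "finite S" "Poly_Mapping.keys x \<subseteq> S"
  shows "lin \<phi> x = (\<Sum>F\<in>S. Poly_Mapping.lookup x F * \<phi> F)"
  unfolding lin_def by (rule sum.mono_neutral_left) (use assms in \<open>auto simp: in_keys_iff\<close>)

lemma lin_add: "lin \<phi> (x + y) = lin \<phi> x + lin \<phi> y"
proof -
  let ?S = "Poly_Mapping.keys x \<union> Poly_Mapping.keys y"
  have "lin \<phi> (x + y) = (\<Sum>F\<in>?S. Poly_Mapping.lookup (x + y) F * \<phi> F)"
    by (rule lin_superset) (use keys_add[of x y] in auto)
  also have "\<dots> = lin \<phi> x + lin \<phi> y"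
    using lin_superset[of ?S x \<phi>] lin_superset[of ?S y \<phi>]
    by (simp add: lookup_add distrib_right sum.distrib)
  finally show ?thesis .
qed

lemma lin_single: "lin \<phi> (Poly_Mapping.single F c) = c * \<phi> F"
  using lin_superset[of "{F}" "Poly_Mapping.single F c" \<phi>] by simp

lemma lin_scale: "lin \<phi> (scale c x) = c * lin \<phi> x"
proof -
  have l: "Poly_Mapping.lookup (scale c x) F = c * Poly_Mapping.lookup x F" for F
    unfolding scale_def by (simp add: Poly_Mapping.map.rep_eq when_def)
  have "lin \<phi> (scale c x) = (\<Sum>F\<in>Poly_Mapping.keys x. Poly_Mapping.lookup (scale c x) F * \<phi> F)"
    by (rule lin_superset) (auto simp: in_keys_iff l)
  then show ?thesis unfolding lin_def by (simp add: l sum_distrib_left mult.assoc)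
qed

lemma lin_sum: "finite S \<Longrightarrow> lin \<phi> (sum g S) = (\<Sum>s\<in>S. lin \<phi> (g s))"
proof (induction S rule: finite_induct)
  case empty
  then show ?case by (simp add: lin_def)
next
  case (insert s S)
  then show ?case by (simp add: lin_add)
qed

lemma lin_ATL_mult:
  "lin \<phi> (ATL_mult x y) = lin (\<lambda>F. lin (\<lambda>G. cycle_factor F G * \<phi> (arrow_product F G)) y) x"
  unfolding ATL_mult_def bilinear_extension_def
  by (simp add: lin_sum lin_scale lin_single, simp add: lin_def sum_distrib_left mult.assoc)

lemma lin_cong: "Poly_Mapping.keys x \<subseteq> S \<Longrightarrow> (\<And>F. F \<in> S \<Longrightarrow> \<phi> F = \<psi> F) \<Longrightarrow> lin \<phi> x = lin \<psi> x"
  unfolding lin_def by (rule sum.cong) auto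

lemma lin_combination: "lin (\<lambda>F. a * \<phi> F + b * \<psi> F) x = a * lin \<phi> x + b * lin \<psi> x"
  unfolding lin_def by (simp add: distrib_left sum.distrib sum_distrib_left mult.left_commute)


section \<open>Generators as operators\<close>

text \<open>Between East strands \<open>Under\<close> has sign 1 and \<open>Over\<close> has sign
  -1. The coefficients in the first case are those of the image of a generator sigma.\<close>

lemma cont_classical_EW:
  assumes i: "Suc h < n" and s: "dirs s = EW n"
  shows "cont (Cross Under h) K s = - A_pow (-2) * K s + - A_pow (-4) * flat (cup_cap h) K s"
    and "cont (Cross Over h) K s = - A_pow 2 * K s + - A_pow 4 * flat (cup_cap h) K s"
proof -
  have e: "EW n ! h = East" "EW n ! Suc h = East" using i by (simp_all add: EW_nth)
  have sm: "smoothing1 h East East = []" "smoothing2 h East East = cup_cap h"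
    by (simp_all add: smoothing1_def smoothing2_def)
  have p: "A_pow (-3) * A_pow 1 = A_pow (-2)" "A_pow (-3) * A_pow (-1) = A_pow (-4)"
    "A_pow 3 * A_pow (-1) = A_pow 2" "A_pow 3 * A_pow 1 = A_pow 4"
    by (simp_all add: A_pow_add[symmetric])
  have "cont (Cross Under h) K s =
      - A_pow (-3) * (A_pow 1 * K s + A_pow (-1) * flat (cup_cap h) K s)"
    unfolding cont_def Let_def s by (simp only: classical.simps height.simps piece_sign.simps e sign.simps sm flat_simps(1)) simp
  then show "cont (Cross Under h) K s = - A_pow (-2) * K s + - A_pow (-4) * flat (cup_cap h) K s"
    by (simp only: distrib_left minus_mult_left[symmetric] mult.assoc[symmetric] p)
  have "cont (Cross Over h) K s =
      - A_pow 3 * (A_pow (-1) * K s + A_pow 1 * flat (cup_cap h) K s)"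
    unfolding cont_def Let_def s by (simp only: classical.simps height.simps piece_sign.simps e sign.simps sm flat_simps(1)) simp
  then show "cont (Cross Over h) K s = - A_pow 2 * K s + - A_pow 4 * flat (cup_cap h) K s"
    by (simp only: distrib_left minus_mult_left[symmetric] mult.assoc[symmetric] p)
qed

text \<open>The second closing meets the arc created by the first smoothing. Its cusp cancels
  against the added one, so a loop of value 0 splits off, and the rest agrees with one smoothing up
  to renaming.\<close>

lemma cup_cap_twice:
  assumes K: "resp (EW n) K" and i: "Suc h < n" and g: "good s" "dirs s = EW n"
  shows "flat (cup_cap h) (flat (cup_cap h) K) s = z 0 * flat (cup_cap h) K s"
proof -
  obtain xs D A g0 where s: "s = (xs, D, A, g0)" by (cases s)
  have "length xs = 2 * n" using arg_cong[OF g(2), of length] unfolding s dirs.simps by simp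
  then have "Suc h < length xs" using i by simp
  then obtain us x y zs where xs: "xs = us @ x # y # zs" and l: "length us = h" by (rule split_at2)
  note g1 = g(1)[unfolded s xs]
  obtain a b D' A' g' where st: "a \<noteq> b" "a \<notin> set (us @ zs)" "b \<notin> set (us @ zs)"
    "stps (cup_cap h) (us @ x # y # zs, D, A, g0) = (us @ a # b # zs, D', A', g')"
    "A' a = b" "A' b = a" "g' a = - 1" "g' b = 1"
    by (rule cup_cap_steps[OF g1 l]) blast
  let ?s1 = "(us @ a # b # zs, D', A', g')"
  have r: "run (cup_cap h) (EW n) = Some (EW n)" by (rule run_cup_cap[OF i])
  have s1: "good ?s1" "dirs ?s1 = EW n"
    using good_stps[OF g(1), of "cup_cap h"] r g(2) unfolding s xs st(4) by simp_all
  obtain c d D2 A2 g2 where st2: "c \<noteq> d" "c \<notin> set (us @ zs)" "d \<notin> set (us @ zs)"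
    "stps (cup_cap h) ?s1 = (us @ c # d # zs, D2, A2, g2)" "A2 c = d" "A2 d = c" "g2 c = - 1" "g2 d = 1"
    "\<And>u. u \<in> set (us @ zs) \<Longrightarrow> A2 u = (if A' u = a then A' b else if A' u = b then A' a else A' u) \<and>
       g2 u = (if A' u = a then g' u \<oplus> 1 \<oplus> g' b else if A' u = b then g' u \<oplus> (- 1 \<oplus> g' a) else g' u)"
    "facs (cup_cap h) ?s1 = (if A' a = b then zval (- 1 \<oplus> g' a) else 1)"
    by (rule cup_cap_steps[OF s1(1) l]) blast
  let ?s2 = "(us @ c # d # zs, D2, A2, g2)"
  have s2: "dirs ?s2 = EW n" using good_stps[OF s1(1), of "cup_cap h"] r s1(2) unfolding st2(4) by simp
  have f: "facs (cup_cap h) ?s1 = z 0" unfolding st2(10) using st(5,7) by (simp add: zval_def dop_def)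
  have "rn ?s1 ?s2"
  proof -
    define \<phi> where "\<phi> = id(a := c, b := d)"
    have \<phi>: "\<phi> a = c" "\<phi> b = d" "\<And>u. u \<in> set (us @ zs) \<Longrightarrow> \<phi> u = u"
      using st(1-3) by (auto simp: \<phi>_def)
    have m: "us @ c # d # zs = map \<phi> (us @ a # b # zs)"
      using \<phi> by (simp add: map_idI)
    have inj: "inj_on \<phi> (set (us @ a # b # zs))"
    proof (rule inj_onI)
      fix u v assume "u \<in> set (us @ a # b # zs)" "v \<in> set (us @ a # b # zs)" and e: "\<phi> u = \<phi> v"
      then have "u = a \<or> u = b \<or> u \<in> set (us @ zs)" "v = a \<or> v = b \<or> v \<in> set (us @ zs)" by auto
      then show "u = v" using e \<phi> st2(1-3) by metis
    qed
    have D: "D2 (\<phi> u) = D' u" if "u \<in> set (us @ a # b # zs)" for u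
    proof -
      have "map D2 (map \<phi> (us @ a # b # zs)) = map D' (us @ a # b # zs)"
        using s1(2) s2 unfolding dirs.simps m[symmetric] by simp
      then have "map (D2 \<circ> \<phi>) (us @ a # b # zs) = map D' (us @ a # b # zs)" by (simp only: map_map)
      then have "(D2 \<circ> \<phi>) u = D' u" using that unfolding map_eq_conv by blast
      then show ?thesis by simp
    qed
    have AG: "A2 (\<phi> u) = \<phi> (A' u) \<and> g2 (\<phi> u) = g' u" if u: "u \<in> set (us @ a # b # zs)" for u
    proof -
      consider (1) "u = a" | (2) "u = b" | (3) "u \<in> set (us @ zs)" using u by auto
      then show ?thesis
      proof cases
        case 1
        then show ?thesis using st(5,7) st2(5,7) \<phi>(1,2) by simp
      next
        case 2
        then show ?thesis using st(6,8) st2(6,8) \<phi>(1,2) by simp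
      next
        case 3
        have uu: "A' (A' u) = u" "A' u \<in> set (us @ a # b # zs)" using goodD(1,2)[OF s1(1) u] by blast+
        have "u \<noteq> a" "u \<noteq> b" using 3 st(2,3) by auto
        then have ne: "A' u \<noteq> a" "A' u \<noteq> b" using uu(1) st(5,6) by metis+
        then have "A' u \<in> set (us @ zs)" using uu(2) by auto
        then show ?thesis using st2(9)[OF 3] ne \<phi>(3)[OF 3] \<phi>(3)[of "A' u"] by simp
      qed
    qed
    show ?thesis by (rule rnI[of \<phi>]) (use inj m D AG in \<open>simp only: rnf.simps, blast\<close>)
  qed
  then have "K ?s2 = K ?s1" by (rule respD[OF K s1])
  then show ?thesis unfolding s xs flat_def st(4) f st2(4) by (simp add: mult.left_commute)
qed

abbreviation on_tangles :: "nat \<Rightarrow> (lstate \<Rightarrow> ra) \<Rightarrow> arrow_tangle \<Rightarrow> ra" where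
  "on_tangles n K T \<equiv> K (tangle_state n T)"

lemma good_ts: "T \<in> arrow_tangles n \<Longrightarrow> good (tangle_state n T) \<and> dirs (tangle_state n T) = EW n"
  using good_tangle_state by (cases T) blast

lemma times_id:
  assumes "T \<in> arrow_tangles n" "resp (EW n) K"
  shows "cycle_factor T (tangle_id n) * on_tangles n K (arrow_product T (tangle_id n)) = on_tangles n K T"
proof -
  have "on_tangles n K (arrow_product T (tangle_id n)) = on_tangles n K T"
    by (rule respD[OF assms(2) _ _ product_id(2)[OF assms(1)]]) (use good_ts[OF assms(1)] in blast)+
  then show ?thesis by (simp only: product_id(1)[OF assms(1)] mult_1)
qed

lemma cont_Virtual: "cont (Cross Virtual h) K s = K (stp (Cross Virtual h) s)"
  by (simp add: cont_def)

lemma times_w: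
  assumes "T \<in> arrow_tangles n" "resp (EW n) K" "Suc h < n"
  shows "cycle_factor T (tangle_w n (Suc h)) * on_tangles n K (arrow_product T (tangle_w n (Suc h))) =
    on_tangles n (cont (Cross Virtual h) K) T"
proof -
  let ?s = "tangle_state n T"
  have g: "good ?s" "dirs ?s = EW n" using good_ts[OF assms(1)] by simp_all
  have a: "act (Cross Virtual h) (dirs ?s) = Some (EW n)" unfolding g(2) by (rule act_EW[OF assms(3)])
  have "on_tangles n K (arrow_product T (tangle_w n (Suc h))) = K (stp (Cross Virtual h) ?s)"
    by (rule respD[OF assms(2) good_stp[OF g(1) a] dirs_stp[OF g(1) a] product_w(2)[OF assms(1,3)]])
  then show ?thesis by (simp only: product_w(1)[OF assms(1,3)] mult_1 cont_Virtual)
qed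

lemma times_F:
  assumes "T \<in> arrow_tangles n" "resp (EW n) K" "Suc h < n"
  shows "cycle_factor T (tangle_F n (Suc h)) * on_tangles n K (arrow_product T (tangle_F n (Suc h))) =
    on_tangles n (flat (cup_cap h) K) T"
proof -
  let ?s = "tangle_state n T"
  have g: "good ?s" "dirs ?s = EW n" using good_ts[OF assms(1)] by simp_all
  have "good (stps (cup_cap h) ?s)" "dirs (stps (cup_cap h) ?s) = EW n"
    using good_stps[OF g(1), of "cup_cap h"] run_cup_cap[OF assms(3)] g(2) by simp_all
  then show ?thesis
    using product_F[OF assms(1,3)] respD[OF assms(2)] unfolding flat_def by metis
qed


section \<open>Virtual braids\<close>

lemma braid_words_append [simp]: "u @ v \<in> braid_words n \<longleftrightarrow> u \<in> braid_words n \<and> v \<in> braid_words n"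
  by (simp add: braid_words_def)

lemma braid_words_Nil [simp]: "[] \<in> braid_words n"
  by (simp add: braid_words_def)

lemma crossings_word: "u \<in> braid_words n \<Longrightarrow> crossings n (map letter_piece u)"
proof (induction u)
  case Nil
  then show ?case by simp
next
  case (Cons l u)
  then show ?case by (auto simp: braid_words_def crossings_def)
qed

lemma run_word: "u \<in> braid_words n \<Longrightarrow> run (map letter_piece u) (EW n) = Some (EW n)"
  by (rule run_crossings[OF crossings_word])

lemma closure_eq: "closure_diagram n u = opens n @ map letter_piece u @ closers n"
  by (simp add: closure_diagram_def opens_def closers_def)

lemma closure_link_diagram:
  assumes "n \<ge> 1" "u \<in> braid_words n" shows "link_diagram (closure_diagram n u)"
proof -
  have "run (closure_diagram n u) [] = Some []"
    unfolding closure_eq by (simp add: run_append run_opens run_word[OF assms(2)] run_closers)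
  moreover have "closure_diagram n u \<noteq> []" using assms(1) by (simp add: closure_diagram_def)
  moreover have "Cusp i s \<notin> set (closure_diagram n u)" for i s
  proof -
    have "letter_piece l \<noteq> Cusp i s" for l by (cases l) auto
    then have "Cusp i s \<notin> letter_piece ` set u" by (metis imageE)
    then show ?thesis by (auto simp: closure_diagram_def)
  qed
  ultimately show ?thesis by (simp add: link_diagram_def arrow_diagram_def)
qed

lemma exchange_crossings:
  assumes "Suc (Suc h) \<le> k" shows "local_move [Cross c h, Cross d k] [Cross d k, Cross c h]"
proof -
  have "Suc (Suc (k - 2)) = k" using assms by linarith
  then show ?thesis using local_move.exchange[of "Cross c h" "Cross d k"] assms by simp
qed

text \<open>Which side of a relation is the left side of a local move depends on which of the two
  indices is larger.\<close>

lemma braid_relation_move: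
  assumes "braid_relation l r" "l \<in> braid_words n"
  shows "local_move (map letter_piece l) (map letter_piece r) \<or> local_move (map letter_piece r) (map letter_piece l)"
proof -
  have far: "local_move [Cross c h, Cross d k] [Cross d k, Cross c h] \<or> local_move [Cross d k, Cross c h] [Cross c h, Cross d k]"
    if "2 \<le> \<bar>int (Suc h) - int (Suc k)\<bar>" for c d h k
  proof -
    have "Suc (Suc h) \<le> k \<or> Suc (Suc k) \<le> h" using that by linarith
    then show ?thesis using exchange_crossings[of h k c d] exchange_crossings[of k h d c] by blast
  qed
  have near: "b = Suc a \<or> a = Suc b" if "\<bar>int (Suc a) - int (Suc b)\<bar> = 1" for a b
    using that by linarith
  have pos: "\<exists>a. i = Suc a" if "Sigma i \<in> set l \<or> Tau i \<in> set l" for i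
    using that assms(2) by (cases i) (auto simp: braid_words_def)
  note r3' = local_move.r3[of Under Under Under, simplified]
  from assms(1) show ?thesis
  proof cases
    case (1 i)
    then show ?thesis using local_move.r2[of Under "i - 1"] by simp
  next
    case (2 i)
    then show ?thesis using local_move.r2[of Over "i - 1"] by simp
  next
    case (3 i)
    then show ?thesis using local_move.r2[of Virtual "i - 1"] by simp
  next
    case (4 i j)
    then obtain a b where ij: "i = Suc a" "j = Suc b" using pos[of i] pos[of j] by auto
    show ?thesis using far[OF 4(3)[unfolded ij], of Under Under] unfolding 4(1,2) ij by simp
  next
    case (5 i j)
    then obtain a b where ij: "i = Suc a" "j = Suc b" using pos[of i] pos[of j] by auto
    show ?thesis using far[OF 5(3)[unfolded ij], of Virtual Virtual] unfolding 5(1,2) ij by simp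
  next
    case (6 i j)
    then obtain a b where ij: "i = Suc a" "j = Suc b" using pos[of i] pos[of j] by auto
    show ?thesis using far[OF 6(3)[unfolded ij], of Virtual Under] unfolding 6(1,2) ij by simp
  next
    case (7 i j)
    then obtain a b where ij: "i = Suc a" "j = Suc b" using pos[of i] pos[of j] by auto
    from near[OF 7(3)[unfolded ij]] show ?thesis
    proof
      assume "b = Suc a"
      then show ?thesis using r3'[of a] unfolding 7(1,2) ij by simp
    next
      assume "a = Suc b"
      then show ?thesis using r3'[of b] unfolding 7(1,2) ij by simp
    qed
  next
    case (8 i j)
    then obtain a b where ij: "i = Suc a" "j = Suc b" using pos[of i] pos[of j] by auto
    from near[OF 8(3)[unfolded ij]] show ?thesis
    proof
      assume "b = Suc a"
      then show ?thesis using local_move.r3_virtual[of a] unfolding 8(1,2) ij by simp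
    next
      assume "a = Suc b"
      then show ?thesis using local_move.r3_virtual[of b] unfolding 8(1,2) ij by simp
    qed
  next
    case (9 i j)
    then obtain a b where ij: "i = Suc a" "j = Suc b" using pos[of i] pos[of j] by auto
    from near[OF 9(3)[unfolded ij]] show ?thesis
    proof
      assume "b = Suc a"
      then show ?thesis using local_move.r3_mixed[of Virtual Under Virtual a] unfolding 9(1,2) ij by simp
    next
      assume "a = Suc b"
      then show ?thesis using local_move.r3_mixed[of Virtual Virtual Under b] unfolding 9(1,2) ij by simp
    qed
  qed
qed

lemma link_rel_sym: "(v, w) \<in> link_rel \<Longrightarrow> (w, v) \<in> link_rel"
  unfolding link_rel_def by (auto intro: equivclp_sym)

lemma link_rel_trans: "(u, v) \<in> link_rel \<Longrightarrow> (v, w) \<in> link_rel \<Longrightarrow> (u, w) \<in> link_rel"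
  unfolding link_rel_def by (auto intro: equivclp_trans)

lemma link_rel_image: "(v, w) \<in> link_rel \<Longrightarrow> link_rel `` {v} = link_rel `` {w}"
  using link_rel_sym link_rel_trans by blast

lemma braid_step_link:
  assumes "n \<ge> 1" "braid_step n u v"
  shows "(closure_diagram n u, closure_diagram n v) \<in> link_rel"
  using assms(2)
proof cases
  case (1 l r x y)
  have w: "l \<in> braid_words n" "r \<in> braid_words n" "x \<in> braid_words n" "y \<in> braid_words n" "u \<in> braid_words n" "v \<in> braid_words n"
    using 1 by simp_all
  let ?x = "opens n @ map letter_piece x" and ?y = "map letter_piece y @ closers n"
  let ?l = "map letter_piece l" and ?r = "map letter_piece r"
  have c: "closure_diagram n u = ?x @ ?l @ ?y" "closure_diagram n v = ?x @ ?r @ ?y"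
    unfolding closure_eq 1 by simp_all
  note L = closure_link_diagram[OF assms(1) w(5), unfolded c] closure_link_diagram[OF assms(1) w(6), unfolded c]
  have x: "run ?x [] = Some (EW n)" by (simp add: run_append run_opens run_word[OF w(3)])
  note lr = run_word[OF w(1)] run_word[OF w(2)]
  consider "local_move ?l ?r" | "local_move ?r ?l" using braid_relation_move[OF 1(3) w(1)] by blast
  then have "diagram_move (?x @ ?l @ ?y) (?x @ ?r @ ?y) \<or> diagram_move (?x @ ?r @ ?y) (?x @ ?l @ ?y)"
    using diagram_move.intros[of ?l ?r ?x "EW n" "EW n" ?y] diagram_move.intros[of ?r ?l ?x "EW n" "EW n" ?y] x lr L
    by cases blast+
  then have "equivclp diagram_move (?x @ ?l @ ?y) (?x @ ?r @ ?y)"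
    by (metis equivclp_sym r_into_equivclp)
  then show ?thesis using L unfolding link_rel_def c by simp
qed

lemma braid_rel_link:
  assumes "n \<ge> 1" "(u, v) \<in> braid_rel n"
  shows "(closure_diagram n u, closure_diagram n v) \<in> link_rel"
proof -
  have u: "u \<in> braid_words n" and e: "equivclp (braid_step n) u v" using assms(2) by (simp_all add: braid_rel_def)
  from e show ?thesis
  proof (induction rule: equivclp_induct)
    case base
    then show ?case using closure_link_diagram[OF assms(1) u] by (simp add: link_rel_def)
  next
    case (step y z)
    then have "(closure_diagram n y, closure_diagram n z) \<in> link_rel"
      using braid_step_link[OF assms(1)] link_rel_sym by blast
    then show ?case using step.IH link_rel_trans by blast
  qed
qed

abbreviation braid_class :: "nat \<Rightarrow> braid_letter list \<Rightarrow> braid_letter list set" where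
  "braid_class n u \<equiv> braid_rel n `` {u}"

lemma braid_rel_refl: "u \<in> braid_words n \<Longrightarrow> (u, u) \<in> braid_rel n"
  by (simp add: braid_rel_def)

lemma braid_rel_trans: "(u, v) \<in> braid_rel n \<Longrightarrow> (v, w) \<in> braid_rel n \<Longrightarrow> (u, w) \<in> braid_rel n"
  unfolding braid_rel_def by (auto intro: equivclp_trans)

lemma braid_rel_sym: "(u, v) \<in> braid_rel n \<Longrightarrow> (v, u) \<in> braid_rel n"
  unfolding braid_rel_def by (auto intro: equivclp_sym)

lemma braid_class_eq: "(u, v) \<in> braid_rel n \<Longrightarrow> braid_class n u = braid_class n v"
  using braid_rel_sym braid_rel_trans by blast

lemma braid_step_context:
  assumes "braid_step n u v" "x \<in> braid_words n" "y \<in> braid_words n"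
  shows "braid_step n (x @ u @ y) (x @ v @ y)"
  using assms(1)
proof cases
  case (1 l r a b)
  have "braid_step n ((x @ a) @ l @ (b @ y)) ((x @ a) @ r @ (b @ y))"
    by (rule braid_step.intros[OF 1(3)]) (use 1 assms(2,3) in simp_all)
  then show ?thesis unfolding 1 by simp
qed

lemma braid_rel_context:
  assumes "(u, v) \<in> braid_rel n" "x \<in> braid_words n" "y \<in> braid_words n"
  shows "(x @ u @ y, x @ v @ y) \<in> braid_rel n"
proof -
  have "equivclp (braid_step n) u v" using assms(1) by (simp add: braid_rel_def)
  then have "equivclp (braid_step n) (x @ u @ y) (x @ v @ y)"
  proof (induction rule: equivclp_induct)
    case (step y' z)
    then have "braid_step n (x @ y' @ y) (x @ z @ y) \<or> braid_step n (x @ z @ y) (x @ y' @ y)"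
      using braid_step_context[OF _ assms(2,3)] by blast
    then have "equivclp (braid_step n) (x @ y' @ y) (x @ z @ y)" by (metis equivclp_sym r_into_equivclp)
    with step.IH show ?case by (rule equivclp_trans)
  qed simp
  then show ?thesis using assms by (simp add: braid_rel_def)
qed

lemma VB_mult:
  assumes "u \<in> braid_words n" "v \<in> braid_words n"
  shows "braid_class n u \<otimes>\<^bsub>VB n\<^esub> braid_class n v = braid_class n (u @ v)"
proof -
  have "braid_class n (u' @ v') = braid_class n (u @ v)" if "u' \<in> braid_class n u" "v' \<in> braid_class n v" for u' v'
  proof -
    have r: "(u', u) \<in> braid_rel n" "(v', v) \<in> braid_rel n" using that braid_rel_sym by blast+
    have v': "v' \<in> braid_words n" using r(2) by (simp add: braid_rel_def)
    have "(u' @ v', u @ v') \<in> braid_rel n" using braid_rel_context[OF r(1) braid_words_Nil v'] by simp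
    moreover have "(u @ v', u @ v) \<in> braid_rel n" using braid_rel_context[OF r(2) assms(1) braid_words_Nil] by simp
    ultimately show ?thesis using braid_class_eq braid_rel_trans by blast
  qed
  moreover have "u \<in> braid_class n u" "v \<in> braid_class n v" using assms braid_rel_refl by blast+
  ultimately have eq: "\<And>u' v'. u' \<in> braid_class n u \<Longrightarrow> v' \<in> braid_class n v \<Longrightarrow> braid_class n (u' @ v') = braid_class n (u @ v)"
    and ne: "braid_class n u \<noteq> {}" "braid_class n v \<noteq> {}" by blast+
  have "braid_class n u \<otimes>\<^bsub>VB n\<^esub> braid_class n v = (\<Union>u'\<in>braid_class n u. \<Union>v'\<in>braid_class n v. braid_class n (u' @ v'))"
    by (simp add: VB_def)
  also have "\<dots> = (\<Union>u'\<in>braid_class n u. \<Union>v'\<in>braid_class n v. braid_class n (u @ v))"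
    by (intro SUP_cong refl eq)
  also have "\<dots> = braid_class n (u @ v)" using ne by (simp only: UN_constant if_False)
  finally show ?thesis .
qed

lemma class_carrier: "u \<in> braid_words n \<Longrightarrow> braid_class n u \<in> carrier (VB n)"
  by (simp add: VB_def quotientI)

locale representation =
  fixes n :: nat and \<rho> :: "(braid_letter list set \<Rightarrow>\<^sub>0 ra) \<Rightarrow> (arrow_tangle \<Rightarrow>\<^sub>0 ra)"
  assumes rep: "arrow_representation n \<rho>"
begin

definition img :: "braid_letter list \<Rightarrow> (arrow_tangle \<Rightarrow>\<^sub>0 ra)" where
  "img u = \<rho> (Poly_Mapping.single (braid_class n u) 1)"

lemma single_VB: "u \<in> braid_words n \<Longrightarrow> Poly_Mapping.single (braid_class n u) 1 \<in> VB_algebra n"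
  using class_carrier by (simp add: VB_algebra_def)

lemma img_keys: "u \<in> braid_words n \<Longrightarrow> Poly_Mapping.keys (img u) \<subseteq> arrow_tangles n"
  using rep single_VB unfolding arrow_representation_def img_def ATL_def by blast

lemma img_append:
  assumes "u \<in> braid_words n" "v \<in> braid_words n"
  shows "img (u @ v) = ATL_mult (img u) (img v)"
proof -
  have "VB_algebra_mult n (Poly_Mapping.single (braid_class n u) 1) (Poly_Mapping.single (braid_class n v) 1) =
      Poly_Mapping.single (braid_class n (u @ v)) 1"
    unfolding VB_algebra_mult_def bilinear_extension_def scale_def
    by (simp add: VB_mult[OF assms] Poly_Mapping.map_single)
  then show ?thesis
    using rep single_VB[OF assms(1)] single_VB[OF assms(2)] unfolding arrow_representation_def img_def by metis
qed

lemma img_Nil: "img [] = Poly_Mapping.single (tangle_id n) 1"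
  using rep unfolding arrow_representation_def img_def by (simp add: VB_def)

lemma img_Sigma: "Suc h < n \<Longrightarrow> img [Sigma (Suc h)] =
    Poly_Mapping.single (tangle_id n) (- A_pow (-2)) + Poly_Mapping.single (tangle_F n (Suc h)) (- A_pow (-4))"
  using rep unfolding arrow_representation_def img_def by simp

lemma img_Tau: "Suc h < n \<Longrightarrow> img [Tau (Suc h)] = Poly_Mapping.single (tangle_w n (Suc h)) 1"
  using rep unfolding arrow_representation_def img_def by simp

abbreviation "L K x \<equiv> lin (on_tangles n K) x"

lemma L_Sigma:
  assumes "u \<in> braid_words n" "Suc h < n" "resp (EW n) K"
  shows "L K (img (u @ [Sigma (Suc h)])) = - A_pow (-2) * L K (img u) + - A_pow (-4) * L (flat (cup_cap h) K) (img u)"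
proof -
  have w: "[Sigma (Suc h)] \<in> braid_words n" using assms(2) by (auto simp: braid_words_def)
  have "L K (img (u @ [Sigma (Suc h)])) =
      lin (\<lambda>T. - A_pow (-2) * on_tangles n K T + - A_pow (-4) * on_tangles n (flat (cup_cap h) K) T) (img u)"
    unfolding img_append[OF assms(1) w] lin_ATL_mult img_Sigma[OF assms(2)] lin_add lin_single
    by (rule lin_cong[OF img_keys[OF assms(1)]]) (simp only: times_id[OF _ assms(3)] times_F[OF _ assms(3,2)])
  then show ?thesis by (simp only: lin_combination)
qed

text \<open>Multiplication by a generator on the right is transferred to the functional: the last
  letter acts on the continuation as the corresponding piece of a diagram does.\<close>

lemma L_letter:
  assumes "u \<in> braid_words n" "[l] \<in> braid_words n" "resp (EW n) K"
  shows "L K (img (u @ [l])) = L (cont (letter_piece l) K) (img u)"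
proof -
  note cong = lin_cong[OF img_keys[OF assms(1)]]
  have dirs: "dirs (tangle_state n T) = EW n" if "T \<in> arrow_tangles n" for T using good_ts[OF that] by simp
  show ?thesis
  proof (cases l)
    case (Sigma i)
    then obtain h where h: "i = Suc h" "Suc h < n" using assms(2) by (cases i) (auto simp: braid_words_def)
    have "L (cont (letter_piece l) K) (img u) =
        lin (\<lambda>T. - A_pow (-2) * on_tangles n K T + - A_pow (-4) * on_tangles n (flat (cup_cap h) K) T) (img u)"
      by (rule cong) (use cont_classical_EW(1)[OF h(2) dirs] Sigma h(1) in simp)
    then show ?thesis using L_Sigma[OF assms(1) h(2) assms(3)] unfolding Sigma h(1) by (simp only: lin_combination)
  next
    case (Tau i)
    then obtain h where h: "i = Suc h" "Suc h < n" using assms(2) by (cases i) (auto simp: braid_words_def)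
    have "L K (img (u @ [l])) = L (cont (Cross Virtual h) K) (img u)"
      unfolding img_append[OF assms(1,2)] unfolding lin_ATL_mult Tau h(1) img_Tau[OF h(2)] lin_single
      by (rule cong) (simp only: times_w[OF _ assms(3) h(2)] mult_1)
    then show ?thesis using Tau h(1) by simp
  next
    case (SigmaInv i)
    then obtain h where h: "i = Suc h" "Suc h < n" using assms(2) by (cases i) (auto simp: braid_words_def)
    let ?F = "flat (cup_cap h) K"
    let ?v = "u @ [l]"
    have v: "?v \<in> braid_words n" using assms(1,2) by simp
    have F: "resp (EW n) ?F" by (rule resp_flat[OF run_cup_cap[OF h(2)] assms(3)])
    \<comment> \<open>The image of sigma is prescribed, that of its inverse is not. As the two
      letters cancel, the known action of sigma gives linear equations for the values at
      \<open>img ?v\<close>, which are then solved.\<close>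
    have "(?v @ [Sigma (Suc h)], u) \<in> braid_rel n"
    proof -
      have "braid_step n (u @ [SigmaInv (Suc h), Sigma (Suc h)] @ []) (u @ [] @ [])"
        by (rule braid_step.intros[OF braid_relation.intros(2)]) (use assms(1) h in \<open>auto simp: braid_words_def\<close>)
      then have "braid_step n (?v @ [Sigma (Suc h)]) u" unfolding SigmaInv h(1) by simp
      moreover have "?v @ [Sigma (Suc h)] \<in> braid_words n" using v h by (auto simp: braid_words_def)
      ultimately show ?thesis using assms(1) by (auto simp: braid_rel_def)
    qed
    then have cl: "img (?v @ [Sigma (Suc h)]) = img u" unfolding img_def by (simp only: braid_class_eq)
    \<comment> \<open>This closes the system: the functionals from \<open>K\<close> and
      \<open>?F\<close> are mapped to combinations of themselves.\<close>
    have FF: "L (flat (cup_cap h) ?F) (img ?v) = z 0 * L ?F (img ?v)"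
    proof -
      have "L (flat (cup_cap h) ?F) (img ?v) = lin (\<lambda>T. z 0 * on_tangles n ?F T + 0 * on_tangles n ?F T) (img ?v)"
        by (rule lin_cong[OF img_keys[OF v]]) (use cup_cap_twice[OF assms(3) h(2)] good_ts in simp)
      then show ?thesis by (simp only: lin_combination) simp
    qed
    have 1: "L K (img u) = - A_pow (-2) * L K (img ?v) + - A_pow (-4) * L ?F (img ?v)"
      using L_Sigma[OF v h(2) assms(3)] unfolding cl .
    have 2: "L ?F (img u) = - A_pow (-2) * L ?F (img ?v) + - A_pow (-4) * (z 0 * L ?F (img ?v))"
      using L_Sigma[OF v h(2) F] unfolding cl FF .
    have p: "A_pow (-4) * A_pow 2 = A_pow (-2)" "A_pow (-4) * A_pow (-2) = A_pow (-6)" "A_pow 6 * A_pow (-6) = 1"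
      "A_pow 4 * A_pow (-6) = A_pow (-2)" "A_pow 2 * A_pow (-2) = 1" "A_pow 2 * A_pow (-4) = A_pow (-2)"
      by (simp_all add: A_pow_add[symmetric])
    \<comment> \<open>By the value of \<open>z 0\<close>, the eigenvalue of sigma on
      \<open>?F\<close>, which is -A^(-2) - A^(-4) z_0, equals A^(-6).\<close>
    have z0: "A_pow (-4) * z 0 = - A_pow (-2) - A_pow (-6)"
      by (simp add: z_def right_diff_distrib p)
    have "L ?F (img u) = - A_pow (-2) * L ?F (img ?v) - (A_pow (-4) * z 0) * L ?F (img ?v)"
      unfolding 2 by (simp add: mult.assoc)
    also have "\<dots> = A_pow (-6) * L ?F (img ?v)" unfolding z0 by (simp add: algebra_simps)
    finally have 3: "L ?F (img u) = A_pow (-6) * L ?F (img ?v)" .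
    have "- A_pow 2 * L K (img u) + - A_pow 4 * L ?F (img u) =
        (A_pow 2 * A_pow (-2)) * L K (img ?v) + (A_pow 2 * A_pow (-4)) * L ?F (img ?v) - (A_pow 4 * A_pow (-6)) * L ?F (img ?v)"
      unfolding 1 3 by (simp add: algebra_simps)
    also have "\<dots> = L K (img ?v)" unfolding p by simp
    finally have 4: "L K (img ?v) = - A_pow 2 * L K (img u) + - A_pow 4 * L ?F (img u)" by simp
    have "L (cont (letter_piece l) K) (img u) =
        lin (\<lambda>T. - A_pow 2 * on_tangles n K T + - A_pow 4 * on_tangles n ?F T) (img u)"
      by (rule cong) (use cont_classical_EW(2)[OF h(2) dirs] SigmaInv h(1) in simp)
    then show ?thesis unfolding 4 by (simp only: lin_combination)
  qed
qed

text \<open>Letters are split off at the right end, next to the continuation, until the functional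
  is evaluated at the identity tangle.\<close>

lemma L_word:
  "u \<in> braid_words n \<Longrightarrow> resp (EW n) K \<Longrightarrow>
   L K (img u) = on_tangles n (foldr cont (map letter_piece u) K) (tangle_id n)"
proof (induction u arbitrary: K rule: rev_induct)
  case Nil
  then show ?case by (simp add: img_Nil lin_single)
next
  case (snoc l u)
  have w: "u \<in> braid_words n" "[l] \<in> braid_words n" using snoc.prems(1) by simp_all
  have "resp (EW n) (foldr cont (map letter_piece [l]) K)"
    by (rule resp_foldr[OF run_word[OF w(2)] snoc.prems(2)])
  then have "resp (EW n) (cont (letter_piece l) K)" by simp
  then show ?case using snoc.IH[OF w(1)] L_letter[OF w snoc.prems(2)] by simp
qed

end

lemma opens_state:
  "\<exists>xs D A g. stps (opens n) s0 = (xs, D, A, g) \<and> facs (opens n) s0 = 1 \<and> length xs = 2 * n \<and>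
     (\<forall>k<2 * n. A (xs ! k) = xs ! (2 * n - Suc k) \<and> g (xs ! k) = 0)"
proof (induction n)
  case 0
  then show ?case by (simp add: opens_def)
next
  case (Suc n)
  then obtain xs D A g where IH: "stps (opens n) s0 = (xs, D, A, g)" "facs (opens n) s0 = 1" "length xs = 2 * n"
    "\<forall>k<2 * n. A (xs ! k) = xs ! (2 * n - Suc k) \<and> g (xs ! k) = 0" by blast
  have app: "stps (u @ w) s = stps w (stps u s)" "facs (u @ w) s = facs u s * facs w (stps u s)" for u w s
    by (induction u arbitrary: s) (simp_all add: mult.assoc)
  define us zs where "us = take n xs" and "zs = drop n xs"
  have xs: "xs = us @ zs" "length us = n" "length zs = n" using IH(3) by (simp_all add: us_def zs_def)
  define a where "a = fresh xs"
  have a: "a \<notin> set xs" "Suc a \<notin> set xs" unfolding a_def by (rule fresh_notin')+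
  let ?ys = "us @ a # Suc a # zs"
  have st: "stps (opens (Suc n)) s0 = (?ys, D(a := East, Suc a := opp East), A(a := Suc a, Suc a := a), g(a := 0, Suc a := 0))"
    unfolding opens_Suc app IH(1) using stp_Open(1)[of us East zs] unfolding xs(1)[symmetric] xs(2) a_def by simp
  have fc: "facs (opens (Suc n)) s0 = 1" unfolding opens_Suc app IH(2) by simp
  have pair: "(A(a := Suc a, Suc a := a)) (?ys ! k) = ?ys ! (2 * Suc n - Suc k) \<and> (g(a := 0, Suc a := 0)) (?ys ! k) = 0"
    if k: "k < 2 * Suc n" for k
  proof -
    have low: "?ys ! j = xs ! j" if "j < n" for j using that xs by (simp add: nth_append)
    have mid: "?ys ! n = a" "?ys ! Suc n = Suc a" using xs by (simp_all add: nth_append)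
    have high: "?ys ! j = xs ! (j - 2)" if jn: "Suc n < j" "j < 2 * n + 2" for j
    proof -
      obtain i where "j = Suc (Suc n) + i" using jn(1) by (metis Suc_leI le_add_diff_inverse)
      then show ?thesis using xs by (simp add: nth_append)
    qed
    have old: "xs ! j \<noteq> a" "xs ! j \<noteq> Suc a" if "j < 2 * n" for j
    proof -
      have "xs ! j \<in> set xs" using that IH(3) by simp
      then show "xs ! j \<noteq> a" "xs ! j \<noteq> Suc a" using a by metis+
    qed
    consider (1) "k < n" | (2) "k = n" | (3) "k = Suc n" | (4) "Suc n < k" by linarith
    then show ?thesis
    proof cases
      case 1
      have "?ys ! (2 * Suc n - Suc k) = xs ! (2 * n - Suc k)"
        using high[of "2 * Suc n - Suc k"] 1 by (simp add: Suc_diff_Suc)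
      then show ?thesis using low[OF 1] old[of k] IH(4) 1 by simp
    next
      case 2
      then show ?thesis using mid by simp
    next
      case 3
      then show ?thesis using mid by simp
    next
      case 4
      define j where "j = k - 2"
      have j: "k = j + 2" "j < 2 * n" "n \<le> j" using 4 k unfolding j_def by simp_all
      have "?ys ! (2 * Suc n - Suc k) = xs ! (2 * n - Suc j)"
        using low[of "2 * Suc n - Suc k"] j by simp
      moreover have "?ys ! k = xs ! j" using high[of k] 4 k j(1) by simp
      ultimately show ?thesis using old[OF j(2)] IH(4) j(2) by simp
    qed
  qed
  show ?case using st fc pair xs by (intro exI conjI) auto
qed

text \<open>The nested opening arcs join the positions j and 2 n - 1 - j without cusps, which is the
  identity tangle up to renaming.\<close>

lemma closure_ev:
  assumes "resp (EW n) K"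
  shows "foldr cont (opens n) K s0 = on_tangles n K (tangle_id n)"
proof -
  obtain xs D A g where o: "stps (opens n) s0 = (xs, D, A, g)" "facs (opens n) s0 = 1" "length xs = 2 * n"
     "\<forall>k<2 * n. A (xs ! k) = xs ! (2 * n - Suc k) \<and> g (xs ! k) = 0" using opens_state by blast
  have gd: "good (xs, D, A, g)" "dirs (xs, D, A, g) = EW n"
    using good_stps[of s0 "opens n" "EW n"] good_s0 run_opens unfolding o(1) by simp_all
  obtain E f where T: "tangle_id n = (E, f)" by (cases "tangle_id n")
  have Ef1: "E = (\<lambda>k. {(0, k), (1, k)}) ` {1..n}" using T by (simp add: tangle_id_def Let_def)
  have Ef2: "f = (\<lambda>\<alpha>\<in>E. 0)" using T unfolding Ef1 by (simp add: tangle_id_def Let_def)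
  note Ef = Ef1 Ef2
  have E: "E \<in> flat_tangles n" using tangle_id_in[of n] unfolding T by (rule arrow_tangleD(1))
  have p: "partner E (dec n j) = dec n (2 * n - Suc j)" "f {dec n j, dec n (2 * n - Suc j)} = 0" if j: "j < 2 * n" for j
  proof -
    have "{dec n j, dec n (2 * n - Suc j)} \<in> E"
    proof (cases "j < n")
      case True
      then have "dec n j = (1, Suc j)" "dec n (2 * n - Suc j) = (0, Suc j)" "Suc j \<in> {1..n}" by (auto simp: dec_def)
      then show ?thesis unfolding Ef(1) by (simp only:) (metis (no_types, lifting) image_eqI insert_commute)
    next
      case False
      then have "dec n j = (0, 2 * n - j)" "dec n (2 * n - Suc j) = (1, 2 * n - j)" "2 * n - j \<in> {1..n}"
        using j by (auto simp: dec_def)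
      then show ?thesis unfolding Ef(1) by (simp only:) (metis (no_types, lifting) image_eqI)
    qed
    then show "partner E (dec n j) = dec n (2 * n - Suc j)" "f {dec n j, dec n (2 * n - Suc j)} = 0"
      using partner_eq[OF E dec_V[OF j]] unfolding Ef(2) by simp_all
  qed
  have "rnf (nth xs) (tangle_state n (E, f)) (xs, D, A, g)"
    unfolding tangle_state.simps rnf.simps
  proof (intro conjI ballI)
    show "inj_on ((!) xs) (set [0..<2 * n])"
      using good_distinct[OF gd(1)] o(3) by (simp add: inj_on_nth)
    show "xs = map ((!) xs) [0..<2 * n]" using o(3) by (metis map_nth)
    fix j assume "j \<in> set [0..<2 * n]"
    then have j: "j < 2 * n" by simp
    have "D (xs ! j) = EW n ! j" using arg_cong[OF gd(2), of "\<lambda>l. l ! j"] o(3) j by (simp add: dirs.simps)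
    then show "D (xs ! j) = (if j < n then East else West)" using EW_nth(1)[of j n] EW_nth(2)[of n j] j by (cases "j < n") auto
    show "A (xs ! j) = xs ! enc n (partner E (dec n j))" using o(4) j p(1)[OF j] by simp
    show "g (xs ! j) = olab f (dec n j) (partner E (dec n j))" using o(4) j p[OF j] by (simp add: olab_def)
  qed
  then have "rn (tangle_state n (tangle_id n)) (xs, D, A, g)" unfolding T by (rule rnI)
  then have "K (xs, D, A, g) = on_tangles n K (tangle_id n)"
    using respD[OF assms] good_ts[OF tangle_id_in[of n]] by blast
  moreover have "filter classical (opens n) = []" by (auto simp: opens_def filter_empty_conv)
  ultimately show ?thesis by (simp add: foldr_flat flat_def o(1,2))
qed

text \<open>The three parts of the closed braid correspond to the three ingredients of the trace:
  the closing arcs to the trace of a basis element, the letters to operators, and the opening arcs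
  to the identity tangle.\<close>

theorem trace_closure:
  assumes "n \<ge> 1" "arrow_representation n \<rho>" "u \<in> braid_words n"
  shows "arrow_trace (\<rho> (Poly_Mapping.single (braid_class n u) 1)) = ev (closure_diagram n u) s0"
proof -
  interpret representation n \<rho> using assms(2) by unfold_locales
  let ?K = "foldr cont (closers n) (\<lambda>_. 1)"
  have cl: "filter classical (closers n) = []" by (auto simp: closers_def filter_empty_conv)
  have K: "resp (EW n) ?K" by (rule resp_foldr[OF run_closers]) (simp add: resp_def)
  have "arrow_trace (img u) = lin basis_trace (img u)" by (simp add: arrow_trace_def lin_def)
  also have "\<dots> = lin (on_tangles n ?K) (img u)"
  proof (rule lin_cong[OF img_keys[OF assms(3)]])
    fix T assume T: "T \<in> arrow_tangles n"
    obtain E f where Ef: "T = (E, f)" by (cases T)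
    interpret tangle n E f using T unfolding Ef by unfold_locales
    show "basis_trace T = on_tangles n ?K T"
      unfolding Ef basis_trace_facs by (simp only: foldr_flat[OF cl] flat_def mult_1_right)
  qed
  also have "\<dots> = on_tangles n (foldr cont (map letter_piece u) ?K) (tangle_id n)" by (rule L_word[OF assms(3) K])
  also have "\<dots> = foldr cont (opens n) (foldr cont (map letter_piece u) ?K) s0"
    by (rule closure_ev[symmetric]) (rule resp_foldr[OF run_word[OF assms(3)] K])
  also have "\<dots> = ev (closure_diagram n u) s0" unfolding closure_eq ev_def by simp
  finally show ?thesis unfolding img_def .
qed

theorem theorem3p9:
  fixes \<rho> :: "nat \<Rightarrow> (braid_letter list set \<Rightarrow>\<^sub>0 ra) \<Rightarrow> (arrow_tangle \<Rightarrow>\<^sub>0 ra)"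
    and I :: "piece list set \<Rightarrow> ra"
  assumes "\<And>n. n \<ge> 1 \<Longrightarrow> arrow_representation n (\<rho> n)"
    and "\<And>n \<beta>. \<lbrakk>n \<ge> 1; \<beta> \<in> carrier (VB n)\<rbrakk> \<Longrightarrow>
           I (braid_closure n \<beta>) = arrow_trace (\<rho> n (Poly_Mapping.single \<beta> 1))"
  shows "\<forall>L\<in>virtual_links. \<forall>D\<in>L. I L = arrow_polynomial D"
proof (intro ballI)
  fix L D assume L: "L \<in> virtual_links" and D: "D \<in> L"
  obtain w where w: "L = link_rel `` {w}" using L unfolding virtual_links_def by (rule quotientE)
  have wD: "(w, D) \<in> link_rel" using D w by simp
  then have link: "link_diagram D" by (simp add: link_rel_def)
  obtain n u where n: "n \<ge> 1" and u: "u \<in> braid_words n" and t: "teq [] D (closure_diagram n u)"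
    using virtual_Alexander[OF link] by metis
  have "(w, closure_diagram n u) \<in> link_rel" by (rule link_rel_trans[OF wD teq_link[OF t link]])
  then have Lu: "L = link_rel `` {closure_diagram n u}" unfolding w by (rule link_rel_image)
  \<comment> \<open>The closures of all words of one braid are equivalent diagrams, so the union in
    the definition is a single class.\<close>
  have "braid_closure n (braid_class n u) = L"
  proof -
    have "link_rel `` {closure_diagram n v} = L" if "v \<in> braid_class n u" for v
    proof -
      have "(u, v) \<in> braid_rel n" using that by simp
      then show ?thesis unfolding Lu using link_rel_image[OF braid_rel_link[OF n]] by blast
    qed
    moreover have "u \<in> braid_class n u" using braid_rel_refl[OF u] by simp
    ultimately show ?thesis unfolding braid_closure_def by blast
  qed
  then have "I L = arrow_trace (\<rho> n (Poly_Mapping.single (braid_class n u) 1))"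
    using assms(2)[OF n class_carrier[OF u]] by simp
  also have "\<dots> = ev (closure_diagram n u) s0" by (rule trace_closure[OF n assms(1)[OF n] u])
  \<comment> \<open>The moves that lead from \<open>D\<close> to the closed braid preserve the state
    sum.\<close>
  also have "\<dots> = ev D s0"
    by (rule ev_sim[symmetric, OF teq_sim[OF t]]) (use link in \<open>simp add: link_diagram_def arrow_diagram_def\<close>)
  also have "\<dots> = arrow_polynomial D" by (rule arrow_polynomial_ev[OF link, symmetric])
  finally show "I L = arrow_polynomial D" .
qed

end
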